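(* Consider a pair $(\xi,v)$ solving the system $$d\xi_r=f_r(\xi,v)\,dt+\langle\sigma_r(\xi,v),dW\rangle,\quad r=1,2,$$ $$dv=\Big(\sum_jc_j^\xi u_j^\xi+\mathcal L^\xi v+\mathcal N(\tilde u^\xi,v)\Big)dt+dW-\sum_j\tilde u_j^\xi\,d\xi_j-\tfrac12\sum_{i,j}\tilde u_{ij}^\xi\langle\mathcal Q\sigma_j,\sigma_i\rangle\,dt,$$ where, with the $2\times2$ matrix $A_{kj}=\langle\psi_k^\xi,\tilde u_j^\xi\rangle-\langle v,\psi_{k,j}^\xi\rangle$, $$\sigma_r=\sum_iA^{-1}_{ri}\psi_i^\xi,$$ $$f_r=\sum_iA^{-1}_{ri}\Big\{\langle\mathcal L(v+\tilde u^\xi),\psi_i^\xi\rangle+\sum_{j,k}\Big[\tfrac12\langle v,\psi_{i,jk}^\xi\rangle-\langle\psi_{i,j}^\xi,\tilde u_k^\xi\rangle-\tfrac12\langle\psi_i^\xi,\tilde u_{jk}^\xi\rangle\Big]\langle\mathcal Q\sigma_k,\sigma_j\rangle+\sum_j\langle\mathcal Q\psi_{i,j}^\xi,\sigma_j\rangle\Big\}.$$ Suppose that initially $\langle\psi_k^{\xi(0)},v(0)\rangle=0$ for $k=1,2$. Then $u=\tilde u^\xi+v$ solves the stochastic Cahn-Hilliard equation $du=\mathcal L(u)\,dt+dW$, and $\langle\psi_k^{\xi},v\rangle=0$ for $k=1,2$ for all times (of existence).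
   Context: Domain and spaces. $\Omega\subset\mathbb R^2$ is a bounded smooth domain, $F(u)=\frac14(u^2-1)^2$, $0<\varepsilon\ll1$. $-\Delta$ denotes the (positive self-adjoint) negative Neumann Laplacian on $L^2_0(\Omega)=\{\phi\in L^2:\int_\Omega\phi=0\}$. $H^{-1}_0(\Omega)$ is the zero-average subspace of $H^{-1}(\Omega)$ with $\langle\psi,\phi\rangle=\langle\psi,\phi\rangle_{H^{-1}}=((-\Delta)^{-1/2}\psi,(-\Delta)^{-1/2}\phi)_{L^2}$ and norm $\|\cdot\|=\|\cdot\|_{H^{-1}}$. A term is $\mathcal O(\exp)$ if it is $\mathcal O(e^{-c/\varepsilon})$ as $\varepsilon\to0$ for some $c>0$. Droplets. There are $\bar\rho>0$ and smooth functions $\varsigma:(\bar\rho,\infty)\to\mathbb R$, $U^\star:[0,\infty)\times(\bar\rho,\infty)\to\mathbb R$ such that $x\mapsto U^\star(|x|,\varrho)$ solves $\Delta u-F'(u)=\varsigma(\varrho)$ on $\mathbb R^2$, $U^\star$ is increasing in $r$, and, as $\varrho\to\infty$, $\varsigma(\varrho)=\mathcal O(\varrho^{-1})$, $U^\star(\varrho,\varrho)=\mathcal O(\varrho^{-1})$, $1+U^\star(0,\varrho)=\mathcal O(\varrho^{-1})$, with $\lim_{r\to\infty}U^\star(r,\varrho)=\alpha(\varrho)$ attained exponentially fast, $\alpha(\varrho)$ being the root near $1$ of $F'(\alpha)+\varsigma(\varrho)=0$. Fix a radius $\rho>0$ with $\{\xi\in\Omega:d(\xi,\partial\Omega)>\rho\}\ne\emptyset$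 and a small $\delta>0$; $\Omega_{\rho+\delta}=\{\xi\in\Omega:d(\xi,\partial\Omega)>\rho+\delta\}$. The droplet with center $\xi\in\Omega_{\rho+\delta}$ is $u^\xi(x)=U^\star(|x-\xi|/\varepsilon,(\rho-a^\xi)/\varepsilon)$, where $a^{\xi_0}=0$ at a fixed $\xi_0$ and $a^\xi=\mathcal O(\exp)$ is determined by $\int_\Omega u^\xi=\int_\Omega u^{\xi_0}$. Slow manifold. For small $\varepsilon$ there are (known result, fixed choice) maps $\xi\mapsto w^\xi\in C^4(\bar\Omega)$ and $\xi\mapsto c^\xi\in\mathbb R^2$ on $\Omega_{\rho+\delta}$, with $\int_\Omega w^\xi=0$, both $\mathcal O(\exp)$ together with their derivatives, such that $\tilde u^\xi=u^\xi+w^\xi$ satisfies $\partial_n\tilde u^\xi=\partial_n\Delta\tilde u^\xi=0$ on $\partial\Omega$ and $\mathcal L(\tilde u^\xi)=c_1^\xi u_1^\xi+c_2^\xi u_2^\xi$, where $\mathcal L(\Phi)=\Delta(-\varepsilon^2\Delta\Phi+F'(\Phi))$. Put $\mathcal L^\xi=\Delta(-\varepsilon^2\Delta+F''(\tilde u^\xi))$ and $\mathcal N(y,z)=\Delta(F'(y+z)-F'(y)-F''(y)z)$, so $\mathcal L(\tilde u^\xi+v)=\mathcal L(\tilde u^\xi)+\mathcal L^\xi v+\mathcal N(\tilde u^\xi,v)$. Eigenfunctions. $\mathcal L^\xi$ (with $\partial_n\psi=\partial_n\Delta\psi=0$) is self-adjoint on $H^{-1}_0$; the eigenvalues of $-\mathcal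 L^\xi$ satisfy $\lambda_1^\xi,\lambda_2^\xi=\mathcal O(\exp)$ and $\lambda_3^\xi\ge C'\varepsilon$. $\psi_1^\xi,\psi_2^\xi$ is an $H^{-1}$-orthonormal basis, smooth in $\xi$, of the eigenspace for $\lambda_1^\xi,\lambda_2^\xi$. Derivatives in $\xi$: $u_j^\xi=\partial_{\xi_j}u^\xi$, $\tilde u_j^\xi=\partial_{\xi_j}\tilde u^\xi$, $\tilde u_{ij}^\xi=\partial_{\xi_i}\partial_{\xi_j}\tilde u^\xi$, $\psi_{i,j}^\xi=\partial_{\xi_j}\psi_i^\xi$, $\psi_{i,jk}^\xi=\partial_{\xi_j}\partial_{\xi_k}\psi_i^\xi$ (the smoothness needed for It\^o's formula is assumed). All sums run over $\{1,2\}$. Noise. $W$ is a $\mathcal Q$-Wiener process in $H^{-1}_0(\Omega)$ with $\operatorname{trace}(\mathcal Q)<\infty$. Solutions of $du=\mathcal L(u)\,dt+dW$ are subject to $\partial_nu=\partial_n\Delta u=0$ on $\partial\Omega$ and assumed sufficiently regular. One works on times for which $\xi(t)\in\Omega_{\rho+\delta}$ and $\|v(t)\|<\varepsilon^\eta$ for some $\eta>1$, where $A$ is invertible. *)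

theory Defs
  imports "HOL-Probability.Probability"
begin

section \<open>Derivatives and function classes\<close>

definition pdir :: "'a::euclidean_space \<Rightarrow> ('a \<Rightarrow> real) \<Rightarrow> 'a \<Rightarrow> real" where
  "pdir b f = (\<lambda>x. frechet_derivative f (at x) b)"

definition pds :: "'a::euclidean_space list \<Rightarrow> ('a \<Rightarrow> real) \<Rightarrow> 'a \<Rightarrow> real" where
  "pds bs f = foldr pdir bs f"

definition Ck_on :: "nat \<Rightarrow> 'a::euclidean_space set \<Rightarrow> ('a \<Rightarrow> real) \<Rightarrow> bool" where
  "Ck_on k S f \<longleftrightarrow> (\<forall>bs \<in> lists Basis.
      (length bs \<le> k \<longrightarrow> continuous_on S (pds bs f)) \<and>
      (length bs < k \<longrightarrow> (\<forall>x\<in>S. pds bs f differentiable (at x))))"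

definition smooth_on :: "'a::euclidean_space set \<Rightarrow> ('a \<Rightarrow> real) \<Rightarrow> bool" where
  "smooth_on S f \<longleftrightarrow> (\<forall>k. Ck_on k S f)"

definition extends_continuously :: "'a::euclidean_space set \<Rightarrow> ('a \<Rightarrow> real) \<Rightarrow> bool" where
  "extends_continuously \<Omega> f \<longleftrightarrow> (\<exists>g. continuous_on (closure \<Omega>) g \<and> (\<forall>x\<in>\<Omega>. g x = f x))"

text \<open>The space \<open>C\<^sup>k\<close> on the closure of an open set: all derivatives up to order \<open>k\<close>
  extend continuously to the closure.  Only the values inside the open set matter.\<close>

definition Ck_closure :: "nat \<Rightarrow> 'a::euclidean_space set \<Rightarrow> ('a \<Rightarrow> real) \<Rightarrow> bool" where
  "Ck_closure k \<Omega> f \<longleftrightarrow> (\<forall>bs \<in> lists Basis.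
      (length bs \<le> k \<longrightarrow> extends_continuously \<Omega> (pds bs f)) \<and>
      (length bs < k \<longrightarrow> (\<forall>x\<in>\<Omega>. pds bs f differentiable (at x))))"

definition grad :: "(real^2 \<Rightarrow> real) \<Rightarrow> real^2 \<Rightarrow> real^2" where
  "grad f x = (\<chi> j. pdir (axis j 1) f x)"

definition lap :: "(real^2 \<Rightarrow> real) \<Rightarrow> real^2 \<Rightarrow> real" where
  "lap f = (\<lambda>x. \<Sum>j\<in>UNIV. pdir (axis j 1) (pdir (axis j 1) f) x)"

text \<open>For a family \<open>g\<close> of functions on the plane indexed by \<open>\<xi>\<close>, \<open>dxi j g\<close> is the family of
  the derivatives with respect to \<open>\<xi>\<^sub>j\<close> at fixed \<open>x\<close>.\<close>

definition dxi :: "2 \<Rightarrow> (real^2 \<Rightarrow> real^2 \<Rightarrow> real) \<Rightarrow> real^2 \<Rightarrow> real^2 \<Rightarrow> real" where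
  "dxi j g = (\<lambda>\<xi> x. pdir (axis j 1) (\<lambda>\<eta>. g \<eta> x) \<xi>)"

definition dxis :: "2 list \<Rightarrow> (real^2 \<Rightarrow> real^2 \<Rightarrow> real) \<Rightarrow> real^2 \<Rightarrow> real^2 \<Rightarrow> real" where
  "dxis js g = foldr dxi js g"

text \<open>\<open>\<xi> \<mapsto> g \<xi>\<close> is twice continuously differentiable on the open set \<open>D\<close> as a map into the space of
  continuous functions on the closure of \<open>\<Omega>\<close> with the supremum norm.\<close>

definition C2_family ::
  "(real^2) set \<Rightarrow> (real^2) set \<Rightarrow> (real^2 \<Rightarrow> real^2 \<Rightarrow> real) \<Rightarrow> bool" where
  "C2_family D \<Omega> g \<longleftrightarrow> (\<forall>js. length js \<le> 2 \<longrightarrow> (\<forall>\<xi>\<in>D.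
      extends_continuously \<Omega> (dxis js g \<xi>) \<and>
      uniform_limit \<Omega> (dxis js g) (dxis js g \<xi>) (at \<xi>) \<and>
      (length js < 2 \<longrightarrow> (\<forall>x\<in>\<Omega>. (\<lambda>\<eta>. dxis js g \<eta> x) differentiable (at \<xi>)))))"

text \<open>\<open>O(exp)\<close> as \<open>\<epsilon> \<rightarrow> 0\<close>, uniformly over the parameter set \<open>P\<close>.\<close>

definition O_exp :: "'p set \<Rightarrow> (real \<Rightarrow> 'p \<Rightarrow> real) \<Rightarrow> bool" where
  "O_exp P g \<longleftrightarrow> (\<exists>c>0. \<exists>C. \<forall>\<^sub>F \<epsilon> in at_right 0. \<forall>p\<in>P. \<bar>g \<epsilon> p\<bar> \<le> C * exp (- c / \<epsilon>))"


section \<open>Domain and boundary conditions\<close>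

definition boundary_chart :: "(real^2) set \<Rightarrow> real^2 \<Rightarrow> (real^2) set \<Rightarrow> (real^2 \<Rightarrow> real) \<Rightarrow> bool" where
  "boundary_chart \<Omega> x N g \<longleftrightarrow> open N \<and> x \<in> N \<and> smooth_on N g \<and> (\<forall>y\<in>N. grad g y \<noteq> 0) \<and>
     \<Omega> \<inter> N = {y\<in>N. g y < 0} \<and> frontier \<Omega> \<inter> N = {y\<in>N. g y = 0}"

definition smooth_bounded_domain :: "(real^2) set \<Rightarrow> bool" where
  "smooth_bounded_domain \<Omega> \<longleftrightarrow> open \<Omega> \<and> connected \<Omega> \<and> bounded \<Omega> \<and> \<Omega> \<noteq> {} \<and>
     (\<forall>x\<in>frontier \<Omega>. \<exists>N g. boundary_chart \<Omega> x N g)"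

definition outer_normal :: "(real^2) set \<Rightarrow> real^2 \<Rightarrow> real^2 \<Rightarrow> bool" where
  "outer_normal \<Omega> x n \<longleftrightarrow> (\<exists>N g. boundary_chart \<Omega> x N g \<and> n = sgn (grad g x))"

definition normal_deriv_zero :: "(real^2) set \<Rightarrow> (real^2 \<Rightarrow> real) \<Rightarrow> bool" where
  "normal_deriv_zero \<Omega> f \<longleftrightarrow> (\<forall>x\<in>frontier \<Omega>. \<forall>n. outer_normal \<Omega> x n \<longrightarrow>
     ((\<lambda>y. grad f y \<bullet> n) \<longlongrightarrow> 0) (at x within \<Omega>))"

definition neumann_C4 :: "(real^2) set \<Rightarrow> (real^2 \<Rightarrow> real) \<Rightarrow> bool" where
  "neumann_C4 \<Omega> f \<longleftrightarrow>
     Ck_closure 4 \<Omega> f \<and> normal_deriv_zero \<Omega> f \<and> normal_deriv_zero \<Omega> (lap f)"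

definition inner_region :: "(real^2) set \<Rightarrow> real \<Rightarrow> (real^2) set" where
  "inner_region \<Omega> r = {\<xi>\<in>\<Omega>. infdist \<xi> (frontier \<Omega>) > r}"


section \<open>The space of zero-average distributions\<close>

definition int_dom :: "(real^2) set \<Rightarrow> (real^2 \<Rightarrow> real) \<Rightarrow> real" where
  "int_dom \<Omega> f = integral\<^sup>L (lebesgue_on \<Omega>) f"

definition L2 :: "(real^2) set \<Rightarrow> (real^2 \<Rightarrow> real) set" where
  "L2 \<Omega> = {f. f \<in> borel_measurable (lebesgue_on \<Omega>) \<and> integrable (lebesgue_on \<Omega>) (\<lambda>x. (f x)\<^sup>2)}"

definition L2_0 :: "(real^2) set \<Rightarrow> (real^2 \<Rightarrow> real) set" where
  "L2_0 \<Omega> = {f \<in> L2 \<Omega>. int_dom \<Omega> f = 0}"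

definition L2_inner :: "(real^2) set \<Rightarrow> (real^2 \<Rightarrow> real) \<Rightarrow> (real^2 \<Rightarrow> real) \<Rightarrow> real" where
  "L2_inner \<Omega> f g = int_dom \<Omega> (\<lambda>x. f x * g x)"

definition zero_avg :: "(real^2) set \<Rightarrow> (real^2 \<Rightarrow> real) \<Rightarrow> real^2 \<Rightarrow> real" where
  "zero_avg \<Omega> f = (\<lambda>x. f x - int_dom \<Omega> f / measure lebesgue \<Omega>)"

definition weak_grad :: "(real^2) set \<Rightarrow> (real^2 \<Rightarrow> real) \<Rightarrow> (real^2 \<Rightarrow> real^2) \<Rightarrow> bool" where
  "weak_grad \<Omega> p G \<longleftrightarrow> p \<in> L2 \<Omega> \<and> (\<forall>j. (\<lambda>x. G x $ j) \<in> L2 \<Omega>) \<and>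
     (\<forall>\<phi> j. smooth_on UNIV \<phi> \<and> compact (closure {x. \<phi> x \<noteq> 0}) \<and> closure {x. \<phi> x \<noteq> 0} \<subseteq> \<Omega> \<longrightarrow>
        int_dom \<Omega> (\<lambda>x. p x * pdir (axis j 1) \<phi> x) = - int_dom \<Omega> (\<lambda>x. G x $ j * \<phi> x))"

text \<open>\<open>p\<close> is in the domain of the negative Neumann Laplacian on \<open>L\<^sup>2\<^sub>0\<close>, with image \<open>f\<close>:
  this is the self-adjoint operator given by the form \<open>\<integral>\<nabla>p\<cdot>\<nabla>q\<close> on \<open>H\<^sup>1\<close>.\<close>

definition neg_neumann_lap :: "(real^2) set \<Rightarrow> (real^2 \<Rightarrow> real) \<Rightarrow> (real^2 \<Rightarrow> real) \<Rightarrow> bool" where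
  "neg_neumann_lap \<Omega> p f \<longleftrightarrow> p \<in> L2_0 \<Omega> \<and> f \<in> L2_0 \<Omega> \<and>
     (\<exists>G. weak_grad \<Omega> p G \<and>
        (\<forall>q H. weak_grad \<Omega> q H \<longrightarrow> int_dom \<Omega> (\<lambda>x. G x \<bullet> H x) = L2_inner \<Omega> f q))"

text \<open>\<open>S\<close> represents the inverse square root of the negative Neumann Laplacian: the bounded positive
  self-adjoint operator on \<open>L\<^sup>2\<^sub>0\<close> (functions up to null sets) whose square is the
  inverse.\<close>

definition neumann_inv_sqrt ::
  "(real^2) set \<Rightarrow> ((real^2 \<Rightarrow> real) \<Rightarrow> (real^2 \<Rightarrow> real)) \<Rightarrow> bool" where
  "neumann_inv_sqrt \<Omega> S \<longleftrightarrow>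
     (\<forall>f\<in>L2_0 \<Omega>. S f \<in> L2_0 \<Omega>) \<and>
     (\<forall>f\<in>L2_0 \<Omega>. \<forall>g\<in>L2_0 \<Omega>. \<forall>a b. AE x in lebesgue_on \<Omega>.
        S (\<lambda>y. a * f y + b * g y) x = a * S f x + b * S g x) \<and>
     (\<exists>K. \<forall>f\<in>L2_0 \<Omega>. L2_inner \<Omega> (S f) (S f) \<le> K * L2_inner \<Omega> f f) \<and>
     (\<forall>f\<in>L2_0 \<Omega>. \<forall>g\<in>L2_0 \<Omega>. L2_inner \<Omega> (S f) g = L2_inner \<Omega> f (S g)) \<and>
     (\<forall>f\<in>L2_0 \<Omega>. 0 \<le> L2_inner \<Omega> (S f) f) \<and>
     (\<forall>f\<in>L2_0 \<Omega>. neg_neumann_lap \<Omega> (S (S f)) f)"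

text \<open>The type \<open>'h\<close> together with the map \<open>\<iota>\<close> is \<open>H\<^sup>-\<^sup>1\<^sub>0(\<Omega>)\<close>.  That space is the
  completion of \<open>L\<^sup>2\<^sub>0(\<Omega>)\<close> for the inner product prescribed below, so a complete \<open>'h\<close> into which
  \<open>L\<^sup>2\<^sub>0\<close> embeds densely with this inner product is determined up to a unique isometric isomorphism.
  \<open>\<iota> f\<close> carries its intended meaning for \<open>f\<close> in \<open>L2_0 \<Omega>\<close>; it depends only on the class of \<open>f\<close> up to
  null sets of \<open>\<Omega>\<close>.\<close>

definition Hm1_0 ::
  "(real^2) set \<Rightarrow> ((real^2 \<Rightarrow> real) \<Rightarrow> 'h::{real_inner,banach,second_countable_topology}) \<Rightarrow> bool" where
  "Hm1_0 \<Omega> \<iota> \<longleftrightarrow>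
     (\<forall>f g. (AE x in lebesgue_on \<Omega>. f x = g x) \<longrightarrow> \<iota> f = \<iota> g) \<and>
     (\<forall>f\<in>L2_0 \<Omega>. \<forall>g\<in>L2_0 \<Omega>. \<forall>a b. \<iota> (\<lambda>x. a * f x + b * g x) = a *\<^sub>R \<iota> f + b *\<^sub>R \<iota> g) \<and>
     (\<exists>S. neumann_inv_sqrt \<Omega> S \<and>
        (\<forall>f\<in>L2_0 \<Omega>. \<forall>g\<in>L2_0 \<Omega>. \<iota> f \<bullet> \<iota> g = L2_inner \<Omega> (S f) (S g))) \<and>
     closure (\<iota> ` L2_0 \<Omega>) = UNIV"


section \<open>The Cahn-Hilliard operator, droplets and the slow manifold\<close>

definition F_pot :: "real \<Rightarrow> real" where
  "F_pot u = (u\<^sup>2 - 1)\<^sup>2 / 4"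

definition F1 :: "real \<Rightarrow> real" where "F1 = deriv F_pot"

definition F2 :: "real \<Rightarrow> real" where "F2 = deriv F1"

definition CH_op :: "real \<Rightarrow> (real^2 \<Rightarrow> real) \<Rightarrow> real^2 \<Rightarrow> real" where
  "CH_op \<epsilon> \<Phi> = lap (\<lambda>x. - \<epsilon>\<^sup>2 * lap \<Phi> x + F1 (\<Phi> x))"

definition CH_lin :: "real \<Rightarrow> (real^2 \<Rightarrow> real) \<Rightarrow> (real^2 \<Rightarrow> real) \<Rightarrow> real^2 \<Rightarrow> real" where
  "CH_lin \<epsilon> \<Phi> v = lap (\<lambda>x. - \<epsilon>\<^sup>2 * lap v x + F2 (\<Phi> x) * v x)"

definition CH_nonlin :: "(real^2 \<Rightarrow> real) \<Rightarrow> (real^2 \<Rightarrow> real) \<Rightarrow> real^2 \<Rightarrow> real" where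
  "CH_nonlin y z = lap (\<lambda>x. F1 (y x + z x) - F1 (y x) - F2 (y x) * z x)"

text \<open>Smoothness of \<open>U\<close> up to \<open>r = 0\<close> is expressed by a smooth extension to all real \<open>r\<close>.
  The function \<open>\<alpha>\<close> is the root near 1 of \<open>F1 (\<alpha> R) + \<kappa> R = 0\<close>.\<close>

definition droplet_profile ::
  "real \<Rightarrow> (real \<Rightarrow> real) \<Rightarrow> (real \<Rightarrow> real \<Rightarrow> real) \<Rightarrow> (real \<Rightarrow> real) \<Rightarrow> bool" where
  "droplet_profile \<rho>bar \<kappa> U \<alpha> \<longleftrightarrow>
     \<rho>bar > 0 \<and> smooth_on {\<rho>bar<..} \<kappa> \<and>
     (\<exists>V. smooth_on (UNIV \<times> {\<rho>bar<..}) V \<and> (\<forall>r\<ge>0. \<forall>R>\<rho>bar. V (r, R) = U r R)) \<and>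
     (\<forall>R>\<rho>bar. Ck_on 2 UNIV (\<lambda>x::real^2. U (norm x) R) \<and>
        (\<forall>x. lap (\<lambda>y. U (norm y) R) x - F1 (U (norm x) R) = \<kappa> R) \<and>
        mono_on {0..} (\<lambda>r. U r R) \<and>
        F1 (\<alpha> R) + \<kappa> R = 0 \<and>
        (\<exists>C. \<exists>c>0. \<forall>r\<ge>0. \<bar>U r R - \<alpha> R\<bar> \<le> C * exp (- c * r))) \<and>
     \<kappa> \<in> O[at_top](\<lambda>R. 1 / R) \<and>
     (\<lambda>R. U R R) \<in> O[at_top](\<lambda>R. 1 / R) \<and>
     (\<lambda>R. 1 + U 0 R) \<in> O[at_top](\<lambda>R. 1 / R) \<and>
     (\<alpha> \<longlongrightarrow> 1) at_top"

definition droplet ::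
  "(real \<Rightarrow> real \<Rightarrow> real) \<Rightarrow> real \<Rightarrow> (real \<Rightarrow> real^2 \<Rightarrow> real) \<Rightarrow> real \<Rightarrow> real^2 \<Rightarrow> real^2 \<Rightarrow> real" where
  "droplet U \<rho> a \<epsilon> \<xi> x = U (norm (x - \<xi>) / \<epsilon>) ((\<rho> - a \<epsilon> \<xi>) / \<epsilon>)"

text \<open>The radius correction \<open>a\<close>.  Only for \<open>\<epsilon>\<close> below the threshold \<open>\<epsilon>0\<close> are the
  \<open>\<epsilon>\<close>-dependent objects constrained here and below.\<close>

definition droplet_family ::
  "(real^2) set \<Rightarrow> (real^2) set \<Rightarrow> real \<Rightarrow> (real \<Rightarrow> real \<Rightarrow> real) \<Rightarrow> real \<Rightarrow> real^2 \<Rightarrow> real \<Rightarrow>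
   (real \<Rightarrow> real^2 \<Rightarrow> real) \<Rightarrow> bool" where
  "droplet_family \<Omega> D \<rho>bar U \<rho> \<xi>0 \<epsilon>0 a \<longleftrightarrow>
     O_exp D a \<and>
     (\<forall>\<epsilon>. 0 < \<epsilon> \<and> \<epsilon> < \<epsilon>0 \<longrightarrow> a \<epsilon> \<xi>0 = 0 \<and> C2_family D \<Omega> (droplet U \<rho> a \<epsilon>) \<and>
        (\<forall>\<xi>\<in>D. (\<rho> - a \<epsilon> \<xi>) / \<epsilon> > \<rho>bar \<and>
           int_dom \<Omega> (droplet U \<rho> a \<epsilon> \<xi>) = int_dom \<Omega> (droplet U \<rho> a \<epsilon> \<xi>0)))"

definition slow_manifold ::
  "(real^2) set \<Rightarrow> (real^2) set \<Rightarrow> real \<Rightarrow> (real \<Rightarrow> real^2 \<Rightarrow> real^2 \<Rightarrow> real) \<Rightarrow>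
   (real \<Rightarrow> real^2 \<Rightarrow> real^2 \<Rightarrow> real) \<Rightarrow> (real \<Rightarrow> real^2 \<Rightarrow> real^2) \<Rightarrow>
   (real \<Rightarrow> real^2 \<Rightarrow> real^2 \<Rightarrow> real) \<Rightarrow> bool" where
  "slow_manifold \<Omega> D \<epsilon>0 u w c ut \<longleftrightarrow>
     (\<forall>js bs. length js \<le> 2 \<and> length bs \<le> 4 \<and> bs \<in> lists Basis \<longrightarrow>
        O_exp (D \<times> \<Omega>) (\<lambda>\<epsilon> (\<xi>, x). pds bs (dxis js (w \<epsilon>) \<xi>) x)) \<and>
     (\<forall>bs i. length bs \<le> 2 \<and> bs \<in> lists Basis \<longrightarrow>
        O_exp D (\<lambda>\<epsilon> \<xi>. pds bs (\<lambda>\<eta>. c \<epsilon> \<eta> $ i) \<xi>)) \<and>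
     (\<forall>\<epsilon>. 0 < \<epsilon> \<and> \<epsilon> < \<epsilon>0 \<longrightarrow>
        C2_family D \<Omega> (w \<epsilon>) \<and> (\<forall>i. Ck_on 2 D (\<lambda>\<xi>. c \<epsilon> \<xi> $ i)) \<and>
        ut \<epsilon> = (\<lambda>\<xi> x. u \<epsilon> \<xi> x + w \<epsilon> \<xi> x) \<and>
        (\<forall>\<xi>\<in>D.
           (\<forall>js. length js \<le> 2 \<longrightarrow> Ck_closure 4 \<Omega> (dxis js (w \<epsilon>) \<xi>)) \<and>
           int_dom \<Omega> (w \<epsilon> \<xi>) = 0 \<and>
           neumann_C4 \<Omega> (ut \<epsilon> \<xi>) \<and>
           (\<forall>x\<in>\<Omega>. CH_op \<epsilon> (ut \<epsilon> \<xi>) x = (\<Sum>j\<in>UNIV. c \<epsilon> \<xi> $ j * dxi j (u \<epsilon>) \<xi> x))))"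

text \<open>\<open>lam \<epsilon> \<xi> k\<close> are the eigenvalues of minus the linearised operator, counted with multiplicity in
  nondecreasing order from \<open>k = 0\<close>, with eigenfunctions \<open>e \<epsilon> \<xi> k\<close> forming an orthonormal basis of
  \<open>H\<^sup>-\<^sup>1\<^sub>0\<close>.  The basis \<open>\<psi>\<close> of the eigenspace for the first two need not consist of
  eigenfunctions.\<close>

definition spectral_data ::
  "(real^2) set \<Rightarrow> (real^2) set \<Rightarrow> ((real^2 \<Rightarrow> real) \<Rightarrow> 'h::{real_inner,banach,second_countable_topology}) \<Rightarrow>
   real \<Rightarrow> (real \<Rightarrow> real^2 \<Rightarrow> real^2 \<Rightarrow> real) \<Rightarrow> (real \<Rightarrow> real^2 \<Rightarrow> nat \<Rightarrow> real) \<Rightarrow>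
   (real \<Rightarrow> real^2 \<Rightarrow> nat \<Rightarrow> real^2 \<Rightarrow> real) \<Rightarrow> (real \<Rightarrow> 2 \<Rightarrow> real^2 \<Rightarrow> real^2 \<Rightarrow> real) \<Rightarrow> bool" where
  "spectral_data \<Omega> D \<iota> \<epsilon>0 ut lam e \<psi> \<longleftrightarrow>
     O_exp D (\<lambda>\<epsilon> \<xi>. lam \<epsilon> \<xi> 0) \<and> O_exp D (\<lambda>\<epsilon> \<xi>. lam \<epsilon> \<xi> 1) \<and>
     (\<exists>C'>0. \<forall>\<epsilon>. 0 < \<epsilon> \<and> \<epsilon> < \<epsilon>0 \<longrightarrow> (\<forall>\<xi>\<in>D. lam \<epsilon> \<xi> 2 \<ge> C' * \<epsilon>)) \<and>
     (\<forall>\<epsilon>. 0 < \<epsilon> \<and> \<epsilon> < \<epsilon>0 \<longrightarrow>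
        (\<forall>i. C2_family D \<Omega> (\<psi> \<epsilon> i)) \<and>
        (\<forall>\<xi>\<in>D.
           incseq (lam \<epsilon> \<xi>) \<and>
           (\<forall>k. neumann_C4 \<Omega> (e \<epsilon> \<xi> k) \<and> e \<epsilon> \<xi> k \<in> L2_0 \<Omega> \<and>
              (\<forall>x\<in>\<Omega>. - CH_lin \<epsilon> (ut \<epsilon> \<xi>) (e \<epsilon> \<xi> k) x = lam \<epsilon> \<xi> k * e \<epsilon> \<xi> k x)) \<and>
           (\<forall>k l. \<iota> (e \<epsilon> \<xi> k) \<bullet> \<iota> (e \<epsilon> \<xi> l) = (if k = l then 1 else 0)) \<and>
           closure (span (range (\<lambda>k. \<iota> (e \<epsilon> \<xi> k)))) = UNIV \<and>
           (\<forall>i. neumann_C4 \<Omega> (\<psi> \<epsilon> i \<xi>) \<and> \<psi> \<epsilon> i \<xi> \<in> L2_0 \<Omega>) \<and>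
           (\<forall>i j. \<iota> (\<psi> \<epsilon> i \<xi>) \<bullet> \<iota> (\<psi> \<epsilon> j \<xi>) = (if i = j then 1 else 0)) \<and>
           span (range (\<lambda>i. \<iota> (\<psi> \<epsilon> i \<xi>))) = span {\<iota> (e \<epsilon> \<xi> 0), \<iota> (e \<epsilon> \<xi> 1)}))"


section \<open>Noise and stochastic integrals\<close>

definition orthonormal_basis :: "'h::real_inner set \<Rightarrow> bool" where
  "orthonormal_basis B \<longleftrightarrow>
     (\<forall>b\<in>B. \<forall>b'\<in>B. b \<bullet> b' = (if b = b' then 1 else 0)) \<and> closure (span B) = UNIV"

text \<open>For a nonnegative operator, finiteness of the trace does not depend on the basis.\<close>

definition finite_trace :: "('h::real_inner \<Rightarrow> 'h) \<Rightarrow> bool" where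
  "finite_trace Q \<longleftrightarrow> (\<exists>B. orthonormal_basis B \<and> (\<lambda>b. Q b \<bullet> b) summable_on B)"

definition covariance_op :: "('h::real_inner \<Rightarrow> 'h) \<Rightarrow> bool" where
  "covariance_op Q \<longleftrightarrow> bounded_linear Q \<and> (\<forall>x y. Q x \<bullet> y = x \<bullet> Q y) \<and> (\<forall>x. 0 \<le> Q x \<bullet> x) \<and>
     finite_trace Q"

definition centered_gaussian :: "'s measure \<Rightarrow> ('s \<Rightarrow> real) \<Rightarrow> real \<Rightarrow> bool" where
  "centered_gaussian M X s2 \<longleftrightarrow>
     (if s2 = 0 then AE \<omega> in M. X \<omega> = 0
      else s2 > 0 \<and> distributed M lborel X (normal_density 0 (sqrt s2)))"

definition complete_filtration :: "'s measure \<Rightarrow> (real \<Rightarrow> 's measure) \<Rightarrow> bool" where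
  "complete_filtration M F \<longleftrightarrow> complete_measure M \<and> filtration (space M) F \<and>
     (\<forall>t. subalgebra M (F t)) \<and> null_sets M \<subseteq> sets (F 0)"

definition Q_Wiener ::
  "'s measure \<Rightarrow> (real \<Rightarrow> 's measure) \<Rightarrow> ('h::{real_inner,banach,second_countable_topology} \<Rightarrow> 'h) \<Rightarrow>
   (real \<Rightarrow> 's \<Rightarrow> 'h) \<Rightarrow> bool" where
  "Q_Wiener M F Q W \<longleftrightarrow>
     (\<forall>t\<ge>0. W t \<in> borel_measurable (F t)) \<and>
     (AE \<omega> in M. W 0 \<omega> = 0 \<and> continuous_on {0..} (\<lambda>t. W t \<omega>)) \<and>
     (\<forall>s t. 0 \<le> s \<and> s < t \<longrightarrow>
        prob_space.indep_set M (sets (F s))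
          {(\<lambda>\<omega>. W t \<omega> - W s \<omega>) -` B \<inter> space M | B. B \<in> sets borel} \<and>
        (\<forall>h. centered_gaussian M (\<lambda>\<omega>. (W t \<omega> - W s \<omega>) \<bullet> h) ((t - s) * (Q h \<bullet> h))))"

definition stopping :: "'s measure \<Rightarrow> (real \<Rightarrow> 's measure) \<Rightarrow> ('s \<Rightarrow> ereal) \<Rightarrow> bool" where
  "stopping M F \<tau> \<longleftrightarrow> (\<forall>t\<ge>0. {\<omega> \<in> space M. \<tau> \<omega> \<le> ereal t} \<in> sets (F t))"

text \<open>Processes live on the stochastic interval \<open>[0, \<tau>)\<close>.\<close>

definition adapted_upto ::
  "(real \<Rightarrow> 's measure) \<Rightarrow> ('s \<Rightarrow> ereal) \<Rightarrow> (real \<Rightarrow> 's \<Rightarrow> 'b::{zero,topological_space}) \<Rightarrow> bool" where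
  "adapted_upto F \<tau> X \<longleftrightarrow>
     (\<forall>t\<ge>0. (\<lambda>\<omega>. if ereal t < \<tau> \<omega> then X t \<omega> else 0) \<in> borel_measurable (F t))"

definition continuous_upto :: "ereal \<Rightarrow> (real \<Rightarrow> 'b::topological_space) \<Rightarrow> bool" where
  "continuous_upto T x \<longleftrightarrow> continuous_on {t. 0 \<le> t \<and> ereal t < T} x"

text \<open>Outer probabilities tending to zero, so that no measurability is needed of the sets \<open>B m\<close>.\<close>

definition vanishing :: "'s measure \<Rightarrow> (nat \<Rightarrow> 's set) \<Rightarrow> bool" where
  "vanishing M B \<longleftrightarrow>
     (\<exists>E. (\<forall>m. E m \<in> sets M \<and> B m \<inter> space M \<subseteq> E m) \<and> (\<lambda>m. measure M (E m)) \<longlonglongrightarrow> 0)"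

text \<open>Elementary processes \<open>\<Sum>\<^sub>i \<phi>\<^sub>i 1\<^bsub>(t\<^sub>i,t\<^sub>i\<^sub>+\<^sub>1]\<^esub>\<close>, operator valued, with
  \<open>\<phi>\<^sub>i\<close> taking finitely many values.\<close>

definition elementary ::
  "(real \<Rightarrow> 's measure) \<Rightarrow> nat \<Rightarrow> (nat \<Rightarrow> real) \<Rightarrow>
   (nat \<Rightarrow> 's \<Rightarrow> 'h::real_normed_vector \<Rightarrow>\<^sub>L 'k::real_normed_vector) \<Rightarrow> bool" where
  "elementary F n t \<phi> \<longleftrightarrow> 0 \<le> t 0 \<and> (\<forall>i<n. t i < t (Suc i) \<and> simple_function (F (t i)) (\<phi> i))"

definition elem_process ::
  "nat \<Rightarrow> (nat \<Rightarrow> real) \<Rightarrow> (nat \<Rightarrow> 's \<Rightarrow> 'h::real_normed_vector \<Rightarrow>\<^sub>L 'k::real_normed_vector) \<Rightarrow>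
   real \<Rightarrow> 's \<Rightarrow> 'h \<Rightarrow>\<^sub>L 'k" where
  "elem_process n t \<phi> s \<omega> = (\<Sum>i<n. if t i < s \<and> s \<le> t (Suc i) then \<phi> i \<omega> else 0)"

definition elem_integral ::
  "(real \<Rightarrow> 's \<Rightarrow> 'h) \<Rightarrow> nat \<Rightarrow> (nat \<Rightarrow> real) \<Rightarrow>
   (nat \<Rightarrow> 's \<Rightarrow> 'h::real_normed_vector \<Rightarrow>\<^sub>L 'k::real_normed_vector) \<Rightarrow> real \<Rightarrow> 's \<Rightarrow> 'k" where
  "elem_integral W n t \<phi> T \<omega> =
     (\<Sum>i<n. blinfun_apply (\<phi> i \<omega>) (W (min (t (Suc i)) T) \<omega> - W (min (t i) T) \<omega>))"

text \<open>\<open>X T\<close> is the Ito integral \<open>\<integral>\<^sub>0\<^sup>T \<Phi> dW\<close> for \<open>T < \<tau>\<close>, where \<open>\<Phi>\<close> is an operator valued process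
  with continuous paths on \<open>[0, \<tau>)\<close>: the limit in probability, on the event \<open>T < \<tau>\<close>, of the integrals
  of elementary processes that approximate \<open>\<Phi>\<close> in \<open>L\<^sup>2(0,T)\<close> in probability.  Since the trace of
  \<open>Q\<close> is finite, the operator norm dominates the Hilbert-Schmidt norm of \<open>\<Phi> Q\<^sup>1\<^sup>/\<^sup>2\<close> in the
  Ito isometry, so the limit does not depend on the approximation.\<close>

definition has_ito_integral ::
  "'s measure \<Rightarrow> (real \<Rightarrow> 's measure) \<Rightarrow> (real \<Rightarrow> 's \<Rightarrow> 'h::real_normed_vector) \<Rightarrow> ('s \<Rightarrow> ereal) \<Rightarrow>
   (real \<Rightarrow> 's \<Rightarrow> 'h \<Rightarrow>\<^sub>L 'k::real_normed_vector) \<Rightarrow> (real \<Rightarrow> 's \<Rightarrow> 'k) \<Rightarrow> bool" where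
  "has_ito_integral M F W \<tau> \<Phi> X \<longleftrightarrow>
     (AE \<omega> in M. continuous_upto (\<tau> \<omega>) (\<lambda>s. \<Phi> s \<omega>)) \<and>
     (\<exists>n t \<phi>. (\<forall>m. elementary F (n m) (t m) (\<phi> m)) \<and>
        (\<forall>T\<ge>0. \<forall>r>0.
           vanishing M (\<lambda>m. {\<omega>. ereal T < \<tau> \<omega> \<and>
             (\<integral>\<^sup>+s\<in>{0..T}. ennreal ((norm (elem_process (n m) (t m) (\<phi> m) s \<omega> - \<Phi> s \<omega>))\<^sup>2) \<partial>lborel)
               > ennreal r}) \<and>
           vanishing M (\<lambda>m. {\<omega>. ereal T < \<tau> \<omega> \<and>
             norm (elem_integral W (n m) (t m) (\<phi> m) T \<omega> - X T \<omega>) > r})))"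


section \<open>The stochastic Cahn-Hilliard equation and the reduced system\<close>

definition solves_SCH ::
  "'s measure \<Rightarrow> (real \<Rightarrow> 's measure) \<Rightarrow> (real \<Rightarrow> 's \<Rightarrow> 'h) \<Rightarrow>
   ((real^2 \<Rightarrow> real) \<Rightarrow> 'h::{real_inner,banach,second_countable_topology}) \<Rightarrow>
   (real^2) set \<Rightarrow> real \<Rightarrow> ('s \<Rightarrow> ereal) \<Rightarrow> (real \<Rightarrow> 's \<Rightarrow> real^2 \<Rightarrow> real) \<Rightarrow> bool" where
  "solves_SCH M F W \<iota> \<Omega> \<epsilon> \<tau> u \<longleftrightarrow>
     adapted_upto F \<tau> (\<lambda>t \<omega>. \<iota> (zero_avg \<Omega> (u t \<omega>))) \<and>
     (AE \<omega> in M. continuous_upto (\<tau> \<omega>) (\<lambda>t. \<iota> (zero_avg \<Omega> (u t \<omega>)))) \<and>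
     (AE \<omega> in M. \<forall>t\<ge>0. ereal t < \<tau> \<omega> \<longrightarrow>
        neumann_C4 \<Omega> (u t \<omega>) \<and>
        (\<lambda>x. u t \<omega> x - u 0 \<omega> x) \<in> L2_0 \<Omega> \<and>
        set_integrable lborel {0..t} (\<lambda>s. \<iota> (CH_op \<epsilon> (u s \<omega>))) \<and>
        \<iota> (\<lambda>x. u t \<omega> x - u 0 \<omega> x) = (LINT s:{0..t}|lborel. \<iota> (CH_op \<epsilon> (u s \<omega>))) + W t \<omega>)"

text \<open>Below, \<open>ut\<close>, \<open>u\<close>, \<open>c\<close> and \<open>\<psi>\<close> are the objects for one fixed \<open>\<epsilon>\<close>.\<close>

definition A_mat ::
  "((real^2 \<Rightarrow> real) \<Rightarrow> 'h::real_inner) \<Rightarrow> (real^2 \<Rightarrow> real^2 \<Rightarrow> real) \<Rightarrow>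
   (2 \<Rightarrow> real^2 \<Rightarrow> real^2 \<Rightarrow> real) \<Rightarrow> real^2 \<Rightarrow> (real^2 \<Rightarrow> real) \<Rightarrow> real^2^2" where
  "A_mat \<iota> ut \<psi> \<xi> v =
     (\<chi> k j. \<iota> (\<psi> k \<xi>) \<bullet> \<iota> (dxi j ut \<xi>) - \<iota> v \<bullet> \<iota> (dxi j (\<psi> k) \<xi>))"

definition sig ::
  "((real^2 \<Rightarrow> real) \<Rightarrow> 'h::real_inner) \<Rightarrow> (real^2 \<Rightarrow> real^2 \<Rightarrow> real) \<Rightarrow>
   (2 \<Rightarrow> real^2 \<Rightarrow> real^2 \<Rightarrow> real) \<Rightarrow> 2 \<Rightarrow> real^2 \<Rightarrow> (real^2 \<Rightarrow> real) \<Rightarrow> 'h" where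
  "sig \<iota> ut \<psi> r \<xi> v = (\<Sum>i\<in>UNIV. (matrix_inv (A_mat \<iota> ut \<psi> \<xi> v) $ r $ i) *\<^sub>R \<iota> (\<psi> i \<xi>))"

definition drift_xi ::
  "((real^2 \<Rightarrow> real) \<Rightarrow> 'h::real_inner) \<Rightarrow> ('h \<Rightarrow> 'h) \<Rightarrow> real \<Rightarrow> (real^2 \<Rightarrow> real^2 \<Rightarrow> real) \<Rightarrow>
   (2 \<Rightarrow> real^2 \<Rightarrow> real^2 \<Rightarrow> real) \<Rightarrow> 2 \<Rightarrow> real^2 \<Rightarrow> (real^2 \<Rightarrow> real) \<Rightarrow> real" where
  "drift_xi \<iota> Q \<epsilon> ut \<psi> r \<xi> v =
     (\<Sum>i\<in>UNIV. matrix_inv (A_mat \<iota> ut \<psi> \<xi> v) $ r $ i *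
       (\<iota> (CH_op \<epsilon> (\<lambda>x. v x + ut \<xi> x)) \<bullet> \<iota> (\<psi> i \<xi>) +
        (\<Sum>j\<in>UNIV. \<Sum>k\<in>UNIV.
           (1/2 * (\<iota> v \<bullet> \<iota> (dxi j (dxi k (\<psi> i)) \<xi>))
            - \<iota> (dxi j (\<psi> i) \<xi>) \<bullet> \<iota> (dxi k ut \<xi>)
            - 1/2 * (\<iota> (\<psi> i \<xi>) \<bullet> \<iota> (dxi j (dxi k ut) \<xi>)))
           * (Q (sig \<iota> ut \<psi> k \<xi> v) \<bullet> sig \<iota> ut \<psi> j \<xi> v)) +
        (\<Sum>j\<in>UNIV. Q (\<iota> (dxi j (\<psi> i) \<xi>)) \<bullet> sig \<iota> ut \<psi> j \<xi> v)))"

definition drift_v ::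
  "real \<Rightarrow> (real^2 \<Rightarrow> real^2 \<Rightarrow> real) \<Rightarrow> (real^2 \<Rightarrow> real^2 \<Rightarrow> real) \<Rightarrow> (real^2 \<Rightarrow> real^2) \<Rightarrow>
   real^2 \<Rightarrow> (real^2 \<Rightarrow> real) \<Rightarrow> real^2 \<Rightarrow> real" where
  "drift_v \<epsilon> u ut c \<xi> v =
     (\<lambda>x. (\<Sum>j\<in>UNIV. c \<xi> $ j * dxi j u \<xi> x) + CH_lin \<epsilon> (ut \<xi>) v x + CH_nonlin (ut \<xi>) v x)"

text \<open>Integrated form of the system on \<open>[0, \<tau>)\<close>.  \<open>I r\<close> is \<open>\<integral>\<langle>\<sigma>\<^sub>r, dW\<rangle>\<close>.
  \<open>J j\<close> is the martingale part \<open>\<integral> (\<partial>\<^sub>j ut) \<langle>\<sigma>\<^sub>j, dW\<rangle>\<close> of \<open>\<integral> (\<partial>\<^sub>j ut) d\<xi>\<^sub>j\<close>, whose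
  integrand is the rank one operator \<open>h \<mapsto> \<langle>\<sigma>\<^sub>j, h\<rangle> \<partial>\<^sub>j ut\<close>.\<close>

definition solves_system ::
  "'s measure \<Rightarrow> (real \<Rightarrow> 's measure) \<Rightarrow> ('h \<Rightarrow> 'h) \<Rightarrow> (real \<Rightarrow> 's \<Rightarrow> 'h) \<Rightarrow>
   ((real^2 \<Rightarrow> real) \<Rightarrow> 'h::{real_inner,banach,second_countable_topology}) \<Rightarrow>
   (real^2) set \<Rightarrow> real \<Rightarrow> (real^2 \<Rightarrow> real^2 \<Rightarrow> real) \<Rightarrow> (real^2 \<Rightarrow> real^2 \<Rightarrow> real) \<Rightarrow>
   (real^2 \<Rightarrow> real^2) \<Rightarrow> (2 \<Rightarrow> real^2 \<Rightarrow> real^2 \<Rightarrow> real) \<Rightarrow>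
   ('s \<Rightarrow> ereal) \<Rightarrow> (real \<Rightarrow> 's \<Rightarrow> real^2) \<Rightarrow> (real \<Rightarrow> 's \<Rightarrow> real^2 \<Rightarrow> real) \<Rightarrow> bool" where
  "solves_system M F Q W \<iota> \<Omega> \<epsilon> u ut c \<psi> \<tau> \<xi> v \<longleftrightarrow>
     adapted_upto F \<tau> \<xi> \<and> adapted_upto F \<tau> (\<lambda>t \<omega>. \<iota> (v t \<omega>)) \<and>
     (AE \<omega> in M. continuous_upto (\<tau> \<omega>) (\<lambda>t. \<xi> t \<omega>) \<and> continuous_upto (\<tau> \<omega>) (\<lambda>t. \<iota> (v t \<omega>))) \<and>
     (AE \<omega> in M. \<forall>t\<ge>0. ereal t < \<tau> \<omega> \<longrightarrow>
        neumann_C4 \<Omega> (v t \<omega>) \<and> v t \<omega> \<in> L2_0 \<Omega> \<and>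
        (\<forall>r. set_integrable lborel {0..t} (\<lambda>s. drift_xi \<iota> Q \<epsilon> ut \<psi> r (\<xi> s \<omega>) (v s \<omega>))) \<and>
        set_integrable lborel {0..t} (\<lambda>s. \<iota> (drift_v \<epsilon> u ut c (\<xi> s \<omega>) (v s \<omega>)))) \<and>
     (\<exists>I. (\<forall>r. has_ito_integral M F W \<tau>
                (\<lambda>s \<omega>. blinfun_inner_right (sig \<iota> ut \<psi> r (\<xi> s \<omega>) (v s \<omega>))) (I r)) \<and>
        (AE \<omega> in M. \<forall>t\<ge>0. ereal t < \<tau> \<omega> \<longrightarrow> (\<forall>r.
           \<xi> t \<omega> $ r = \<xi> 0 \<omega> $ r
             + (LINT s:{0..t}|lborel. drift_xi \<iota> Q \<epsilon> ut \<psi> r (\<xi> s \<omega>) (v s \<omega>)) + I r t \<omega>))) \<and>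
     (\<exists>J. (\<forall>j. has_ito_integral M F W \<tau>
                (\<lambda>s \<omega>. blinfun_scaleR_left (\<iota> (dxi j ut (\<xi> s \<omega>)))
                   o\<^sub>L blinfun_inner_right (sig \<iota> ut \<psi> j (\<xi> s \<omega>) (v s \<omega>))) (J j)) \<and>
        (AE \<omega> in M. \<forall>t\<ge>0. ereal t < \<tau> \<omega> \<longrightarrow>
           \<iota> (v t \<omega>) = \<iota> (v 0 \<omega>)
             + (LINT s:{0..t}|lborel. \<iota> (drift_v \<epsilon> u ut c (\<xi> s \<omega>) (v s \<omega>))) + W t \<omega>
             - (\<Sum>j\<in>UNIV. (LINT s:{0..t}|lborel.
                   drift_xi \<iota> Q \<epsilon> ut \<psi> j (\<xi> s \<omega>) (v s \<omega>) *\<^sub>R \<iota> (dxi j ut (\<xi> s \<omega>))) + J j t \<omega>)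
             - (1/2) *\<^sub>R (\<Sum>i\<in>UNIV. \<Sum>j\<in>UNIV. LINT s:{0..t}|lborel.
                   (Q (sig \<iota> ut \<psi> j (\<xi> s \<omega>) (v s \<omega>)) \<bullet> sig \<iota> ut \<psi> i (\<xi> s \<omega>) (v s \<omega>))
                     *\<^sub>R \<iota> (dxi i (dxi j ut) (\<xi> s \<omega>)))))"

end

theory Submission
  imports Defs
begin

text \<open>Ito's formula is proved pathwise, in the manner of Foellmer, along dyadic partitions of \<open>[0, T]\<close>.
  Almost surely the sums of \<open>\<langle>a, dW\<rangle>\<^sup>2\<close> converge to the integral of \<open>\<langle>Qa, a\<rangle>\<close> for all continuous \<open>a\<close> at once,
  and on \<open>T < \<tau>\<close> the increments of an Ito integral with continuous integrand \<open>g\<close> may be replaced by \<open>\<langle>g, dW\<rangle>\<close>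
  in Riemann sums, with an error that vanishes in probability and hence almost surely along a subsequence.
  The rest is a second order Taylor expansion of a single path.

  Let \<open>G(\<xi>)\<close> be the image of \<open>ut \<xi> - ut \<xi>0\<close> in \<open>H\<^sup>-\<^sup>1\<close>.  Ito's formula for \<open>\<langle>h, G(\<xi>)\<rangle>\<close>, with \<open>h\<close> from a countable
  dense set, cancels all terms with \<open>d\<xi>\<close> in the equation of \<open>v\<close> and leaves \<open>d(G(\<xi>) + v) = L(ut + v) dt + dW\<close>, which
  is the first claim.  The same expansion for \<open>\<langle>\<psi>\<^sub>k, v\<rangle>\<close>, where \<open>v = (G(\<xi>) + v) - G(\<xi>)\<close>, has the martingale part
  \<open>\<langle>\<psi>\<^sub>k, dW\<rangle> - \<Sum>\<^sub>j A\<^sub>k\<^sub>j \<langle>\<sigma>\<^sub>j, dW\<rangle> = 0\<close>, and its drift vanishes by the choice of \<open>f\<close>.\<close>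

section \<open>Increments of the Wiener process\<close>

text \<open>The obstacle is that an Ito integral is given only as a limit in probability, separately
  at each time, of integrals of unrelated elementary processes. Neither path continuity of
  \<open>J\<close> nor its covariation with \<xi> can be read off. Therefore the equation of v is
  used only once, tested against a fixed vector, to identify G(\<xi>) + v. From then on an increment
  of v is an increment of an absolutely continuous term, plus one of W, minus one of G(\<xi>), and
  all second-order terms involve only W and \<xi>. The sums built from
  \<open>\<langle>\<psi>\<^sub>k, dW\<rangle>\<close> and from the matrix A times the Ito part of
  \<xi> are never given separate limits: their difference is an error sum that tends to zero.
  Replacing increments of Ito integrals in these sums needs a second-moment bound for integrands
  that are only continuous; it comes from the Ito isometry for elementary integrands, used as an
  inequality, after the integrands have been stopped once their energy is too large. Exceptional
  null sets depend on the time and on the test vector; rational times, countably many vectors and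
  path continuity remove this dependence at the end.\<close>

lemma orthonormal_countable:
  fixes B :: "'h::{real_inner,second_countable_topology} set"
  assumes on: "\<forall>b\<in>B. \<forall>b'\<in>B. b \<bullet> b' = (if b = b' then 1 else 0)"
  shows "countable B"
proof -
  have far: "dist b b' > 1" if "b \<in> B" "b' \<in> B" "b \<noteq> b'" for b b'
  proof -
    have "(dist b b')\<^sup>2 = 2"
      using on that by (simp add: dist_norm power2_norm_eq_inner inner_diff inner_commute)
    then show ?thesis
      by (smt (verit) one_power2 power_mono zero_le_dist)
  qed
  \<comment> \<open>Distinct orthonormal vectors are at distance sqrt 2, so these balls are
    disjoint, and a second countable space holds only countably many disjoint open sets.\<close>
  have disj: "ball b (1/2) \<inter> ball b' (1/2) = {}" if "b \<in> B" "b' \<in> B" "b \<noteq> b'" for b b'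
  proof (rule ccontr)
    assume "ball b (1/2) \<inter> ball b' (1/2) \<noteq> {}"
    then obtain x where "dist b x < 1/2" "dist b' x < 1/2" by auto
    then have "dist b b' < 1" by (metis dist_commute dist_triangle_half_l)
    then show False using far[OF that] by simp
  qed
  have "countable ((\<lambda>b. ball b (1/2)) ` B)"
  proof (rule countable_disjoint_open_subsets)
    show "pairwise disjnt ((\<lambda>b. ball b (1/2)) ` B)"
      unfolding pairwise_def disjnt_def using disj by fastforce
  qed auto
  moreover have "inj_on (\<lambda>b. ball b (1/2)) B"
  proof (rule inj_onI)
    fix b b' assume "b \<in> B" "b' \<in> B" "ball b (1/2) = ball b' (1/2)"
    moreover have "b \<in> ball b (1/2)" by simp
    ultimately show "b = b'" using disj[of b b'] by auto
  qed
  ultimately show ?thesis by (rule countable_image_inj_on)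
qed

text \<open>This is the half of Parseval's identity that uses completeness. A vector y of the span
  close to x involves finitely many basis vectors, and the orthogonal projection of x onto these is
  at least as close to x as y is.\<close>

lemma norm_span_le:
  fixes B :: "'h::real_inner set"
  assumes on: "orthonormal_basis B" and e: "e > 0"
  shows "\<exists>F. finite F \<and> F \<subseteq> B \<and> (norm x)\<^sup>2 \<le> (\<Sum>b\<in>F. (x \<bullet> b)\<^sup>2) + e"
proof -
  have "x \<in> closure (span B)" using on by (simp add: orthonormal_basis_def)
  then obtain y where y: "y \<in> span B" "dist y x < sqrt e"
    using e by (meson closure_approachable real_sqrt_gt_zero)
  from y(1) obtain F r where F: "finite F" "F \<subseteq> B" "y = (\<Sum>b\<in>F. r b *\<^sub>R b)"
    unfolding span_explicit by blast
  have on': "b \<bullet> b' = (if b = b' then 1 else 0)" if "b \<in> F" "b' \<in> F" for b b'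
    using on F that unfolding orthonormal_basis_def by blast
  have yy: "y \<bullet> y = (\<Sum>b\<in>F. (r b)\<^sup>2)"
  proof -
    have "y \<bullet> y = (\<Sum>b\<in>F. \<Sum>b'\<in>F. r b * r b' * (b' \<bullet> b))"
      unfolding F by (simp add: inner_sum_left inner_sum_right sum_distrib_left mult_ac)
    also have "\<dots> = (\<Sum>b\<in>F. \<Sum>b'\<in>F. if b = b' then r b * r b' else 0)"
      by (intro sum.cong refl) (simp add: on')
    finally show ?thesis using F(1) by (simp add: power2_eq_square)
  qed
  have "(norm x)\<^sup>2 - (\<Sum>b\<in>F. (x \<bullet> b)\<^sup>2) \<le> (norm (x - y))\<^sup>2"
  proof -
    have "(norm (x - y))\<^sup>2 = (norm x)\<^sup>2 - 2 * (\<Sum>b\<in>F. r b * (x \<bullet> b)) + (\<Sum>b\<in>F. (r b)\<^sup>2)"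
      using yy by (simp add: power2_norm_eq_inner inner_diff inner_commute F inner_sum_right)
    \<comment> \<open>Completing the square separates the optimal coefficients, the inner products
      of x with the basis vectors, from the deviation of \<open>r\<close> from them.\<close>
    also have "\<dots> = (norm x)\<^sup>2 - (\<Sum>b\<in>F. (x \<bullet> b)\<^sup>2) + (\<Sum>b\<in>F. (x \<bullet> b - r b)\<^sup>2)"
      by (simp add: power2_diff sum.distrib sum_subtractf sum_distrib_left mult_ac)
    finally show ?thesis by (smt (verit) sum_nonneg zero_le_power2)
  qed
  also have "\<dots> \<le> e"
    using y(2) e by (smt (verit) dist_norm norm_minus_commute norm_ge_zero power_mono real_sqrt_pow2)
  finally show ?thesis using F by (intro exI[of _ F]) auto
qed

text \<open>Cauchy-Schwarz with weights. It is applied with \<open>a b\<close> the squared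
  coordinate of an increment along b and \<open>q b\<close> proportional to its variance: a fourth
  moment is of order \<open>(q b)\<^sup>2\<close>, so the division by \<open>q b\<close> leaves a
  sum that the trace bounds.\<close>

lemma sum_sq_C_S:
  fixes a q :: "'b \<Rightarrow> real"
  assumes "finite F" "\<And>b. b \<in> F \<Longrightarrow> 0 < q b"
  shows "(\<Sum>b\<in>F. a b)\<^sup>2 \<le> (\<Sum>b\<in>F. q b) * (\<Sum>b\<in>F. (a b)\<^sup>2 / q b)"
proof -
  have "(\<Sum>b\<in>F. a b) = (\<Sum>b\<in>F. sqrt (q b) * (a b / sqrt (q b)))"
    using assms(2) by (intro sum.cong) (auto dest!: assms(2))
  also have "\<dots>\<^sup>2 \<le> (\<Sum>b\<in>F. (sqrt (q b))\<^sup>2) * (\<Sum>b\<in>F. (a b / sqrt (q b))\<^sup>2)"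
    by (rule Cauchy_Schwarz_ineq_sum)
  also have "\<dots> = (\<Sum>b\<in>F. q b) * (\<Sum>b\<in>F. (a b)\<^sup>2 / q b)"
    using assms by (intro arg_cong2[where f="(*)"] sum.cong refl) (auto simp: power_divide less_imp_le)
  finally show ?thesis .
qed

text \<open>Variance zero is a case of its own because the definition then prescribes a null
  variable and no density. The fourth moment is a nonnegative integral since Fatou's lemma is
  applied to it.\<close>

lemma centered_gaussian_moments:
  assumes "prob_space M" "centered_gaussian M X s" and X: "X \<in> borel_measurable M"
  shows "s \<ge> 0" "(\<integral>\<^sup>+\<omega>. ennreal ((X \<omega>)^4) \<partial>M) = ennreal (3 * s\<^sup>2)"
    "integrable M X" "(\<integral>\<omega>. X \<omega> \<partial>M) = 0" "integrable M (\<lambda>\<omega>. (X \<omega>)\<^sup>2)" "(\<integral>\<omega>. (X \<omega>)\<^sup>2 \<partial>M) = s"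
proof -
  interpret prob_space M by fact
  have "s \<ge> 0 \<and> (\<integral>\<^sup>+\<omega>. ennreal ((X \<omega>)^4) \<partial>M) = ennreal (3 * s\<^sup>2) \<and>
    integrable M X \<and> (\<integral>\<omega>. X \<omega> \<partial>M) = 0 \<and> integrable M (\<lambda>\<omega>. (X \<omega>)\<^sup>2) \<and> (\<integral>\<omega>. (X \<omega>)\<^sup>2 \<partial>M) = s"
  proof (cases "s = 0")
    case True
    then have ae: "AE \<omega> in M. X \<omega> = 0" using assms(2) by (simp add: centered_gaussian_def)
    have "(\<integral>\<^sup>+\<omega>. ennreal ((X \<omega>)^4) \<partial>M) = (\<integral>\<^sup>+\<omega>. 0 \<partial>M)"
      using ae by (intro nn_integral_cong_AE) auto
    moreover have "integrable M X" using ae X by (subst integrable_cong_AE[where g="\<lambda>_. 0"]) auto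
    moreover have "integrable M (\<lambda>\<omega>. (X \<omega>)\<^sup>2)" using ae X by (subst integrable_cong_AE[where g="\<lambda>_. 0"]) auto
    moreover have "(\<integral>\<omega>. X \<omega> \<partial>M) = (\<integral>\<omega>. 0 \<partial>M)" using ae X by (intro integral_cong_AE) auto
    moreover have "(\<integral>\<omega>. (X \<omega>)\<^sup>2 \<partial>M) = (\<integral>\<omega>. 0 \<partial>M)" using ae X by (intro integral_cong_AE) auto
    ultimately show ?thesis using True by simp
  next
    case False
    then have s: "s > 0" and d: "distributed M lborel X (normal_density 0 (sqrt s))"
      using assms(2) by (auto simp: centered_gaussian_def)
    have sp: "0 < sqrt s" using s by simp
    note m4 = normal_moment_even[OF sp, of 0 2]
    note m2 = normal_moment_even[OF sp, of 0 1]
    note m1 = normal_moment_odd[OF sp, of 0 0]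
    have i1: "integrable M X"
      using m1 distributed_integrable[OF d, of "\<lambda>x. x"] by (auto simp: has_bochner_integral_iff)
    have i2: "integrable M (\<lambda>\<omega>. (X \<omega>)\<^sup>2)"
      using m2 distributed_integrable[OF d, of "\<lambda>x. x\<^sup>2"] by (auto simp: has_bochner_integral_iff)
    have i4: "integrable M (\<lambda>\<omega>. (X \<omega>)^4)"
      using m4 distributed_integrable[OF d, of "\<lambda>x. x^4"] by (auto simp: has_bochner_integral_iff)
    have e1: "(\<integral>\<omega>. X \<omega> \<partial>M) = 0"
      using m1 distributed_integral[OF d, of "\<lambda>x. x"] by (auto simp: has_bochner_integral_iff)
    have e2: "(\<integral>\<omega>. (X \<omega>)\<^sup>2 \<partial>M) = s"
      using m2 s distributed_integral[OF d, of "\<lambda>x. x\<^sup>2"] by (auto simp: has_bochner_integral_iff fact_numeral)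
    have e4: "(\<integral>\<omega>. (X \<omega>)^4 \<partial>M) = 3 * s\<^sup>2"
      using m4 s distributed_integral[OF d, of "\<lambda>x. x^4"]
      by (auto simp: has_bochner_integral_iff fact_numeral power_divide power2_eq_square)
    have "(\<integral>\<^sup>+\<omega>. ennreal ((X \<omega>)^4) \<partial>M) = ennreal (\<integral>\<omega>. (X \<omega>)^4 \<partial>M)"
      by (intro nn_integral_eq_integral i4) auto
    then show ?thesis using s i1 i2 e1 e2 e4 by auto
  qed
  then show "s \<ge> 0" "(\<integral>\<^sup>+\<omega>. ennreal ((X \<omega>)^4) \<partial>M) = ennreal (3 * s\<^sup>2)"
    "integrable M X" "(\<integral>\<omega>. X \<omega> \<partial>M) = 0" "integrable M (\<lambda>\<omega>. (X \<omega>)\<^sup>2)" "(\<integral>\<omega>. (X \<omega>)\<^sup>2 \<partial>M) = s"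
    by auto
qed

section \<open>Independence and fourth moments of Hilbert space valued increments\<close>

locale wiener = prob_space M for M :: "'s measure" +
  fixes F :: "real \<Rightarrow> 's measure"
    and Q :: "'h::{real_inner,banach,second_countable_topology} \<Rightarrow> 'h"
    and W :: "real \<Rightarrow> 's \<Rightarrow> 'h"
  assumes filt: "complete_filtration M F" and cov: "covariance_op Q" and Wiener: "Q_Wiener M F Q W"
begin

definition dW :: "real \<Rightarrow> real \<Rightarrow> 's \<Rightarrow> 'h" where
  "dW s t \<omega> = W t \<omega> - W s \<omega>"

lemma space_F [simp]: "space (F t) = space M"
  using filt unfolding complete_filtration_def filtration_def by auto

lemma sets_F: "sets (F t) \<subseteq> sets M"
  using filt unfolding complete_filtration_def subalgebra_def by auto

lemma sets_F_mono: "s \<le> t \<Longrightarrow> sets (F s) \<subseteq> sets (F t)"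
  using filt unfolding complete_filtration_def filtration_def by auto

lemma measurable_F: "f \<in> measurable (F t) N \<Longrightarrow> f \<in> measurable M N"
  by (rule measurable_from_subalg[of M "F t"]) (simp_all add: subalgebra_def sets_F)

lemma measurable_F_mono: "f \<in> measurable (F s) N \<Longrightarrow> s \<le> t \<Longrightarrow> f \<in> measurable (F t) N"
  by (rule measurable_from_subalg[of "F t" "F s"]) (simp_all add: subalgebra_def sets_F_mono)

lemma W_F: "0 \<le> t \<Longrightarrow> W t \<in> borel_measurable (F t)"
  using conjunct1[OF Wiener[unfolded Q_Wiener_def]] by simp

lemma W_M [measurable]: "0 \<le> t \<Longrightarrow> W t \<in> borel_measurable M"
  using W_F measurable_F by blast

lemma dW_F: "0 \<le> s \<Longrightarrow> s \<le> t \<Longrightarrow> dW s t \<in> borel_measurable (F t)"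
  unfolding dW_def by (rule borel_measurable_diff[OF W_F measurable_F_mono[OF W_F]]) auto

lemma dW_M [measurable]: "0 \<le> s \<Longrightarrow> 0 \<le> t \<Longrightarrow> dW s t \<in> borel_measurable M"
  unfolding dW_def by (rule borel_measurable_diff[OF W_M W_M])

lemma dW_gaussian: "0 \<le> s \<Longrightarrow> s < t \<Longrightarrow> centered_gaussian M (\<lambda>\<omega>. dW s t \<omega> \<bullet> h) ((t - s) * (Q h \<bullet> h))"
  using conjunct2[OF conjunct2[OF Wiener[unfolded Q_Wiener_def]]] unfolding dW_def by simp

text \<open>The definition of the Wiener process states independence for two families of events. The
  product formula for expectations follows once \<open>f\<close> and \<open>G\<close> of the
  increment are seen to generate subfamilies of these.\<close>

lemma
  assumes s: "0 \<le> s" "s < t" and f: "f \<in> borel_measurable (F s)" "integrable M f"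
    and G: "G \<in> borel_measurable borel" "integrable M (\<lambda>\<omega>. G (dW s t \<omega>))"
  shows indep_dW_integral: "(\<integral>\<omega>. f \<omega> * G (dW s t \<omega>) \<partial>M) = (\<integral>\<omega>. f \<omega> \<partial>M) * (\<integral>\<omega>. G (dW s t \<omega>) \<partial>M :: real)"
    and indep_dW_integrable: "integrable M (\<lambda>\<omega>. f \<omega> * G (dW s t \<omega>))"
proof -
  have ind: "indep_set (sets (F s)) {(\<lambda>\<omega>. dW s t \<omega>) -` B \<inter> space M | B. B \<in> sets borel}"
    using conjunct2[OF conjunct2[OF Wiener[unfolded Q_Wiener_def]]] s unfolding dW_def by simp
  have "indep_var borel f borel (\<lambda>\<omega>. G (dW s t \<omega>))"
    unfolding indep_var_eq
  proof (intro conjI)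
    show "random_variable borel f" using f by simp
    show "random_variable borel (\<lambda>\<omega>. G (dW s t \<omega>))" using G by simp
    have 1: "sigma_sets (space M) {f -` A \<inter> space M |A. A \<in> sets borel} \<subseteq> sets (F s)"
      using sets.sigma_sets_subset[of "{f -` A \<inter> space M |A. A \<in> sets borel}" "F s"]
        measurable_sets[OF f(1)] by auto
    have "{(\<lambda>\<omega>. G (dW s t \<omega>)) -` A \<inter> space M |A. A \<in> sets borel}
      \<subseteq> {(\<lambda>\<omega>. dW s t \<omega>) -` B \<inter> space M | B. B \<in> sets borel}" (is "?L \<subseteq> ?R")
    proof
      fix S assume "S \<in> ?L"
      then obtain A where A: "A \<in> sets borel" "S = (\<lambda>\<omega>. G (dW s t \<omega>)) -` A \<inter> space M" by auto
      then have "S = dW s t -` (G -` A) \<inter> space M" "G -` A \<in> sets borel"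
        using measurable_sets[OF G(1) A(1)] by auto
      then show "S \<in> ?R" by auto
    qed
    then have "sigma_sets (space M) ?L \<subseteq> sigma_sets (space M) ?R"
      by (rule sigma_sets_mono')
    \<comment> \<open>The preimages of all Borel sets already form a sigma-algebra, so generating
      one adds no events.\<close>
    moreover have "sigma_sets (space M) ?R = ?R"
      using sigma_sets_vimage_commute[of "dW s t" "space M" UNIV "sets borel"]
        sets.sigma_sets_eq[of "borel::'h measure"] by auto
    ultimately have 2: "sigma_sets (space M) ?L \<subseteq> ?R" by (simp only:)
    show "indep_set (sigma_sets (space M) {f -` A \<inter> space M |A. A \<in> sets borel}) (sigma_sets (space M) ?L)"
      unfolding indep_sets2_eq
    proof (intro conjI ballI)
      note i = ind[unfolded indep_sets2_eq]
      show "sigma_sets (space M) {f -` A \<inter> space M |A. A \<in> sets borel} \<subseteq> events"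
        using 1 sets_F by (rule order_trans)
      show "sigma_sets (space M) ?L \<subseteq> events" using 2 conjunct1[OF conjunct2[OF i]] by (rule order_trans)
      fix a b assume "a \<in> sigma_sets (space M) {f -` A \<inter> space M |A. A \<in> sets borel}" "b \<in> sigma_sets (space M) ?L"
      then show "prob (a \<inter> b) = prob a * prob b"
        using conjunct2[OF conjunct2[OF i], rule_format, OF subsetD[OF 1] subsetD[OF 2]] by simp
    qed
  qed
  then show "(\<integral>\<omega>. f \<omega> * G (dW s t \<omega>) \<partial>M) = (\<integral>\<omega>. f \<omega> \<partial>M) * (\<integral>\<omega>. G (dW s t \<omega>) \<partial>M)"
    "integrable M (\<lambda>\<omega>. f \<omega> * G (dW s t \<omega>))"
    using f G by (auto intro: indep_var_lebesgue_integral indep_var_integrable)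
qed

text \<open>The squared norm is a sum of squares of centred Gaussian coordinates, possibly
  correlated, with variances (t - s) \<open>q b\<close>. The weighted Cauchy-Schwarz inequality
  bounds its square by the fourth powers of the coordinates divided by \<open>q b\<close>, of total
  expectation at most 3 (t - s)^2 times the squared trace. The order (t - s)^2 is what makes
  variances summable over dyadic levels later.\<close>

lemma dW_fourth_moment:
  "\<exists>C>0. \<forall>s t. 0 \<le> s \<and> s < t \<longrightarrow> (\<integral>\<^sup>+\<omega>. ennreal ((norm (dW s t \<omega>))^4) \<partial>M) \<le> ennreal (C * (t - s)\<^sup>2)"
proof -
  obtain B where B: "orthonormal_basis B" and summ: "(\<lambda>b. Q b \<bullet> b) summable_on B"
    using cov unfolding covariance_op_def finite_trace_def by blast
  have Q0: "0 \<le> Q x \<bullet> x" for x using cov unfolding covariance_op_def by blast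
  have cB: "countable B"
    by (rule orthonormal_countable) (use B orthonormal_basis_def in blast)
  \<comment> \<open>An enumeration of the basis gives an increasing exhaustion by finite sets, as
    Fatou's lemma requires.\<close>
  define Fn where "Fn n = {b\<in>B. to_nat_on B b < n}" for n
  have finF: "finite (Fn n)" for n
  proof -
    have "inj_on (to_nat_on B) (Fn n)"
      by (rule inj_on_subset[OF inj_on_to_nat_on[OF cB]]) (auto simp: Fn_def)
    moreover have "to_nat_on B ` Fn n \<subseteq> {..<n}" by (auto simp: Fn_def)
    ultimately show ?thesis by (meson finite_lessThan finite_subset finite_imageD)
  qed
  define tr where "tr = infsum (\<lambda>b. Q b \<bullet> b) B"
  have tr: "(\<Sum>b\<in>G. Q b \<bullet> b) \<le> tr" if "finite G" "G \<subseteq> B" for G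
    unfolding tr_def using finite_sum_le_infsum[OF summ that] Q0 by auto
  have tr0: "tr \<ge> 0" using tr[of "{}"] by simp
  have "(\<integral>\<^sup>+\<omega>. ennreal ((norm (dW s t \<omega>))^4) \<partial>M) \<le> ennreal (3 * (tr + 1)\<^sup>2 * (t - s)\<^sup>2)"
    if st: "0 \<le> s" "s < t" for s t
  proof -
    note [measurable] = dW_M[of s t]
    define X where "X b \<omega> = dW s t \<omega> \<bullet> b" for b \<omega>
    have Xm [measurable]: "X b \<in> borel_measurable M" for b using st unfolding X_def by simp
    note mom = centered_gaussian_moments[OF prob_space_axioms dW_gaussian[OF st], folded X_def, OF Xm]
    define q where "q b = Q b \<bullet> b" for b
    \<comment> \<open>Directions of variance zero are removed because the weights are divided by;
      along them the increment vanishes almost surely.\<close>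
    define Fp where "Fp n = {b\<in>Fn n. q b \<noteq> 0}" for n
    have zero: "AE \<omega> in M. \<forall>b\<in>B. q b = 0 \<longrightarrow> X b \<omega> = 0"
    proof -
      have "AE \<omega> in M. q b = 0 \<longrightarrow> X b \<omega> = 0" for b
        using dW_gaussian[OF st, of b] by (cases "q b = 0") (auto simp: centered_gaussian_def q_def X_def)
      then show ?thesis using cB by (subst AE_ball_countable) auto
    qed
    \<comment> \<open>Bessel's inequality makes the partial sums converge, and
      \<open>norm_span_le\<close> identifies their limit with the squared norm. Fatou's lemma then
      applies to the squares of the partial sums.\<close>
    have ae: "AE \<omega> in M. ennreal ((norm (dW s t \<omega>))^4) \<le> liminf (\<lambda>n. ennreal ((\<Sum>b\<in>Fp n. (X b \<omega>)\<^sup>2)\<^sup>2))"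
      using zero
    proof eventually_elim
      case (elim \<omega>)
      let ?x = "dW s t \<omega>"
      have eqs: "(\<Sum>b\<in>Fp n. (X b \<omega>)\<^sup>2) = (\<Sum>b\<in>Fn n. (X b \<omega>)\<^sup>2)" for n
        using elim finF by (intro sum.mono_neutral_left) (auto simp: Fp_def Fn_def)
      have lim: "(\<lambda>n. (\<Sum>b\<in>Fn n. (X b \<omega>)\<^sup>2)) \<longlonglongrightarrow> S \<Longrightarrow> (norm ?x)\<^sup>2 \<le> S" for S
      proof (rule field_le_epsilon)
        fix e :: real assume L: "(\<lambda>n. (\<Sum>b\<in>Fn n. (X b \<omega>)\<^sup>2)) \<longlonglongrightarrow> S" and e: "e > 0"
        obtain G where G: "finite G" "G \<subseteq> B" "(norm ?x)\<^sup>2 \<le> (\<Sum>b\<in>G. (?x \<bullet> b)\<^sup>2) + e"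
          using norm_span_le[OF B e] by blast
        obtain N where N: "\<forall>k\<in>to_nat_on B ` G. k < N"
          using G(1) by (meson finite_imageI finite_nat_set_iff_bounded)
        have "(\<Sum>b\<in>G. (?x \<bullet> b)\<^sup>2) \<le> (\<Sum>b\<in>Fn n. (X b \<omega>)\<^sup>2)" if "n \<ge> N" for n
          unfolding X_def using N that G finF by (intro sum_mono2) (auto simp: Fn_def)
        then have "(norm ?x)\<^sup>2 - e \<le> (\<Sum>b\<in>Fn n. (X b \<omega>)\<^sup>2)" if "n \<ge> N" for n
          using G(3) that by fastforce
        then have "(norm ?x)\<^sup>2 - e \<le> S"
          using L by (meson LIMSEQ_le_const)
        then show "(norm ?x)\<^sup>2 \<le> S + e" by simp
      qed
      have bes: "(\<Sum>b\<in>Fn n. (X b \<omega>)\<^sup>2) \<le> (norm ?x)\<^sup>2" for n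
      proof -
        let ?p = "\<Sum>b\<in>Fn n. (?x \<bullet> b) *\<^sub>R b"
        have on: "b \<bullet> b' = (if b = b' then 1 else 0)" if "b \<in> Fn n" "b' \<in> Fn n" for b b'
          using B that unfolding orthonormal_basis_def Fn_def by blast
        have "?p \<bullet> ?p = (\<Sum>b\<in>Fn n. \<Sum>b'\<in>Fn n. (?x \<bullet> b) * (?x \<bullet> b') * (b' \<bullet> b))"
          by (simp add: inner_sum_left inner_sum_right sum_distrib_left mult_ac)
        also have "\<dots> = (\<Sum>b\<in>Fn n. \<Sum>b'\<in>Fn n. if b = b' then (?x \<bullet> b) * (?x \<bullet> b') else 0)"
          by (intro sum.cong refl) (simp add: on)
        finally have pp: "?p \<bullet> ?p = (\<Sum>b\<in>Fn n. (X b \<omega>)\<^sup>2)" using finF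
          by (simp add: power2_eq_square X_def)
        have "0 \<le> (?x - ?p) \<bullet> (?x - ?p)" by simp
        also have "\<dots> = (norm ?x)\<^sup>2 - 2 * (?x \<bullet> ?p) + ?p \<bullet> ?p"
          by (simp add: inner_diff inner_commute power2_norm_eq_inner)
        also have "?x \<bullet> ?p = (\<Sum>b\<in>Fn n. (X b \<omega>)\<^sup>2)"
          by (simp add: inner_sum_right power2_eq_square X_def)
        finally show ?thesis using pp by simp
      qed
      have inc: "incseq (\<lambda>n. (\<Sum>b\<in>Fn n. (X b \<omega>)\<^sup>2))"
        using finF by (intro incseq_SucI sum_mono2) (auto simp: Fn_def)
      obtain S where S: "(\<lambda>n. (\<Sum>b\<in>Fn n. (X b \<omega>)\<^sup>2)) \<longlonglongrightarrow> S"
        using incseq_convergent[OF inc] bes by blast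
      have "S \<le> (norm ?x)\<^sup>2" using bes S by (meson LIMSEQ_le_const2)
      with lim[OF S] have "S = (norm ?x)\<^sup>2" by simp
      with S have "(\<lambda>n. (\<Sum>b\<in>Fp n. (X b \<omega>)\<^sup>2)) \<longlonglongrightarrow> (norm ?x)\<^sup>2" by (simp add: eqs)
      then have "(\<lambda>n. (\<Sum>b\<in>Fp n. (X b \<omega>)\<^sup>2)\<^sup>2) \<longlonglongrightarrow> ((norm ?x)\<^sup>2)\<^sup>2"
        by (intro tendsto_intros)
      then have "(\<lambda>n. ennreal ((\<Sum>b\<in>Fp n. (X b \<omega>)\<^sup>2)\<^sup>2)) \<longlonglongrightarrow> ennreal ((norm ?x)^4)"
        by (intro tendsto_ennrealI) (simp add: power_mult[symmetric])
      from lim_imp_Liminf[OF sequentially_bot this] show ?case by simp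
    qed
    have bd: "(\<integral>\<^sup>+\<omega>. ennreal ((\<Sum>b\<in>Fp n. (X b \<omega>)\<^sup>2)\<^sup>2) \<partial>M) \<le> ennreal (3 * (tr + 1)\<^sup>2 * (t - s)\<^sup>2)" for n
    proof -
      have qp: "q b > 0" if "b \<in> Fp n" for b
      proof -
        have "q b \<noteq> 0" "q b \<ge> 0" using that Q0[of b] by (auto simp: Fp_def q_def)
        then show ?thesis by linarith
      qed
      have finFp: "finite (Fp n)" using finF by (simp add: Fp_def)
      have trF: "(\<Sum>b\<in>Fp n. q b) \<le> tr"
        unfolding q_def by (rule tr) (use finFp in \<open>auto simp: Fp_def Fn_def\<close>)
      have "(\<integral>\<^sup>+\<omega>. ennreal ((\<Sum>b\<in>Fp n. (X b \<omega>)\<^sup>2)\<^sup>2) \<partial>M)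
        \<le> (\<integral>\<^sup>+\<omega>. (\<Sum>b\<in>Fp n. ennreal (tr / q b) * ennreal ((X b \<omega>)^4)) \<partial>M)"
      proof (rule nn_integral_mono)
        fix \<omega>
        have "(\<Sum>b\<in>Fp n. (X b \<omega>)\<^sup>2)\<^sup>2 \<le> (\<Sum>b\<in>Fp n. q b) * (\<Sum>b\<in>Fp n. ((X b \<omega>)\<^sup>2)\<^sup>2 / q b)"
          by (rule sum_sq_C_S) (use finFp qp in auto)
        also have "\<dots> \<le> tr * (\<Sum>b\<in>Fp n. ((X b \<omega>)\<^sup>2)\<^sup>2 / q b)"
          using trF qp by (intro mult_right_mono sum_nonneg) (auto simp: less_imp_le)
        also have "\<dots> = (\<Sum>b\<in>Fp n. tr / q b * (X b \<omega>)^4)"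
          by (simp add: sum_distrib_left power_mult[symmetric])
        finally have "ennreal ((\<Sum>b\<in>Fp n. (X b \<omega>)\<^sup>2)\<^sup>2) \<le> ennreal (\<Sum>b\<in>Fp n. tr / q b * (X b \<omega>)^4)"
          by (rule ennreal_leI)
        also have "\<dots> = (\<Sum>b\<in>Fp n. ennreal (tr / q b * (X b \<omega>)^4))"
          using qp tr0 by (intro sum_ennreal[symmetric]) (auto simp: less_imp_le)
        also have "\<dots> = (\<Sum>b\<in>Fp n. ennreal (tr / q b) * ennreal ((X b \<omega>)^4))"
          using qp tr0 by (intro sum.cong ennreal_mult refl) (auto simp: less_imp_le)
        finally show "ennreal ((\<Sum>b\<in>Fp n. (X b \<omega>)\<^sup>2)\<^sup>2) \<le> (\<Sum>b\<in>Fp n. ennreal (tr / q b) * ennreal ((X b \<omega>)^4))" .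
      qed
      also have "\<dots> = (\<Sum>b\<in>Fp n. ennreal (tr / q b) * ennreal (3 * ((t - s) * q b)\<^sup>2))"
        by (subst nn_integral_sum) (auto simp: nn_integral_cmult mom(2) q_def)
      also have "\<dots> = (\<Sum>b\<in>Fp n. ennreal (tr * (3 * (t - s)\<^sup>2) * q b))"
      proof (intro sum.cong refl)
        fix b assume "b \<in> Fp n"
        then have qb: "q b > 0" by (rule qp)
        have "ennreal (tr / q b) * ennreal (3 * ((t - s) * q b)\<^sup>2) = ennreal (tr / q b * (3 * ((t - s) * q b)\<^sup>2))"
          using qb tr0 by (intro ennreal_mult[symmetric]) auto
        also have "tr / q b * (3 * ((t - s) * q b)\<^sup>2) = tr * (3 * (t - s)\<^sup>2) * q b"
          using qb by (simp add: power_mult_distrib power2_eq_square)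
        finally show "ennreal (tr / q b) * ennreal (3 * ((t - s) * q b)\<^sup>2) = ennreal (tr * (3 * (t - s)\<^sup>2) * q b)" .
      qed
      also have "\<dots> = ennreal (\<Sum>b\<in>Fp n. tr * (3 * (t - s)\<^sup>2) * q b)"
      proof (rule sum_ennreal)
        fix b assume "b \<in> Fp n"
        then have "q b > 0" by (rule qp)
        then show "0 \<le> tr * (3 * (t - s)\<^sup>2) * q b" using tr0 by simp
      qed
      also have "\<dots> = ennreal (tr * (3 * (t - s)\<^sup>2) * (\<Sum>b\<in>Fp n. q b))"
        by (simp only: sum_distrib_left)
      also have "\<dots> \<le> ennreal (3 * (tr + 1)\<^sup>2 * (t - s)\<^sup>2)"
      proof (rule ennreal_leI)
        have "tr * (3 * (t - s)\<^sup>2) * (\<Sum>b\<in>Fp n. q b) \<le> tr * (3 * (t - s)\<^sup>2) * tr"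
          using trF tr0 by (intro mult_left_mono) auto
        also have "\<dots> = 3 * (t - s)\<^sup>2 * tr\<^sup>2" by (simp add: power2_eq_square)
        also have "\<dots> \<le> 3 * (t - s)\<^sup>2 * (tr + 1)\<^sup>2"
          using tr0 by (intro mult_left_mono power_mono) auto
        finally show "tr * (3 * (t - s)\<^sup>2) * (\<Sum>b\<in>Fp n. q b) \<le> 3 * (tr + 1)\<^sup>2 * (t - s)\<^sup>2"
          by (simp add: mult_ac)
      qed
      finally show ?thesis .
    qed
    have "(\<integral>\<^sup>+\<omega>. ennreal ((norm (dW s t \<omega>))^4) \<partial>M)
      \<le> (\<integral>\<^sup>+\<omega>. liminf (\<lambda>n. ennreal ((\<Sum>b\<in>Fp n. (X b \<omega>)\<^sup>2)\<^sup>2)) \<partial>M)"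
      by (rule nn_integral_mono_AE[OF ae])
    also have "\<dots> \<le> liminf (\<lambda>n. (\<integral>\<^sup>+\<omega>. ennreal ((\<Sum>b\<in>Fp n. (X b \<omega>)\<^sup>2)\<^sup>2) \<partial>M))"
      by (rule nn_integral_liminf) measurable
    also have "\<dots> \<le> ennreal (3 * (tr + 1)\<^sup>2 * (t - s)\<^sup>2)"
      by (rule Liminf_le) (simp_all add: bd)
    finally show ?thesis .
  qed
  note bound = this
  \<comment> \<open>The added 1 keeps the constant positive when the trace is zero.\<close>
  have pos: "3 * (tr + 1)\<^sup>2 > 0" using tr0 by (intro mult_pos_pos zero_less_power) auto
  show ?thesis
    by (intro exI[of _ "3 * (tr + 1)\<^sup>2"] conjI pos allI impI bound) auto
qed

end

section \<open>Dyadic grids and quadratic variation\<close>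

definition grid :: "real \<Rightarrow> nat \<Rightarrow> nat \<Rightarrow> real" where
  "grid T n i = T * real i / 2 ^ n"

lemma grid_0 [simp]: "grid T n 0 = 0"
  by (simp add: grid_def)

lemma grid_last [simp]: "grid T n (2 ^ n) = T"
  by (simp add: grid_def)

lemma grid_Suc: "grid T n (Suc i) = grid T n i + T / 2 ^ n"
  by (simp add: grid_def field_simps)

lemma grid_mono: "0 \<le> T \<Longrightarrow> i \<le> j \<Longrightarrow> grid T n i \<le> grid T n j"
  by (simp add: grid_def divide_right_mono mult_left_mono)

lemma grid_nonneg: "0 \<le> T \<Longrightarrow> 0 \<le> grid T n i"
  by (simp add: grid_def)

lemma grid_less: "0 < T \<Longrightarrow> i < j \<Longrightarrow> grid T n i < grid T n j"
  by (simp add: grid_def divide_strict_right_mono)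

lemma grid_le: "0 \<le> T \<Longrightarrow> i \<le> 2 ^ n \<Longrightarrow> grid T n i \<le> T"
  using grid_mono[of T i "2 ^ n" n] by simp

lemma grid_mem: "0 \<le> T \<Longrightarrow> i \<le> 2 ^ n \<Longrightarrow> grid T n i \<in> {0..T}"
  by (simp add: grid_le grid_nonneg)

lemma grid_refine: "grid T (m + n) (b * 2 ^ n) = grid T m b"
  by (simp add: grid_def power_add)

lemma grid_fine:
  assumes "0 < (\<delta>::real)"
  shows "\<forall>\<^sub>F n in sequentially. T / 2 ^ n < \<delta>"
proof -
  have "(\<lambda>n. T * (1 / 2) ^ n) \<longlonglongrightarrow> T * 0"
    by (intro tendsto_intros LIMSEQ_realpow_zero) auto
  then have "(\<lambda>n. T / 2 ^ n) \<longlonglongrightarrow> 0" by (simp add: power_one_over)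
  then show ?thesis using assms by (rule order_tendstoD)
qed

text \<open>Uniform continuity on the compact interval, in the form used by the Riemann sums: on a
  fine grid every point of a cell is close to the left end, where the integrands are frozen.\<close>

lemma continuous_grid_osc:
  fixes y :: "real \<Rightarrow> 'a::metric_space"
  assumes "0 \<le> T" "continuous_on {0..T} y" "e > 0"
  shows "\<forall>\<^sub>F n in sequentially. \<forall>i<2 ^ n. \<forall>s\<in>{grid T n i..grid T n (Suc i)}. dist (y s) (y (grid T n i)) < e"
proof -
  have "uniformly_continuous_on {0..T} y"
    by (intro compact_uniformly_continuous assms) auto
  then have "\<exists>d>0. \<forall>s\<in>{0..T}. \<forall>t\<in>{0..T}. dist t s < d \<longrightarrow> dist (y t) (y s) < e"
    using \<open>e > 0\<close> by (simp only: uniformly_continuous_on_def)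
  then obtain d where d: "d > 0" and "\<forall>s\<in>{0..T}. \<forall>t\<in>{0..T}. dist t s < d \<longrightarrow> dist (y t) (y s) < e"
    by (elim exE conjE)
  then have d2: "dist (y t) (y s) < e" if "s \<in> {0..T}" "t \<in> {0..T}" "dist t s < d" for s t
    using that by simp
  show ?thesis
    using grid_fine[OF d, of T]
  proof eventually_elim
    case (elim n)
    show ?case
    proof (intro allI impI ballI)
      fix i s assume i: "i < (2::nat) ^ n" and s: "s \<in> {grid T n i..grid T n (Suc i)}"
      have "grid T n (Suc i) \<le> T" "0 \<le> grid T n i"
        using i assms(1) by (auto intro: grid_le grid_nonneg)
      moreover have "dist s (grid T n i) < d"
        using s elim by (auto simp: dist_real_def grid_Suc)
      ultimately show "dist (y s) (y (grid T n i)) < e" using s by (intro d2) auto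
    qed
  qed
qed

section \<open>Integrals and left-point Riemann sums over grid cells\<close>

lemma set_integral_split:
  fixes f :: "real \<Rightarrow> 'b::{banach,second_countable_topology}"
  assumes "a \<le> b" "b \<le> c" "set_integrable lborel {a..c} f"
  shows "(LINT s:{a..c}|lborel. f s) = (LINT s:{a..b}|lborel. f s) + (LINT s:{b..c}|lborel. f s)"
proof -
  have eq: "{a..c} = {a..b} \<union> {b..c}" using assms by auto
  have ae: "AE x in lborel. x \<noteq> b" by (rule AE_lborel_singleton)
  show ?thesis unfolding eq
    by (rule set_integral_Un_AE)
      (use ae assms(1,2) in \<open>auto elim!: eventually_mono intro!: set_integrable_subset[OF assms(3)]\<close>)
qed

lemma set_integral_grid_upto:
  fixes f :: "real \<Rightarrow> 'b::{banach,second_countable_topology}"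
  assumes "0 \<le> T" "set_integrable lborel {0..T} f" "k \<le> 2 ^ n"
  shows "(LINT s:{0..grid T n k}|lborel. f s) = (\<Sum>i<k. LINT s:{grid T n i..grid T n (Suc i)}|lborel. f s)"
  using assms(3)
proof (induction k)
  case 0
  have "(LINT s:{0}|lborel. f s) = 0"
    unfolding set_lebesgue_integral_def
    by (intro integral_eq_zero_AE eventually_mono[OF AE_lborel_singleton[of 0]]) auto
  then show ?case by simp
next
  case (Suc k)
  have "(LINT s:{0..grid T n (Suc k)}|lborel. f s)
    = (LINT s:{0..grid T n k}|lborel. f s) + (LINT s:{grid T n k..grid T n (Suc k)}|lborel. f s)"
    using Suc.prems assms
    by (intro set_integral_split set_integrable_subset[OF assms(2)])
      (auto intro: grid_nonneg grid_mono grid_le order_trans)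
  with Suc show ?case by simp
qed

lemma set_integral_grid:
  fixes f :: "real \<Rightarrow> 'b::{banach,second_countable_topology}"
  assumes "0 \<le> T" "set_integrable lborel {0..T} f"
  shows "(LINT s:{0..T}|lborel. f s) = (\<Sum>i<2 ^ n. LINT s:{grid T n i..grid T n (Suc i)}|lborel. f s)"
  using set_integral_grid_upto[OF assms, of "2 ^ n" n] by simp

lemma set_integrable_grid:
  fixes f :: "real \<Rightarrow> 'b::{banach,second_countable_topology}"
  assumes "0 \<le> T" "set_integrable lborel {0..T} f" "i < 2 ^ n"
  shows "set_integrable lborel {grid T n i..grid T n (Suc i)} f"
  using assms grid_le[of T "Suc i" n] grid_nonneg[of T n i]
  by (intro set_integrable_subset[OF assms(2)]) auto

lemma set_integrable_bilinear:
  fixes y :: "real \<Rightarrow> 'a::{banach,second_countable_topology}"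
    and f :: "real \<Rightarrow> 'b::{banach,second_countable_topology}"
    and prod :: "'a \<Rightarrow> 'b \<Rightarrow> 'c::{banach,second_countable_topology}"
  assumes "bounded_bilinear prod" and y: "continuous_on {a..b} y" and f: "set_integrable lborel {a..b} f"
  shows "set_integrable lborel {a..b} (\<lambda>s. prod (y s) (f s))"
proof -
  interpret bounded_bilinear prod by fact
  obtain K where K: "K > 0" "\<And>u v. norm (prod u v) \<le> norm u * norm v * K" using pos_bounded by blast
  have "bounded (y ` {a..b})" by (intro compact_imp_bounded compact_continuous_image y) auto
  then obtain Y where "\<forall>x\<in>y ` {a..b}. norm x \<le> Y" unfolding bounded_iff by blast
  then have Y: "\<And>s. s \<in> {a..b} \<Longrightarrow> norm (y s) \<le> Y" by blast
  have eq: "indicator {a..b} s *\<^sub>R prod (y s) (f s) = prod (indicator {a..b} s *\<^sub>R y s) (indicator {a..b} s *\<^sub>R f s)" for s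
    by (auto simp: indicator_def zero_left)
  have "(\<lambda>s. indicator {a..b} s *\<^sub>R y s) \<in> borel_measurable borel"
    by (rule borel_measurable_continuous_on_indicator[OF _ y]) auto
  then have ym: "(\<lambda>s. indicator {a..b} s *\<^sub>R y s) \<in> borel_measurable lborel" by simp
  have fm: "(\<lambda>s. indicator {a..b} s *\<^sub>R f s) \<in> borel_measurable lborel"
    using f unfolding set_integrable_def by auto
  have "(\<lambda>s. prod (indicator {a..b} s *\<^sub>R y s) (indicator {a..b} s *\<^sub>R f s)) \<in> borel_measurable lborel"
    by (rule borel_measurable_continuous_Pair[OF ym fm])
      (auto simp: split_beta intro!: continuous_intros continuous_on)
  then show ?thesis unfolding set_integrable_def eq
  proof (rule Bochner_Integration.integrable_bound[rotated])
    show "integrable lborel (\<lambda>s. (Y * K) *\<^sub>R norm (indicator {a..b} s *\<^sub>R f s))"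
      using f unfolding set_integrable_def by (intro integrable_scaleR_right integrable_norm)
    show "AE s in lborel. norm (prod (indicator {a..b} s *\<^sub>R y s) (indicator {a..b} s *\<^sub>R f s))
        \<le> norm ((Y * K) *\<^sub>R norm (indicator {a..b} s *\<^sub>R f s))"
    proof (rule AE_I2)
      fix s
      show "norm (prod (indicator {a..b} s *\<^sub>R y s) (indicator {a..b} s *\<^sub>R f s))
        \<le> norm ((Y * K) *\<^sub>R norm (indicator {a..b} s *\<^sub>R f s))"
      proof (cases "s \<in> {a..b}")
        case True
        have "norm (prod (y s) (f s)) \<le> norm (y s) * norm (f s) * K" by (rule K)
        also have "\<dots> \<le> Y * norm (f s) * K"
          using Y[OF True] K(1) by (intro mult_right_mono) auto
        also have "\<dots> \<le> \<bar>Y * K\<bar> * norm (f s)"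
          by (metis abs_ge_self mult.commute mult.left_commute mult_right_mono norm_ge_zero)
        finally show ?thesis using True by (simp add: abs_mult)
      qed (simp add: zero_left)
    qed
  qed
qed

lemma set_integrable_continuous:
  fixes y :: "real \<Rightarrow> 'a::{banach,second_countable_topology}"
  assumes y: "continuous_on {a..b} y"
  shows "set_integrable lborel {a..b} y"
  using borel_integrable_compact[of "{a..b}" y] y unfolding set_integrable_def by auto

text \<open>Freezing \<open>y\<close> at the left end of each cell costs at most the oscillation of
  \<open>y\<close> there times the integral of the norm of \<open>f\<close>. The total error is thus
  at most the oscillation times a bound of the product times the L1 norm of
  \<open>f\<close>.\<close>

lemma riemann_bilinear:
  fixes y :: "real \<Rightarrow> 'a::{banach,second_countable_topology}"
    and f :: "real \<Rightarrow> 'b::{banach,second_countable_topology}"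
    and prod :: "'a \<Rightarrow> 'b \<Rightarrow> 'c::{banach,second_countable_topology}"
  assumes bl: "bounded_bilinear prod" and T: "0 \<le> T" and y: "continuous_on {0..T} y"
    and f: "set_integrable lborel {0..T} f"
  shows "(\<lambda>n. \<Sum>i<2 ^ n. prod (y (grid T n i)) (LINT s:{grid T n i..grid T n (Suc i)}|lborel. f s))
    \<longlonglongrightarrow> (LINT s:{0..T}|lborel. prod (y s) (f s))" (is "?S \<longlonglongrightarrow> ?L")
proof (rule LIMSEQ_I)
  fix r :: real assume r: "r > 0"
  interpret bounded_bilinear prod by fact
  obtain K where K: "K > 0" "\<And>u v. norm (prod u v) \<le> norm u * norm v * K" using pos_bounded by blast
  define N where "N = (LINT s:{0..T}|lborel. norm (f s))"
  have N0: "N \<ge> 0" unfolding N_def set_lebesgue_integral_def by (intro integral_nonneg_AE) auto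
  have fn: "set_integrable lborel {0..T} (\<lambda>s. norm (f s))" using f by (rule set_integrable_norm)
  \<comment> \<open>The oscillation is chosen with e K N < r; the 1 covers the case that the L1 norm
    N vanishes.\<close>
  define e where "e = r / (2 * K * (N + 1))"
  have e: "e > 0" using r K N0 by (simp add: e_def)
  have pf: "set_integrable lborel {0..T} (\<lambda>s. prod (y s) (f s))"
    by (rule set_integrable_bilinear[OF bl y f])
  have "\<forall>\<^sub>F n in sequentially. norm (?S n - ?L) < r"
    using continuous_grid_osc[OF T y e]
  proof eventually_elim
    case (elim n)
    let ?I = "\<lambda>i. {grid T n i..grid T n (Suc i)}"
    have one: "norm (prod (y (grid T n i)) (LINT s:?I i|lborel. f s) - (LINT s:?I i|lborel. prod (y s) (f s)))
      \<le> e * K * (LINT s:?I i|lborel. norm (f s))" if i: "i < 2 ^ n" for i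
    proof -
      have fi: "set_integrable lborel (?I i) f" by (rule set_integrable_grid[OF T f i])
      have pi: "set_integrable lborel (?I i) (\<lambda>s. prod (y s) (f s))"
        by (rule set_integrable_grid[OF T pf i])
      have ci: "set_integrable lborel (?I i) (\<lambda>s. prod (y (grid T n i)) (f s))"
        by (rule set_integrable_bilinear[OF bl _ fi]) auto
      have "prod (y (grid T n i)) (LINT s:?I i|lborel. f s) = (LINT s:?I i|lborel. prod (y (grid T n i)) (f s))"
        unfolding set_lebesgue_integral_def
        using integral_bounded_linear[OF bounded_linear_right[of "y (grid T n i)"], of lborel "\<lambda>s. indicator (?I i) s *\<^sub>R f s"]
          fi by (simp add: set_integrable_def scaleR_right)
      then have "prod (y (grid T n i)) (LINT s:?I i|lborel. f s) - (LINT s:?I i|lborel. prod (y s) (f s))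
        = (LINT s:?I i|lborel. prod (y (grid T n i)) (f s) - prod (y s) (f s))"
        using ci pi by simp
      also have "norm \<dots> \<le> (LINT s:?I i|lborel. norm (prod (y (grid T n i)) (f s) - prod (y s) (f s)))"
        using ci pi by (intro set_integral_norm_bound) auto
      also have "\<dots> \<le> (LINT s:?I i|lborel. e * K * norm (f s))"
      proof (rule set_integral_mono)
        show "set_integrable lborel (?I i) (\<lambda>s. norm (prod (y (grid T n i)) (f s) - prod (y s) (f s)))"
          using ci pi by (intro set_integrable_norm) auto
        show "set_integrable lborel (?I i) (\<lambda>s. e * K * norm (f s))"
          using set_integrable_norm[OF fi] by auto
        fix s assume s: "s \<in> ?I i"
        have "norm (prod (y (grid T n i)) (f s) - prod (y s) (f s)) = norm (prod (y (grid T n i) - y s) (f s))"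
          by (simp add: diff_left)
        also have "\<dots> \<le> norm (y (grid T n i) - y s) * norm (f s) * K" by (rule K)
        also have "\<dots> \<le> e * norm (f s) * K"
          using elim i s K(1) by (intro mult_right_mono) (auto simp: dist_norm norm_minus_commute less_imp_le)
        finally show "norm (prod (y (grid T n i)) (f s) - prod (y s) (f s)) \<le> e * K * norm (f s)"
          by (simp add: mult_ac)
      qed
      finally show ?thesis by simp
    qed
    have "norm (?S n - ?L) = norm (\<Sum>i<2 ^ n. prod (y (grid T n i)) (LINT s:?I i|lborel. f s) - (LINT s:?I i|lborel. prod (y s) (f s)))"
      unfolding set_integral_grid[OF T pf, of n] by (simp add: sum_subtractf)
    also have "\<dots> \<le> (\<Sum>i<2 ^ n. e * K * (LINT s:?I i|lborel. norm (f s)))"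
      by (rule sum_norm_le) (use one in auto)
    also have "\<dots> = e * K * N"
      unfolding N_def set_integral_grid[OF T fn, of n] by (simp add: sum_distrib_left)
    also have "\<dots> < r"
    proof -
      have "e * K * N = r * (N / (2 * (N + 1)))" using K by (simp add: e_def)
      also have "\<dots> < r * 1" using r N0 by (intro mult_strict_left_mono) (auto simp: field_simps)
      finally show ?thesis by simp
    qed
    finally show ?case .
  qed
  then show "\<exists>no. \<forall>n\<ge>no. norm (?S n - ?L) < r" by (simp add: eventually_sequentially)
qed

text \<open>Absolute continuity of the integral, obtained as uniform continuity of the indefinite
  integral of the norm.\<close>

lemma integral_grid_small:
  fixes f :: "real \<Rightarrow> 'b::{banach,second_countable_topology}"
  assumes T: "0 \<le> T" and f: "set_integrable lborel {0..T} f" and e: "e > 0"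
  shows "\<forall>\<^sub>F n in sequentially. \<forall>i<2 ^ n. norm (LINT s:{grid T n i..grid T n (Suc i)}|lborel. f s) < e"
proof -
  have fn: "set_integrable lborel {0..T} (\<lambda>s. norm (f s))" using f by (rule set_integrable_norm)
  have "continuous_on {0..T} (\<lambda>t. integral {0..t} (\<lambda>s. norm (f s)))"
    by (rule indefinite_integral_continuous_1) (rule set_borel_integral_eq_integral(1)[OF fn])
  from continuous_grid_osc[OF T this e] show ?thesis
  proof eventually_elim
    case (elim n)
    show ?case
    proof (intro allI impI)
      fix i assume i: "i < (2::nat) ^ n"
      let ?a = "grid T n i" and ?b = "grid T n (Suc i)"
      have ab: "0 \<le> ?a" "?a \<le> ?b" "?b \<le> T" using i T by (auto intro: grid_nonneg grid_mono grid_le)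
      have sub: "set_integrable lborel {0..c} (\<lambda>s. norm (f s))" if "c \<le> T" for c
        using that by (intro set_integrable_subset[OF fn]) auto
      have "norm (LINT s:{?a..?b}|lborel. f s) \<le> (LINT s:{?a..?b}|lborel. norm (f s))"
        by (intro set_integral_norm_bound set_integrable_grid[OF T f i])
      also have "\<dots> = (LINT s:{0..?b}|lborel. norm (f s)) - (LINT s:{0..?a}|lborel. norm (f s))"
        using set_integral_split[OF ab(1,2) sub[OF ab(3)]] by simp
      also have "\<dots> = integral {0..?b} (\<lambda>s. norm (f s)) - integral {0..?a} (\<lambda>s. norm (f s))"
        using ab by (simp add: set_borel_integral_eq_integral(2) sub)
      also have "\<dots> < e"
        using elim[rule_format, OF i, of ?b] ab by (simp add: dist_real_def)
      finally show "norm (LINT s:{?a..?b}|lborel. f s) < e" .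
    qed
  qed
qed

text \<open>In each square one factor is uniformly small and the other factors sum to at most the L1
  norm. In other words, an absolutely continuous path has quadratic variation zero.\<close>

lemma integral_grid_square:
  fixes f :: "real \<Rightarrow> 'b::{banach,second_countable_topology}"
  assumes T: "0 \<le> T" and f: "set_integrable lborel {0..T} f"
  shows "(\<lambda>n. \<Sum>i<2 ^ n. (norm (LINT s:{grid T n i..grid T n (Suc i)}|lborel. f s))\<^sup>2) \<longlonglongrightarrow> 0"
proof (rule LIMSEQ_I)
  fix r :: real assume r: "r > 0"
  define N where "N = (LINT s:{0..T}|lborel. norm (f s))"
  have N0: "N \<ge> 0" unfolding N_def set_lebesgue_integral_def by (intro integral_nonneg_AE) auto
  have fn: "set_integrable lborel {0..T} (\<lambda>s. norm (f s))" using f by (rule set_integrable_norm)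
  define e where "e = r / (N + 1)"
  have e: "e > 0" using r N0 by (simp add: e_def)
  let ?x = "\<lambda>n i. LINT s:{grid T n i..grid T n (Suc i)}|lborel. f s"
  have "\<forall>\<^sub>F n in sequentially. norm ((\<Sum>i<2 ^ n. (norm (?x n i))\<^sup>2) - 0) < r"
    using integral_grid_small[OF T f e]
  proof eventually_elim
    case (elim n)
    have "(\<Sum>i<2 ^ n. (norm (?x n i))\<^sup>2) \<le> (\<Sum>i<2 ^ n. e * (LINT s:{grid T n i..grid T n (Suc i)}|lborel. norm (f s)))"
    proof (rule sum_mono)
      fix i assume "i \<in> {..<(2::nat) ^ n}"
      then have i: "i < 2 ^ n" by simp
      have "(norm (?x n i))\<^sup>2 \<le> e * norm (?x n i)"
        using elim i unfolding power2_eq_square by (intro mult_right_mono) (auto simp: less_imp_le)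
      also have "\<dots> \<le> e * (LINT s:{grid T n i..grid T n (Suc i)}|lborel. norm (f s))"
        using e by (intro mult_left_mono set_integral_norm_bound set_integrable_grid[OF T f i]) auto
      finally show "(norm (?x n i))\<^sup>2 \<le> e * (LINT s:{grid T n i..grid T n (Suc i)}|lborel. norm (f s))" .
    qed
    also have "\<dots> = e * N" unfolding N_def set_integral_grid[OF T fn, of n] by (simp add: sum_distrib_left)
    also have "\<dots> < r"
    proof -
      have "e * N = r * (N / (N + 1))" by (simp add: e_def)
      also have "\<dots> < r * 1" using r N0 by (intro mult_strict_left_mono) (simp_all add: divide_less_eq_1)
      finally show ?thesis by simp
    qed
    finally have lt: "(\<Sum>i<2 ^ n. (norm (?x n i))\<^sup>2) < r" .
    have "0 \<le> (\<Sum>i<2 ^ n. (norm (?x n i))\<^sup>2)" by (rule sum_nonneg) (rule zero_le_power2)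
    with lt show ?case unfolding diff_zero real_norm_def by linarith
  qed
  then show "\<exists>no. \<forall>n\<ge>no. norm ((\<Sum>i<2 ^ n. (norm (?x n i))\<^sup>2) - 0) < r" unfolding eventually_sequentially .
qed

lemma sum_blocks:
  fixes f :: "nat \<Rightarrow> 'a::comm_monoid_add"
  shows "(\<Sum>i<2 ^ (m + n). f i) = (\<Sum>b<2 ^ m. \<Sum>i\<in>{b * 2 ^ n..<b * 2 ^ n + 2 ^ n}. f i)"
  using sum.nat_group[of f "2 ^ n" "2 ^ m"] by (simp add: power_add)

text \<open>It suffices to test the quadratic variation on dyadic blocks against a countable dense set of
  constant vectors; then it holds for all continuous integrands at once.  This makes the pathwise
  Ito calculus below applicable to integrands that depend on the path.\<close>

lemma quadratic_variation_continuous: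
  fixes w :: "real \<Rightarrow> 'h::{real_inner,banach,second_countable_topology}" and Q :: "'h \<Rightarrow> 'h"
  assumes T: "0 < T" and Q: "bounded_linear Q" "\<And>x y. Q x \<bullet> y = x \<bullet> Q y"
    and V: "\<And>n. (\<Sum>i<2 ^ n. (norm (w (grid T n (Suc i)) - w (grid T n i)))\<^sup>2) \<le> V"
    and dense: "closure D = UNIV"
    and blocks: "\<And>h m b. h \<in> D \<Longrightarrow> b < 2 ^ m \<Longrightarrow>
      (\<lambda>n. \<Sum>i\<in>{b * 2 ^ n..<b * 2 ^ n + 2 ^ n}. (h \<bullet> (w (grid T (m + n) (Suc i)) - w (grid T (m + n) i)))\<^sup>2)
        \<longlonglongrightarrow> T / 2 ^ m * (Q h \<bullet> h)"
    and a: "continuous_on {0..T} a"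
  shows "(\<lambda>n. \<Sum>i<2 ^ n. (a (grid T n i) \<bullet> (w (grid T n (Suc i)) - w (grid T n i)))\<^sup>2)
    \<longlonglongrightarrow> (LINT s:{0..T}|lborel. Q (a s) \<bullet> a s)" (is "?S \<longlonglongrightarrow> ?L")
proof -
  have T0: "0 \<le> T" using T by simp
  obtain q where q: "q > 0" "\<And>x. norm (Q x) \<le> norm x * q"
    using bounded_linear.pos_bounded[OF Q(1)] by blast
  have "bounded (a ` {0..T})" by (intro compact_imp_bounded compact_continuous_image a) auto
  then obtain K0 where "\<forall>x\<in>a ` {0..T}. norm x \<le> K0" unfolding bounded_iff by blast
  then have K0: "\<And>s. s \<in> {0..T} \<Longrightarrow> norm (a s) \<le> K0" by blast
  \<comment> \<open>The margin 1 absorbs the passage from \<open>a\<close> to a nearby vector of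
    \<open>D\<close>, which changes the norm by at most 2 e \<le> 1.\<close>
  define K where "K = max K0 0 + 1"
  have K: "\<And>s. s \<in> {0..T} \<Longrightarrow> norm (a s) + 1 \<le> K" "K > 0" using K0 by (auto simp: K_def le_max_iff_disj intro: order_trans)
  have V0: "V \<ge> 0" using V[of 0] by (smt (verit) sum_nonneg zero_le_power2)
  have phi: "continuous_on {0..T} (\<lambda>s. Q (a s) \<bullet> a s)"
    by (intro continuous_intros a continuous_on_compose2[OF linear_continuous_on[OF Q(1), of UNIV] a]) auto
  have phii: "set_integrable lborel {0..T} (\<lambda>s. Q (a s) \<bullet> a s)"
    by (rule set_integrable_continuous[OF phi])
  define Cst where "Cst = 4 * K * V + 4 * K * q * T"
  have Cst0: "Cst \<ge> 0" using K V0 q T by (simp add: Cst_def)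
  have main: "\<forall>\<^sub>F n in sequentially. \<bar>?S n - ?L\<bar> \<le> Cst * e + e" if e: "0 < e" "e \<le> 1/2" for e
  proof -
    obtain m where "\<forall>i<2 ^ m. \<forall>s\<in>{grid T m i..grid T m (Suc i)}. dist (a s) (a (grid T m i)) < e"
      using eventually_happens'[OF sequentially_bot continuous_grid_osc[OF T0 a e(1)]] by (elim exE)
    then have m: "dist (a s) (a (grid T m i)) < e" if "i < 2 ^ m" "s \<in> {grid T m i..grid T m (Suc i)}" for i s
      using that by blast
    \<comment> \<open>The level m stays fixed while n grows: \<open>a\<close> is frozen on each of
      the finitely many coarse blocks at a vector of the dense set, for which the limit is
      known.\<close>
    have "\<exists>h. h \<in> D \<and> dist h (a (grid T m b)) < e" for b
      using dense e(1) closure_approachable[of "a (grid T m b)" D] by auto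
    then obtain h where h: "\<And>b. h b \<in> D" "\<And>b. dist (h b) (a (grid T m b)) < e" by metis
    have ah: "norm (a s - h b) \<le> 2 * e" "norm (h b) \<le> K" "norm (a s) \<le> K"
      if "b < 2 ^ m" "s \<in> {grid T m b..grid T m (Suc b)}" for b s
    proof -
      show 1: "norm (a s - h b) \<le> 2 * e"
        using m[OF that] h(2)[of b] dist_triangle2[of "a s" "h b" "a (grid T m b)"] by (simp add: dist_norm)
      have "s \<in> {0..T}" using that T0 grid_le[of T "Suc b" m] grid_nonneg[of T m b] by auto
      from K(1)[OF this] show "norm (a s) \<le> K" "norm (h b) \<le> K"
        using 1 e(2) norm_triangle_ineq2[of "h b" "a s"] by (auto simp: norm_minus_commute)
    qed
    define D1 where "D1 n i = w (grid T n (Suc i)) - w (grid T n i)" for n i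
    define R where "R n = (\<Sum>b<2 ^ m. \<Sum>i\<in>{b * 2 ^ n..<b * 2 ^ n + 2 ^ n}. (h b \<bullet> D1 (m + n) i)\<^sup>2)" for n
    have "R \<longlonglongrightarrow> (\<Sum>b<2 ^ m. T / 2 ^ m * (Q (h b) \<bullet> h b))"
      unfolding R_def D1_def by (intro tendsto_sum blocks h) auto
    then have "\<forall>\<^sub>F n in sequentially. dist (R n) (\<Sum>b<2 ^ m. T / 2 ^ m * (Q (h b) \<bullet> h b)) < e"
      using e(1) by (rule tendstoD)
    moreover have SR: "\<bar>?S (m + n) - R n\<bar> \<le> 4 * K * V * e" for n
    proof -
      have "\<bar>?S (m + n) - R n\<bar> = \<bar>\<Sum>b<2 ^ m. \<Sum>i\<in>{b * 2 ^ n..<b * 2 ^ n + 2 ^ n}.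
          (a (grid T (m + n) i) \<bullet> D1 (m + n) i)\<^sup>2 - (h b \<bullet> D1 (m + n) i)\<^sup>2\<bar>"
        unfolding R_def D1_def[symmetric] sum_blocks by (simp add: sum_subtractf)
      also have "\<dots> \<le> (\<Sum>b<2 ^ m. \<Sum>i\<in>{b * 2 ^ n..<b * 2 ^ n + 2 ^ n}. 4 * K * e * (norm (D1 (m + n) i))\<^sup>2)"
      proof (rule order_trans[OF sum_abs], rule sum_mono, rule order_trans[OF sum_abs], rule sum_mono)
        fix b i assume b: "b \<in> {..<(2::nat) ^ m}" and i: "i \<in> {b * 2 ^ n..<b * 2 ^ n + 2 ^ n}"
        let ?d = "D1 (m + n) i" and ?a = "a (grid T (m + n) i)"
        have "grid T (m + n) (b * 2 ^ n) \<le> grid T (m + n) i" "grid T (m + n) i \<le> grid T (m + n) (Suc b * 2 ^ n)"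
          using i by (intro grid_mono T0; simp)+
        then have s: "grid T (m + n) i \<in> {grid T m b..grid T m (Suc b)}" by (simp only: grid_refine atLeastAtMost_iff)
        note ah' = ah[OF _ s]
        \<comment> \<open>A difference of squares factors into two terms linear in the increment,
          the first with a coefficient of norm at most 2 e. The bound \<open>V\<close> then controls
          the sum of the squared increments.\<close>
        have "(?a \<bullet> ?d)\<^sup>2 - (h b \<bullet> ?d)\<^sup>2 = ((?a - h b) \<bullet> ?d) * ((?a + h b) \<bullet> ?d)"
          by (simp add: inner_diff_left inner_add_left power2_eq_square algebra_simps)
        then have "\<bar>(?a \<bullet> ?d)\<^sup>2 - (h b \<bullet> ?d)\<^sup>2\<bar> = \<bar>(?a - h b) \<bullet> ?d\<bar> * \<bar>(?a + h b) \<bullet> ?d\<bar>"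
          by (simp add: abs_mult)
        also have "\<dots> \<le> (2 * e * norm ?d) * (2 * K * norm ?d)"
        proof (rule mult_mono)
          show "\<bar>(?a - h b) \<bullet> ?d\<bar> \<le> 2 * e * norm ?d"
            using ah'(1) b by (intro order_trans[OF Cauchy_Schwarz_ineq2] mult_right_mono) auto
          have "norm (?a + h b) \<le> 2 * K" using ah'(2,3) b norm_triangle_ineq[of ?a "h b"] by auto
          then show "\<bar>(?a + h b) \<bullet> ?d\<bar> \<le> 2 * K * norm ?d"
            by (intro order_trans[OF Cauchy_Schwarz_ineq2] mult_right_mono) auto
        qed (use e in auto)
        finally show "\<bar>(?a \<bullet> ?d)\<^sup>2 - (h b \<bullet> ?d)\<^sup>2\<bar> \<le> 4 * K * e * (norm ?d)\<^sup>2"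
          by (simp add: power2_eq_square mult_ac)
      qed
      also have "\<dots> = 4 * K * e * (\<Sum>i<2 ^ (m + n). (norm (D1 (m + n) i))\<^sup>2)"
        unfolding sum_blocks by (simp add: sum_distrib_left)
      also have "\<dots> \<le> 4 * K * e * V"
        using V[of "m + n"] K(2) e unfolding D1_def by (intro mult_left_mono) auto
      finally show ?thesis by (simp add: mult_ac)
    qed
    \<comment> \<open>The same freezing on the side of the limit. Here the symmetry of
      \<open>Q\<close> lets the difference of the two quadratic forms factor in the same
      way.\<close>
    moreover have RL: "\<bar>(\<Sum>b<2 ^ m. T / 2 ^ m * (Q (h b) \<bullet> h b)) - ?L\<bar> \<le> 4 * K * q * T * e"
    proof -
      have one: "\<bar>T / 2 ^ m * (Q (h b) \<bullet> h b) - (LINT s:{grid T m b..grid T m (Suc b)}|lborel. Q (a s) \<bullet> a s)\<bar>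
        \<le> T / 2 ^ m * (4 * K * q * e)" if b: "b < 2 ^ m" for b
      proof -
        let ?I = "{grid T m b..grid T m (Suc b)}"
        have len: "measure lborel ?I = T / 2 ^ m" using T by (simp add: grid_Suc)
        have ii: "set_integrable lborel ?I (\<lambda>s. Q (a s) \<bullet> a s)"
          by (rule set_integrable_grid[OF T0 phii b])
        have cc: "set_integrable lborel ?I (\<lambda>s. c)" for c :: real
          by (rule set_integrable_continuous) auto
        have const: "(LINT s:?I|lborel. c) = T / 2 ^ m * c" for c :: real
        proof -
          have "emeasure lborel ?I \<noteq> \<infinity>" by (simp add: emeasure_lborel_Icc_eq)
          then have "(LINT s:?I|lborel. c) = measure lborel ?I *\<^sub>R c" by (intro set_integral_const) auto
          then show ?thesis unfolding len by simp
        qed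
        have "T / 2 ^ m * (Q (h b) \<bullet> h b) - (LINT s:?I|lborel. Q (a s) \<bullet> a s)
          = (LINT s:?I|lborel. Q (h b) \<bullet> h b - Q (a s) \<bullet> a s)"
          using ii cc by (simp add: const)
        also have "\<bar>\<dots>\<bar> \<le> (LINT s:?I|lborel. \<bar>Q (h b) \<bullet> h b - Q (a s) \<bullet> a s\<bar>)"
          using set_integral_norm_bound[of lborel ?I "\<lambda>s. Q (h b) \<bullet> h b - Q (a s) \<bullet> a s"] ii cc by auto
        also have "\<dots> \<le> (LINT s:?I|lborel. 4 * K * q * e)"
        proof (rule set_integral_mono)
          show "set_integrable lborel ?I (\<lambda>s. \<bar>Q (h b) \<bullet> h b - Q (a s) \<bullet> a s\<bar>)"
            using set_integrable_norm[of lborel ?I "\<lambda>s. Q (h b) \<bullet> h b - Q (a s) \<bullet> a s"] ii cc by auto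
          fix s assume s: "s \<in> ?I"
          note ah' = ah[OF b s]
          have "Q (h b) \<bullet> h b - Q (a s) \<bullet> a s = Q (h b - a s) \<bullet> (h b + a s)"
          proof -
            have "Q (a s) \<bullet> h b = Q (h b) \<bullet> a s" using Q(2)[of "a s" "h b"] inner_commute[of "a s" "Q (h b)"] by simp
            then show ?thesis
              by (simp add: linear_diff[OF bounded_linear.linear[OF Q(1)]] inner_diff_left inner_add_right)
          qed
          also have "\<bar>\<dots>\<bar> \<le> norm (Q (h b - a s)) * norm (h b + a s)" by (rule Cauchy_Schwarz_ineq2)
          also have "\<dots> \<le> (2 * e * q) * (2 * K)"
          proof (rule mult_mono)
            have "norm (Q (h b - a s)) \<le> norm (h b - a s) * q" by (rule q)
            also have "\<dots> \<le> 2 * e * q" using ah'(1) q(1) by (intro mult_right_mono) (auto simp: norm_minus_commute)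
            finally show "norm (Q (h b - a s)) \<le> 2 * e * q" .
            show "norm (h b + a s) \<le> 2 * K" using ah'(2,3) norm_triangle_ineq[of "h b" "a s"] by auto
          qed (use e q in auto)
          finally show "\<bar>Q (h b) \<bullet> h b - Q (a s) \<bullet> a s\<bar> \<le> 4 * K * q * e" by (simp add: mult_ac)
        qed (rule cc)
        also have "\<dots> = T / 2 ^ m * (4 * K * q * e)" by (rule const)
        finally show ?thesis .
      qed
      have "\<bar>(\<Sum>b<2 ^ m. T / 2 ^ m * (Q (h b) \<bullet> h b)) - ?L\<bar>
        = \<bar>\<Sum>b<2 ^ m. T / 2 ^ m * (Q (h b) \<bullet> h b) - (LINT s:{grid T m b..grid T m (Suc b)}|lborel. Q (a s) \<bullet> a s)\<bar>"
        unfolding set_integral_grid[OF T0 phii, of m] by (simp add: sum_subtractf)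
      also have "\<dots> \<le> (\<Sum>b<(2::nat) ^ m. T / 2 ^ m * (4 * K * q * e))"
        by (rule order_trans[OF sum_abs], rule sum_mono) (use one in auto)
      also have "\<dots> = 4 * K * q * T * e" by simp
      finally show ?thesis .
    qed
    ultimately have "\<forall>\<^sub>F n in sequentially. \<bar>?S (m + n) - ?L\<bar> \<le> Cst * e + e"
    proof (elim eventually_mono)
      fix n assume "dist (R n) (\<Sum>b<2 ^ m. T / 2 ^ m * (Q (h b) \<bullet> h b)) < e"
      then show "\<bar>?S (m + n) - ?L\<bar> \<le> Cst * e + e"
        using SR[of n] RL by (simp add: Cst_def dist_real_def algebra_simps)
    qed
    then show ?thesis
      by (simp add: eventually_sequentially_seg[of "\<lambda>n. \<bar>?S n - ?L\<bar> \<le> Cst * e + e" m] add.commute[of m])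
  qed
  show ?thesis
  proof (rule tendstoI)
    fix r :: real assume r: "r > 0"
    \<comment> \<open>The cap 1/2 is required by \<open>main\<close>, which in turn owes it to the
      margin in \<open>K\<close>.\<close>
    define e where "e = min (1/2) (r / (2 * (Cst + 1)))"
    have e: "0 < e" using r Cst0 by (simp add: e_def)
    have e2: "e \<le> 1/2" unfolding e_def by (rule min.cobounded1)
    have "Cst * e + e = (Cst + 1) * e" by (simp add: algebra_simps)
    also have "\<dots> \<le> (Cst + 1) * (r / (2 * (Cst + 1)))"
      using Cst0 by (intro mult_left_mono) (auto simp: e_def)
    also have "\<dots> = r / 2" using Cst0 by (simp add: field_simps)
    finally have "Cst * e + e < r" using r by simp
    with main[OF e e2] show "\<forall>\<^sub>F n in sequentially. dist (?S n) ?L < r"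
      by (elim eventually_mono) (auto simp: dist_real_def)
  qed
qed

text \<open>The series of the squares has finite expectation, hence converges almost surely, and its
  terms tend to zero.\<close>

lemma AE_tendsto_0_summable_squares:
  fixes X :: "nat \<Rightarrow> 'a \<Rightarrow> real"
  assumes X: "\<And>n. integrable M (\<lambda>\<omega>. (X n \<omega>)\<^sup>2)" and a: "\<And>n. (\<integral>\<omega>. (X n \<omega>)\<^sup>2 \<partial>M) \<le> a n" and s: "summable a"
  shows "AE \<omega> in M. (\<lambda>n. X n \<omega>) \<longlonglongrightarrow> 0"
proof -
  have m: "(\<lambda>\<omega>. ennreal ((X n \<omega>)\<^sup>2)) \<in> borel_measurable M" for n
    by (rule measurable_compose[OF borel_measurable_integrable[OF X] measurable_ennreal])
  have a0: "0 \<le> a n" for n by (rule order_trans[OF _ a[of n]]) simp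
  have "(\<integral>\<^sup>+\<omega>. (\<Sum>n. ennreal ((X n \<omega>)\<^sup>2)) \<partial>M) = (\<Sum>n. \<integral>\<^sup>+\<omega>. ennreal ((X n \<omega>)\<^sup>2) \<partial>M)"
    by (rule nn_integral_suminf) (rule m)
  also have "\<dots> \<le> (\<Sum>n. ennreal (a n))"
  proof (rule suminf_le[OF _ summableI summableI])
    fix n
    have "(\<integral>\<^sup>+\<omega>. ennreal ((X n \<omega>)\<^sup>2) \<partial>M) = ennreal (\<integral>\<omega>. (X n \<omega>)\<^sup>2 \<partial>M)"
      by (rule nn_integral_eq_integral[OF X]) simp
    also have "\<dots> \<le> ennreal (a n)" by (rule ennreal_leI[OF a])
    finally show "(\<integral>\<^sup>+\<omega>. ennreal ((X n \<omega>)\<^sup>2) \<partial>M) \<le> ennreal (a n)" .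
  qed
  also have "\<dots> = ennreal (suminf a)" using suminf_ennreal2[OF a0 s] .
  also have "\<dots> < \<infinity>" by simp
  finally have "AE \<omega> in M. (\<Sum>n. ennreal ((X n \<omega>)\<^sup>2)) \<noteq> \<infinity>"
    using m by (intro nn_integral_PInf_AE borel_measurable_suminf_order) auto
  then show ?thesis
  proof eventually_elim
    case (elim \<omega>)
    have "summable (\<lambda>n. (X n \<omega>)\<^sup>2)"
      using elim by (intro summable_suminf_not_top) auto
    from summable_LIMSEQ_zero[OF this] have "(\<lambda>n. sqrt ((X n \<omega>)\<^sup>2)) \<longlonglongrightarrow> sqrt 0"
      by (rule tendsto_real_sqrt)
    then have "(\<lambda>n. \<bar>X n \<omega>\<bar>) \<longlonglongrightarrow> 0" by simp
    then show ?case by (rule tendsto_rabs_zero_cancel)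
  qed
qed

section \<open>Variances of sums over the grid and almost sure quadratic variation\<close>

context wiener
begin

text \<open>One fourth-moment constant is fixed for the whole locale. Through it all second-moment
  bounds below are expressed, with 1 + \<open>C4\<close> in the place that the trace of Q takes in
  the exact isometry.\<close>

definition C4 :: real where
  "C4 = (SOME C. C > 0 \<and> (\<forall>s t. 0 \<le> s \<and> s < t \<longrightarrow>
    (\<integral>\<^sup>+\<omega>. ennreal ((norm (dW s t \<omega>))^4) \<partial>M) \<le> ennreal (C * (t - s)\<^sup>2)))"

lemma C4_pos: "C4 > 0"
  and C4: "0 \<le> s \<Longrightarrow> s < t \<Longrightarrow> (\<integral>\<^sup>+\<omega>. ennreal ((norm (dW s t \<omega>))^4) \<partial>M) \<le> ennreal (C4 * (t - s)\<^sup>2)"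
  using someI_ex[OF dW_fourth_moment, folded C4_def] by auto

lemma
  assumes st: "0 \<le> s" "s < t"
  shows dW_pow4_integrable: "integrable M (\<lambda>\<omega>. (norm (dW s t \<omega>))^4)"
    and dW_pow4: "(\<integral>\<omega>. (norm (dW s t \<omega>))^4 \<partial>M) \<le> C4 * (t - s)\<^sup>2"
proof -
  have m: "(\<lambda>\<omega>. (norm (dW s t \<omega>))^4) \<in> borel_measurable M"
    using dW_M[of s t] st by (intro borel_measurable_power borel_measurable_norm) auto
  show i: "integrable M (\<lambda>\<omega>. (norm (dW s t \<omega>))^4)"
  proof (rule integrableI_bounded[OF m])
    have "(\<integral>\<^sup>+\<omega>. ennreal (norm ((norm (dW s t \<omega>))^4)) \<partial>M) \<le> ennreal (C4 * (t - s)\<^sup>2)"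
      using C4[OF st] by simp
    also have "\<dots> < \<infinity>" by simp
    finally show "(\<integral>\<^sup>+\<omega>. ennreal (norm ((norm (dW s t \<omega>))^4)) \<partial>M) < \<infinity>" .
  qed
  have "ennreal (\<integral>\<omega>. (norm (dW s t \<omega>))^4 \<partial>M) \<le> ennreal (C4 * (t - s)\<^sup>2)"
    using C4[OF st] nn_integral_eq_integral[OF i] by simp
  then show "(\<integral>\<omega>. (norm (dW s t \<omega>))^4 \<partial>M) \<le> C4 * (t - s)\<^sup>2"
    using C4_pos by (subst (asm) ennreal_le_iff) auto
qed

text \<open>The second moment is drawn from the fourth by 2 x d \<le> x^2 + d^2, with x the squared
  norm of the increment and d = t - s as the balancing scale.\<close>

lemma
  assumes st: "0 \<le> s" "s < t"
  shows dW_sq_integrable: "integrable M (\<lambda>\<omega>. (norm (dW s t \<omega>))\<^sup>2)"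
    and dW_sq: "(\<integral>\<omega>. (norm (dW s t \<omega>))\<^sup>2 \<partial>M) \<le> (1 + C4) * (t - s)"
    and dW_integrable: "integrable M (\<lambda>\<omega>. dW s t \<omega>)"
proof -
  have m [measurable]: "dW s t \<in> borel_measurable M" using dW_M[of s t] st by auto
  note i4 = dW_pow4_integrable[OF st]
  have d: "t - s > 0" using st by simp
  have le: "(norm (dW s t \<omega>))\<^sup>2 \<le> ((t - s) + (norm (dW s t \<omega>))^4 / (t - s)) / 2" for \<omega>
  proof -
    let ?x = "(norm (dW s t \<omega>))\<^sup>2"
    have "0 \<le> (?x - (t - s))\<^sup>2" by simp
    then have "2 * ?x * (t - s) \<le> ?x\<^sup>2 + (t - s)\<^sup>2" by (simp add: power2_diff)
    then have "2 * ?x \<le> (?x\<^sup>2 + (t - s)\<^sup>2) / (t - s)" using d by (simp add: pos_le_divide_eq)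
    also have "\<dots> = (t - s) + ?x\<^sup>2 / (t - s)" using d by (simp add: add_divide_distrib power2_eq_square)
    finally show ?thesis by simp
  qed
  have ib: "integrable M (\<lambda>\<omega>. ((t - s) + (norm (dW s t \<omega>))^4 / (t - s)) / 2)"
    using i4 by auto
  show i2: "integrable M (\<lambda>\<omega>. (norm (dW s t \<omega>))\<^sup>2)"
    by (rule Bochner_Integration.integrable_bound[OF ib])
      (measurable, use le d in \<open>auto intro!: AE_I2\<close>)
  have "(\<integral>\<omega>. (norm (dW s t \<omega>))\<^sup>2 \<partial>M) \<le> (\<integral>\<omega>. ((t - s) + (norm (dW s t \<omega>))^4 / (t - s)) / 2 \<partial>M)"
    by (rule integral_mono[OF i2 ib le])
  also have "\<dots> = ((t - s) + (\<integral>\<omega>. (norm (dW s t \<omega>))^4 \<partial>M) / (t - s)) / 2"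
    using i4 by (simp add: prob_space)
  also have "\<dots> \<le> ((t - s) + C4 * (t - s)\<^sup>2 / (t - s)) / 2"
    using dW_pow4[OF st] d by (intro divide_right_mono add_left_mono) auto
  also have "C4 * (t - s)\<^sup>2 / (t - s) = C4 * (t - s)" using d by (simp add: power2_eq_square)
  also have "((t - s) + C4 * (t - s)) / 2 = (1 + C4) * (t - s) / 2" by (simp only: distrib_right mult_1)
  also have "\<dots> \<le> (1 + C4) * (t - s)" using d C4_pos by simp
  finally show "(\<integral>\<omega>. (norm (dW s t \<omega>))\<^sup>2 \<partial>M) \<le> (1 + C4) * (t - s)" .
  have ib': "integrable M (\<lambda>\<omega>. (1 + (norm (dW s t \<omega>))\<^sup>2) / 2)" using i2 by auto
  have le': "norm (dW s t \<omega>) \<le> (1 + (norm (dW s t \<omega>))\<^sup>2) / 2" for \<omega>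
    using zero_le_power2[of "norm (dW s t \<omega>) - 1"] by (simp add: power2_diff)
  show "integrable M (\<lambda>\<omega>. dW s t \<omega>)"
    by (rule Bochner_Integration.integrable_bound[OF ib' m]) (use le' in \<open>auto intro!: AE_I2 order_trans[OF le']\<close>)
qed

text \<open>The Bochner mean z of the increment satisfies z \<bullet> z = 0, because z \<bullet> z
  is the mean of a centred Gaussian variable. Bounded functionals commute with the Bochner
  integral.\<close>

lemma dW_mean_zero:
  assumes st: "0 \<le> s" "s < t" and f: "bounded_linear (f :: 'h \<Rightarrow> real)"
  shows "(\<integral>\<omega>. f (dW s t \<omega>) \<partial>M) = 0" "integrable M (\<lambda>\<omega>. f (dW s t \<omega>))"
proof -
  note i = dW_integrable[OF st]
  define z where "z = (\<integral>\<omega>. dW s t \<omega> \<partial>M)"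
  have m: "(\<lambda>\<omega>. dW s t \<omega> \<bullet> z) \<in> borel_measurable M" using dW_M[of s t] st by auto
  have "z \<bullet> z = (\<integral>\<omega>. dW s t \<omega> \<bullet> z \<partial>M)"
    unfolding z_def by (rule integral_inner_left[symmetric]) (use i in auto)
  also have "\<dots> = 0"
    by (rule centered_gaussian_moments(4)[OF prob_space_axioms dW_gaussian[OF st] m])
  finally have "z = 0" by simp
  then show "(\<integral>\<omega>. f (dW s t \<omega>) \<partial>M) = 0"
    using integral_bounded_linear[OF f i] linear_0[OF bounded_linear.linear[OF f]] unfolding z_def by simp
  show "integrable M (\<lambda>\<omega>. f (dW s t \<omega>))" by (rule integrable_bounded_linear[OF f i])
qed

text \<open>Mixed products have expectation zero: the factor with the smaller index is known when
  the later increment starts, and the later factor is centred and independent of that past. Only the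
  diagonal terms remain.\<close>

lemma independent_sum_variance:
  assumes I: "finite I" and st: "\<And>i. i \<in> I \<Longrightarrow> 0 \<le> s i \<and> s i < t i"
    and ord: "\<And>i j. i \<in> I \<Longrightarrow> j \<in> I \<Longrightarrow> i < (j::nat) \<Longrightarrow> t i \<le> s j"
    and G: "\<And>i. i \<in> I \<Longrightarrow> G i \<in> borel_measurable (borel :: 'h measure)"
    and i2: "\<And>i. i \<in> I \<Longrightarrow> integrable M (\<lambda>\<omega>. (G i (dW (s i) (t i) \<omega>))\<^sup>2)"
    and i1: "\<And>i. i \<in> I \<Longrightarrow> integrable M (\<lambda>\<omega>. G i (dW (s i) (t i) \<omega>))"
    and c: "\<And>i. i \<in> I \<Longrightarrow> (\<integral>\<omega>. (G i (dW (s i) (t i) \<omega>))\<^sup>2 \<partial>M) \<le> c"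
    and z: "\<And>i. i \<in> I \<Longrightarrow> (\<integral>\<omega>. G i (dW (s i) (t i) \<omega>) \<partial>M) = (0::real)"
  shows "integrable M (\<lambda>\<omega>. (\<Sum>i\<in>I. G i (dW (s i) (t i) \<omega>))\<^sup>2)"
    and "(\<integral>\<omega>. (\<Sum>i\<in>I. G i (dW (s i) (t i) \<omega>))\<^sup>2 \<partial>M) \<le> real (card I) * c"
proof -
  define X where "X i \<omega> = G i (dW (s i) (t i) \<omega>)" for i \<omega>
  have ordd: "integrable M (\<lambda>\<omega>. X i \<omega> * X j \<omega>) \<and> (\<integral>\<omega>. X i \<omega> * X j \<omega> \<partial>M) = 0"
    if ij: "i \<in> I" "j \<in> I" "i < j" for i j
  proof -
    have "dW (s i) (t i) \<in> borel_measurable (F (s j))"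
      using st[OF ij(1)] ord[OF ij] by (intro measurable_F_mono[OF dW_F]) auto
    then have Xm: "X i \<in> borel_measurable (F (s j))"
      unfolding X_def using G[OF ij(1)] by (rule measurable_compose)
    have Xi: "integrable M (X i)" using i1[OF ij(1)] by (simp add: X_def[abs_def])
    show ?thesis
      using indep_dW_integral[OF _ _ Xm Xi G[OF ij(2)] i1[OF ij(2)]]
        indep_dW_integrable[OF _ _ Xm Xi G[OF ij(2)] i1[OF ij(2)]] st[OF ij(2)] z[OF ij(2)]
      by (simp add: X_def[of j])
  qed
  have XX: "integrable M (\<lambda>\<omega>. X i \<omega> * X j \<omega>) \<and> (\<integral>\<omega>. X i \<omega> * X j \<omega> \<partial>M) \<le> (if i = j then c else 0)"
    if ij: "i \<in> I" "j \<in> I" for i j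
  proof (cases i j rule: linorder_cases)
    case less
    then show ?thesis using ordd[OF ij less] less by simp
  next
    case equal
    then show ?thesis using i2[OF ij(1)] c[OF ij(1)] by (simp add: X_def power2_eq_square)
  next
    case greater
    have "(\<lambda>\<omega>. X i \<omega> * X j \<omega>) = (\<lambda>\<omega>. X j \<omega> * X i \<omega>)" by (simp add: mult.commute)
    then show ?thesis using ordd[OF ij(2,1) greater] greater by simp
  qed
  have eq: "(\<Sum>i\<in>I. X i \<omega>)\<^sup>2 = (\<Sum>i\<in>I. \<Sum>j\<in>I. X i \<omega> * X j \<omega>)" for \<omega>
    by (simp add: power2_eq_square sum_product)
  have int: "integrable M (\<lambda>\<omega>. (\<Sum>i\<in>I. X i \<omega>)\<^sup>2)"
    unfolding eq using XX by (intro Bochner_Integration.integrable_sum) blast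
  have "(\<integral>\<omega>. (\<Sum>i\<in>I. X i \<omega>)\<^sup>2 \<partial>M) = (\<Sum>i\<in>I. \<Sum>j\<in>I. \<integral>\<omega>. X i \<omega> * X j \<omega> \<partial>M)"
    unfolding eq using XX
    by (subst Bochner_Integration.integral_sum; (intro Bochner_Integration.integrable_sum sum.cong refl Bochner_Integration.integral_sum)?) blast+
  also have "\<dots> \<le> (\<Sum>i\<in>I. \<Sum>j\<in>I. if i = j then c else 0)"
    using XX by (intro sum_mono) blast
  also have "\<dots> = real (card I) * c" using I by simp
  finally have le: "(\<integral>\<omega>. (\<Sum>i\<in>I. X i \<omega>)\<^sup>2 \<partial>M) \<le> real (card I) * c" .
  show "integrable M (\<lambda>\<omega>. (\<Sum>i\<in>I. G i (dW (s i) (t i) \<omega>))\<^sup>2)" using int by (simp add: X_def)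
  show "(\<integral>\<omega>. (\<Sum>i\<in>I. G i (dW (s i) (t i) \<omega>))\<^sup>2 \<partial>M) \<le> real (card I) * c" using le by (simp add: X_def)
qed

lemma Q_linear: "bounded_linear Q"
  and Q_symmetric: "Q x \<bullet> y = x \<bullet> Q y"
  and Q_nonneg: "0 \<le> Q x \<bullet> x"
  using cov unfolding covariance_op_def by blast+

text \<open>Centred functions of quadratic growth, applied to increments over cells of length T /
  2^(m + n), have variances of order 4^(-n). There are of order 2^n of them, so the variance of the
  sum is of order 2^(-n), which is summable.\<close>

lemma AE_grid_squares_tendsto_0:
  assumes T: "0 < T" and G: "\<And>n i. G n i \<in> borel_measurable (borel :: 'h measure)"
    and bd: "\<And>n i x. \<bar>G n i x\<bar> \<le> K * (norm x)\<^sup>2 + K * (T / 2 ^ (m + n))"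
    and z: "\<And>n i. (\<integral>\<omega>. G n i (dW (grid T (m + n) i) (grid T (m + n) (Suc i)) \<omega>) \<partial>M) = (0::real)"
    and I: "\<And>n. finite (I n)" "\<And>n. real (card (I n)) \<le> c * 2 ^ n"
  shows "AE \<omega> in M. (\<lambda>n. \<Sum>i\<in>I n. G n i (dW (grid T (m + n) i) (grid T (m + n) (Suc i)) \<omega>)) \<longlonglongrightarrow> 0"
proof -
  let ?d = "\<lambda>n i. dW (grid T (m + n) i) (grid T (m + n) (Suc i))"
  have st: "0 \<le> grid T (m + n) i" "grid T (m + n) i < grid T (m + n) (Suc i)" for n i
    using T by (auto intro: grid_nonneg grid_less)
  have len: "grid T (m + n) (Suc i) - grid T (m + n) i = T / 2 ^ (m + n)" for n i
    by (simp add: grid_Suc)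
  have dm: "?d n i \<in> borel_measurable M" for n i using st[of n i] by (intro dW_M) auto
  have Gm: "(\<lambda>\<omega>. G n i (?d n i \<omega>)) \<in> borel_measurable M" for n i
    by (rule measurable_compose[OF dm G])
  have i1: "integrable M (\<lambda>\<omega>. G n i (?d n i \<omega>))" for n i
  proof (rule Bochner_Integration.integrable_bound[OF _ Gm])
    show "integrable M (\<lambda>\<omega>. K * (norm (?d n i \<omega>))\<^sup>2 + K * (T / 2 ^ (m + n)))"
      using dW_sq_integrable[OF st] by auto
    show "AE \<omega> in M. norm (G n i (?d n i \<omega>)) \<le> norm (K * (norm (?d n i \<omega>))\<^sup>2 + K * (T / 2 ^ (m + n)))"
      unfolding real_norm_def by (intro AE_I2 order_trans[OF bd] abs_ge_self)
  qed
  \<comment> \<open>The bound for one variance: the fourth moment contributes \<open>C4\<close>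
    times the squared mesh, the constant in the growth bound contributes the squared mesh, and the 2
    comes from (a + b)^2 \<le> 2 a^2 + 2 b^2.\<close>
  define C where "C n = 2 * K\<^sup>2 * (C4 + 1) * (T / 2 ^ (m + n))\<^sup>2" for n
  have sq: "(G n i x)\<^sup>2 \<le> 2 * K\<^sup>2 * (norm x)^4 + 2 * K\<^sup>2 * (T / 2 ^ (m + n))\<^sup>2" for n i x
  proof -
    let ?a = "K * (norm x)\<^sup>2" and ?b = "K * (T / 2 ^ (m + n))"
    have "(G n i x)\<^sup>2 = \<bar>G n i x\<bar>\<^sup>2" by simp
    also have "\<dots> \<le> (?a + ?b)\<^sup>2" using bd by (intro power_mono) auto
    also have "\<dots> \<le> 2 * ?a\<^sup>2 + 2 * ?b\<^sup>2" using sum_squares_bound[of ?a ?b] by (simp add: power2_sum)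
    also have "\<dots> = 2 * K\<^sup>2 * (norm x)^4 + 2 * K\<^sup>2 * (T / 2 ^ (m + n))\<^sup>2"
      unfolding power_mult_distrib by (simp flip: power_mult)
    finally show ?thesis .
  qed
  have i4: "integrable M (\<lambda>\<omega>. 2 * K\<^sup>2 * (norm (?d n i \<omega>))^4 + 2 * K\<^sup>2 * (T / 2 ^ (m + n))\<^sup>2)" for n i
    using dW_pow4_integrable[OF st] by auto
  have i2: "integrable M (\<lambda>\<omega>. (G n i (?d n i \<omega>))\<^sup>2)" for n i
  proof (rule Bochner_Integration.integrable_bound[OF i4[of n i]])
    show "(\<lambda>\<omega>. (G n i (?d n i \<omega>))\<^sup>2) \<in> borel_measurable M" by (rule borel_measurable_power[OF Gm])
    show "AE \<omega> in M. norm ((G n i (?d n i \<omega>))\<^sup>2) \<le> norm (2 * K\<^sup>2 * (norm (?d n i \<omega>))^4 + 2 * K\<^sup>2 * (T / 2 ^ (m + n))\<^sup>2)"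
      using sq[of n i] by (intro AE_I2) (simp add: order_trans[OF _ abs_ge_self])
  qed
  have le: "(\<integral>\<omega>. (G n i (?d n i \<omega>))\<^sup>2 \<partial>M) \<le> C n" for n i
  proof -
    have "(\<integral>\<omega>. (G n i (?d n i \<omega>))\<^sup>2 \<partial>M) \<le> (\<integral>\<omega>. 2 * K\<^sup>2 * (norm (?d n i \<omega>))^4 + 2 * K\<^sup>2 * (T / 2 ^ (m + n))\<^sup>2 \<partial>M)"
      by (rule integral_mono[OF i2 i4 sq])
    also have "\<dots> = 2 * K\<^sup>2 * (\<integral>\<omega>. (norm (?d n i \<omega>))^4 \<partial>M) + 2 * K\<^sup>2 * (T / 2 ^ (m + n))\<^sup>2"
      using dW_pow4_integrable[OF st] by (simp add: prob_space)
    also have "\<dots> \<le> 2 * K\<^sup>2 * (C4 * (T / 2 ^ (m + n))\<^sup>2) + 2 * K\<^sup>2 * (T / 2 ^ (m + n))\<^sup>2"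
      using dW_pow4[OF st, of n i] unfolding len by (intro add_right_mono mult_left_mono) auto
    also have "\<dots> = C n" by (simp only: C_def distrib_left distrib_right mult_ac mult_1_right)
    finally show ?thesis .
  qed
  have ord: "i < j \<Longrightarrow> grid T (m + n) (Suc i) \<le> grid T (m + n) j" for n i j
    using T by (intro grid_mono) auto
  note var = independent_sum_variance[where I="I n" and s="grid T (m + n)" and t="\<lambda>i. grid T (m + n) (Suc i)"
      and G="G n" and c="C n" for n, OF I(1) conjI[OF st] ord G i2 i1 le z]
  define D where "D = 2 * K\<^sup>2 * (C4 + 1) * T\<^sup>2 * (c / 2 ^ m)"
  have bound: "real (card (I n)) * C n \<le> \<bar>D\<bar> * (1 / 2) ^ n" for n
  proof -
    have C0: "0 \<le> C n" using C4_pos by (simp add: C_def)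
    have "real (card (I n)) * C n \<le> c * 2 ^ n * C n" using I(2) C0 by (intro mult_right_mono) auto
    also have "\<dots> = D / 2 ^ m * (1 / 2) ^ n"
      by (simp add: C_def D_def power_add power_divide power2_eq_square field_simps)
    also have "\<dots> \<le> \<bar>D\<bar> * (1 / 2) ^ n"
    proof (intro mult_right_mono)
      have "D / 2 ^ m \<le> \<bar>D / 2 ^ m\<bar>" by (rule abs_ge_self)
      also have "\<dots> = \<bar>D\<bar> / 2 ^ m" by simp
      also have "\<dots> \<le> \<bar>D\<bar> / 1" by (intro divide_left_mono) auto
      finally show "D / 2 ^ m \<le> \<bar>D\<bar>" by simp
    qed auto
    finally show ?thesis .
  qed
  show ?thesis
  proof (rule AE_tendsto_0_summable_squares)
    show "integrable M (\<lambda>\<omega>. (\<Sum>i\<in>I n. G n i (?d n i \<omega>))\<^sup>2)" for n by (rule var(1))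
    show "(\<integral>\<omega>. (\<Sum>i\<in>I n. G n i (?d n i \<omega>))\<^sup>2 \<partial>M) \<le> \<bar>D\<bar> * (1 / 2) ^ n" for n
      using var(2) bound by (rule order_trans)
    show "summable (\<lambda>n. \<bar>D\<bar> * (1 / 2) ^ n)" by (intro summable_mult summable_geometric) simp
  qed
qed

text \<open>The centred sums converge and are therefore bounded, while the subtracted expectations
  sum to at most (1 + \<open>C4\<close>) T on every level.\<close>

lemma AE_grid_norm_squares_bounded:
  assumes T: "0 < T"
  shows "AE \<omega> in M. \<exists>V. \<forall>n. (\<Sum>i<2 ^ n. (norm (W (grid T n (Suc i)) \<omega> - W (grid T n i) \<omega>))\<^sup>2) \<le> V"
proof -
  let ?d = "\<lambda>n i. dW (grid T (0 + n) i) (grid T (0 + n) (Suc i))"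
  define e where "e n i = (\<integral>\<omega>. (norm (?d n i \<omega>))\<^sup>2 \<partial>M)" for n i
  have st: "0 \<le> grid T (0 + n) i" "grid T (0 + n) i < grid T (0 + n) (Suc i)" for n i
    using T by (auto intro: grid_nonneg grid_less)
  have len: "grid T (0 + n) (Suc i) - grid T (0 + n) i = T / 2 ^ (0 + n)" for n i
    by (simp add: grid_Suc)
  have e: "0 \<le> e n i" "e n i \<le> (1 + C4) * (T / 2 ^ (0 + n))" for n i
    using dW_sq[OF st, of n i] unfolding e_def len by simp_all
  define G where "G n i x = (norm x)\<^sup>2 - e n i" for n i and x :: 'h
  have "AE \<omega> in M. (\<lambda>n. \<Sum>i\<in>{..<(2::nat) ^ n}. G n i (?d n i \<omega>)) \<longlonglongrightarrow> 0"
  proof (rule AE_grid_squares_tendsto_0[OF T, where K="1 + C4" and c=1])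
    fix n i and x :: 'h
    show "G n i \<in> borel_measurable borel" unfolding G_def by measurable
    have "\<bar>G n i x\<bar> \<le> 1 * (norm x)\<^sup>2 + e n i" unfolding G_def using e(1)[of n i] zero_le_power2[of "norm x"] by linarith
    also have "\<dots> \<le> (1 + C4) * (norm x)\<^sup>2 + (1 + C4) * (T / 2 ^ (0 + n))"
      using e(2) C4_pos by (intro add_mono mult_right_mono) auto
    finally show "\<bar>G n i x\<bar> \<le> (1 + C4) * (norm x)\<^sup>2 + (1 + C4) * (T / 2 ^ (0 + n))" .
    show "(\<integral>\<omega>. G n i (?d n i \<omega>) \<partial>M) = 0"
      unfolding G_def using dW_sq_integrable[OF st] by (simp add: e_def prob_space)
  qed auto
  then show ?thesis
  proof eventually_elim
    case (elim \<omega>)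
    from elim have "Bseq (\<lambda>n. \<Sum>i\<in>{..<(2::nat) ^ n}. G n i (?d n i \<omega>))"
      by (rule convergent_imp_Bseq[OF convergentI])
    then obtain K where K: "\<And>n. norm (\<Sum>i\<in>{..<(2::nat) ^ n}. G n i (?d n i \<omega>)) \<le> K"
      by (rule BseqE) blast
    show ?case
    proof (intro exI[of _ "K + (1 + C4) * T"] allI)
      fix n
      have "(\<Sum>i<2 ^ n. (norm (?d n i \<omega>))\<^sup>2) = (\<Sum>i<2 ^ n. G n i (?d n i \<omega>)) + (\<Sum>i<2 ^ n. e n i)"
        by (simp add: G_def sum_subtractf)
      also have "\<dots> \<le> K + (\<Sum>i<(2::nat) ^ n. (1 + C4) * (T / 2 ^ (0 + n)))"
        using K[of n] by (intro add_mono sum_mono e) auto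
      also have "\<dots> = K + (1 + C4) * T" by simp
      finally show "(\<Sum>i<2 ^ n. (norm (W (grid T n (Suc i)) \<omega> - W (grid T n i) \<omega>))\<^sup>2) \<le> K + (1 + C4) * T"
        by (simp add: dW_def)
    qed
  qed
qed

text \<open>The subtracted means are exact here: a block contains 2^n cells of length T / 2^(m + n),
  and on each the squared Gaussian has mean equal to that length times
  \<open>Q h \<bullet> h\<close>.\<close>

lemma AE_grid_block:
  assumes T: "0 < T" and b: "b < 2 ^ m"
  shows "AE \<omega> in M. (\<lambda>n. \<Sum>i\<in>{b * 2 ^ n..<b * 2 ^ n + 2 ^ n}.
      (h \<bullet> (W (grid T (m + n) (Suc i)) \<omega> - W (grid T (m + n) i) \<omega>))\<^sup>2) \<longlonglongrightarrow> T / 2 ^ m * (Q h \<bullet> h)"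
proof -
  let ?d = "\<lambda>n i. dW (grid T (m + n) i) (grid T (m + n) (Suc i))"
  have st: "0 \<le> grid T (m + n) i" "grid T (m + n) i < grid T (m + n) (Suc i)" for n i
    using T by (auto intro: grid_nonneg grid_less)
  have len: "grid T (m + n) (Suc i) - grid T (m + n) i = T / 2 ^ (m + n)" for n i
    by (simp add: grid_Suc)
  have Q0: "0 \<le> Q h \<bullet> h" by (rule Q_nonneg)
  define G where "G n i x = (h \<bullet> x)\<^sup>2 - T / 2 ^ (m + n) * (Q h \<bullet> h)" for n and i :: nat and x :: 'h
  let ?K = "(norm h)\<^sup>2 + Q h \<bullet> h"
  have "AE \<omega> in M. (\<lambda>n. \<Sum>i\<in>{b * 2 ^ n..<b * 2 ^ n + 2 ^ n}. G n i (?d n i \<omega>)) \<longlonglongrightarrow> 0"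
  proof (rule AE_grid_squares_tendsto_0[OF T, where K="?K" and c=1])
    fix n i and x :: 'h
    show "G n i \<in> borel_measurable borel" unfolding G_def by measurable
    have "(h \<bullet> x)\<^sup>2 \<le> (norm h)\<^sup>2 * (norm x)\<^sup>2"
      using Cauchy_Schwarz_ineq[of h x] by (simp add: power2_norm_eq_inner)
    moreover have "0 \<le> T / 2 ^ (m + n) * (Q h \<bullet> h)" using T Q0 by simp
    ultimately have "\<bar>G n i x\<bar> \<le> (norm h)\<^sup>2 * (norm x)\<^sup>2 + (Q h \<bullet> h) * (T / 2 ^ (m + n))"
      using zero_le_power2[of "h \<bullet> x"] unfolding G_def mult.commute[of "Q h \<bullet> h"] by linarith
    also have "\<dots> \<le> ?K * (norm x)\<^sup>2 + ?K * (T / 2 ^ (m + n))"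
      using Q0 T by (intro add_mono mult_right_mono) auto
    finally show "\<bar>G n i x\<bar> \<le> ?K * (norm x)\<^sup>2 + ?K * (T / 2 ^ (m + n))" .
    have dm: "(\<lambda>\<omega>. ?d n i \<omega> \<bullet> h) \<in> borel_measurable M" using dW_M st[of n i] by simp
    note mom = centered_gaussian_moments[OF prob_space_axioms dW_gaussian[OF st] dm]
    show "(\<integral>\<omega>. G n i (?d n i \<omega>) \<partial>M) = 0"
      unfolding G_def using mom(5,6) by (simp add: inner_commute[of h] prob_space len[simplified])
    show "real (card {b * 2 ^ n..<b * 2 ^ n + 2 ^ n}) \<le> 1 * 2 ^ n" by simp
  qed auto
  then show ?thesis
  proof eventually_elim
    case (elim \<omega>)
    then have "(\<lambda>n. (\<Sum>i\<in>{b * 2 ^ n..<b * 2 ^ n + 2 ^ n}. G n i (?d n i \<omega>)) + T / 2 ^ m * (Q h \<bullet> h))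
        \<longlonglongrightarrow> 0 + T / 2 ^ m * (Q h \<bullet> h)"
      by (intro tendsto_intros)
    moreover have "(\<Sum>i\<in>{b * 2 ^ n..<b * 2 ^ n + 2 ^ n}. G n i (?d n i \<omega>)) + T / 2 ^ m * (Q h \<bullet> h)
      = (\<Sum>i\<in>{b * 2 ^ n..<b * 2 ^ n + 2 ^ n}. (h \<bullet> ?d n i \<omega>)\<^sup>2)" for n
      by (simp add: G_def sum_subtractf power_add)
    ultimately show ?case by (simp add: dW_def)
  qed
qed

lemma AE_quadratic_variation:
  assumes T: "0 < T"
  shows "AE \<omega> in M. (\<exists>V. \<forall>n. (\<Sum>i<2 ^ n. (norm (W (grid T n (Suc i)) \<omega> - W (grid T n i) \<omega>))\<^sup>2) \<le> V) \<and>
    (\<forall>a. continuous_on {0..T} a \<longrightarrow>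
      (\<lambda>n. \<Sum>i<2 ^ n. (a (grid T n i) \<bullet> (W (grid T n (Suc i)) \<omega> - W (grid T n i) \<omega>))\<^sup>2)
        \<longlonglongrightarrow> (LINT s:{0..T}|lborel. Q (a s) \<bullet> a s))"
proof -
  obtain D :: "'h set" where D: "countable D" "closure D = UNIV"
  proof -
    obtain D :: "'h set" where "countable D" and D: "\<And>X. open X \<Longrightarrow> X \<noteq> {} \<Longrightarrow> \<exists>d\<in>D. d \<in> X"
      by (rule countable_dense_setE) blast
    moreover have "x \<in> closure D" for x
      unfolding closure_approachable
    proof (intro allI impI)
      fix e :: real assume "e > 0"
      then have "\<exists>d\<in>D. d \<in> ball x e" by (intro D) auto
      then show "\<exists>y\<in>D. dist y x < e" by (auto simp: dist_commute)
    qed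
    ultimately show ?thesis by (intro that[of D]) auto
  qed
  \<comment> \<open>Only countably many conditions are imposed, one for each dense vector, level and
    block, so one null set serves all of them before any integrand is chosen.\<close>
  have "AE \<omega> in M. \<forall>h\<in>D. \<forall>m. \<forall>b\<in>{..<2 ^ m}. (\<lambda>n. \<Sum>i\<in>{b * 2 ^ n..<b * 2 ^ n + 2 ^ n}.
      (h \<bullet> (W (grid T (m + n) (Suc i)) \<omega> - W (grid T (m + n) i) \<omega>))\<^sup>2) \<longlonglongrightarrow> T / 2 ^ m * (Q h \<bullet> h)"
    using AE_grid_block[OF T] by (simp add: AE_ball_countable[OF D(1)] AE_all_countable AE_ball_countable)
  with AE_grid_norm_squares_bounded[OF T] show ?thesis
  proof eventually_elim
    case (elim \<omega>)
    then obtain V where V: "\<And>n. (\<Sum>i<2 ^ n. (norm (W (grid T n (Suc i)) \<omega> - W (grid T n i) \<omega>))\<^sup>2) \<le> V" by blast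
    show ?case
    proof (intro conjI allI impI)
      show "\<exists>V. \<forall>n. (\<Sum>i<2 ^ n. (norm (W (grid T n (Suc i)) \<omega> - W (grid T n i) \<omega>))\<^sup>2) \<le> V" using V by blast
      fix a :: "real \<Rightarrow> 'h" assume "continuous_on {0..T} a"
      then show "(\<lambda>n. \<Sum>i<2 ^ n. (a (grid T n i) \<bullet> (W (grid T n (Suc i)) \<omega> - W (grid T n i) \<omega>))\<^sup>2)
        \<longlonglongrightarrow> (LINT s:{0..T}|lborel. Q (a s) \<bullet> a s)"
        by (rule quadratic_variation_continuous[OF T Q_linear Q_symmetric V D(2), rotated]) (use elim(2) in auto)
    qed
  qed
qed

end

section \<open>Ito integrals along dyadic grids\<close>

text \<open>A bound on the outer probability, so that \<open>B\<close> need not be measurable.\<close>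

definition small :: "'s measure \<Rightarrow> 's set \<Rightarrow> real \<Rightarrow> bool" where
  "small M B e \<longleftrightarrow> (\<exists>E\<in>sets M. B \<inter> space M \<subseteq> E \<and> measure M E \<le> e)"

lemma vanishing_small: "vanishing M B \<Longrightarrow> 0 < e \<Longrightarrow> \<forall>\<^sub>F m in sequentially. small M (B m) e"
proof -
  assume "vanishing M B" and e: "0 < e"
  then obtain E where E: "\<And>m. E m \<in> sets M" "\<And>m. B m \<inter> space M \<subseteq> E m" "(\<lambda>m. measure M (E m)) \<longlonglongrightarrow> 0"
    unfolding vanishing_def by blast
  have "\<forall>\<^sub>F m in sequentially. measure M (E m) < e"
    using E(3) e by (rule order_tendstoD)
  then show ?thesis
    by (rule eventually_mono) (use E in \<open>auto simp: small_def intro!: bexI[of _ "E _"]\<close>)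
qed

lemma small_mono_set: "small M C e \<Longrightarrow> B \<inter> space M \<subseteq> C \<Longrightarrow> e \<le> e' \<Longrightarrow> small M B e'"
  unfolding small_def by (meson IntE Int_subset_iff inf_le2 order_trans)

section \<open>Outer probabilities: unions, limits and subsequences\<close>

context prob_space
begin

lemma small_measurable: "B \<in> sets M \<Longrightarrow> measure M B \<le> e \<Longrightarrow> small M B e"
  unfolding small_def by blast

lemma small_Un: "small M A a \<Longrightarrow> small M B b \<Longrightarrow> small M (A \<union> B) (a + b)"
proof -
  assume "small M A a" "small M B b"
  then obtain E G where E: "E \<in> sets M" "A \<inter> space M \<subseteq> E" "measure M E \<le> a"
    and G: "G \<in> sets M" "B \<inter> space M \<subseteq> G" "measure M G \<le> b"
    unfolding small_def by blast
  have "measure M (E \<union> G) \<le> measure M E + measure M G"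
    by (rule measure_subadditive) (use E G in auto)
  then show ?thesis
    unfolding small_def using E G by (intro bexI[of _ "E \<union> G"]) auto
qed

lemma small_AE_subset:
  assumes "small M C e" "AE \<omega> in M. \<omega> \<in> B \<longrightarrow> \<omega> \<in> C"
  shows "small M B e"
proof -
  obtain E where E: "E \<in> sets M" "C \<inter> space M \<subseteq> E" "measure M E \<le> e"
    using assms(1) unfolding small_def by blast
  obtain N where N: "N \<in> null_sets M" "{\<omega>\<in>space M. \<not> (\<omega> \<in> B \<longrightarrow> \<omega> \<in> C)} \<subseteq> N"
    using assms(2) unfolding eventually_ae_filter by blast
  have "measure M (E \<union> N) = measure M E" using E N by (intro measure_Un_null_set)
  then show ?thesis unfolding small_def using E N by (intro bexI[of _ "E \<union> N"]) auto
qed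

lemma small_finite_UN:
  assumes "finite I" "\<And>i. i \<in> I \<Longrightarrow> small M (B i) (e / real (card I))" "0 \<le> e"
  shows "small M (\<Union>i\<in>I. B i) e"
proof -
  have "small M (\<Union>i\<in>J. B i) (real (card J) * (e / real (card I)))" if "J \<subseteq> I" for J
    using finite_subset[OF that assms(1)] that
  proof (induction J rule: finite_induct)
    case empty
    show ?case unfolding small_def by (intro bexI[of _ "{}"]) auto
  next
    case (insert x J)
    have "small M (B x \<union> (\<Union>i\<in>J. B i)) (e / real (card I) + real (card J) * (e / real (card I)))"
      using insert assms(2) by (intro small_Un) auto
    then show ?case using insert by (simp add: algebra_simps add_divide_distrib)
  qed
  from this[OF order_refl] show ?thesis
  proof (cases "card I = 0")
    case True
    then have "I = {}" using assms(1) by simp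
    then show ?thesis unfolding small_def using assms(3) by (intro bexI[of _ "{}"]) auto
  qed simp
qed

text \<open>Borel-Cantelli for outer probabilities. The index \<open>k j\<close> is so large that
  the bad set at threshold 1 / (j + 1) is covered by a measurable set of measure at most 2^(-j).
  Monotonicity in the threshold then handles every fixed r.\<close>

lemma small_AE_subseq:
  assumes bad: "\<And>r e. 0 < r \<Longrightarrow> 0 < e \<Longrightarrow> \<forall>\<^sub>F m in sequentially. small M (bad m r) e"
    and mono: "\<And>m r r'. 0 < r \<Longrightarrow> r \<le> r' \<Longrightarrow> bad m r' \<subseteq> bad m (r::real)"
  shows "\<exists>k. strict_mono (k :: nat \<Rightarrow> nat) \<and> (AE \<omega> in M. \<forall>r>0. \<forall>\<^sub>F j in sequentially. \<omega> \<notin> bad (k j) r)"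
proof -
  have "\<exists>N. \<forall>m\<ge>N. small M (bad m (1 / Suc j)) ((1/2) ^ j)" for j
    using bad[of "1 / Suc j" "(1/2) ^ j"] by (simp add: eventually_sequentially)
  then obtain N where N: "\<And>j m. m \<ge> N j \<Longrightarrow> small M (bad m (1 / Suc j)) ((1/2) ^ j)" by metis
  \<comment> \<open>Adding up the earlier indices makes \<open>k\<close> strictly increasing while
    keeping \<open>k j\<close> at least \<open>N j\<close>.\<close>
  define k where "k j = (\<Sum>i\<le>j. N i) + j" for j
  have k: "strict_mono k" unfolding strict_mono_Suc_iff by (simp add: k_def)
  have kN: "k j \<ge> N j" for j unfolding k_def by (simp add: member_le_sum trans_le_add1)
  have "\<exists>E. E \<in> sets M \<and> bad (k j) (1 / Suc j) \<inter> space M \<subseteq> E \<and> measure M E \<le> (1/2) ^ j" for j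
    using N[OF kN] unfolding small_def by blast
  then obtain E where E: "\<And>j. E j \<in> sets M" "\<And>j. bad (k j) (1 / Suc j) \<inter> space M \<subseteq> E j"
    "\<And>j. measure M (E j) \<le> (1/2) ^ j" by metis
  have "AE \<omega> in M. \<forall>\<^sub>F j in sequentially. \<omega> \<in> space M - E j"
  proof (rule borel_cantelli_AE1)
    show "summable (\<lambda>j. measure M (E j))"
      by (rule summable_comparison_test'[OF summable_geometric[of "1/2::real"], of 0]) (use E in auto)
  qed (use E in \<open>auto simp: less_top[symmetric]\<close>)
  then have "AE \<omega> in M. \<forall>r>0. \<forall>\<^sub>F j in sequentially. \<omega> \<notin> bad (k j) r"
  proof eventually_elim
    case (elim \<omega>)
    show ?case
    proof (intro allI impI)
      fix r :: real assume r: "r > 0"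
      then obtain j0 :: nat where j0: "1 / Suc j0 < r" using nat_approx_posE by blast
      have "\<forall>\<^sub>F j in sequentially. j \<ge> j0" by (rule eventually_ge_at_top)
      with elim show "\<forall>\<^sub>F j in sequentially. \<omega> \<notin> bad (k j) r"
      proof eventually_elim
        case (elim j)
        have "1 / real (Suc j) \<le> 1 / Suc j0" using elim(2) by (intro divide_left_mono) auto
        then have "bad (k j) r \<subseteq> bad (k j) (1 / Suc j)" using j0 by (intro mono) auto
        moreover have "\<omega> \<notin> bad (k j) (1 / Suc j)" using elim(1) E(2)[of j] by blast
        ultimately show ?case by blast
      qed
    qed
  qed
  with k show ?thesis by blast
qed

text \<open>Fatou's lemma for outer probabilities. An outcome that lies in all but finitely many
  \<open>B k\<close> lies in some tail intersection of their measurable covers; these intersections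
  increase and each has measure at most e.\<close>

lemma small_liminf:
  assumes s: "\<And>k. small M (B k) e" and AE: "AE \<omega> in M. \<omega> \<in> C \<longrightarrow> (\<forall>\<^sub>F k in sequentially. \<omega> \<in> B k)"
  shows "small M C e"
proof -
  have "\<exists>E. E \<in> sets M \<and> B k \<inter> space M \<subseteq> E \<and> measure M E \<le> e" for k
    using s unfolding small_def by blast
  then obtain E where E: "\<And>k. E k \<in> sets M" "\<And>k. B k \<inter> space M \<subseteq> E k" "\<And>k. measure M (E k) \<le> e" by metis
  define G where "G k = (\<Inter>j\<in>{k..}. E j)" for k
  have Gm: "G k \<in> sets M" for k unfolding G_def using E by (intro sets.countable_INT) auto
  have inc: "incseq G" unfolding incseq_def G_def by (intro allI impI INT_anti_mono) auto
  have le: "measure M (G k) \<le> e" for k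
  proof -
    have "measure M (G k) \<le> measure M (E k)"
      using E(1) Gm unfolding G_def by (intro finite_measure_mono) auto
    then show ?thesis using E(3)[of k] by linarith
  qed
  have "(\<lambda>k. measure M (G k)) \<longlonglongrightarrow> measure M (\<Union>k. G k)"
    by (rule finite_Lim_measure_incseq[OF _ inc]) (use Gm in auto)
  then have Ue: "measure M (\<Union>k. G k) \<le> e" by (rule LIMSEQ_le_const2) (use le in auto)
  have "small M (\<Union>k. G k) e" by (rule small_measurable[OF _ Ue]) (use Gm in auto)
  moreover have "AE \<omega> in M. \<omega> \<in> C \<longrightarrow> \<omega> \<in> (\<Union>k. G k)"
    using AE AE_space
  proof eventually_elim
    case (elim \<omega>)
    show ?case
    proof
      assume "\<omega> \<in> C"
      with elim obtain k where "\<And>j. j \<ge> k \<Longrightarrow> \<omega> \<in> B j" by (auto simp: eventually_sequentially)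
      then have "\<omega> \<in> G k" unfolding G_def using E(2) elim(2) by blast
      then show "\<omega> \<in> (\<Union>k. G k)" by blast
    qed
  qed
  ultimately show ?thesis by (rule small_AE_subset)
qed

lemma decseq_small:
  assumes E: "\<And>l. E l \<in> sets M" "decseq E" and AE: "AE \<omega> in M. \<exists>l. \<omega> \<notin> E l" and e: "0 < e"
  shows "\<forall>\<^sub>F l in sequentially. measure M (E l) \<le> e"
proof -
  have lim: "(\<lambda>l. measure M (E l)) \<longlonglongrightarrow> measure M (\<Inter>l. E l)"
    by (rule finite_Lim_measure_decseq[OF _ E(2)]) (use E in auto)
  have Im: "(\<Inter>l. E l) \<in> sets M" using E by auto
  have "AE \<omega> in M. \<omega> \<notin> (\<Inter>l. E l)" using AE by eventually_elim auto
  then have "measure M (\<Inter>l. E l) = 0"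
    using Im by (subst (asm) AE_iff_measurable[OF Im]) (auto simp: measure_def dest: sets.sets_into_space)
  with lim have "(\<lambda>l. measure M (E l)) \<longlonglongrightarrow> 0" by simp
  from order_tendstoD(2)[OF this e] show ?thesis by (rule eventually_mono) simp
qed

end

text \<open>Open conditions on a continuous path can be tested at rational times, which turns
  conditions over a continuum of times into countable, hence measurable, unions.\<close>

lemma rational_witness:
  fixes f :: "real \<Rightarrow> 'a::topological_space"
  assumes T: "0 < T" and f: "continuous_on {0..T} f" and s: "s \<in> {0..T}" and U: "open U" "f s \<in> U" and e: "0 < e"
  shows "\<exists>q\<in>\<rat> \<inter> {0..T}. f q \<in> U \<and> \<bar>q - s\<bar> < e"
proof -
  obtain V where V: "open V" "s \<in> V" "\<And>x. x \<in> {0..T} \<Longrightarrow> x \<in> V \<Longrightarrow> f x \<in> U"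
    using f s U unfolding continuous_on_topological by metis
  obtain d where d: "d > 0" "\<And>x. dist x s < d \<Longrightarrow> x \<in> V" using V(1,2) unfolding open_dist by metis
  let ?d = "min d e"
  \<comment> \<open>Clipping at 0 and T keeps the rational inside the interval when s is one of its
    ends.\<close>
  have "max 0 (s - ?d) < min T (s + ?d)" using s T d(1) e by auto
  then obtain q where q: "q \<in> \<rat>" "max 0 (s - ?d) < q" "q < min T (s + ?d)"
    using Rats_dense_in_real by blast
  have qT: "q \<in> {0..T}" using q by auto
  have "\<bar>q - s\<bar> < ?d" using q unfolding abs_less_iff by linarith
  then have "\<bar>q - s\<bar> < d" "\<bar>q - s\<bar> < e" by auto
  then show ?thesis
    using d(2)[of q] V(3)[OF qT] q(1) qT by (intro bexI[of _ q]) (auto simp: dist_real_def)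
qed

section \<open>Size and oscillation of stopped paths\<close>

context wiener
begin

lemma stopping_set: "stopping M F \<tau> \<Longrightarrow> 0 \<le> t \<Longrightarrow> {\<omega> \<in> space M. ereal t < \<tau> \<omega>} \<in> sets (F t)"
proof -
  assume "stopping M F \<tau>" "0 \<le> t"
  then have "{\<omega> \<in> space M. \<tau> \<omega> \<le> ereal t} \<in> sets (F t)" unfolding stopping_def by blast
  then have "space (F t) - {\<omega> \<in> space M. \<tau> \<omega> \<le> ereal t} \<in> sets (F t)" by (rule sets.compl_sets)
  moreover have "space (F t) - {\<omega> \<in> space M. \<tau> \<omega> \<le> ereal t} = {\<omega> \<in> space M. ereal t < \<tau> \<omega>}" by auto
  ultimately show ?thesis by simp
qed

lemma continuous_uptoD: "continuous_upto S x \<Longrightarrow> ereal T < S \<Longrightarrow> continuous_on {0..T} x"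
  unfolding continuous_upto_def
  by (erule continuous_on_subset) (auto intro: le_less_trans[of _ "ereal T"])

text \<open>The events that the path exceeds a level at some rational time are measurable and
  decrease in the level. Almost every path leaves them eventually, since it is bounded on the
  compact interval. The cut-off process \<open>Z\<close> is measurable and equals \<open>Y\<close>
  on [0, T] where T < \<tau>.\<close>

lemma bounded_path_small:
  fixes Y :: "real \<Rightarrow> 's \<Rightarrow> 'b::{real_normed_vector,second_countable_topology}"
  assumes tau: "stopping M F \<tau>" and ad: "adapted_upto F \<tau> Y" and c: "AE \<omega> in M. continuous_upto (\<tau> \<omega>) (\<lambda>t. Y t \<omega>)"
    and T: "0 < T" and e: "0 < e"
  shows "\<exists>K\<ge>1. small M {\<omega>. ereal T < \<tau> \<omega> \<and> (\<exists>s\<in>{0..T}. norm (Y s \<omega>) > K)} e"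
proof -
  define Z where "Z s \<omega> = (if ereal s < \<tau> \<omega> then Y s \<omega> else 0)" for s \<omega>
  have Zm: "Z s \<in> borel_measurable M" if "0 \<le> s" for s
    unfolding Z_def by (rule measurable_F[OF ad[unfolded adapted_upto_def, rule_format, OF that]])
  have Am: "{\<omega> \<in> space M. ereal T < \<tau> \<omega>} \<in> sets M"
    by (rule subsetD[OF sets_F stopping_set[OF tau less_imp_le[OF T]]])
  define E where "E l = {\<omega> \<in> space M. ereal T < \<tau> \<omega>} \<inter> (\<Union>q\<in>\<rat> \<inter> {0..T}. {\<omega> \<in> space M. norm (Z q \<omega>) > real (Suc l)})" for l :: nat
  have Em: "E l \<in> sets M" for l
    unfolding E_def
  proof (intro sets.Int Am sets.countable_UN'')
    show "countable (\<rat> \<inter> {0..T})" using countable_rat by blast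
    fix q assume "q \<in> \<rat> \<inter> {0..T}"
    then have [measurable]: "Z q \<in> borel_measurable M" using Zm by auto
    show "{\<omega> \<in> space M. norm (Z q \<omega>) > real (Suc l)} \<in> sets M" by measurable
  qed
  have dec: "decseq E" unfolding decseq_def E_def by (intro allI impI Int_mono UN_mono) auto
  have Zeq: "ereal T < \<tau> \<omega> \<Longrightarrow> q \<in> {0..T} \<Longrightarrow> Z q \<omega> = Y q \<omega>" for q \<omega>
    unfolding Z_def using le_less_trans[of "ereal q" "ereal T" "\<tau> \<omega>"] by auto
  have ae: "AE \<omega> in M. \<exists>l. \<omega> \<notin> E l"
    using c
  proof eventually_elim
    case (elim \<omega>)
    show ?case
    proof (cases "ereal T < \<tau> \<omega>")
      case True
      then have "continuous_on {0..T} (\<lambda>t. Y t \<omega>)" using elim by (blast intro: continuous_uptoD)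
      then have "bounded ((\<lambda>t. Y t \<omega>) ` {0..T})" by (intro compact_imp_bounded compact_continuous_image) auto
      then obtain K where K: "\<forall>x\<in>(\<lambda>t. Y t \<omega>) ` {0..T}. norm x \<le> K" unfolding bounded_iff by blast
      obtain l :: nat where l: "K < real l" using reals_Archimedean2 by blast
      have "\<omega> \<notin> E l"
      proof
        assume "\<omega> \<in> E l"
        then obtain q where q: "q \<in> {0..T}" "norm (Z q \<omega>) > real (Suc l)" unfolding E_def by blast
        have "norm (Y q \<omega>) \<le> K" using K q(1) by blast
        then show False using q Zeq[OF True q(1)] l by simp
      qed
      then show ?thesis by blast
    next
      case False
      then show ?thesis by (auto simp: E_def)
    qed
  qed
  obtain l where l: "measure M (E l) \<le> e"
    using eventually_happens'[OF sequentially_bot decseq_small[OF Em dec ae e]] by blast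
  have "small M {\<omega>. ereal T < \<tau> \<omega> \<and> (\<exists>s\<in>{0..T}. norm (Y s \<omega>) > real (Suc l))} e"
  proof (rule small_AE_subset[OF small_measurable[OF Em l]])
    show "AE \<omega> in M. \<omega> \<in> {\<omega>. ereal T < \<tau> \<omega> \<and> (\<exists>s\<in>{0..T}. norm (Y s \<omega>) > real (Suc l))} \<longrightarrow> \<omega> \<in> E l"
      using c AE_space
    proof eventually_elim
      case (elim \<omega>)
      show ?case
      proof
        assume "\<omega> \<in> {\<omega>. ereal T < \<tau> \<omega> \<and> (\<exists>s\<in>{0..T}. norm (Y s \<omega>) > real (Suc l))}"
        then obtain s where A: "ereal T < \<tau> \<omega>" and s: "s \<in> {0..T}" "norm (Y s \<omega>) > real (Suc l)" by blast
        have "open {y::'b. norm y > real (Suc l)}" by (intro open_Collect_less continuous_intros)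
        from rational_witness[OF T continuous_uptoD[OF elim(1) A] s(1) this _ zero_less_one] s(2)
        obtain q where q: "q \<in> \<rat> \<inter> {0..T}" "norm (Y q \<omega>) > real (Suc l)" by blast
        then have "norm (Z q \<omega>) > real (Suc l)" using Zeq[OF A, of q] by simp
        with q(1) show "\<omega> \<in> E l" unfolding E_def using A elim(2) by blast
      qed
    qed
  qed
  then show ?thesis by (intro exI[of _ "real (Suc l)"]) auto
qed

text \<open>The scheme of \<open>bounded_path_small\<close> applied to the modulus of continuity:
  uniform continuity of each path makes the measurable events, which decrease in l, shrink to a null
  set.\<close>

lemma path_oscillation_small:
  fixes g :: "real \<Rightarrow> 's \<Rightarrow> 'b::{real_normed_vector,second_countable_topology}"
  assumes tau: "stopping M F \<tau>" and ad: "adapted_upto F \<tau> g" and c: "AE \<omega> in M. continuous_upto (\<tau> \<omega>) (\<lambda>t. g t \<omega>)"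
    and T: "0 < T" and e: "0 < e" and d: "0 < d"
  shows "\<forall>\<^sub>F l in sequentially. small M {\<omega>. ereal T < \<tau> \<omega> \<and>
    (\<exists>s\<in>{0..T}. \<exists>t\<in>{0..T}. \<bar>s - t\<bar> \<le> T / 2 ^ l \<and> norm (g s \<omega> - g t \<omega>) > d)} e"
proof -
  define Z where "Z s \<omega> = (if ereal s < \<tau> \<omega> then g s \<omega> else 0)" for s \<omega>
  have Zm: "Z s \<in> borel_measurable M" if "0 \<le> s" for s
    unfolding Z_def by (rule measurable_F[OF ad[unfolded adapted_upto_def, rule_format, OF that]])
  have Am: "{\<omega> \<in> space M. ereal T < \<tau> \<omega>} \<in> sets M"
    by (rule subsetD[OF sets_F stopping_set[OF tau less_imp_le[OF T]]])
  \<comment> \<open>The factor 2 leaves room for replacing two real times by nearby rational ones: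
    each is moved by less than half the mesh.\<close>
  define S where "S l = {(p, q). p \<in> \<rat> \<inter> {0..T} \<and> q \<in> \<rat> \<inter> {0..T} \<and> \<bar>p - q\<bar> < 2 * (T / 2 ^ l)}" for l :: nat
  define E where "E l = {\<omega> \<in> space M. ereal T < \<tau> \<omega>} \<inter> (\<Union>pq\<in>S l. {\<omega> \<in> space M. norm (Z (fst pq) \<omega> - Z (snd pq) \<omega>) > d})" for l :: nat
  have cS: "countable (S l)" for l
    by (rule countable_subset[of _ "\<rat> \<times> \<rat>"]) (auto simp: S_def countable_rat)
  have Em: "E l \<in> sets M" for l
    unfolding E_def
  proof (intro sets.Int Am sets.countable_UN'' cS)
    fix pq assume "pq \<in> S l"
    then have [measurable]: "Z (fst pq) \<in> borel_measurable M" "Z (snd pq) \<in> borel_measurable M"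
      using Zm by (auto simp: S_def)
    show "{\<omega> \<in> space M. norm (Z (fst pq) \<omega> - Z (snd pq) \<omega>) > d} \<in> sets M" by measurable
  qed
  have "S l' \<subseteq> S l" if "l \<le> l'" for l l'
  proof -
    have "T / 2 ^ l' \<le> T / 2 ^ l" using T that by (intro divide_left_mono power_increasing) auto
    then show ?thesis unfolding S_def by auto
  qed
  then have dec: "decseq E" unfolding decseq_def E_def by (intro allI impI Int_mono UN_mono) auto
  have Zeq: "ereal T < \<tau> \<omega> \<Longrightarrow> q \<in> {0..T} \<Longrightarrow> Z q \<omega> = g q \<omega>" for q \<omega>
    unfolding Z_def using le_less_trans[of "ereal q" "ereal T" "\<tau> \<omega>"] by auto
  have ae: "AE \<omega> in M. \<exists>l. \<omega> \<notin> E l"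
    using c
  proof eventually_elim
    case (elim \<omega>)
    show ?case
    proof (cases "ereal T < \<tau> \<omega>")
      case True
      have "uniformly_continuous_on {0..T} (\<lambda>t. g t \<omega>)"
        by (intro compact_uniformly_continuous continuous_uptoD[OF elim True]) auto
      then have "\<exists>h>0. \<forall>s\<in>{0..T}. \<forall>t\<in>{0..T}. dist t s < h \<longrightarrow> dist (g t \<omega>) (g s \<omega>) < d"
        using d by (simp only: uniformly_continuous_on_def)
      then obtain h where h: "h > 0" "\<forall>s\<in>{0..T}. \<forall>t\<in>{0..T}. dist t s < h \<longrightarrow> dist (g t \<omega>) (g s \<omega>) < d"
        by (elim exE conjE)
      obtain l where l: "2 * T / 2 ^ l < h"
        using eventually_happens'[OF sequentially_bot grid_fine[OF h(1), of "2 * T"]] by blast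
      have "\<omega> \<notin> E l"
      proof
        assume "\<omega> \<in> E l"
        then obtain p q where pq: "p \<in> {0..T}" "q \<in> {0..T}" "\<bar>p - q\<bar> < 2 * (T / 2 ^ l)" "norm (Z p \<omega> - Z q \<omega>) > d"
          unfolding E_def S_def by auto
        have "dist p q < h" using pq(3) l by (simp add: dist_real_def)
        then have "dist (g p \<omega>) (g q \<omega>) < d" using h(2) pq(1,2) by blast
        then show False using pq Zeq[OF True] by (simp add: dist_norm)
      qed
      then show ?thesis by blast
    next
      case False
      then show ?thesis by (auto simp: E_def)
    qed
  qed
  have sub: "AE \<omega> in M. \<omega> \<in> {\<omega>. ereal T < \<tau> \<omega> \<and>
    (\<exists>s\<in>{0..T}. \<exists>t\<in>{0..T}. \<bar>s - t\<bar> \<le> T / 2 ^ l \<and> norm (g s \<omega> - g t \<omega>) > d)} \<longrightarrow> \<omega> \<in> E l" for l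
    using c AE_space
  proof eventually_elim
    case (elim \<omega>)
    show ?case
    proof
      assume "\<omega> \<in> {\<omega>. ereal T < \<tau> \<omega> \<and>
        (\<exists>s\<in>{0..T}. \<exists>t\<in>{0..T}. \<bar>s - t\<bar> \<le> T / 2 ^ l \<and> norm (g s \<omega> - g t \<omega>) > d)}"
      then obtain s t where A: "ereal T < \<tau> \<omega>" and st: "s \<in> {0..T}" "t \<in> {0..T}" "\<bar>s - t\<bar> \<le> T / 2 ^ l"
        "norm (g s \<omega> - g t \<omega>) > d" by blast
      define h where "h = T / 2 ^ l / 2"
      have h: "h > 0" using T by (simp add: h_def)
      have h2: "T / 2 ^ l = 2 * h" by (simp add: h_def)
      note cont = continuous_uptoD[OF elim(1) A]
      have "open {y::'b. norm (y - g t \<omega>) > d}" by (intro open_Collect_less continuous_intros)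
      from rational_witness[OF T cont st(1) this _ h] st(4)
      obtain p where p: "p \<in> \<rat> \<inter> {0..T}" "norm (g p \<omega> - g t \<omega>) > d" "\<bar>p - s\<bar> < h" by blast
      have "open {y::'b. norm (g p \<omega> - y) > d}" by (intro open_Collect_less continuous_intros)
      from rational_witness[OF T cont st(2) this _ h] p(2)
      obtain q where q: "q \<in> \<rat> \<inter> {0..T}" "norm (g p \<omega> - g q \<omega>) > d" "\<bar>q - t\<bar> < h" by blast
      have "\<bar>p - q\<bar> < 2 * (T / 2 ^ l)" using p(3) q(3) st(3) unfolding h2 by linarith
      then have "(p, q) \<in> S l" using p q by (simp add: S_def)
      moreover have "norm (Z p \<omega> - Z q \<omega>) > d" using p(1) q(1,2) Zeq[OF A, of p] Zeq[OF A, of q] by auto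
      ultimately show "\<omega> \<in> E l" unfolding E_def using A elim(2) by force
    qed
  qed
  from decseq_small[OF Em dec ae e] show ?thesis
    by (rule eventually_mono) (rule small_AE_subset[OF small_measurable[OF Em] sub])
qed

section \<open>Isometry and truncation for elementary integrands\<close>

lemma simple_function_F_mono: "simple_function (F s) f \<Longrightarrow> s \<le> t \<Longrightarrow> simple_function (F t) f"
  using sets_F_mono[of s t] unfolding simple_function_def by auto

lemma simple_function_F_M: "simple_function (F s) f \<Longrightarrow> simple_function M f"
  using sets_F[of s] unfolding simple_function_def by auto

lemma simple_function_bounded_norm:
  fixes f :: "'s \<Rightarrow> 'b::real_normed_vector"
  assumes "simple_function M f"
  shows "\<exists>K. \<forall>\<omega>\<in>space M. norm (f \<omega>) \<le> K"
proof -
  have "finite (norm ` f ` space M)" using assms by (simp add: simple_function_def)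
  then have "bdd_above (norm ` f ` space M)" by (rule bdd_above_finite)
  then show ?thesis unfolding bdd_above_def by blast
qed

lemma simple_function_sq_integrable:
  fixes f :: "'s \<Rightarrow> 'b::real_normed_vector"
  assumes f: "simple_function M f"
  shows "integrable M (\<lambda>\<omega>. (norm (f \<omega>))\<^sup>2)"
proof -
  obtain K where K: "\<forall>\<omega>\<in>space M. norm (f \<omega>) \<le> K" using simple_function_bounded_norm[OF f] by blast
  have "(\<lambda>\<omega>. (norm (f \<omega>))\<^sup>2) \<in> borel_measurable M"
    by (intro borel_measurable_simple_function simple_function_compose1[OF f])
  then show ?thesis
    by (rule integrable_const_bound[where B="K\<^sup>2", rotated]) (use K in \<open>auto intro!: AE_I2 power_mono\<close>)
qed

text \<open>Splitting over the finitely many values of \<open>\<theta>\<close> leaves indicators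
  known at the left end point times fixed functionals of the increment. Independence applies to such
  products.\<close>

lemma simple_dW_sum:
  fixes \<theta> :: "'s \<Rightarrow> 'h \<Rightarrow>\<^sub>L real"
  assumes "simple_function (F p) \<theta>" "\<omega> \<in> space M"
  shows "blinfun_apply (\<theta> \<omega>) x = (\<Sum>v\<in>\<theta> ` space M. indicator {\<omega> \<in> space M. \<theta> \<omega> = v} \<omega> * blinfun_apply v (x :: 'h))"
proof -
  have "finite (\<theta> ` space M)" using assms(1) by (auto simp: simple_function_def)
  then have "(\<Sum>v\<in>\<theta> ` space M. indicator {\<omega> \<in> space M. \<theta> \<omega> = v} \<omega> * blinfun_apply v x)
    = (\<Sum>v\<in>\<theta> ` space M. if v = \<theta> \<omega> then blinfun_apply v x else 0)"
    using assms(2) by (intro sum.cong) (auto simp: indicator_def)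
  also have "\<dots> = blinfun_apply (\<theta> \<omega>) x" using assms(2) \<open>finite (\<theta> ` space M)\<close> by simp
  finally show ?thesis by simp
qed

lemma simple_level_sets: "simple_function (F p) \<theta> \<Longrightarrow> {\<omega> \<in> space M. \<theta> \<omega> = v} \<in> sets (F p)"
proof -
  assume "simple_function (F p) \<theta>"
  then have "\<theta> -` {v} \<inter> space (F p) \<in> sets (F p)" by (rule simple_functionD(2))
  moreover have "\<theta> -` {v} \<inter> space (F p) = {\<omega> \<in> space M. \<theta> \<omega> = v}" by auto
  ultimately show ?thesis by simp
qed

lemma simple_dW_measurable:
  fixes \<theta> :: "'s \<Rightarrow> 'h \<Rightarrow>\<^sub>L real"
  assumes th: "simple_function (F p) \<theta>" and pq: "0 \<le> p" "p \<le> q"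
  shows "(\<lambda>\<omega>. blinfun_apply (\<theta> \<omega>) (dW p q \<omega>)) \<in> borel_measurable (F q)"
proof -
  have "(\<lambda>\<omega>. \<Sum>v\<in>\<theta> ` space M. indicator {\<omega> \<in> space M. \<theta> \<omega> = v} \<omega> * blinfun_apply v (dW p q \<omega>)) \<in> borel_measurable (F q)"
  proof (intro borel_measurable_sum borel_measurable_times)
    fix v
    show "(\<lambda>\<omega>. indicator {\<omega> \<in> space M. \<theta> \<omega> = v} \<omega> :: real) \<in> borel_measurable (F q)"
      by (intro borel_measurable_indicator subsetD[OF sets_F_mono[OF pq(2)] simple_level_sets[OF th]])
    show "(\<lambda>\<omega>. blinfun_apply v (dW p q \<omega>)) \<in> borel_measurable (F q)"
      by (rule borel_measurable_continuous_on[OF _ dW_F[OF pq]]) (intro continuous_intros)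
  qed
  then show ?thesis
    by (rule measurable_cong[THEN iffD1, rotated]) (simp add: simple_dW_sum[OF th, symmetric])
qed

text \<open>The Ito isometry of one step as an inequality: the operator norm separates the integrand
  from the norm of the increment, and the two are independent.\<close>

lemma simple_dW_square:
  fixes \<theta> :: "'s \<Rightarrow> 'h \<Rightarrow>\<^sub>L real"
  assumes th: "simple_function (F p) \<theta>" and pq: "0 \<le> p" "p < q"
  shows "integrable M (\<lambda>\<omega>. (blinfun_apply (\<theta> \<omega>) (dW p q \<omega>))\<^sup>2)" (is ?int2)
    and "(\<integral>\<omega>. (blinfun_apply (\<theta> \<omega>) (dW p q \<omega>))\<^sup>2 \<partial>M) \<le> (1 + C4) * (q - p) * (\<integral>\<omega>. (norm (\<theta> \<omega>))\<^sup>2 \<partial>M)" (is ?le)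
    and "integrable M (\<lambda>\<omega>. blinfun_apply (\<theta> \<omega>) (dW p q \<omega>))" (is ?int1)
proof -
  have mF: "(\<lambda>\<omega>. blinfun_apply (\<theta> \<omega>) (dW p q \<omega>)) \<in> borel_measurable M"
    by (rule measurable_F[OF simple_dW_measurable[OF th]]) (use pq in auto)
  have thF: "(\<lambda>\<omega>. (norm (\<theta> \<omega>))\<^sup>2) \<in> borel_measurable (F p)"
    by (intro borel_measurable_simple_function simple_function_compose1[OF th])
  have thi: "integrable M (\<lambda>\<omega>. (norm (\<theta> \<omega>))\<^sup>2)"
    by (rule simple_function_sq_integrable[OF simple_function_F_M[OF th]])
  have Gm: "(\<lambda>x::'h. (norm x)\<^sup>2) \<in> borel_measurable borel" by measurable
  note ii = indep_dW_integral[OF pq thF thi Gm dW_sq_integrable[OF pq]]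
    indep_dW_integrable[OF pq thF thi Gm dW_sq_integrable[OF pq]]
  have le: "(blinfun_apply (\<theta> \<omega>) (dW p q \<omega>))\<^sup>2 \<le> (norm (\<theta> \<omega>))\<^sup>2 * (norm (dW p q \<omega>))\<^sup>2" for \<omega>
    using power_mono[OF norm_blinfun[of "\<theta> \<omega>" "dW p q \<omega>"], of 2] by (simp add: power_mult_distrib)
  show i2: ?int2
    by (rule Bochner_Integration.integrable_bound[OF ii(2)])
      (use le mF in \<open>auto intro!: AE_I2 borel_measurable_power\<close>)
  have "(\<integral>\<omega>. (blinfun_apply (\<theta> \<omega>) (dW p q \<omega>))\<^sup>2 \<partial>M) \<le> (\<integral>\<omega>. (norm (\<theta> \<omega>))\<^sup>2 * (norm (dW p q \<omega>))\<^sup>2 \<partial>M)"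
    by (rule integral_mono[OF i2 ii(2) le])
  also have "\<dots> = (\<integral>\<omega>. (norm (\<theta> \<omega>))\<^sup>2 \<partial>M) * (\<integral>\<omega>. (norm (dW p q \<omega>))\<^sup>2 \<partial>M)" by (rule ii(1))
  also have "\<dots> \<le> (\<integral>\<omega>. (norm (\<theta> \<omega>))\<^sup>2 \<partial>M) * ((1 + C4) * (q - p))"
    by (intro mult_left_mono dW_sq[OF pq]) simp
  finally show ?le by (simp add: mult_ac)
  show ?int1
    by (rule square_integrable_imp_integrable[OF mF i2])
qed

text \<open>On each level set of the later integrand it is a fixed functional, of mean zero on its
  increment; the earlier factor and the indicator of the level set are known when that increment
  starts.\<close>

lemma simple_dW_orthogonal:
  fixes \<theta> \<eta> :: "'s \<Rightarrow> 'h \<Rightarrow>\<^sub>L real"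
  assumes th: "simple_function (F p) \<theta>" "0 \<le> p" "p < q" and et: "simple_function (F r) \<eta>" "q \<le> r" "r < s"
  shows "integrable M (\<lambda>\<omega>. blinfun_apply (\<theta> \<omega>) (dW p q \<omega>) * blinfun_apply (\<eta> \<omega>) (dW r s \<omega>))"
    and "(\<integral>\<omega>. blinfun_apply (\<theta> \<omega>) (dW p q \<omega>) * blinfun_apply (\<eta> \<omega>) (dW r s \<omega>) \<partial>M) = 0"
proof -
  have r: "0 \<le> r" using assms by simp
  define f where "f v \<omega> = blinfun_apply (\<theta> \<omega>) (dW p q \<omega>) * indicator {\<omega> \<in> space M. \<eta> \<omega> = v} \<omega>" for v \<omega>
  have set: "{\<omega> \<in> space M. \<eta> \<omega> = v} \<in> sets (F r)" for v by (rule simple_level_sets[OF et(1)])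
  have fm: "f v \<in> borel_measurable (F r)" for v
    unfolding f_def[abs_def]
    by (intro borel_measurable_times borel_measurable_indicator set measurable_F_mono[OF simple_dW_measurable[OF th(1)]])
      (use assms in auto)
  have fi: "integrable M (f v)" for v
  proof -
    have "integrable M (\<lambda>\<omega>. indicator {\<omega> \<in> space M. \<eta> \<omega> = v} \<omega> *\<^sub>R blinfun_apply (\<theta> \<omega>) (dW p q \<omega>))"
      by (rule integrable_mult_indicator[OF subsetD[OF sets_F set] simple_dW_square(3)[OF th]])
    then show ?thesis by (simp add: f_def[abs_def] mult.commute)
  qed
  have bl: "bounded_linear (blinfun_apply v)" for v :: "'h \<Rightarrow>\<^sub>L real" by (rule blinfun.bounded_linear_right)
  have bm: "blinfun_apply v \<in> borel_measurable borel" for v :: "'h \<Rightarrow>\<^sub>L real"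
    by (intro borel_measurable_continuous_onI continuous_intros)
  note z = dW_mean_zero[OF r et(3) bl]
  have one: "integrable M (\<lambda>\<omega>. f v \<omega> * blinfun_apply v (dW r s \<omega>))"
    "(\<integral>\<omega>. f v \<omega> * blinfun_apply v (dW r s \<omega>) \<partial>M) = 0" for v
    using indep_dW_integral[OF r et(3) fm fi bm z(2)] indep_dW_integrable[OF r et(3) fm fi bm z(2)] z(1) by auto
  have eq: "blinfun_apply (\<theta> \<omega>) (dW p q \<omega>) * blinfun_apply (\<eta> \<omega>) (dW r s \<omega>)
    = (\<Sum>v\<in>\<eta> ` space M. f v \<omega> * blinfun_apply v (dW r s \<omega>))" if "\<omega> \<in> space M" for \<omega>
    unfolding simple_dW_sum[OF et(1) that, of "dW r s \<omega>"] f_def by (simp add: sum_distrib_left mult.assoc)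
  have "integrable M (\<lambda>\<omega>. \<Sum>v\<in>\<eta> ` space M. f v \<omega> * blinfun_apply v (dW r s \<omega>))"
    by (intro Bochner_Integration.integrable_sum one)
  then show "integrable M (\<lambda>\<omega>. blinfun_apply (\<theta> \<omega>) (dW p q \<omega>) * blinfun_apply (\<eta> \<omega>) (dW r s \<omega>))"
    by (rule Bochner_Integration.integrable_cong[THEN iffD1, rotated 2]) (simp_all add: eq)
  have "(\<integral>\<omega>. blinfun_apply (\<theta> \<omega>) (dW p q \<omega>) * blinfun_apply (\<eta> \<omega>) (dW r s \<omega>) \<partial>M)
    = (\<integral>\<omega>. (\<Sum>v\<in>\<eta> ` space M. f v \<omega> * blinfun_apply v (dW r s \<omega>)) \<partial>M)"
    by (rule Bochner_Integration.integral_cong) (simp_all add: eq)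
  also have "\<dots> = (\<Sum>v\<in>\<eta> ` space M. \<integral>\<omega>. f v \<omega> * blinfun_apply v (dW r s \<omega>) \<partial>M)"
    by (rule Bochner_Integration.integral_sum) (rule one)
  also have "\<dots> = 0" by (simp add: one)
  finally show "(\<integral>\<omega>. blinfun_apply (\<theta> \<omega>) (dW p q \<omega>) * blinfun_apply (\<eta> \<omega>) (dW r s \<omega>) \<partial>M) = 0" .
qed

text \<open>Orthogonality of distinct steps plus the bound for a single step. Steps are indexed by
  their left end points, with \<open>nx p\<close> the end of the step that starts at p.\<close>

lemma simple_dW_sum_square:
  fixes \<theta> :: "real \<Rightarrow> 's \<Rightarrow> 'h \<Rightarrow>\<^sub>L real"
  assumes P: "finite P" "\<And>p. p \<in> P \<Longrightarrow> 0 \<le> p \<and> p < nx p" "\<And>p q. p \<in> P \<Longrightarrow> q \<in> P \<Longrightarrow> p < q \<Longrightarrow> nx p \<le> q"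
    and th: "\<And>p. p \<in> P \<Longrightarrow> simple_function (F p) (\<theta> p)"
  shows "integrable M (\<lambda>\<omega>. (\<Sum>p\<in>P. blinfun_apply (\<theta> p \<omega>) (dW p (nx p) \<omega>))\<^sup>2)"
    and "(\<integral>\<omega>. (\<Sum>p\<in>P. blinfun_apply (\<theta> p \<omega>) (dW p (nx p) \<omega>))\<^sup>2 \<partial>M)
      \<le> (1 + C4) * (\<Sum>p\<in>P. (nx p - p) * (\<integral>\<omega>. (norm (\<theta> p \<omega>))\<^sup>2 \<partial>M))"
proof -
  define X where "X p \<omega> = blinfun_apply (\<theta> p \<omega>) (dW p (nx p) \<omega>)" for p \<omega>
  let ?c = "\<lambda>p. (1 + C4) * (nx p - p) * (\<integral>\<omega>. (norm (\<theta> p \<omega>))\<^sup>2 \<partial>M)"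
  have ordd: "integrable M (\<lambda>\<omega>. X p \<omega> * X q \<omega>) \<and> (\<integral>\<omega>. X p \<omega> * X q \<omega> \<partial>M) = 0"
    if "p \<in> P" "q \<in> P" "p < q" for p q
    unfolding X_def using that P(2)[of p] P(2)[of q] P(3)[OF that]
    by (intro conjI simple_dW_orthogonal th) auto
  have XX: "integrable M (\<lambda>\<omega>. X p \<omega> * X q \<omega>) \<and> (\<integral>\<omega>. X p \<omega> * X q \<omega> \<partial>M) \<le> (if p = q then ?c p else 0)"
    if pq: "p \<in> P" "q \<in> P" for p q
  proof (cases p q rule: linorder_cases)
    case less
    then show ?thesis using ordd[OF pq less] by simp
  next
    case equal
    then show ?thesis
      using simple_dW_square[OF th[OF pq(1)], of "nx p"] P(2)[OF pq(1)]
      by (simp add: X_def power2_eq_square[of "blinfun_apply _ _"])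
  next
    case greater
    have "(\<lambda>\<omega>. X p \<omega> * X q \<omega>) = (\<lambda>\<omega>. X q \<omega> * X p \<omega>)" by (simp add: mult.commute)
    then show ?thesis using ordd[OF pq(2,1) greater] greater by simp
  qed
  have eq: "(\<Sum>p\<in>P. X p \<omega>)\<^sup>2 = (\<Sum>p\<in>P. \<Sum>q\<in>P. X p \<omega> * X q \<omega>)" for \<omega>
    by (simp add: power2_eq_square sum_product)
  have int: "integrable M (\<lambda>\<omega>. (\<Sum>p\<in>P. X p \<omega>)\<^sup>2)"
    unfolding eq using XX by (intro Bochner_Integration.integrable_sum) blast
  have "(\<integral>\<omega>. (\<Sum>p\<in>P. X p \<omega>)\<^sup>2 \<partial>M) = (\<Sum>p\<in>P. \<Sum>q\<in>P. \<integral>\<omega>. X p \<omega> * X q \<omega> \<partial>M)"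
    unfolding eq using XX
    by (subst Bochner_Integration.integral_sum; (intro Bochner_Integration.integrable_sum sum.cong refl Bochner_Integration.integral_sum)?) blast+
  also have "\<dots> \<le> (\<Sum>p\<in>P. \<Sum>q\<in>P. if p = q then ?c p else 0)"
    using XX by (intro sum_mono) blast
  also have "\<dots> = (1 + C4) * (\<Sum>p\<in>P. (nx p - p) * (\<integral>\<omega>. (norm (\<theta> p \<omega>))\<^sup>2 \<partial>M))"
    using P(1) by (simp add: sum_distrib_left mult.assoc)
  finally have le: "(\<integral>\<omega>. (\<Sum>p\<in>P. X p \<omega>)\<^sup>2 \<partial>M) \<le> (1 + C4) * (\<Sum>p\<in>P. (nx p - p) * (\<integral>\<omega>. (norm (\<theta> p \<omega>))\<^sup>2 \<partial>M))" .
  show "integrable M (\<lambda>\<omega>. (\<Sum>p\<in>P. blinfun_apply (\<theta> p \<omega>) (dW p (nx p) \<omega>))\<^sup>2)"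
    using int by (simp add: X_def)
  show "(\<integral>\<omega>. (\<Sum>p\<in>P. blinfun_apply (\<theta> p \<omega>) (dW p (nx p) \<omega>))\<^sup>2 \<partial>M)
      \<le> (1 + C4) * (\<Sum>p\<in>P. (nx p - p) * (\<integral>\<omega>. (norm (\<theta> p \<omega>))\<^sup>2 \<partial>M))" using le by (simp add: X_def)
qed

text \<open>Truncating when the accumulated energy exceeds \<open>r\<close> keeps the integrands adapted and bounds
  the second moment, while nothing changes where the total energy is at most \<open>r\<close>.\<close>

lemma truncated_integrands:
  fixes \<theta> :: "real \<Rightarrow> 's \<Rightarrow> 'h \<Rightarrow>\<^sub>L real"
  assumes P: "finite P" "\<And>p. p \<in> P \<Longrightarrow> 0 \<le> p \<and> p < nx p" "\<And>p q. p \<in> P \<Longrightarrow> q \<in> P \<Longrightarrow> p < q \<Longrightarrow> nx p \<le> q"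
    and th: "\<And>p. p \<in> P \<Longrightarrow> simple_function (F p) (\<theta> p)" and r: "0 \<le> r"
  shows "\<exists>\<eta>. (\<forall>p\<in>P. simple_function (F p) (\<eta> p)) \<and>
    (\<Sum>p\<in>P. (nx p - p) * (\<integral>\<omega>. (norm (\<eta> p \<omega>))\<^sup>2 \<partial>M)) \<le> r \<and>
    (\<forall>\<omega>. (\<Sum>p\<in>P. (nx p - p) * (norm (\<theta> p \<omega>))\<^sup>2) \<le> r \<longrightarrow> (\<forall>p\<in>P. \<eta> p \<omega> = \<theta> p \<omega>))"
proof -
  \<comment> \<open>The step that starts at p is included: its integrand is known at time p, so the
    decision whether to keep it is already measurable then.\<close>
  define E where "E p \<omega> = (\<Sum>q\<in>{q\<in>P. q \<le> p}. (nx q - q) * (norm (\<theta> q \<omega>))\<^sup>2)" for p \<omega>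
  define \<eta> where "\<eta> p \<omega> = (if E p \<omega> \<le> r then \<theta> p \<omega> else 0)" for p \<omega>
  have pos: "0 \<le> (nx q - q) * (norm (\<theta> q \<omega>))\<^sup>2" if "q \<in> P" for q \<omega> using P(2)[OF that] by simp
  have simple: "simple_function (F p) (\<eta> p)" if p: "p \<in> P" for p
  proof -
    have "simple_function (F p) (E p)"
      unfolding E_def
      by (intro simple_function_sum simple_function_compose1[of _ _ "\<lambda>x. (nx _ - _) * (norm x)\<^sup>2"] simple_function_F_mono[OF th]) auto
    then have "E p -` {..r} \<inter> space (F p) \<in> sets (F p)" by (rule simple_functionD(2))
    moreover have "E p -` {..r} \<inter> space (F p) = {\<omega> \<in> space (F p). E p \<omega> \<le> r}" by auto
    ultimately show ?thesis unfolding \<eta>_def by (intro simple_function_If th[OF p]) auto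
  qed
  have pw: "(\<Sum>p\<in>P. (nx p - p) * (norm (\<eta> p \<omega>))\<^sup>2) \<le> r" for \<omega>
  proof -
    define G where "G = {p\<in>P. E p \<omega> \<le> r}"
    have "(\<Sum>p\<in>P. (nx p - p) * (norm (\<eta> p \<omega>))\<^sup>2) = (\<Sum>p\<in>G. (nx p - p) * (norm (\<theta> p \<omega>))\<^sup>2)"
      unfolding G_def using P(1) by (intro sum.mono_neutral_cong_right) (auto simp: \<eta>_def)
    also have "\<dots> \<le> r"
    proof (cases "G = {}")
      case False
      have fG: "finite G" using P(1) by (simp add: G_def)
      \<comment> \<open>Every kept step starts no later than the last kept one, so the energy
        accumulated at \<open>m\<close> counts all of them.\<close>
      define m where "m = Max G"
      have m: "m \<in> G" unfolding m_def by (rule Max_in[OF fG False])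
      have "(\<Sum>p\<in>G. (nx p - p) * (norm (\<theta> p \<omega>))\<^sup>2) \<le> E m \<omega>"
        unfolding E_def
        by (rule sum_mono2) (use P(1) pos Max_ge[OF fG] in \<open>auto simp: G_def m_def\<close>)
      also have "\<dots> \<le> r" using m by (simp add: G_def)
      finally show ?thesis .
    qed (use r in simp)
    finally show ?thesis .
  qed
  have int: "integrable M (\<lambda>\<omega>. (norm (\<eta> p \<omega>))\<^sup>2)" if "p \<in> P" for p
    by (rule simple_function_sq_integrable[OF simple_function_F_M[OF simple[OF that]]])
  have "(\<Sum>p\<in>P. (nx p - p) * (\<integral>\<omega>. (norm (\<eta> p \<omega>))\<^sup>2 \<partial>M)) = (\<integral>\<omega>. (\<Sum>p\<in>P. (nx p - p) * (norm (\<eta> p \<omega>))\<^sup>2) \<partial>M)"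
    using int by (subst Bochner_Integration.integral_sum) auto
  also have "\<dots> \<le> (\<integral>\<omega>. r \<partial>M)"
    using int pw by (intro integral_mono Bochner_Integration.integrable_sum) auto
  also have "\<dots> = r" by (simp add: prob_space)
  finally have le: "(\<Sum>p\<in>P. (nx p - p) * (\<integral>\<omega>. (norm (\<eta> p \<omega>))\<^sup>2 \<partial>M)) \<le> r" .
  have same: "\<eta> p \<omega> = \<theta> p \<omega>" if "(\<Sum>p\<in>P. (nx p - p) * (norm (\<theta> p \<omega>))\<^sup>2) \<le> r" "p \<in> P" for p \<omega>
  proof -
    have "E p \<omega> \<le> (\<Sum>p\<in>P. (nx p - p) * (norm (\<theta> p \<omega>))\<^sup>2)"
      unfolding E_def by (rule sum_mono2) (use P(1) pos in auto)
    then show ?thesis using that(1) by (simp add: \<eta>_def)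
  qed
  show ?thesis using simple le same by (intro exI[of _ \<eta>]) blast
qed

end

section \<open>Merging an elementary partition with the dyadic grid\<close>

definition nxt :: "real set \<Rightarrow> real \<Rightarrow> real" where
  "nxt P p = Min {q \<in> P. p < q}"

lemma nxt:
  assumes "finite P" "y \<in> P" "p < y"
  shows "nxt P p \<in> P" "p < nxt P p" "nxt P p \<le> y"
proof -
  have f: "finite {q \<in> P. p < q}" and y: "y \<in> {q \<in> P. p < q}" using assms by auto
  have "nxt P p \<in> {q \<in> P. p < q}" unfolding nxt_def by (rule Min_in[OF f]) (use y in blast)
  then show "nxt P p \<in> P" "p < nxt P p" by auto
  show "nxt P p \<le> y" unfolding nxt_def by (rule Min_le[OF f y])
qed

lemma sum_nxt_telescope:
  fixes f :: "real \<Rightarrow> 'a::ab_group_add"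
  assumes P: "finite P" "y \<in> P" "x \<in> P" "x \<le> y"
  shows "(\<Sum>p\<in>{p\<in>P. x \<le> p \<and> p < y}. f (nxt P p) - f p) = f y - f x"
  using P(3,4)
proof (induction "card {p\<in>P. x \<le> p \<and> p < y}" arbitrary: x rule: less_induct)
  case less
  show ?case
  proof (cases "x = y")
    case True
    then have "{p\<in>P. x \<le> p \<and> p < y} = {}" by auto
    then show ?thesis using True by (simp only: sum.empty diff_self)
  next
    case False
    then have xy: "x < y" using less.prems by simp
    let ?x = "nxt P x"
    note n = nxt[OF P(1,2) xy]
    have eq: "{p\<in>P. x \<le> p \<and> p < y} = insert x {p\<in>P. ?x \<le> p \<and> p < y}"
    proof (intro set_eqI iffI)
      fix p assume p: "p \<in> {p\<in>P. x \<le> p \<and> p < y}"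
      show "p \<in> insert x {p\<in>P. ?x \<le> p \<and> p < y}"
      proof (cases "p = x")
        case False
        then have "x < p" using p by auto
        then have "?x \<le> p" using nxt(3)[OF P(1), of p x] p by auto
        then show ?thesis using p by auto
      qed auto
    qed (use n xy less.prems in auto)
    have notin: "x \<notin> {p\<in>P. ?x \<le> p \<and> p < y}" using n(2) by auto
    have fin: "finite {p\<in>P. ?x \<le> p \<and> p < y}" using P(1) by simp
    have "(\<Sum>p\<in>{p\<in>P. ?x \<le> p \<and> p < y}. f (nxt P p) - f p) = f y - f ?x"
    proof (rule less.hyps)
      show "card {p\<in>P. ?x \<le> p \<and> p < y} < card {p\<in>P. x \<le> p \<and> p < y}"
        unfolding eq using notin fin by simp
    qed (use n in auto)
    then show ?thesis unfolding eq using notin fin by (simp add: algebra_simps)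
  qed
qed

lemma grid_block_ex:
  assumes "0 < T" "0 \<le> p" "p < T"
  shows "\<exists>i<2 ^ l. grid T l i \<le> p \<and> p < grid T l (Suc i)"
proof -
  define i where "i = nat \<lfloor>p * 2 ^ l / T\<rfloor>"
  have nn: "0 \<le> p * 2 ^ l / T" using assms by simp
  have ri: "real i = of_int \<lfloor>p * 2 ^ l / T\<rfloor>" using nn by (simp add: i_def)
  have 1: "real i \<le> p * 2 ^ l / T" unfolding ri by (rule of_int_floor_le)
  have 2: "p * 2 ^ l / T < real i + 1" unfolding ri by (rule real_of_int_floor_add_one_gt)
  have a: "grid T l i \<le> p" "p < grid T l (Suc i)"
    using 1 2 assms(1) unfolding grid_def by (auto simp: field_simps)
  have "i < 2 ^ l"
  proof (rule ccontr)
    assume "\<not> i < 2 ^ l"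
    then have "grid T l (2 ^ l) \<le> grid T l i" using assms(1) by (intro grid_mono) auto
    then show False using a(1) assms(3) by simp
  qed
  with a show ?thesis by blast
qed

lemma grid_block_unique:
  assumes "0 < T" "grid T l i \<le> p" "p < grid T l (Suc i)" "grid T l j \<le> p" "p < grid T l (Suc j)"
  shows "i = j"
proof -
  have "\<not> i < j" using grid_mono[of T "Suc i" j l] assms by auto
  moreover have "\<not> j < i" using grid_mono[of T "Suc j" i l] assms by auto
  ultimately show ?thesis by simp
qed

context wiener
begin

text \<open>On the common refinement the elementary integrand and the vector \<open>g i\<close>
  frozen on a grid cell are both constant on each step. Hence the weighted difference between the
  increment of the elementary integral over a cell and \<open>g i \<bullet> dW\<close> is itself an
  elementary sum, with integrands \<open>\<theta>\<close>. Its energy is bounded by the integral of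
  any \<open>h\<close> that dominates the squared norm of the integrand.\<close>

lemma elementary_refinement:
  fixes \<phi> :: "nat \<Rightarrow> 's \<Rightarrow> 'h \<Rightarrow>\<^sub>L real"
  assumes T: "0 < T" and el: "elementary F n t \<phi>"
    and y: "\<forall>i<2 ^ l. simple_function (F (grid T l i)) (y i :: 's \<Rightarrow> real)"
    and g: "\<forall>i<2 ^ l. simple_function (F (grid T l i)) (g i :: 's \<Rightarrow> 'h)"
  shows "\<exists>P nx \<theta>. finite P \<and> (\<forall>p\<in>P. 0 \<le> p \<and> p < nx p \<and> p < T) \<and> (\<forall>p\<in>P. \<forall>q\<in>P. p < q \<longrightarrow> nx p \<le> q) \<and>
    (\<forall>p\<in>P. simple_function (F p) (\<theta> p)) \<and>
    (\<forall>i<2 ^ l. \<forall>\<omega>. (\<Sum>p\<in>{p\<in>P. grid T l i \<le> p \<and> p < grid T l (Suc i)}. blinfun_apply (\<theta> p \<omega>) (dW p (nx p) \<omega>))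
      = y i \<omega> * (elem_integral W n t \<phi> (grid T l (Suc i)) \<omega> - elem_integral W n t \<phi> (grid T l i) \<omega>
          - g i \<omega> \<bullet> dW (grid T l i) (grid T l (Suc i)) \<omega>)) \<and>
    (\<forall>\<omega> h. (\<forall>i<2 ^ l. \<forall>s. grid T l i < s \<and> s \<le> grid T l (Suc i) \<longrightarrow>
        ennreal ((norm (y i \<omega> *\<^sub>R (elem_process n t \<phi> s \<omega> - blinfun_inner_right (g i \<omega>))))\<^sup>2) \<le> h s) \<longrightarrow>
      ennreal (\<Sum>p\<in>P. (nx p - p) * (norm (\<theta> p \<omega>))\<^sup>2) \<le> (\<integral>\<^sup>+s\<in>{0..T}. h s \<partial>lborel))"
proof -
  define b where "b i = grid T l i" for i
  have t0: "0 \<le> t 0" and tlt: "\<And>k. k < n \<Longrightarrow> t k < t (Suc k)" and ph: "\<And>k. k < n \<Longrightarrow> simple_function (F (t k)) (\<phi> k)"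
    using el unfolding elementary_def by auto
  have tpos: "0 \<le> t k" if "k \<le> n" for k
    using that
  proof (induction k)
    case (Suc k)
    then show ?case using tlt[of k] by simp
  qed (use t0 in simp)
  \<comment> \<open>No step starts at T, so T is left out here; \<open>P'\<close> adds it as the end
    of the last step.\<close>
  define P where "P = b ` {..<2 ^ l} \<union> {x \<in> t ` {..n}. x < T}"
  define P' where "P' = insert T P"
  define nx where "nx = nxt P'"
  have bT: "b i < T" if "i < 2 ^ l" for i using grid_less[OF T that, of l] by (simp add: b_def)
  have bT': "b i \<le> T" if "i \<le> 2 ^ l" for i using grid_le[of T i l] T that by (simp add: b_def)
  have b0: "0 \<le> b i" for i using grid_nonneg[of T l i] T by (simp add: b_def)
  have bb: "b i < b (Suc i)" for i using grid_less[OF T, of i "Suc i" l] by (simp add: b_def)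
  have finP: "finite P" "finite P'" by (auto simp: P_def P'_def)
  have PT: "p < T" if "p \<in> P" for p using that bT by (auto simp: P_def)
  have P0: "0 \<le> p" if "p \<in> P" for p using that b0 tpos by (auto simp: P_def)
  have TP': "T \<in> P'" by (simp add: P'_def)
  have nxP: "nx p \<in> P'" "p < nx p" "nx p \<le> T" if "p \<in> P" for p
    unfolding nx_def using nxt[OF finP(2) TP' PT[OF that]] by auto
  have nxle: "nx p \<le> q" if "p < q" "q \<in> P'" for p q
    unfolding nx_def using nxt(3)[OF finP(2) that(2,1)] .
  have bP': "b i \<in> P'" if "i \<le> 2 ^ l" for i
    using that by (cases "i = 2 ^ l") (auto simp: P'_def P_def b_def)
  \<comment> \<open>The value of the elementary process just to the right of p. The process lives on
    intervals open at the left and closed at the right, while steps are addressed by their left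
    ends; this is why the strict and the weak inequality change places.\<close>
  define pr where "pr p \<omega> = (\<Sum>k<n. if t k \<le> p \<and> p < t (Suc k) then \<phi> k \<omega> else 0)" for p \<omega>
  define \<theta> where "\<theta> p \<omega> = (\<Sum>i<2 ^ l. if b i \<le> p \<and> p < b (Suc i)
      then y i \<omega> *\<^sub>R (pr p \<omega> - blinfun_inner_right (g i \<omega>)) else 0)" for p \<omega>
  have th: "\<theta> p \<omega> = y i \<omega> *\<^sub>R (pr p \<omega> - blinfun_inner_right (g i \<omega>))"
    if i: "i < 2 ^ l" "b i \<le> p" "p < b (Suc i)" for p i \<omega>
  proof -
    have "\<theta> p \<omega> = (\<Sum>j<2 ^ l. if j = i then y i \<omega> *\<^sub>R (pr p \<omega> - blinfun_inner_right (g i \<omega>)) else 0)"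
      unfolding \<theta>_def
    proof (rule sum.cong[OF refl])
      fix j
      have "(b j \<le> p \<and> p < b (Suc j)) = (j = i)"
        using i(2,3) grid_block_unique[OF T, of l j p i] unfolding b_def by blast
      then show "(if b j \<le> p \<and> p < b (Suc j) then y j \<omega> *\<^sub>R (pr p \<omega> - blinfun_inner_right (g j \<omega>)) else 0)
        = (if j = i then y i \<omega> *\<^sub>R (pr p \<omega> - blinfun_inner_right (g i \<omega>)) else 0)"
        by (simp only:) simp
    qed
    then show ?thesis using i(1) by simp
  qed
  have simp1: "simple_function (F p) (\<lambda>\<omega>. if c then f \<omega> else 0)"
    if "c \<Longrightarrow> simple_function (F p) f" for c p and f :: "'s \<Rightarrow> 'h \<Rightarrow>\<^sub>L real"
    using that by (cases c) auto
  have pr_simple: "simple_function (F p) (pr p)" for p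
    unfolding pr_def[abs_def] using simple_function_F_mono[OF ph] by (intro simple_function_sum simp1) auto
  have th_simple: "simple_function (F p) (\<theta> p)" for p
    unfolding \<theta>_def[abs_def]
  proof (intro simple_function_sum simp1)
    fix i assume "i \<in> {..<(2::nat) ^ l}" and c: "b i \<le> p \<and> p < b (Suc i)"
    then have i: "i < 2 ^ l" by simp
    have "simple_function (F p) (y i)" "simple_function (F p) (g i)"
      using y[rule_format, OF i] g[rule_format, OF i] c by (auto intro: simple_function_F_mono simp: b_def)
    then show "simple_function (F p) (\<lambda>\<omega>. y i \<omega> *\<^sub>R (pr p \<omega> - blinfun_inner_right (g i \<omega>)))"
      by (intro simple_function_compose2[where h="(*\<^sub>R)"] simple_function_diff
          simple_function_compose1[where g=blinfun_inner_right] pr_simple)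
  qed
  have block: "(\<Sum>p\<in>{p\<in>P. b i \<le> p \<and> p < b (Suc i)}. blinfun_apply (\<theta> p \<omega>) (dW p (nx p) \<omega>))
      = y i \<omega> * (elem_integral W n t \<phi> (b (Suc i)) \<omega> - elem_integral W n t \<phi> (b i) \<omega> - g i \<omega> \<bullet> dW (b i) (b (Suc i)) \<omega>)"
    if i: "i < 2 ^ l" for i \<omega>
  proof -
    let ?B = "{p\<in>P. b i \<le> p \<and> p < b (Suc i)}"
    have BT: "b (Suc i) \<le> T" using bT'[of "Suc i"] i by simp
    have tele: "(\<Sum>p\<in>{p\<in>P. x \<le> p \<and> p < z}. dW p (nx p) \<omega>) = W z \<omega> - W x \<omega>"
      if "x \<in> P'" "z \<in> P'" "x \<le> z" "z \<le> T" for x z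
    proof -
      have "{p\<in>P. x \<le> p \<and> p < z} = {p\<in>P'. x \<le> p \<and> p < z}" using that(4) by (auto simp: P'_def)
      then show ?thesis
        using sum_nxt_telescope[OF finP(2) that(2,1,3), of "\<lambda>s. W s \<omega>"] by (simp add: dW_def nx_def)
    qed
    have phik: "(\<Sum>p\<in>?B. if t k \<le> p \<and> p < t (Suc k) then blinfun_apply (\<phi> k \<omega>) (dW p (nx p) \<omega>) else 0)
      = blinfun_apply (\<phi> k \<omega>) (W (min (t (Suc k)) (b (Suc i))) \<omega> - W (min (t k) (b (Suc i))) \<omega>)
        - blinfun_apply (\<phi> k \<omega>) (W (min (t (Suc k)) (b i)) \<omega> - W (min (t k) (b i)) \<omega>)"
      if k: "k < n" for k
    proof -
      \<comment> \<open>The part of the partition interval that lies in the grid cell. If it is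
        nonempty, both of its ends belong to the refinement and the increments telescope; otherwise
        both sides vanish.\<close>
      let ?x = "max (b i) (t k)" and ?z = "min (b (Suc i)) (t (Suc k))"
      have "(\<Sum>p\<in>?B. if t k \<le> p \<and> p < t (Suc k) then blinfun_apply (\<phi> k \<omega>) (dW p (nx p) \<omega>) else 0)
        = (\<Sum>p\<in>{p\<in>P. ?x \<le> p \<and> p < ?z}. blinfun_apply (\<phi> k \<omega>) (dW p (nx p) \<omega>))"
        using finP(1) by (intro sum.mono_neutral_cong_right) auto
      also have "\<dots> = blinfun_apply (\<phi> k \<omega>) (\<Sum>p\<in>{p\<in>P. ?x \<le> p \<and> p < ?z}. dW p (nx p) \<omega>)"
        by (simp add: blinfun.sum_right)
      also have "(\<Sum>p\<in>{p\<in>P. ?x \<le> p \<and> p < ?z}. dW p (nx p) \<omega>)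
        = (W (min (t (Suc k)) (b (Suc i))) \<omega> - W (min (t k) (b (Suc i))) \<omega>)
        - (W (min (t (Suc k)) (b i)) \<omega> - W (min (t k) (b i)) \<omega>)"
      proof (cases "t k < b (Suc i) \<and> b i < t (Suc k)")
        case True
        have "t k \<in> P'" using True BT k by (auto simp: P'_def P_def)
        then have x: "?x \<in> P'" using bP'[of i] i by (simp add: max_def)
        have z: "?z \<in> P'"
        proof (cases "t (Suc k) < b (Suc i)")
          case True
          then have "t (Suc k) \<in> P" using k BT by (auto simp: P_def)
          then show ?thesis using True by (simp add: P'_def min_def)
        qed (use bP'[of "Suc i"] i in \<open>auto simp: min_def\<close>)
        have "?x \<le> ?z" using True tlt[OF k] bb[of i] by auto
        from tele[OF x z this] BT
        have "(\<Sum>p\<in>{p\<in>P. ?x \<le> p \<and> p < ?z}. dW p (nx p) \<omega>) = W ?z \<omega> - W ?x \<omega>" by simp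
        then show ?thesis using True by (auto simp: min_def max_def)
      next
        case False
        then have e: "{p\<in>P. ?x \<le> p \<and> p < ?z} = {}" by auto
        show ?thesis unfolding e using False tlt[OF k] bb[of i] by (auto simp: min_def)
      qed
      finally show ?thesis by (simp add: blinfun.diff_right)
    qed
    have "(\<Sum>p\<in>?B. blinfun_apply (\<theta> p \<omega>) (dW p (nx p) \<omega>))
      = (\<Sum>p\<in>?B. y i \<omega> * ((\<Sum>k<n. if t k \<le> p \<and> p < t (Suc k) then blinfun_apply (\<phi> k \<omega>) (dW p (nx p) \<omega>) else 0)
          - g i \<omega> \<bullet> dW p (nx p) \<omega>))"
    proof (rule sum.cong[OF refl])
      fix p assume p: "p \<in> ?B"
      have "blinfun_apply (pr p \<omega>) x = (\<Sum>k<n. if t k \<le> p \<and> p < t (Suc k) then blinfun_apply (\<phi> k \<omega>) x else 0)" for x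
        unfolding pr_def by (simp add: blinfun.sum_left if_distrib[of "\<lambda>f. blinfun_apply f x"] cong: if_cong)
      then show "blinfun_apply (\<theta> p \<omega>) (dW p (nx p) \<omega>)
        = y i \<omega> * ((\<Sum>k<n. if t k \<le> p \<and> p < t (Suc k) then blinfun_apply (\<phi> k \<omega>) (dW p (nx p) \<omega>) else 0)
          - g i \<omega> \<bullet> dW p (nx p) \<omega>)"
        using p th[OF i] by (simp add: blinfun.scaleR_left blinfun.diff_left)
    qed
    also have "\<dots> = y i \<omega> * ((\<Sum>k<n. \<Sum>p\<in>?B. if t k \<le> p \<and> p < t (Suc k) then blinfun_apply (\<phi> k \<omega>) (dW p (nx p) \<omega>) else 0)
          - g i \<omega> \<bullet> (\<Sum>p\<in>?B. dW p (nx p) \<omega>))"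
      unfolding sum_distrib_left[symmetric] sum_subtractf inner_sum_right by (subst sum.swap) simp
    also have "(\<Sum>k<n. \<Sum>p\<in>?B. if t k \<le> p \<and> p < t (Suc k) then blinfun_apply (\<phi> k \<omega>) (dW p (nx p) \<omega>) else 0)
      = elem_integral W n t \<phi> (b (Suc i)) \<omega> - elem_integral W n t \<phi> (b i) \<omega>"
      unfolding elem_integral_def sum_subtractf[symmetric] by (rule sum.cong[OF refl]) (rule phik, simp)
    also have "(\<Sum>p\<in>?B. dW p (nx p) \<omega>) = dW (b i) (b (Suc i)) \<omega>"
      using tele[OF bP'[of i] bP'[of "Suc i"] less_imp_le[OF bb] BT] i by (simp add: dW_def)
    finally show ?thesis .
  qed
  have energy: "ennreal (\<Sum>p\<in>P. (nx p - p) * (norm (\<theta> p \<omega>))\<^sup>2) \<le> (\<integral>\<^sup>+s\<in>{0..T}. h s \<partial>lborel)"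
    if h: "\<And>i s. i < 2 ^ l \<Longrightarrow> b i < s \<Longrightarrow> s \<le> b (Suc i) \<Longrightarrow>
      ennreal ((norm (y i \<omega> *\<^sub>R (elem_process n t \<phi> s \<omega> - blinfun_inner_right (g i \<omega>))))\<^sup>2) \<le> h s" for \<omega> h
  proof -
    have le: "ennreal ((norm (\<theta> p \<omega>))\<^sup>2) \<le> h s" if p: "p \<in> P" and s: "p < s" "s \<le> nx p" for p s
    proof -
      obtain i where i: "i < 2 ^ l" "b i \<le> p" "p < b (Suc i)"
        using grid_block_ex[OF T P0[OF p] PT[OF p], of l] unfolding b_def by blast
      have sb: "b i < s" "s \<le> b (Suc i)"
        using i s nxle[OF i(3) bP'] by auto
      have "elem_process n t \<phi> s \<omega> = pr p \<omega>"
        unfolding elem_process_def pr_def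
      proof (rule sum.cong[OF refl])
        fix k assume "k \<in> {..<n}"
        then have k: "k < n" by simp
        \<comment> \<open>No partition point lies strictly between p and s, since s is at most the
          next point of the refinement.\<close>
        have 1: "t j < s \<longleftrightarrow> t j \<le> p" if "j \<le> n" for j
        proof
          assume "t j < s"
          then have "t j < T" using s nxP(3)[OF p] by simp
          then have "t j \<in> P'" using that by (auto simp: P'_def P_def)
          then show "t j \<le> p" using nxle[of p "t j"] \<open>t j < s\<close> s by (meson leD leI less_le_trans)
        qed (use s in simp)
        have "t k < s \<longleftrightarrow> t k \<le> p" by (rule 1) (use k in simp)
        moreover have "t (Suc k) < s \<longleftrightarrow> t (Suc k) \<le> p" by (rule 1) (use k in simp)
        then have "s \<le> t (Suc k) \<longleftrightarrow> p < t (Suc k)" by linarith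
        ultimately show "(if t k < s \<and> s \<le> t (Suc k) then \<phi> k \<omega> else 0) = (if t k \<le> p \<and> p < t (Suc k) then \<phi> k \<omega> else 0)"
          by (simp only:)
      qed
      then show ?thesis using h[OF i(1) sb] th[OF i] by simp
    qed
    have meas: "(\<lambda>s. ennreal ((norm (\<theta> p \<omega>))\<^sup>2) * indicator {p<..nx p} s) \<in> borel_measurable lborel" for p
      by measurable
    have "ennreal (\<Sum>p\<in>P. (nx p - p) * (norm (\<theta> p \<omega>))\<^sup>2) = (\<Sum>p\<in>P. ennreal ((nx p - p) * (norm (\<theta> p \<omega>))\<^sup>2))"
    proof (rule sum_ennreal[symmetric])
      fix p assume "p \<in> P"
      from nxP(2)[OF this] show "0 \<le> (nx p - p) * (norm (\<theta> p \<omega>))\<^sup>2" by simp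
    qed
    also have "\<dots> = (\<Sum>p\<in>P. \<integral>\<^sup>+s. ennreal ((norm (\<theta> p \<omega>))\<^sup>2) * indicator {p<..nx p} s \<partial>lborel)"
    proof (rule sum.cong[OF refl])
      fix p assume p: "p \<in> P"
      have "(\<integral>\<^sup>+s. ennreal ((norm (\<theta> p \<omega>))\<^sup>2) * indicator {p<..nx p} s \<partial>lborel)
        = ennreal ((norm (\<theta> p \<omega>))\<^sup>2) * emeasure lborel {p<..nx p}"
        by (rule nn_integral_cmult_indicator) simp
      also have "\<dots> = ennreal ((norm (\<theta> p \<omega>))\<^sup>2) * ennreal (nx p - p)"
        using nxP(2)[OF p] by (simp add: less_imp_le)
      also have "\<dots> = ennreal ((nx p - p) * (norm (\<theta> p \<omega>))\<^sup>2)"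
        using nxP(2)[OF p] by (subst ennreal_mult[symmetric]) (auto simp: mult.commute)
      finally show "ennreal ((nx p - p) * (norm (\<theta> p \<omega>))\<^sup>2)
        = (\<integral>\<^sup>+s. ennreal ((norm (\<theta> p \<omega>))\<^sup>2) * indicator {p<..nx p} s \<partial>lborel)" by simp
    qed
    also have "\<dots> = (\<integral>\<^sup>+s. (\<Sum>p\<in>P. ennreal ((norm (\<theta> p \<omega>))\<^sup>2) * indicator {p<..nx p} s) \<partial>lborel)"
      by (rule nn_integral_sum[symmetric]) (rule meas)
    also have "\<dots> \<le> (\<integral>\<^sup>+s\<in>{0..T}. h s \<partial>lborel)"
    proof (rule nn_integral_mono)
      fix s
      show "(\<Sum>p\<in>P. ennreal ((norm (\<theta> p \<omega>))\<^sup>2) * indicator {p<..nx p} s) \<le> h s * indicator {0..T} s"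
      proof (cases "\<exists>p\<in>P. s \<in> {p<..nx p}")
        case True
        then obtain p where p: "p \<in> P" "p < s" "s \<le> nx p" by auto
        have uniq: "q = p" if "q \<in> P" "q < s" "s \<le> nx q" for q
        proof (rule ccontr)
          assume "q \<noteq> p"
          then consider "q < p" | "p < q" by linarith
          then show False
          proof cases
            case 1
            from nxle[OF this, of] p(1) have "nx q \<le> p" by (simp add: P'_def)
            then show False using p that by simp
          next
            case 2
            from nxle[OF this] that(1) have "nx p \<le> q" by (simp add: P'_def)
            then show False using p that by simp
          qed
        qed
        have "(\<Sum>q\<in>P. ennreal ((norm (\<theta> q \<omega>))\<^sup>2) * indicator {q<..nx q} s) = (\<Sum>q\<in>P. if q = p then ennreal ((norm (\<theta> p \<omega>))\<^sup>2) else 0)"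
        proof (rule sum.cong[OF refl])
          fix q assume q: "q \<in> P"
          have "(s \<in> {q<..nx q}) = (q = p)" using uniq[OF q] p by auto
          then show "ennreal ((norm (\<theta> q \<omega>))\<^sup>2) * indicator {q<..nx q} s = (if q = p then ennreal ((norm (\<theta> p \<omega>))\<^sup>2) else 0)"
            by (cases "q = p") (simp_all only: indicator_def if_True if_False mult_1_right mult_zero_right of_bool_eq simp_thms)
        qed
        also have "\<dots> = ennreal ((norm (\<theta> p \<omega>))\<^sup>2)" using finP(1) p(1) by simp
        also have "\<dots> \<le> h s" by (rule le[OF p])
        also have "\<dots> = h s * indicator {0..T} s"
          using p P0[OF p(1)] nxP(3)[OF p(1)] by simp
        finally show ?thesis .
      next
        case False
        then have "(\<Sum>p\<in>P. ennreal ((norm (\<theta> p \<omega>))\<^sup>2) * indicator {p<..nx p} s) = 0"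
          by (intro sum.neutral) (auto simp: indicator_def)
        then show ?thesis by simp
      qed
    qed
    finally show ?thesis .
  qed
  show ?thesis
  proof (intro exI[of _ P] exI[of _ nx] exI[of _ \<theta>] conjI ballI allI impI)
    show "finite P" by (rule finP)
    fix p assume p: "p \<in> P"
    show "0 \<le> p" "p < nx p" "p < T" using P0[OF p] nxP(2)[OF p] PT[OF p] .
    show "simple_function (F p) (\<theta> p)" by (rule th_simple)
    fix q assume "q \<in> P" "p < q"
    then show "nx p \<le> q" by (intro nxle) (auto simp: P'_def)
  next
    fix i \<omega> assume "i < (2::nat) ^ l"
    from block[OF this, of \<omega>] show "(\<Sum>p\<in>{p\<in>P. grid T l i \<le> p \<and> p < grid T l (Suc i)}. blinfun_apply (\<theta> p \<omega>) (dW p (nx p) \<omega>))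
      = y i \<omega> * (elem_integral W n t \<phi> (grid T l (Suc i)) \<omega> - elem_integral W n t \<phi> (grid T l i) \<omega>
          - g i \<omega> \<bullet> dW (grid T l i) (grid T l (Suc i)) \<omega>)" unfolding b_def .
  next
    fix \<omega> h
    assume "\<forall>i<2 ^ l. \<forall>s. grid T l i < s \<and> s \<le> grid T l (Suc i) \<longrightarrow>
        ennreal ((norm (y i \<omega> *\<^sub>R (elem_process n t \<phi> s \<omega> - blinfun_inner_right (g i \<omega>))))\<^sup>2) \<le> h s"
    then show "ennreal (\<Sum>p\<in>P. (nx p - p) * (norm (\<theta> p \<omega>))\<^sup>2) \<le> (\<integral>\<^sup>+s\<in>{0..T}. h s \<partial>lborel)"
      by (intro energy) (simp add: b_def)
  qed
qed

end

section \<open>Comparing Ito integrals with left-point sums\<close>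

lemma norm_blinfun_inner_right [simp]: "norm (blinfun_inner_right x) = norm x"
proof (rule antisym)
  show "norm (blinfun_inner_right x) \<le> norm x"
    by (rule norm_blinfun_bound) (auto simp: Cauchy_Schwarz_ineq2)
  show "norm x \<le> norm (blinfun_inner_right x)"
  proof (cases "x = 0")
    case False
    have "norm x * norm x = norm (blinfun_apply (blinfun_inner_right x) x)"
      by (simp add: dot_square_norm power2_eq_square)
    also have "\<dots> \<le> norm (blinfun_inner_right x) * norm x" by (rule norm_blinfun)
    finally show ?thesis using False by simp
  qed simp
qed

lemma blinfun_inner_right_diff: "blinfun_inner_right x - blinfun_inner_right y = blinfun_inner_right (x - y)"
  using linear_diff[OF bounded_linear.linear[OF bounded_linear_blinfun_inner_right]] by metis

text \<open>A vector and the functional it represents have the same norm, so the continuity of the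
  functional-valued integrand, part of the definition of the Ito integral, is continuity of the
  vector.\<close>

lemma continuous_on_blinfun_inner_right:
  fixes g :: "'a::metric_space \<Rightarrow> 'b::real_inner"
  shows "continuous_on S (\<lambda>s. blinfun_inner_right (g s)) \<longleftrightarrow> continuous_on S g"
proof -
  have "dist (blinfun_inner_right x) (blinfun_inner_right y) = dist x y" for x y :: 'b
    by (simp add: dist_norm blinfun_inner_right_diff)
  then show ?thesis by (simp add: continuous_on_iff)
qed

lemma measurable_simple_minus_continuous:
  fixes \<Phi> :: "real \<Rightarrow> 'b::real_normed_vector"
  assumes e: "simple_function borel e" and c: "continuous_on {0..T} \<Phi>"
  shows "(\<lambda>s. ennreal ((norm (e s - \<Phi> s))\<^sup>2) * indicator {0..T} s) \<in> borel_measurable borel"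
proof -
  have fin: "finite (range e)" using e by (simp add: simple_function_def)
  have "(\<lambda>s. \<Sum>v\<in>range e. ennreal (indicator {0..T} s *\<^sub>R (norm (v - \<Phi> s))\<^sup>2) * indicator (e -` {v}) s) \<in> borel_measurable borel"
  proof (intro borel_measurable_sum borel_measurable_times_ennreal borel_measurable_indicator)
    fix v assume "v \<in> range e"
    show "e -` {v} \<in> sets borel" using simple_functionD(2)[OF e, of "{v}"] by simp
    have "(\<lambda>s. indicator {0..T} s *\<^sub>R (norm (v - \<Phi> s))\<^sup>2) \<in> borel_measurable borel"
      by (intro borel_measurable_continuous_on_indicator continuous_intros c) auto
    then show "(\<lambda>s. ennreal (indicator {0..T} s *\<^sub>R (norm (v - \<Phi> s))\<^sup>2)) \<in> borel_measurable borel"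
      by (rule measurable_compose[OF _ measurable_ennreal])
  qed
  also have "(\<lambda>s. \<Sum>v\<in>range e. ennreal (indicator {0..T} s *\<^sub>R (norm (v - \<Phi> s))\<^sup>2) * indicator (e -` {v}) s)
    = (\<lambda>s. ennreal ((norm (e s - \<Phi> s))\<^sup>2) * indicator {0..T} s)"
  proof
    fix s
    have "(\<Sum>v\<in>range e. ennreal (indicator {0..T} s *\<^sub>R (norm (v - \<Phi> s))\<^sup>2) * indicator (e -` {v}) s)
      = (\<Sum>v\<in>range e. if v = e s then ennreal ((norm (e s - \<Phi> s))\<^sup>2) * indicator {0..T} s else 0)"
      by (rule sum.cong) (auto simp: indicator_def)
    then show "(\<Sum>v\<in>range e. ennreal (indicator {0..T} s *\<^sub>R (norm (v - \<Phi> s))\<^sup>2) * indicator (e -` {v}) s)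
      = ennreal ((norm (e s - \<Phi> s))\<^sup>2) * indicator {0..T} s" using fin by simp
  qed
  finally show ?thesis .
qed

lemma simple_function_elem_process: "simple_function borel (\<lambda>s. elem_process n t \<phi> s \<omega>)"
proof -
  have "simple_function borel (\<lambda>s. \<Sum>i<n. if s \<in> {t i<..t (Suc i)} then \<phi> i \<omega> else 0)"
    by (intro simple_function_sum simple_function_If_set) auto
  then show ?thesis by (simp add: elem_process_def)
qed

context wiener
begin

text \<open>\<open>R i\<close> is the sum over cell i of the refinement after stopping at energy
  \<open>r\<close>. The bound on the square of the total serves Riemann sums, the bound on the sum
  of the squares serves quadratic variation; where the energy is at most \<open>r\<close>, nothing
  has been stopped and \<open>R i\<close> is the actual error of the cell.\<close>

lemma truncated_blocks:
  fixes \<phi> :: "nat \<Rightarrow> 's \<Rightarrow> 'h \<Rightarrow>\<^sub>L real"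
  assumes T: "0 < T" and el: "elementary F n t \<phi>"
    and y: "\<forall>i<2 ^ l. simple_function (F (grid T l i)) (y i :: 's \<Rightarrow> real)"
    and g: "\<forall>i<2 ^ l. simple_function (F (grid T l i)) (g i :: 's \<Rightarrow> 'h)"
    and r: "0 \<le> r"
  shows "\<exists>R. integrable M (\<lambda>\<omega>. (\<Sum>i<2 ^ l. R i \<omega>)\<^sup>2) \<and> (\<integral>\<omega>. (\<Sum>i<2 ^ l. R i \<omega>)\<^sup>2 \<partial>M) \<le> (1 + C4) * r \<and>
    integrable M (\<lambda>\<omega>. \<Sum>i<2 ^ l. (R i \<omega>)\<^sup>2) \<and> (\<integral>\<omega>. (\<Sum>i<2 ^ l. (R i \<omega>)\<^sup>2) \<partial>M) \<le> (1 + C4) * r \<and>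
    (\<forall>\<omega> h. (\<forall>i<2 ^ l. \<forall>s. grid T l i < s \<and> s \<le> grid T l (Suc i) \<longrightarrow>
        ennreal ((norm (y i \<omega> *\<^sub>R (elem_process n t \<phi> s \<omega> - blinfun_inner_right (g i \<omega>))))\<^sup>2) \<le> h s) \<and>
        (\<integral>\<^sup>+s\<in>{0..T}. h s \<partial>lborel) \<le> ennreal r \<longrightarrow>
      (\<forall>i<2 ^ l. R i \<omega> = y i \<omega> * (elem_integral W n t \<phi> (grid T l (Suc i)) \<omega> - elem_integral W n t \<phi> (grid T l i) \<omega>
          - g i \<omega> \<bullet> dW (grid T l i) (grid T l (Suc i)) \<omega>)))"
proof -
  define b where "b i = grid T l i" for i
  obtain P nx \<theta> where fin: "finite P" and P0_: "\<forall>p\<in>P. 0 \<le> p \<and> p < nx p \<and> p < T"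
    and nx_: "\<forall>p\<in>P. \<forall>q\<in>P. p < q \<longrightarrow> nx p \<le> q"
    and th_: "\<forall>p\<in>P. simple_function (F p) (\<theta> p)"
    and block_: "\<forall>i<2 ^ l. \<forall>\<omega>. (\<Sum>p\<in>{p\<in>P. grid T l i \<le> p \<and> p < grid T l (Suc i)}. blinfun_apply (\<theta> p \<omega>) (dW p (nx p) \<omega>))
      = y i \<omega> * (elem_integral W n t \<phi> (grid T l (Suc i)) \<omega> - elem_integral W n t \<phi> (grid T l i) \<omega>
          - g i \<omega> \<bullet> dW (grid T l i) (grid T l (Suc i)) \<omega>)"
    and energy_: "\<forall>\<omega> h. (\<forall>i<2 ^ l. \<forall>s. grid T l i < s \<and> s \<le> grid T l (Suc i) \<longrightarrow>
        ennreal ((norm (y i \<omega> *\<^sub>R (elem_process n t \<phi> s \<omega> - blinfun_inner_right (g i \<omega>))))\<^sup>2) \<le> h s) \<longrightarrow>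
      ennreal (\<Sum>p\<in>P. (nx p - p) * (norm (\<theta> p \<omega>))\<^sup>2) \<le> (\<integral>\<^sup>+s\<in>{0..T}. h s \<partial>lborel)"
    using elementary_refinement[OF T el y g] by (elim exE conjE) (rule that; assumption)
  note P0 = P0_[rule_format] and nx = nx_[rule_format] and th = th_[rule_format]
    and block = block_[rule_format, folded b_def] and energy = energy_[rule_format, folded b_def]
  have P0': "0 \<le> p \<and> p < nx p" if "p \<in> P" for p using P0[OF that] by simp
  obtain \<eta> where et_: "\<forall>p\<in>P. simple_function (F p) (\<eta> p)"
    and etr: "(\<Sum>p\<in>P. (nx p - p) * (\<integral>\<omega>. (norm (\<eta> p \<omega>))\<^sup>2 \<partial>M)) \<le> r"
    and same_: "\<forall>\<omega>. (\<Sum>p\<in>P. (nx p - p) * (norm (\<theta> p \<omega>))\<^sup>2) \<le> r \<longrightarrow> (\<forall>p\<in>P. \<eta> p \<omega> = \<theta> p \<omega>)"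
  proof -
    have "\<exists>\<eta>. (\<forall>p\<in>P. simple_function (F p) (\<eta> p)) \<and>
      (\<Sum>p\<in>P. (nx p - p) * (\<integral>\<omega>. (norm (\<eta> p \<omega>))\<^sup>2 \<partial>M)) \<le> r \<and>
      (\<forall>\<omega>. (\<Sum>p\<in>P. (nx p - p) * (norm (\<theta> p \<omega>))\<^sup>2) \<le> r \<longrightarrow> (\<forall>p\<in>P. \<eta> p \<omega> = \<theta> p \<omega>))"
      by (rule truncated_integrands[OF fin P0' nx th r])
    then show ?thesis by (elim exE conjE) (rule that; assumption)
  qed
  note et = et_[rule_format] and same = same_[rule_format]
  define B where "B i = {p\<in>P. b i \<le> p \<and> p < b (Suc i)}" for i
  define R where "R i \<omega> = (\<Sum>p\<in>B i. blinfun_apply (\<eta> p \<omega>) (dW p (nx p) \<omega>))" for i \<omega>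
  have part: "(\<Sum>p\<in>P. f p) = (\<Sum>i<2 ^ l. \<Sum>p\<in>B i. f p)" for f :: "real \<Rightarrow> real"
  proof -
    have "P = (\<Union>i<2 ^ l. B i)"
      using grid_block_ex[OF T, of _ l] P0 unfolding B_def b_def by blast
    moreover have "(\<Sum>p\<in>(\<Union>i<2 ^ l. B i). f p) = (\<Sum>i<2 ^ l. \<Sum>p\<in>B i. f p)"
    proof (rule sum.UNION_disjoint)
      show "\<forall>i\<in>{..<2 ^ l}. finite (B i)" using fin by (simp add: B_def)
      show "\<forall>i\<in>{..<2 ^ l}. \<forall>j\<in>{..<2 ^ l}. i \<noteq> j \<longrightarrow> B i \<inter> B j = {}"
        using grid_block_unique[OF T, of l] unfolding B_def b_def by blast
    qed simp
    ultimately show ?thesis by simp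
  qed
  have BP: "B i \<subseteq> P" "finite (B i)" for i using fin by (auto simp: B_def)
  have sumR: "(\<Sum>i<2 ^ l. R i \<omega>) = (\<Sum>p\<in>P. blinfun_apply (\<eta> p \<omega>) (dW p (nx p) \<omega>))" for \<omega>
    unfolding R_def by (rule part[symmetric])
  have C: "0 \<le> 1 + C4" using C4_pos by simp
  note sq = simple_dW_sum_square[OF fin P0' nx et]
  \<comment> \<open>The isometry is applied to the steps of one cell only; adding over the cells
    gives the same total as for all steps together.\<close>
  have sqB: "integrable M (\<lambda>\<omega>. (R i \<omega>)\<^sup>2)"
    "(\<integral>\<omega>. (R i \<omega>)\<^sup>2 \<partial>M) \<le> (1 + C4) * (\<Sum>p\<in>B i. (nx p - p) * (\<integral>\<omega>. (norm (\<eta> p \<omega>))\<^sup>2 \<partial>M))" for i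
    unfolding R_def
    by (rule simple_dW_sum_square[OF BP(2)]; use BP(1)[of i] P0' nx et in blast)+
  show ?thesis
  proof (intro exI[of _ R] conjI allI impI)
    show "integrable M (\<lambda>\<omega>. (\<Sum>i<2 ^ l. R i \<omega>)\<^sup>2)" unfolding sumR by (rule sq(1))
    have "(\<integral>\<omega>. (\<Sum>i<2 ^ l. R i \<omega>)\<^sup>2 \<partial>M) \<le> (1 + C4) * (\<Sum>p\<in>P. (nx p - p) * (\<integral>\<omega>. (norm (\<eta> p \<omega>))\<^sup>2 \<partial>M))"
      unfolding sumR by (rule sq(2))
    also have "\<dots> \<le> (1 + C4) * r" by (rule mult_left_mono[OF etr C])
    finally show "(\<integral>\<omega>. (\<Sum>i<2 ^ l. R i \<omega>)\<^sup>2 \<partial>M) \<le> (1 + C4) * r" .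
    show "integrable M (\<lambda>\<omega>. \<Sum>i<2 ^ l. (R i \<omega>)\<^sup>2)" by (intro Bochner_Integration.integrable_sum sqB)
    have "(\<integral>\<omega>. (\<Sum>i<2 ^ l. (R i \<omega>)\<^sup>2) \<partial>M) = (\<Sum>i<2 ^ l. \<integral>\<omega>. (R i \<omega>)\<^sup>2 \<partial>M)"
      by (intro Bochner_Integration.integral_sum sqB)
    also have "\<dots> \<le> (\<Sum>i<2 ^ l. (1 + C4) * (\<Sum>p\<in>B i. (nx p - p) * (\<integral>\<omega>. (norm (\<eta> p \<omega>))\<^sup>2 \<partial>M)))"
      by (intro sum_mono sqB)
    also have "\<dots> = (1 + C4) * (\<Sum>p\<in>P. (nx p - p) * (\<integral>\<omega>. (norm (\<eta> p \<omega>))\<^sup>2 \<partial>M))"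
      unfolding part by (simp only: sum_distrib_left)
    also have "\<dots> \<le> (1 + C4) * r" by (rule mult_left_mono[OF etr C])
    finally show "(\<integral>\<omega>. (\<Sum>i<2 ^ l. (R i \<omega>)\<^sup>2) \<partial>M) \<le> (1 + C4) * r" .
    fix \<omega> h i
    assume h: "(\<forall>i<2 ^ l. \<forall>s. grid T l i < s \<and> s \<le> grid T l (Suc i) \<longrightarrow>
        ennreal ((norm (y i \<omega> *\<^sub>R (elem_process n t \<phi> s \<omega> - blinfun_inner_right (g i \<omega>))))\<^sup>2) \<le> h s) \<and>
        (\<integral>\<^sup>+s\<in>{0..T}. h s \<partial>lborel) \<le> ennreal r" and i: "i < (2::nat) ^ l"
    have "ennreal (\<Sum>p\<in>P. (nx p - p) * (norm (\<theta> p \<omega>))\<^sup>2) \<le> ennreal r"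
      by (rule order_trans[OF energy_[rule_format, of \<omega> h] conjunct2[OF h]]) (use h in blast)
    then have "(\<Sum>p\<in>P. (nx p - p) * (norm (\<theta> p \<omega>))\<^sup>2) \<le> r" using r by (simp add: ennreal_le_iff)
    then have "R i \<omega> = (\<Sum>p\<in>B i. blinfun_apply (\<theta> p \<omega>) (dW p (nx p) \<omega>))"
      unfolding R_def using BP(1)[of i] by (intro sum.cong refl) (simp add: same subset_iff)
    then show "R i \<omega> = y i \<omega> * (elem_integral W n t \<phi> (grid T l (Suc i)) \<omega> - elem_integral W n t \<phi> (grid T l i) \<omega>
          - g i \<omega> \<bullet> dW (grid T l i) (grid T l (Suc i)) \<omega>)"
      using block[OF i] by (simp add: B_def b_def)
  qed
qed

text \<open>\<open>D i\<close> is the error of freezing the integrand at the left end of a cell. The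
  integral is only a limit of elementary ones, so second moments are estimated for truncated
  elementary sums. On \<open>Good\<close> the truncation is eventually inactive, because the weights
  and the oscillation of \<open>g\<close> in each cell are bounded there. Markov's inequality and
  \<open>small_liminf\<close> carry the bound over to the limit.\<close>

lemma ito_main_estimate:
  fixes g :: "real \<Rightarrow> 's \<Rightarrow> 'h" and Y X :: "real \<Rightarrow> 's \<Rightarrow> real" and l :: nat
  assumes T: "0 < T" and ito: "has_ito_integral M F W \<tau> (\<lambda>s \<omega>. blinfun_inner_right (g s \<omega>)) X"
    and g: "adapted_upto F \<tau> g" and Y: "adapted_upto F \<tau> Y" and K: "0 < K" and c: "0 < c" and d: "0 < \<delta>"
  defines "D \<equiv> \<lambda>i \<omega>. X (grid T l (Suc i)) \<omega> - X (grid T l i) \<omega> - g (grid T l i) \<omega> \<bullet> dW (grid T l i) (grid T l (Suc i)) \<omega>"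
    and "Good \<equiv> {\<omega>. ereal T < \<tau> \<omega> \<and> (\<forall>i<2 ^ l. \<bar>Y (grid T l i) \<omega>\<bar> \<le> K) \<and>
      (\<forall>i<2 ^ l. \<forall>s\<in>{grid T l i..grid T l (Suc i)}. norm (g s \<omega> - g (grid T l i) \<omega>) \<le> c)}"
    and "r \<equiv> 36 * K\<^sup>2 * c\<^sup>2 * T"
  shows "small M {\<omega> \<in> Good. \<bar>\<Sum>i<2 ^ l. Y (grid T l i) \<omega> * D i \<omega>\<bar> > \<delta>} ((1 + C4) * r / \<delta>\<^sup>2)"
    and "small M {\<omega> \<in> Good. (\<Sum>i<2 ^ l. (Y (grid T l i) \<omega> * D i \<omega>)\<^sup>2) > \<delta>} ((1 + C4) * r / \<delta>)"
proof -
  define b where "b i = grid T l i" for i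
  have b0: "0 \<le> b i" for i using grid_nonneg[of T l i] T by (simp add: b_def)
  have bT: "b i \<le> T" if "i \<le> 2 ^ l" for i using grid_le[of T i l] T that by (simp add: b_def)
  have bb: "b i < b (Suc i)" for i using grid_less[OF T, of i "Suc i" l] by (simp add: b_def)
  have r0: "0 \<le> r" using T by (simp add: r_def)
  let ?\<Phi> = "\<lambda>s \<omega>. blinfun_inner_right (g s \<omega>)"
  from ito obtain n t \<phi> where cont: "AE \<omega> in M. continuous_upto (\<tau> \<omega>) (\<lambda>s. ?\<Phi> s \<omega>)"
    and el: "\<And>m. elementary F (n m) (t m) (\<phi> m)"
    and v1: "\<And>S \<rho>. 0 \<le> S \<Longrightarrow> 0 < \<rho> \<Longrightarrow> vanishing M (\<lambda>m. {\<omega>. ereal S < \<tau> \<omega> \<and>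
             (\<integral>\<^sup>+s\<in>{0..S}. ennreal ((norm (elem_process (n m) (t m) (\<phi> m) s \<omega> - ?\<Phi> s \<omega>))\<^sup>2) \<partial>lborel)
               > ennreal \<rho>})"
    and v2: "\<And>S \<rho>. 0 \<le> S \<Longrightarrow> 0 < \<rho> \<Longrightarrow> vanishing M (\<lambda>m. {\<omega>. ereal S < \<tau> \<omega> \<and>
             norm (elem_integral W (n m) (t m) (\<phi> m) S \<omega> - X S \<omega>) > \<rho>})"
    unfolding has_ito_integral_def by blast
  define V where "V m \<omega> = (\<integral>\<^sup>+s\<in>{0..T}. ennreal ((norm (elem_process (n m) (t m) (\<phi> m) s \<omega> - ?\<Phi> s \<omega>))\<^sup>2) \<partial>lborel)" for m \<omega>
  define E where "E m i \<omega> = elem_integral W (n m) (t m) (\<phi> m) (b i) \<omega>" for m i \<omega>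
  \<comment> \<open>Failures of two kinds: a large energy distance between the approximating process
    and the integrand, or a wrong value of the integral at one of the finitely many grid points.
    Along a subsequence neither persists.\<close>
  define bad where "bad m \<rho> = {\<omega>. ereal T < \<tau> \<omega> \<and> V m \<omega> > ennreal \<rho>} \<union>
    (\<Union>i\<in>{..2 ^ l}. {\<omega>. ereal (b i) < \<tau> \<omega> \<and> norm (E m i \<omega> - X (b i) \<omega>) > \<rho>})" for m \<rho>
  have ev_bad: "\<forall>\<^sub>F m in sequentially. small M (bad m \<rho>) e" if "0 < \<rho>" "0 < e" for \<rho> e
  proof -
    have 1: "\<forall>\<^sub>F m in sequentially. small M {\<omega>. ereal T < \<tau> \<omega> \<and> V m \<omega> > ennreal \<rho>} (e / 2)"
      unfolding V_def using that T by (intro vanishing_small v1) auto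
    have "\<forall>\<^sub>F m in sequentially. \<forall>i\<in>{..(2::nat) ^ l}. small M {\<omega>. ereal (b i) < \<tau> \<omega> \<and> norm (E m i \<omega> - X (b i) \<omega>) > \<rho>}
        (e / 2 / real (card {..(2::nat) ^ l}))"
    proof (intro eventually_ball_finite ballI vanishing_small)
      show "0 < e / 2 / real (card {..(2::nat) ^ l})"
        using that by (intro divide_pos_pos) (auto intro!: add_pos_pos)
      show "vanishing M (\<lambda>m. {\<omega>. ereal (b i) < \<tau> \<omega> \<and> norm (E m i \<omega> - X (b i) \<omega>) > \<rho>})" for i
        unfolding E_def by (rule v2[OF b0 that(1)])
    qed simp
    with 1 show ?thesis
    proof eventually_elim
      case (elim m)
      have "small M (\<Union>i\<in>{..(2::nat) ^ l}. {\<omega>. ereal (b i) < \<tau> \<omega> \<and> norm (E m i \<omega> - X (b i) \<omega>) > \<rho>}) (e / 2)"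
        using elim(2) that by (intro small_finite_UN) auto
      from small_Un[OF elim(1) this] show ?case by (simp add: bad_def)
    qed
  qed
  have "bad m \<rho>' \<subseteq> bad m \<rho>" if "0 < \<rho>" "\<rho> \<le> \<rho>'" for m \<rho> \<rho>'
  proof -
    have "ennreal \<rho> \<le> ennreal \<rho>'" using that by (intro ennreal_leI)
    then have "V m \<omega> > ennreal \<rho>' \<Longrightarrow> V m \<omega> > ennreal \<rho>" for \<omega> by (rule le_less_trans)
    then show ?thesis unfolding bad_def using that by (intro Un_mono UN_mono) auto
  qed
  from small_AE_subseq[of bad, OF ev_bad this] obtain k :: "nat \<Rightarrow> nat" where
    k: "AE \<omega> in M. \<forall>\<rho>>0. \<forall>\<^sub>F j in sequentially. \<omega> \<notin> bad (k j) \<rho>" by blast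
  \<comment> \<open>The weights have to be simple functions in the elementary estimates. The
    approximations are at most twice as large as their limits, which yields the bound 2 K.\<close>
  have "\<exists>ys. (\<forall>j. simple_function (F (b i)) (ys j)) \<and>
      (\<forall>\<omega>\<in>space M. (\<lambda>j. ys j \<omega>) \<longlonglongrightarrow> (if ereal (b i) < \<tau> \<omega> then Y (b i) \<omega> else 0)) \<and>
      (\<forall>j. \<forall>\<omega>\<in>space M. dist (ys j \<omega>) 0 \<le> 2 * dist (if ereal (b i) < \<tau> \<omega> then Y (b i) \<omega> else 0) 0)" for i
    using borel_measurable_implies_sequence_metric[OF Y[unfolded adapted_upto_def, rule_format, OF b0[of i]], of 0]
    by simp
  then obtain ys where ys: "\<And>i j. simple_function (F (b i)) (ys i j)"
    "\<And>i \<omega>. \<omega> \<in> space M \<Longrightarrow> (\<lambda>j. ys i j \<omega>) \<longlonglongrightarrow> (if ereal (b i) < \<tau> \<omega> then Y (b i) \<omega> else 0)"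
    "\<And>i j \<omega>. \<omega> \<in> space M \<Longrightarrow> dist (ys i j \<omega>) 0 \<le> 2 * dist (if ereal (b i) < \<tau> \<omega> then Y (b i) \<omega> else 0) 0"
    by metis
  have "\<exists>gs. (\<forall>j. simple_function (F (b i)) (gs j)) \<and>
      (\<forall>\<omega>\<in>space M. (\<lambda>j. gs j \<omega>) \<longlonglongrightarrow> (if ereal (b i) < \<tau> \<omega> then g (b i) \<omega> else 0))" for i
    using borel_measurable_implies_sequence_metric[OF g[unfolded adapted_upto_def, rule_format, OF b0[of i]], of 0]
    unfolding space_F by (elim exE conjE) (rule exI, rule conjI; assumption)
  then obtain gs where gs: "\<And>i j. simple_function (F (b i)) (gs i j)"
    "\<And>i \<omega>. \<omega> \<in> space M \<Longrightarrow> (\<lambda>j. gs i j \<omega>) \<longlonglongrightarrow> (if ereal (b i) < \<tau> \<omega> then g (b i) \<omega> else 0)"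
    by metis
  define Z where "Z i j \<omega> = ys i j \<omega> * (E (k j) (Suc i) \<omega> - E (k j) i \<omega> - gs i j \<omega> \<bullet> dW (b i) (b (Suc i)) \<omega>)" for i j \<omega>
  define Pr where "Pr j R \<longleftrightarrow> integrable M (\<lambda>\<omega>. (\<Sum>i<2 ^ l. R i \<omega>)\<^sup>2) \<and> (\<integral>\<omega>. (\<Sum>i<2 ^ l. R i \<omega>)\<^sup>2 \<partial>M) \<le> (1 + C4) * r \<and>
    integrable M (\<lambda>\<omega>. \<Sum>i<2 ^ l. (R i \<omega>)\<^sup>2) \<and> (\<integral>\<omega>. (\<Sum>i<2 ^ l. (R i \<omega>)\<^sup>2) \<partial>M) \<le> (1 + C4) * r \<and>
    (\<forall>\<omega> h. (\<forall>i<2 ^ l. \<forall>s. b i < s \<and> s \<le> b (Suc i) \<longrightarrow>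
        ennreal ((norm (ys i j \<omega> *\<^sub>R (elem_process (n (k j)) (t (k j)) (\<phi> (k j)) s \<omega> - blinfun_inner_right (gs i j \<omega>))))\<^sup>2) \<le> h s) \<and>
        (\<integral>\<^sup>+s\<in>{0..T}. h s \<partial>lborel) \<le> ennreal r \<longrightarrow>
      (\<forall>i<2 ^ l. R i \<omega> = Z i j \<omega>))" for j and R :: "nat \<Rightarrow> 's \<Rightarrow> real"
  have "\<exists>R. Pr j R" for j
    unfolding Pr_def Z_def E_def b_def
    by (rule truncated_blocks[OF T el, where y="\<lambda>i. ys i j" and g="\<lambda>i. gs i j", OF _ _ r0])
      (simp_all add: ys(1)[unfolded b_def] gs(1)[unfolded b_def])
  then obtain R where R: "\<And>j. Pr j (R j)" by metis
  note R' = R[unfolded Pr_def]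
  have R1: "integrable M (\<lambda>\<omega>. (\<Sum>i<2 ^ l. R j i \<omega>)\<^sup>2)" "(\<integral>\<omega>. (\<Sum>i<2 ^ l. R j i \<omega>)\<^sup>2 \<partial>M) \<le> (1 + C4) * r" for j
    by (rule conjunct1[OF R'], rule conjunct1[OF conjunct2[OF R']])
  have R2: "integrable M (\<lambda>\<omega>. \<Sum>i<2 ^ l. (R j i \<omega>)\<^sup>2)" "(\<integral>\<omega>. (\<Sum>i<2 ^ l. (R j i \<omega>)\<^sup>2) \<partial>M) \<le> (1 + C4) * r" for j
    by (rule conjunct1[OF conjunct2[OF conjunct2[OF R']]], rule conjunct1[OF conjunct2[OF conjunct2[OF conjunct2[OF R']]]])
  note R3 = conjunct2[OF conjunct2[OF conjunct2[OF conjunct2[OF R']]]]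
  \<comment> \<open>On \<open>Good\<close> the truncated blocks eventually equal the untruncated
    ones, and these converge to the weighted errors cell by cell.\<close>
  have conv: "AE \<omega> in M. \<omega> \<in> Good \<longrightarrow> (\<forall>\<^sub>F j in sequentially. \<forall>i<2 ^ l. R j i \<omega> = Z i j \<omega>) \<and>
    (\<forall>i<2 ^ l. (\<lambda>j. Z i j \<omega>) \<longlonglongrightarrow> Y (b i) \<omega> * D i \<omega>)"
    using k cont AE_space
  proof eventually_elim
    case (elim \<omega>)
    show ?case
    proof
      assume G: "\<omega> \<in> Good"
      then have A: "ereal T < \<tau> \<omega>" and YK: "\<And>i. i < 2 ^ l \<Longrightarrow> \<bar>Y (b i) \<omega>\<bar> \<le> K"
        and gc: "\<And>i s. i < 2 ^ l \<Longrightarrow> b i \<le> s \<Longrightarrow> s \<le> b (Suc i) \<Longrightarrow> norm (g s \<omega> - g (b i) \<omega>) \<le> c"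
        by (auto simp: Good_def b_def)
      have At: "ereal (b i) < \<tau> \<omega>" if "i \<le> 2 ^ l" for i
        using bT[OF that] A by (meson ereal_less_eq(3) le_less_trans)
      have ylim: "(\<lambda>j. ys i j \<omega>) \<longlonglongrightarrow> Y (b i) \<omega>" and glim: "(\<lambda>j. gs i j \<omega>) \<longlonglongrightarrow> g (b i) \<omega>"
        and yb: "\<And>j. \<bar>ys i j \<omega>\<bar> \<le> 2 * K" if "i < 2 ^ l" for i
      proof -
        show "(\<lambda>j. ys i j \<omega>) \<longlonglongrightarrow> Y (b i) \<omega>" "(\<lambda>j. gs i j \<omega>) \<longlonglongrightarrow> g (b i) \<omega>"
          using ys(2)[OF elim(3), of i] gs(2)[OF elim(3), of i] At[of i] that by auto
        show "\<bar>ys i j \<omega>\<bar> \<le> 2 * K" for j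
          using ys(3)[OF elim(3), of i j] At[of i] YK[OF that] that by auto
      qed
      have Elim: "(\<lambda>j. E (k j) i \<omega>) \<longlonglongrightarrow> X (b i) \<omega>" if i: "i \<le> 2 ^ l" for i
      proof (rule tendstoI)
        fix e :: real assume "e > 0"
        then have "0 < e / 2" by simp
        with elim(1) have "\<forall>\<^sub>F j in sequentially. \<omega> \<notin> bad (k j) (e / 2)" by blast
        then show "\<forall>\<^sub>F j in sequentially. dist (E (k j) i \<omega>) (X (b i) \<omega>) < e"
        proof eventually_elim
          case (elim j)
          then have "\<not> norm (E (k j) i \<omega> - X (b i) \<omega>) > e / 2" using i At[OF i] by (auto simp: bad_def)
          then show ?case using \<open>e > 0\<close> by (simp add: dist_norm)
        qed
      qed
      have Zlim: "(\<lambda>j. Z i j \<omega>) \<longlonglongrightarrow> Y (b i) \<omega> * D i \<omega>" if i: "i < 2 ^ l" for i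
        unfolding Z_def D_def b_def[symmetric] using i
        by (intro tendsto_intros ylim glim Elim) auto
      have c2T: "0 < c\<^sup>2 * T" using c T by simp
      then have evV: "\<forall>\<^sub>F j in sequentially. \<omega> \<notin> bad (k j) (c\<^sup>2 * T)" using elim(1) by blast
      have evg: "\<forall>\<^sub>F j in sequentially. \<forall>i\<in>{..<(2::nat) ^ l}. dist (gs i j \<omega>) (g (b i) \<omega>) < c"
        using c by (intro eventually_ball_finite ballI tendstoD[OF glim]) auto
      from evV evg have "\<forall>\<^sub>F j in sequentially. \<forall>i<2 ^ l. R j i \<omega> = Z i j \<omega>"
      proof eventually_elim
        case (elim j)
        let ?e = "\<lambda>s. elem_process (n (k j)) (t (k j)) (\<phi> (k j)) s \<omega>"
        \<comment> \<open>The weight contributes (2 K)^2, and (x + 2 c)^2 \<le> 3 (x^2 + 2 c^2)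
          holds with slack 2 (x - c)^2, which together give 12 K^2. With the integral of x^2 at most
          c^2 T the total energy is at most 12 K^2 times 3 c^2 T, and this is
          \<open>r\<close>.\<close>
        define h where "h s = ennreal (12 * K\<^sup>2) * (ennreal ((norm (?e s - ?\<Phi> s \<omega>))\<^sup>2) + ennreal (2 * c\<^sup>2))" for s
        have V: "V (k j) \<omega> \<le> ennreal (c\<^sup>2 * T)" using elim(1) A by (auto simp: bad_def not_less)
        have "ennreal ((norm (ys i j \<omega> *\<^sub>R (?e s - blinfun_inner_right (gs i j \<omega>))))\<^sup>2) \<le> h s"
          if i: "i < 2 ^ l" and s: "b i < s \<and> s \<le> b (Suc i)" for i s
        proof -
          let ?x = "norm (?e s - ?\<Phi> s \<omega>)"
          have "?e s - blinfun_inner_right (gs i j \<omega>) = (?e s - ?\<Phi> s \<omega>) + blinfun_inner_right (g s \<omega> - g (b i) \<omega>)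
              + blinfun_inner_right (g (b i) \<omega> - gs i j \<omega>)"
            by (simp add: blinfun_inner_right_diff[symmetric])
          also have "norm \<dots> \<le> ?x + norm (g s \<omega> - g (b i) \<omega>) + norm (g (b i) \<omega> - gs i j \<omega>)"
            by (rule order_trans[OF norm_triangle_ineq]) (simp add: norm_triangle_ineq order_trans[OF norm_triangle_ineq])
          also have "\<dots> \<le> ?x + c + c"
            using gc[OF i, of s] s elim(2) i by (intro add_mono) (auto simp: dist_norm norm_minus_commute less_imp_le)
          finally have n1: "norm (?e s - blinfun_inner_right (gs i j \<omega>)) \<le> ?x + c + c" .
          have "(norm (ys i j \<omega> *\<^sub>R (?e s - blinfun_inner_right (gs i j \<omega>))))\<^sup>2
            \<le> (2 * K * (?x + c + c))\<^sup>2"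
            using yb[OF i, of j] n1 K by (intro power_mono) (auto intro!: mult_mono)
          also have "\<dots> = 4 * K\<^sup>2 * (?x + c + c)\<^sup>2" by (simp add: power_mult_distrib)
          also have "\<dots> \<le> 4 * K\<^sup>2 * (3 * (?x\<^sup>2 + 2 * c\<^sup>2))"
          proof (rule mult_left_mono)
            have "0 \<le> 2 * (?x - c)\<^sup>2" by simp
            then show "(?x + c + c)\<^sup>2 \<le> 3 * (?x\<^sup>2 + 2 * c\<^sup>2)"
              by (simp add: power2_eq_square algebra_simps)
          qed simp
          also have "\<dots> = 12 * K\<^sup>2 * (?x\<^sup>2 + 2 * c\<^sup>2)" by simp
          finally show ?thesis unfolding h_def
            by (subst ennreal_plus[symmetric], simp, simp, subst ennreal_mult[symmetric]) (auto intro: ennreal_leI)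
        qed
        moreover have "(\<integral>\<^sup>+s\<in>{0..T}. h s \<partial>lborel) \<le> ennreal r"
        proof -
          have m1: "(\<lambda>s. ennreal ((norm (?e s - ?\<Phi> s \<omega>))\<^sup>2) * indicator {0..T} s) \<in> borel_measurable lborel"
            using measurable_simple_minus_continuous[OF simple_function_elem_process
                continuous_uptoD[OF \<open>continuous_upto (\<tau> \<omega>) (\<lambda>s. ?\<Phi> s \<omega>)\<close> A]] by simp
          have "(\<integral>\<^sup>+s\<in>{0..T}. h s \<partial>lborel)
            = (\<integral>\<^sup>+s. ennreal (12 * K\<^sup>2) * (ennreal ((norm (?e s - ?\<Phi> s \<omega>))\<^sup>2) * indicator {0..T} s + ennreal (2 * c\<^sup>2) * indicator {0..T} s) \<partial>lborel)"
            by (intro nn_integral_cong) (auto simp: h_def indicator_def)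
          also have "\<dots> = ennreal (12 * K\<^sup>2) * (V (k j) \<omega> + ennreal (2 * c\<^sup>2) * emeasure lborel {0..T})"
            using m1 by (subst nn_integral_cmult, simp, subst nn_integral_add) (auto simp: V_def nn_integral_cmult_indicator)
          also have "\<dots> \<le> ennreal (12 * K\<^sup>2) * (ennreal (c\<^sup>2 * T) + ennreal (2 * c\<^sup>2) * ennreal T)"
            using V T by (intro mult_left_mono add_mono) auto
          also have "\<dots> = ennreal (12 * K\<^sup>2 * (c\<^sup>2 * T + 2 * c\<^sup>2 * T))"
          proof -
            have "ennreal (2 * c\<^sup>2) * ennreal T = ennreal (2 * c\<^sup>2 * T)"
              using T by (intro ennreal_mult[symmetric]) auto
            moreover have "ennreal (c\<^sup>2 * T) + ennreal (2 * c\<^sup>2 * T) = ennreal (c\<^sup>2 * T + 2 * c\<^sup>2 * T)"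
              using T by (intro ennreal_plus[symmetric]) auto
            moreover have "ennreal (12 * K\<^sup>2) * ennreal (c\<^sup>2 * T + 2 * c\<^sup>2 * T) = ennreal (12 * K\<^sup>2 * (c\<^sup>2 * T + 2 * c\<^sup>2 * T))"
              using T by (intro ennreal_mult[symmetric]) auto
            ultimately show ?thesis by (simp only:)
          qed
          also have "12 * K\<^sup>2 * (c\<^sup>2 * T + 2 * c\<^sup>2 * T) = r" by (simp add: r_def)
          finally show ?thesis .
        qed
        ultimately show ?case using R3[of j, rule_format, of \<omega> h] by blast
      qed
      with Zlim show "(\<forall>\<^sub>F j in sequentially. \<forall>i<2 ^ l. R j i \<omega> = Z i j \<omega>) \<and>
        (\<forall>i<2 ^ l. (\<lambda>j. Z i j \<omega>) \<longlonglongrightarrow> Y (b i) \<omega> * D i \<omega>)" by blast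
    qed
  qed
  show "small M {\<omega> \<in> Good. \<bar>\<Sum>i<2 ^ l. Y (grid T l i) \<omega> * D i \<omega>\<bar> > \<delta>} ((1 + C4) * r / \<delta>\<^sup>2)"
  proof (rule small_liminf[where B="\<lambda>j. {\<omega> \<in> space M. (\<Sum>i<2 ^ l. R j i \<omega>)\<^sup>2 \<ge> \<delta>\<^sup>2}"])
    fix j
    have m: "{\<omega> \<in> space M. (\<Sum>i<2 ^ l. R j i \<omega>)\<^sup>2 \<ge> \<delta>\<^sup>2} \<in> sets M"
      using borel_measurable_integrable[OF R1(1)[of j]] by measurable
    have "measure M {\<omega> \<in> space M. (\<Sum>i<2 ^ l. R j i \<omega>)\<^sup>2 \<ge> \<delta>\<^sup>2} \<le> (\<integral>\<omega>. (\<Sum>i<2 ^ l. R j i \<omega>)\<^sup>2 \<partial>M) / \<delta>\<^sup>2"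
      by (rule integral_Markov_inequality_measure[OF R1(1), of "space M"]) (use d in auto)
    also have "\<dots> \<le> (1 + C4) * r / \<delta>\<^sup>2" using R1(2) d by (intro divide_right_mono) auto
    finally show "small M {\<omega> \<in> space M. (\<Sum>i<2 ^ l. R j i \<omega>)\<^sup>2 \<ge> \<delta>\<^sup>2} ((1 + C4) * r / \<delta>\<^sup>2)"
      by (rule small_measurable[OF m])
  next
    show "AE \<omega> in M. \<omega> \<in> {\<omega> \<in> Good. \<bar>\<Sum>i<2 ^ l. Y (grid T l i) \<omega> * D i \<omega>\<bar> > \<delta>} \<longrightarrow>
      (\<forall>\<^sub>F j in sequentially. \<omega> \<in> {\<omega> \<in> space M. (\<Sum>i<2 ^ l. R j i \<omega>)\<^sup>2 \<ge> \<delta>\<^sup>2})"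
      using conv AE_space
    proof eventually_elim
      case (elim \<omega>)
      show ?case
      proof
        assume a: "\<omega> \<in> {\<omega> \<in> Good. \<bar>\<Sum>i<2 ^ l. Y (grid T l i) \<omega> * D i \<omega>\<bar> > \<delta>}"
        with elim(1) have ev: "\<forall>\<^sub>F j in sequentially. \<forall>i<2 ^ l. R j i \<omega> = Z i j \<omega>"
          and Zl: "\<And>i. i < 2 ^ l \<Longrightarrow> (\<lambda>j. Z i j \<omega>) \<longlonglongrightarrow> Y (b i) \<omega> * D i \<omega>" by auto
        have "(\<lambda>j. \<bar>\<Sum>i<2 ^ l. Z i j \<omega>\<bar>) \<longlonglongrightarrow> \<bar>\<Sum>i<2 ^ l. Y (b i) \<omega> * D i \<omega>\<bar>"
          by (intro tendsto_rabs tendsto_sum Zl) simp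
        then have "\<forall>\<^sub>F j in sequentially. \<bar>\<Sum>i<2 ^ l. Z i j \<omega>\<bar> > \<delta>"
          using a by (intro order_tendstoD) (auto simp: b_def)
        with ev show "\<forall>\<^sub>F j in sequentially. \<omega> \<in> {\<omega> \<in> space M. (\<Sum>i<2 ^ l. R j i \<omega>)\<^sup>2 \<ge> \<delta>\<^sup>2}"
        proof eventually_elim
          case (elim j)
          then have "\<delta> \<le> \<bar>\<Sum>i<2 ^ l. R j i \<omega>\<bar>" by simp
          then have "\<delta>\<^sup>2 \<le> \<bar>\<Sum>i<2 ^ l. R j i \<omega>\<bar>\<^sup>2" using d by (intro power_mono) auto
          then show ?case using \<open>\<omega> \<in> space M\<close> by simp
        qed
      qed
    qed
  qed
  show "small M {\<omega> \<in> Good. (\<Sum>i<2 ^ l. (Y (grid T l i) \<omega> * D i \<omega>)\<^sup>2) > \<delta>} ((1 + C4) * r / \<delta>)"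
  proof (rule small_liminf[where B="\<lambda>j. {\<omega> \<in> space M. (\<Sum>i<2 ^ l. (R j i \<omega>)\<^sup>2) \<ge> \<delta>}"])
    fix j
    have m: "{\<omega> \<in> space M. (\<Sum>i<2 ^ l. (R j i \<omega>)\<^sup>2) \<ge> \<delta>} \<in> sets M"
      using borel_measurable_integrable[OF R2(1)[of j]] by measurable
    have "measure M {\<omega> \<in> space M. (\<Sum>i<2 ^ l. (R j i \<omega>)\<^sup>2) \<ge> \<delta>} \<le> (\<integral>\<omega>. (\<Sum>i<2 ^ l. (R j i \<omega>)\<^sup>2) \<partial>M) / \<delta>"
      by (rule integral_Markov_inequality_measure[OF R2(1), of "space M"]) (use d in \<open>auto simp: sum_nonneg\<close>)
    also have "\<dots> \<le> (1 + C4) * r / \<delta>" using R2(2) d by (intro divide_right_mono) auto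
    finally show "small M {\<omega> \<in> space M. (\<Sum>i<2 ^ l. (R j i \<omega>)\<^sup>2) \<ge> \<delta>} ((1 + C4) * r / \<delta>)"
      by (rule small_measurable[OF m])
  next
    show "AE \<omega> in M. \<omega> \<in> {\<omega> \<in> Good. (\<Sum>i<2 ^ l. (Y (grid T l i) \<omega> * D i \<omega>)\<^sup>2) > \<delta>} \<longrightarrow>
      (\<forall>\<^sub>F j in sequentially. \<omega> \<in> {\<omega> \<in> space M. (\<Sum>i<2 ^ l. (R j i \<omega>)\<^sup>2) \<ge> \<delta>})"
      using conv AE_space
    proof eventually_elim
      case (elim \<omega>)
      show ?case
      proof
        assume a: "\<omega> \<in> {\<omega> \<in> Good. (\<Sum>i<2 ^ l. (Y (grid T l i) \<omega> * D i \<omega>)\<^sup>2) > \<delta>}"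
        with elim(1) have ev: "\<forall>\<^sub>F j in sequentially. \<forall>i<2 ^ l. R j i \<omega> = Z i j \<omega>"
          and Zl: "\<And>i. i < 2 ^ l \<Longrightarrow> (\<lambda>j. Z i j \<omega>) \<longlonglongrightarrow> Y (b i) \<omega> * D i \<omega>" by auto
        have "(\<lambda>j. \<Sum>i<2 ^ l. (Z i j \<omega>)\<^sup>2) \<longlonglongrightarrow> (\<Sum>i<2 ^ l. (Y (b i) \<omega> * D i \<omega>)\<^sup>2)"
          by (intro tendsto_power tendsto_sum Zl) simp
        then have "\<forall>\<^sub>F j in sequentially. (\<Sum>i<2 ^ l. (Z i j \<omega>)\<^sup>2) > \<delta>"
          using a by (intro order_tendstoD) (auto simp: b_def)
        with ev show "\<forall>\<^sub>F j in sequentially. \<omega> \<in> {\<omega> \<in> space M. (\<Sum>i<2 ^ l. (R j i \<omega>)\<^sup>2) \<ge> \<delta>}"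
        proof eventually_elim
          case (elim j)
          then show ?case using \<open>\<omega> \<in> space M\<close> by simp
        qed
      qed
    qed
  qed
qed

end

text \<open>Stated for arbitrary functions, because it is applied to the squared distance between an
  operator-valued integrand and its approximation. A simple function below c f becomes, after
  division by c, one below f.\<close>

lemma nn_integral_cmult_le:
  assumes c: "0 < (c::real)"
  shows "(\<integral>\<^sup>+x. ennreal c * f x \<partial>M) \<le> ennreal c * (\<integral>\<^sup>+x. f x \<partial>M)"
  unfolding nn_integral_def[of M "\<lambda>x. ennreal c * f x"]
proof (rule SUP_least)
  fix g assume "g \<in> {g. simple_function M g \<and> g \<le> (\<lambda>x. ennreal c * f x)}"
  then have g: "simple_function M g" "\<And>x. g x \<le> ennreal c * f x" by (auto simp: le_fun_def)
  have cc: "ennreal c * ennreal (1 / c) = 1" using c by (subst ennreal_mult[symmetric]) auto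
  have "simple_integral M g = (\<integral>\<^sup>+x. g x \<partial>M)" by (rule nn_integral_eq_simple_integral[OF g(1), symmetric])
  also have "\<dots> = (\<integral>\<^sup>+x. ennreal c * (ennreal (1 / c) * g x) \<partial>M)" by (simp add: mult.assoc[symmetric] cc)
  also have "\<dots> = ennreal c * (\<integral>\<^sup>+x. ennreal (1 / c) * g x \<partial>M)"
    by (intro nn_integral_cmult borel_measurable_times_ennreal borel_measurable_simple_function[OF g(1)]) simp
  also have "\<dots> \<le> ennreal c * (\<integral>\<^sup>+x. f x \<partial>M)"
  proof (intro mult_left_mono nn_integral_mono)
    fix x
    have "ennreal (1 / c) * g x \<le> ennreal (1 / c) * (ennreal c * f x)" by (intro mult_left_mono g) simp
    also have "\<dots> = f x" using cc by (simp add: mult.assoc[symmetric] mult.commute[of "ennreal (1 / c)"])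
    finally show "ennreal (1 / c) * g x \<le> f x" .
  qed simp
  finally show "simple_integral M g \<le> ennreal c * (\<integral>\<^sup>+x. f x \<partial>M)" .
qed

context wiener
begin

text \<open>The order of the choices matters: a bound K for the weights, then an oscillation c of
  the integrand depending on K, and finally a mesh on which the integrand oscillates by at most c
  outside a small event.\<close>

lemma ito_riemann_small:
  fixes g :: "real \<Rightarrow> 's \<Rightarrow> 'h" and Y X :: "real \<Rightarrow> 's \<Rightarrow> real"
  assumes T: "0 < T" and tau: "stopping M F \<tau>"
    and ito: "has_ito_integral M F W \<tau> (\<lambda>s \<omega>. blinfun_inner_right (g s \<omega>)) X"
    and g: "adapted_upto F \<tau> g" and Y: "adapted_upto F \<tau> Y"
    and Yc: "AE \<omega> in M. continuous_upto (\<tau> \<omega>) (\<lambda>t. Y t \<omega>)" and d: "0 < \<delta>" and e: "0 < e"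
  defines "D \<equiv> \<lambda>l i \<omega>. X (grid T l (Suc i)) \<omega> - X (grid T l i) \<omega> - g (grid T l i) \<omega> \<bullet> dW (grid T l i) (grid T l (Suc i)) \<omega>"
  shows "\<forall>\<^sub>F l in sequentially. small M {\<omega>. ereal T < \<tau> \<omega> \<and>
    (\<bar>\<Sum>i<2 ^ l. Y (grid T l i) \<omega> * D l i \<omega>\<bar> > \<delta> \<or> (\<Sum>i<2 ^ l. (Y (grid T l i) \<omega> * D l i \<omega>)\<^sup>2) > \<delta>)} e"
proof -
  have gc: "AE \<omega> in M. continuous_upto (\<tau> \<omega>) (\<lambda>t. g t \<omega>)"
    using ito unfolding has_ito_integral_def continuous_upto_def continuous_on_blinfun_inner_right by blast
  obtain K where K: "1 \<le> K" and sK: "small M {\<omega>. ereal T < \<tau> \<omega> \<and> (\<exists>s\<in>{0..T}. norm (Y s \<omega>) > K)} (e / 4)"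
    using bounded_path_small[OF tau Y Yc T, of "e / 4"] e by auto
  define B where "B = (1 + C4) * 36 * K\<^sup>2 * T"
  have B: "0 < B" using C4_pos K T by (simp add: B_def)
  \<comment> \<open>With c^2 = q both bounds of the main estimate are at most e / 4. The other half
    of e pays for large weights and for large oscillation.\<close>
  define q where "q = min (e * \<delta>\<^sup>2 / (4 * B)) (e * \<delta> / (4 * B))"
  have q: "0 < q" using e d B by (simp add: q_def)
  define c where "c = sqrt q"
  have c: "0 < c" and c2: "c\<^sup>2 = q" using q by (simp_all add: c_def)
  have est1: "(1 + C4) * (36 * K\<^sup>2 * c\<^sup>2 * T) / \<delta>\<^sup>2 \<le> e / 4"
  proof -
    have "(1 + C4) * (36 * K\<^sup>2 * c\<^sup>2 * T) / \<delta>\<^sup>2 = B * q / \<delta>\<^sup>2" by (simp add: B_def c2 mult_ac)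
    also have "\<dots> \<le> B * (e * \<delta>\<^sup>2 / (4 * B)) / \<delta>\<^sup>2"
      using B by (intro divide_right_mono mult_left_mono) (auto simp: q_def)
    also have "\<dots> = e / 4" using B d by simp
    finally show ?thesis .
  qed
  have est2: "(1 + C4) * (36 * K\<^sup>2 * c\<^sup>2 * T) / \<delta> \<le> e / 4"
  proof -
    have "(1 + C4) * (36 * K\<^sup>2 * c\<^sup>2 * T) / \<delta> = B * q / \<delta>" by (simp add: B_def c2 mult_ac)
    also have "\<dots> \<le> B * (e * \<delta> / (4 * B)) / \<delta>"
      using B d by (intro divide_right_mono mult_left_mono) (auto simp: q_def)
    also have "\<dots> = e / 4" using B d by simp
    finally show ?thesis .
  qed
  have "\<forall>\<^sub>F l in sequentially. small M {\<omega>. ereal T < \<tau> \<omega> \<and>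
    (\<exists>s\<in>{0..T}. \<exists>t\<in>{0..T}. \<bar>s - t\<bar> \<le> T / 2 ^ l \<and> norm (g s \<omega> - g t \<omega>) > c)} (e / 4)"
    by (rule path_oscillation_small[OF tau g gc T _ c]) (use e in simp)
  then show ?thesis
  proof eventually_elim
    case (elim l)
    have K0: "0 < K" using K by simp
    note main = ito_main_estimate[OF T ito g Y K0 c d, of l]
    note s12 = small_mono_set[OF main(1) Int_lower1 est1] small_mono_set[OF main(2) Int_lower1 est2]
    let ?A = "{\<omega>. ereal T < \<tau> \<omega> \<and> (\<exists>s\<in>{0..T}. norm (Y s \<omega>) > K)}"
    let ?B = "{\<omega>. ereal T < \<tau> \<omega> \<and> (\<exists>s\<in>{0..T}. \<exists>t\<in>{0..T}. \<bar>s - t\<bar> \<le> T / 2 ^ l \<and> norm (g s \<omega> - g t \<omega>) > c)}"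
    let ?G = "{\<omega>. ereal T < \<tau> \<omega> \<and> (\<forall>i<2 ^ l. \<bar>Y (grid T l i) \<omega>\<bar> \<le> K) \<and>
        (\<forall>i<2 ^ l. \<forall>s\<in>{grid T l i..grid T l (Suc i)}. norm (g s \<omega> - g (grid T l i) \<omega>) \<le> c)}"
    let ?C = "{\<omega> \<in> ?G. \<bar>\<Sum>i<2 ^ l. Y (grid T l i) \<omega> * D l i \<omega>\<bar> > \<delta>}"
    let ?E = "{\<omega> \<in> ?G. (\<Sum>i<2 ^ l. (Y (grid T l i) \<omega> * D l i \<omega>)\<^sup>2) > \<delta>}"
    let ?L = "{\<omega>. ereal T < \<tau> \<omega> \<and> (\<bar>\<Sum>i<2 ^ l. Y (grid T l i) \<omega> * D l i \<omega>\<bar> > \<delta> \<or> (\<Sum>i<2 ^ l. (Y (grid T l i) \<omega> * D l i \<omega>)\<^sup>2) > \<delta>)}"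
    have un: "small M ((?A \<union> ?B) \<union> (?C \<union> ?E)) ((e / 4 + e / 4) + (e / 4 + e / 4))"
      unfolding D_def by (intro small_Un sK elim s12)
    show ?case
    proof (rule small_mono_set[OF un])
      show "(e / 4 + e / 4) + (e / 4 + e / 4) \<le> e" by simp
      show "?L \<inter> space M \<subseteq> (?A \<union> ?B) \<union> (?C \<union> ?E)"
      proof
        fix \<omega> assume L: "\<omega> \<in> ?L \<inter> space M"
        show "\<omega> \<in> (?A \<union> ?B) \<union> (?C \<union> ?E)"
        proof (cases "\<omega> \<in> ?A \<union> ?B")
          case False
          have A: "ereal T < \<tau> \<omega>" using L by blast
          from False A have osc: "norm (g s \<omega> - g t \<omega>) \<le> c" if "s \<in> {0..T}" "t \<in> {0..T}" "\<bar>s - t\<bar> \<le> T / 2 ^ l" for s t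
            using that unfolding not_less[symmetric] by blast
          have "\<bar>Y (grid T l i) \<omega>\<bar> \<le> K" if "i < 2 ^ l" for i
          proof -
            have "grid T l i \<in> {0..T}" using that T by (intro grid_mem) auto
            then show ?thesis using False A by (auto simp: not_less)
          qed
          moreover have "norm (g s \<omega> - g (grid T l i) \<omega>) \<le> c" if i: "i < 2 ^ l" and s: "s \<in> {grid T l i..grid T l (Suc i)}" for i s
          proof -
            have "grid T l i \<in> {0..T}" "grid T l (Suc i) \<in> {0..T}" using i T by (intro grid_mem; simp)+
            moreover from this have "s \<in> {0..T}" using s by auto
            moreover have "\<bar>s - grid T l i\<bar> \<le> T / 2 ^ l" using s by (auto simp: grid_Suc)
            ultimately show ?thesis by (intro osc)
          qed
          ultimately show ?thesis using L A by blast
        qed blast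
      qed
    qed
  qed
qed

text \<open>A bounded operator maps elementary processes to elementary processes and commutes with
  their integrals. With the operator \<open>h \<bullet> _\<close> this turns a vector-valued
  integral into a real one.\<close>

lemma has_ito_integral_compose:
  fixes \<Phi> :: "real \<Rightarrow> 's \<Rightarrow> 'h \<Rightarrow>\<^sub>L 'k::real_normed_vector" and B :: "'k \<Rightarrow>\<^sub>L 'l::real_normed_vector"
  assumes "has_ito_integral M F W \<tau> \<Phi> X"
  shows "has_ito_integral M F W \<tau> (\<lambda>s \<omega>. B o\<^sub>L \<Phi> s \<omega>) (\<lambda>t \<omega>. blinfun_apply B (X t \<omega>))"
proof -
  from assms obtain n t \<phi> where cont: "AE \<omega> in M. continuous_upto (\<tau> \<omega>) (\<lambda>s. \<Phi> s \<omega>)"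
    and el: "\<And>m. elementary F (n m) (t m) (\<phi> m)"
    and v1: "\<And>S \<rho>. 0 \<le> S \<Longrightarrow> 0 < \<rho> \<Longrightarrow> vanishing M (\<lambda>m. {\<omega>. ereal S < \<tau> \<omega> \<and>
             (\<integral>\<^sup>+s\<in>{0..S}. ennreal ((norm (elem_process (n m) (t m) (\<phi> m) s \<omega> - \<Phi> s \<omega>))\<^sup>2) \<partial>lborel)
               > ennreal \<rho>})"
    and v2: "\<And>S \<rho>. 0 \<le> S \<Longrightarrow> 0 < \<rho> \<Longrightarrow> vanishing M (\<lambda>m. {\<omega>. ereal S < \<tau> \<omega> \<and>
             norm (elem_integral W (n m) (t m) (\<phi> m) S \<omega> - X S \<omega>) > \<rho>})"
    unfolding has_ito_integral_def by blast
  \<comment> \<open>The 1 keeps the divisor positive when the operator is zero.\<close>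
  define b where "b = norm B + 1"
  have b: "0 < b" "norm B \<le> b" by (auto simp: b_def add_nonneg_pos)
  let ?\<psi> = "\<lambda>m i \<omega>. B o\<^sub>L \<phi> m i \<omega>"
  let ?P = "\<lambda>m s \<omega>. elem_process (n m) (t m) (\<phi> m) s \<omega>" and ?P' = "\<lambda>m s \<omega>. elem_process (n m) (t m) (?\<psi> m) s \<omega>"
  let ?X = "\<lambda>m S \<omega>. elem_integral W (n m) (t m) (\<phi> m) S \<omega>" and ?X' = "\<lambda>m S \<omega>. elem_integral W (n m) (t m) (?\<psi> m) S \<omega>"
  have proc: "?P' m s \<omega> = (B o\<^sub>L ?P m s \<omega>)" for m s \<omega>
    unfolding elem_process_def
    by (rule blinfun_eqI) (simp add: blinfun.sum_left blinfun.sum_right if_distrib[of "\<lambda>f. blinfun_apply f _"]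
        if_distrib[of "blinfun_apply B"] cong: if_cong)
  have int: "?X' m S \<omega> = blinfun_apply B (?X m S \<omega>)" for m S \<omega>
    unfolding elem_integral_def by (simp add: blinfun.sum_right)
  have diff: "(B o\<^sub>L f) - (B o\<^sub>L h) = B o\<^sub>L (f - h)" for f h :: "'h \<Rightarrow>\<^sub>L 'k"
    by (rule blinfun_eqI) (simp add: blinfun.diff_left blinfun.diff_right)
  have vmono: "vanishing M A \<Longrightarrow> (\<And>m. A' m \<subseteq> A m) \<Longrightarrow> vanishing M A'" for A A' :: "nat \<Rightarrow> 's set"
    unfolding vanishing_def by blast
  show ?thesis
    unfolding has_ito_integral_def
  proof (intro conjI exI[of _ n] exI[of _ t] exI[of _ ?\<psi>] allI impI)
    show "AE \<omega> in M. continuous_upto (\<tau> \<omega>) (\<lambda>s. B o\<^sub>L \<Phi> s \<omega>)"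
      using cont unfolding continuous_upto_def
      by eventually_elim (intro continuous_intros)
    fix m
    show "elementary F (n m) (t m) (?\<psi> m)"
      using el[of m] unfolding elementary_def by (auto intro: simple_function_compose1[where g="\<lambda>f. B o\<^sub>L f"])
  next
    fix S \<rho> :: real assume S: "0 \<le> S" and r: "0 < \<rho>"
    show "vanishing M (\<lambda>m. {\<omega>. ereal S < \<tau> \<omega> \<and>
        norm (?X' m S \<omega> - blinfun_apply B (X S \<omega>)) > \<rho>})"
    proof (rule vmono[OF v2[OF S, of "\<rho> / b"]])
      show "0 < \<rho> / b" using r b by simp
      fix m
      show "{\<omega>. ereal S < \<tau> \<omega> \<and> norm (?X' m S \<omega> - blinfun_apply B (X S \<omega>)) > \<rho>}
        \<subseteq> {\<omega>. ereal S < \<tau> \<omega> \<and> norm (?X m S \<omega> - X S \<omega>) > \<rho> / b}"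
      proof safe
        fix \<omega> assume a: "norm (?X' m S \<omega> - blinfun_apply B (X S \<omega>)) > \<rho>"
        have "norm (?X' m S \<omega> - blinfun_apply B (X S \<omega>))
          = norm (blinfun_apply B (?X m S \<omega> - X S \<omega>))"
          unfolding int by (simp add: blinfun.diff_right)
        also have "\<dots> \<le> norm B * norm (?X m S \<omega> - X S \<omega>)" by (rule norm_blinfun)
        also have "\<dots> \<le> b * norm (?X m S \<omega> - X S \<omega>)"
          by (rule mult_right_mono[OF b(2)]) simp
        finally show "norm (?X m S \<omega> - X S \<omega>) > \<rho> / b"
          using a b by (simp add: pos_divide_less_eq mult.commute)
      qed
    qed
    show "vanishing M (\<lambda>m. {\<omega>. ereal S < \<tau> \<omega> \<and>
        (\<integral>\<^sup>+s\<in>{0..S}. ennreal ((norm (?P' m s \<omega> - (B o\<^sub>L \<Phi> s \<omega>)))\<^sup>2) \<partial>lborel) > ennreal \<rho>})"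
    proof (rule vmono[OF v1[OF S, of "\<rho> / b\<^sup>2"]])
      show "0 < \<rho> / b\<^sup>2" using r b by simp
      fix m
      show "{\<omega>. ereal S < \<tau> \<omega> \<and> (\<integral>\<^sup>+s\<in>{0..S}. ennreal ((norm (?P' m s \<omega> - (B o\<^sub>L \<Phi> s \<omega>)))\<^sup>2) \<partial>lborel) > ennreal \<rho>}
        \<subseteq> {\<omega>. ereal S < \<tau> \<omega> \<and> (\<integral>\<^sup>+s\<in>{0..S}. ennreal ((norm (?P m s \<omega> - \<Phi> s \<omega>))\<^sup>2) \<partial>lborel) > ennreal (\<rho> / b\<^sup>2)}"
      proof safe
        fix \<omega> assume a: "(\<integral>\<^sup>+s\<in>{0..S}. ennreal ((norm (?P' m s \<omega> - (B o\<^sub>L \<Phi> s \<omega>)))\<^sup>2) \<partial>lborel) > ennreal \<rho>"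
        let ?J = "\<integral>\<^sup>+s\<in>{0..S}. ennreal ((norm (?P m s \<omega> - \<Phi> s \<omega>))\<^sup>2) \<partial>lborel"
        have pt: "ennreal ((norm (?P' m s \<omega> - (B o\<^sub>L \<Phi> s \<omega>)))\<^sup>2)
          \<le> ennreal (b\<^sup>2) * ennreal ((norm (?P m s \<omega> - \<Phi> s \<omega>))\<^sup>2)" for s
        proof -
          let ?x = "?P m s \<omega> - \<Phi> s \<omega>"
          have "norm (B o\<^sub>L ?x) \<le> b * norm ?x"
            using norm_blinfun_compose[of B ?x] mult_right_mono[OF b(2), of "norm ?x"] by simp
          then have "(norm (B o\<^sub>L ?x))\<^sup>2 \<le> b\<^sup>2 * (norm ?x)\<^sup>2"
            using power_mono[of "norm (B o\<^sub>L ?x)" "b * norm ?x" 2] by (simp add: power_mult_distrib)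
          then show ?thesis unfolding proc diff by (subst ennreal_mult[symmetric]) (auto intro: ennreal_leI)
        qed
        show "?J > ennreal (\<rho> / b\<^sup>2)"
        proof (rule ccontr)
          assume "\<not> ?J > ennreal (\<rho> / b\<^sup>2)"
          then have J: "?J \<le> ennreal (\<rho> / b\<^sup>2)" by simp
          have "(\<integral>\<^sup>+s\<in>{0..S}. ennreal ((norm (?P' m s \<omega> - (B o\<^sub>L \<Phi> s \<omega>)))\<^sup>2) \<partial>lborel)
            \<le> (\<integral>\<^sup>+s. ennreal (b\<^sup>2) * (ennreal ((norm (?P m s \<omega> - \<Phi> s \<omega>))\<^sup>2) * indicator {0..S} s) \<partial>lborel)"
            by (intro nn_integral_mono) (auto simp: indicator_def pt)
          also have "\<dots> \<le> ennreal (b\<^sup>2) * ?J"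
            using b by (intro nn_integral_cmult_le) simp
          also have "\<dots> \<le> ennreal (b\<^sup>2) * ennreal (\<rho> / b\<^sup>2)" by (intro mult_left_mono J) simp
          also have "\<dots> = ennreal \<rho>" using b r by (subst ennreal_mult[symmetric]) auto
          finally show False using a by simp
        qed
      qed
    qed
  qed
qed

lemma small_AE_tendsto:
  fixes f :: "nat \<Rightarrow> 's \<Rightarrow> real"
  assumes "\<And>d e. 0 < d \<Longrightarrow> 0 < e \<Longrightarrow> \<forall>\<^sub>F l in sequentially. small M {\<omega>. A \<omega> \<and> \<bar>f l \<omega>\<bar> > d} e"
  shows "\<exists>k. strict_mono (k :: nat \<Rightarrow> nat) \<and> (AE \<omega> in M. A \<omega> \<longrightarrow> (\<lambda>j. f (k j) \<omega>) \<longlonglongrightarrow> 0)"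
proof -
  define bad where "bad l d = {\<omega>. A \<omega> \<and> \<bar>f l \<omega>\<bar> > d}" for l d
  have "bad l d' \<subseteq> bad l d" if "d \<le> d'" for l d d' using that by (auto simp: bad_def)
  with small_AE_subseq[of bad] assms
  obtain k where k: "strict_mono (k :: nat \<Rightarrow> nat)" "AE \<omega> in M. \<forall>r>0. \<forall>\<^sub>F j in sequentially. \<omega> \<notin> bad (k j) r"
    unfolding bad_def by blast
  from k(2) have "AE \<omega> in M. A \<omega> \<longrightarrow> (\<lambda>j. f (k j) \<omega>) \<longlonglongrightarrow> 0"
  proof eventually_elim
    case (elim \<omega>)
    show ?case
    proof (intro impI tendstoI)
      fix e :: real assume A: "A \<omega>" and e: "e > 0"
      then have "0 < e / 2" by simp
      with elim have "\<forall>\<^sub>F j in sequentially. \<omega> \<notin> bad (k j) (e / 2)" by blast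
      then show "\<forall>\<^sub>F j in sequentially. dist (f (k j) \<omega>) 0 < e"
        by eventually_elim (use A e in \<open>auto simp: dist_real_def bad_def\<close>)
    qed
  qed
  with k(1) show ?thesis by blast
qed

end

section \<open>Pathwise Ito calculus\<close>

text \<open>Twice continuously differentiable with derivatives \<open>G1\<close> and \<open>G2\<close>.  The Taylor estimate is locally
  uniform in the base point, as needed along the points of a path.\<close>

definition c2map :: "(real^2) set \<Rightarrow> (real^2 \<Rightarrow> 'b::real_normed_vector) \<Rightarrow> (2 \<Rightarrow> real^2 \<Rightarrow> 'b) \<Rightarrow>
    (2 \<Rightarrow> 2 \<Rightarrow> real^2 \<Rightarrow> 'b) \<Rightarrow> bool" where
  "c2map D G G1 G2 \<longleftrightarrow> continuous_on D G \<and> (\<forall>j. continuous_on D (G1 j)) \<and> (\<forall>j k. continuous_on D (G2 j k)) \<and>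
    (\<forall>\<xi>\<in>D. \<forall>e>0. \<exists>\<delta>>0. \<forall>y\<in>ball \<xi> \<delta>. \<forall>z\<in>ball \<xi> \<delta>.
      norm (G z - G y - (\<Sum>j\<in>UNIV. (z $ j - y $ j) *\<^sub>R G1 j y)
        - (1/2) *\<^sub>R (\<Sum>j\<in>UNIV. \<Sum>k\<in>UNIV. ((z $ j - y $ j) * (z $ k - y $ k)) *\<^sub>R G2 j k y))
      \<le> e * (norm (z - y))\<^sup>2)"

text \<open>The image of the path is compact, so the balls of the local Taylor estimates have a
  Lebesgue number. On a grid finer than this number in oscillation, both ends of a cell lie in one
  ball.\<close>

lemma c2map_along_path:
  assumes c2: "c2map D G G1 G2" and T: "0 \<le> T" and x: "continuous_on {0..T} x" "\<forall>t\<in>{0..T}. x t \<in> D" and e: "0 < e"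
  shows "\<forall>\<^sub>F n in sequentially. \<forall>i<2 ^ n.
    norm (G (x (grid T n (Suc i))) - G (x (grid T n i))
        - (\<Sum>j\<in>UNIV. (x (grid T n (Suc i)) $ j - x (grid T n i) $ j) *\<^sub>R G1 j (x (grid T n i)))
        - (1/2) *\<^sub>R (\<Sum>j\<in>UNIV. \<Sum>k\<in>UNIV. ((x (grid T n (Suc i)) $ j - x (grid T n i) $ j) *
            (x (grid T n (Suc i)) $ k - x (grid T n i) $ k)) *\<^sub>R G2 j k (x (grid T n i))))
      \<le> e * (norm (x (grid T n (Suc i)) - x (grid T n i)))\<^sup>2"
proof -
  define P where "P y z \<longleftrightarrow> norm (G z - G y - (\<Sum>j\<in>UNIV. (z $ j - y $ j) *\<^sub>R G1 j y)
        - (1/2) *\<^sub>R (\<Sum>j\<in>UNIV. \<Sum>k\<in>UNIV. ((z $ j - y $ j) * (z $ k - y $ k)) *\<^sub>R G2 j k y))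
      \<le> e * (norm (z - y))\<^sup>2" for y z
  have "\<forall>\<xi>\<in>D. \<exists>\<delta>>0. \<forall>y\<in>ball \<xi> \<delta>. \<forall>z\<in>ball \<xi> \<delta>. P y z"
    using c2 e unfolding c2map_def P_def by blast
  then obtain \<delta> where d: "\<And>\<xi>. \<xi> \<in> D \<Longrightarrow> \<delta> \<xi> > 0" "\<And>\<xi> y z. \<xi> \<in> D \<Longrightarrow> y \<in> ball \<xi> (\<delta> \<xi>) \<Longrightarrow> z \<in> ball \<xi> (\<delta> \<xi>) \<Longrightarrow> P y z"
    by metis
  have cx: "compact (x ` {0..T})" by (intro compact_continuous_image x) auto
  obtain r where r: "0 < r" "\<And>y. y \<in> x ` {0..T} \<Longrightarrow> \<exists>B\<in>(\<lambda>\<xi>. ball \<xi> (\<delta> \<xi>)) ` D. ball y r \<subseteq> B"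
  proof (rule Heine_Borel_lemma[OF cx])
    show "x ` {0..T} \<subseteq> \<Union>((\<lambda>\<xi>. ball \<xi> (\<delta> \<xi>)) ` D)" using x(2) d(1) by fastforce
  qed (use that in auto)
  from continuous_grid_osc[OF T x(1) r(1)] have "\<forall>\<^sub>F n in sequentially. \<forall>i<2 ^ n. P (x (grid T n i)) (x (grid T n (Suc i)))"
  proof eventually_elim
    case (elim n)
    show ?case
    proof (intro allI impI)
      fix i assume i: "i < (2::nat) ^ n"
      have "grid T n i \<in> {0..T}" using i T by (intro grid_mem) auto
      then obtain \<xi> where xi: "\<xi> \<in> D" "ball (x (grid T n i)) r \<subseteq> ball \<xi> (\<delta> \<xi>)" using r(2) by blast
      have "grid T n (Suc i) \<in> {grid T n i..grid T n (Suc i)}" using T by (auto intro: grid_mono)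
      with elim i have "dist (x (grid T n (Suc i))) (x (grid T n i)) < r" by blast
      then have "x (grid T n (Suc i)) \<in> ball (x (grid T n i)) r" by (simp add: dist_commute)
      then show "P (x (grid T n i)) (x (grid T n (Suc i)))"
        by (intro d(2)[OF xi(1)] subsetD[OF xi(2)]) (use r(1) in simp)
    qed
  qed
  then show ?thesis unfolding P_def .
qed

text \<open>Cauchy-Schwarz along the grid: increments with vanishing quadratic variation have
  vanishing covariation with increments whose squares have bounded sums.\<close>

lemma sum_product_null:
  fixes u v :: "nat \<Rightarrow> nat \<Rightarrow> real"
  assumes u: "(\<lambda>n. \<Sum>i<N n. (u n i)\<^sup>2) \<longlonglongrightarrow> 0" and v: "\<And>n. (\<Sum>i<N n. (v n i)\<^sup>2) \<le> K"
  shows "(\<lambda>n. \<Sum>i<N n. u n i * v n i) \<longlonglongrightarrow> 0"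
proof -
  have "(\<lambda>n. (\<Sum>i<N n. u n i * v n i)\<^sup>2) \<longlonglongrightarrow> 0"
  proof (rule tendsto_sandwich[OF _ _ tendsto_const])
    show "(\<lambda>n. (\<Sum>i<N n. (u n i)\<^sup>2) * K) \<longlonglongrightarrow> 0" using tendsto_mult_left_zero[OF u, of K] by simp
    show "\<forall>\<^sub>F n in sequentially. 0 \<le> (\<Sum>i<N n. u n i * v n i)\<^sup>2" by simp
    show "\<forall>\<^sub>F n in sequentially. (\<Sum>i<N n. u n i * v n i)\<^sup>2 \<le> (\<Sum>i<N n. (u n i)\<^sup>2) * K"
    proof (rule always_eventually, rule allI)
      fix n
      have "(\<Sum>i<N n. u n i * v n i)\<^sup>2 \<le> (\<Sum>i<N n. (u n i)\<^sup>2) * (\<Sum>i<N n. (v n i)\<^sup>2)" by (rule Cauchy_Schwarz_ineq_sum)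
      also have "\<dots> \<le> (\<Sum>i<N n. (u n i)\<^sup>2) * K" by (intro mult_left_mono v sum_nonneg) auto
      finally show "(\<Sum>i<N n. u n i * v n i)\<^sup>2 \<le> (\<Sum>i<N n. (u n i)\<^sup>2) * K" .
    qed
  qed
  then have "(\<lambda>n. sqrt ((\<Sum>i<N n. u n i * v n i)\<^sup>2)) \<longlonglongrightarrow> sqrt 0" by (rule tendsto_real_sqrt)
  then show ?thesis by (simp add: tendsto_rabs_zero_iff)
qed

section \<open>Quadratic sums along a single path\<close>

lemma continuous_bounded_norm:
  fixes a :: "real \<Rightarrow> 'a::real_normed_vector"
  assumes "continuous_on {0..T} a"
  shows "\<exists>K\<ge>0. \<forall>s\<in>{0..T}. norm (a s) \<le> K"
proof -
  have "bounded (a ` {0..T})" by (intro compact_imp_bounded compact_continuous_image assms) auto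
  then obtain K where "\<forall>y\<in>a ` {0..T}. norm y \<le> K" unfolding bounded_iff by blast
  then show ?thesis by (intro exI[of _ "max K 0"]) (auto simp: le_max_iff_disj)
qed

text \<open>The data of one outcome, free of probability: the Wiener path \<open>w\<close>, the path
  \<open>x\<close> with drift \<open>f\<close>, Ito part \<open>I\<close> and integrand
  \<open>\<sigma>\<close>. The error of replacing \<open>I\<close> is null only along the levels
  selected by \<open>k\<close>, so all limits are taken along \<open>k\<close>.\<close>

locale ito_path =
  fixes T :: real and Q :: "'h::{real_inner,banach,second_countable_topology} \<Rightarrow> 'h" and w :: "real \<Rightarrow> 'h"
    and k :: "nat \<Rightarrow> nat" and x :: "real \<Rightarrow> real^2" and f :: "2 \<Rightarrow> real \<Rightarrow> real" and I :: "2 \<Rightarrow> real \<Rightarrow> real"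
    and \<sigma> :: "2 \<Rightarrow> real \<Rightarrow> 'h" and V :: real
  assumes T: "0 < T" and Q_lin: "bounded_linear Q" and Q_sym: "\<And>x y. Q x \<bullet> y = x \<bullet> Q y"
    and k: "strict_mono k"
    and qv: "\<And>a. continuous_on {0..T} a \<Longrightarrow>
      (\<lambda>n. \<Sum>i<2 ^ n. (a (grid T n i) \<bullet> (w (grid T n (Suc i)) - w (grid T n i)))\<^sup>2)
        \<longlonglongrightarrow> (LINT s:{0..T}|lborel. Q (a s) \<bullet> a s)"
    and V: "\<And>n. (\<Sum>i<2 ^ n. (norm (w (grid T n (Suc i)) - w (grid T n i)))\<^sup>2) \<le> V"
    and w: "continuous_on {0..T} w" and x: "continuous_on {0..T} x"
    and f: "\<And>r. set_integrable lborel {0..T} (f r)" and \<sigma>: "\<And>r. continuous_on {0..T} (\<sigma> r)"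
    and x_eq: "\<And>t r. t \<in> {0..T} \<Longrightarrow> x t $ r = x 0 $ r + (LINT s:{0..t}|lborel. f r s) + I r t"
    and err: "\<And>r. (\<lambda>n. \<Sum>i<2 ^ k n. (I r (grid T (k n) (Suc i)) - I r (grid T (k n) i)
      - \<sigma> r (grid T (k n) i) \<bullet> (w (grid T (k n) (Suc i)) - w (grid T (k n) i)))\<^sup>2) \<longlonglongrightarrow> 0"
begin

abbreviation g :: "nat \<Rightarrow> nat \<Rightarrow> real" where "g n i \<equiv> grid T (k n) i"
abbreviation dw :: "nat \<Rightarrow> nat \<Rightarrow> 'h" where "dw n i \<equiv> w (g n (Suc i)) - w (g n i)"
abbreviation dI :: "2 \<Rightarrow> nat \<Rightarrow> nat \<Rightarrow> real" where "dI r n i \<equiv> I r (g n (Suc i)) - I r (g n i)"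
abbreviation dx :: "2 \<Rightarrow> nat \<Rightarrow> nat \<Rightarrow> real" where "dx r n i \<equiv> x (g n (Suc i)) $ r - x (g n i) $ r"
abbreviation df :: "2 \<Rightarrow> nat \<Rightarrow> nat \<Rightarrow> real" where "df r n i \<equiv> LINT s:{g n i..g n (Suc i)}|lborel. f r s"

lemma T0: "0 \<le> T" using T by simp

lemma Q_continuous: "continuous_on {0..T} a \<Longrightarrow> continuous_on {0..T} (\<lambda>s. Q (a s))"
  by (rule continuous_on_compose2[OF linear_continuous_on[OF Q_lin, of UNIV] _ subset_UNIV])

lemma g_mem: "i \<le> 2 ^ k n \<Longrightarrow> g n i \<in> {0..T}"
  by (rule grid_mem[OF T0])

lemma dx_eq: "i < 2 ^ k n \<Longrightarrow> dx r n i = df r n i + dI r n i"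
proof -
  assume i: "i < 2 ^ k n"
  have "(LINT s:{0..g n (Suc i)}|lborel. f r s) = (LINT s:{0..g n i}|lborel. f r s) + df r n i"
    using i T0 by (intro set_integral_split set_integrable_subset[OF f[of r]]) (auto intro: grid_nonneg grid_mono grid_le)
  then show ?thesis using x_eq[OF g_mem, of "Suc i" n r] x_eq[OF g_mem, of i n r] i by simp
qed

lemma subsequence: "h \<longlonglongrightarrow> l \<Longrightarrow> (\<lambda>n. h (k n)) \<longlonglongrightarrow> l"
  using LIMSEQ_subseq_LIMSEQ[OF _ k] by (simp add: o_def)

text \<open>Polarisation of the quadratic limit; the symmetry of \<open>Q\<close> merges the two
  mixed terms.\<close>

lemma covariation:
  assumes a: "continuous_on {0..T} a" and b: "continuous_on {0..T} b"
  shows "(\<lambda>n. \<Sum>i<2 ^ k n. (a (g n i) \<bullet> dw n i) * (b (g n i) \<bullet> dw n i)) \<longlonglongrightarrow> (LINT s:{0..T}|lborel. Q (a s) \<bullet> b s)"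
proof -
  let ?S = "\<lambda>c n. \<Sum>i<2 ^ n. (c (grid T n i) \<bullet> (w (grid T n (Suc i)) - w (grid T n i)))\<^sup>2"
  let ?p = "\<lambda>s. a s + b s" and ?m = "\<lambda>s. a s - b s"
  have p: "continuous_on {0..T} ?p" and m: "continuous_on {0..T} ?m" using a b by (auto intro: continuous_intros)
  have ip: "set_integrable lborel {0..T} (\<lambda>s. Q (?p s) \<bullet> ?p s)" "set_integrable lborel {0..T} (\<lambda>s. Q (?m s) \<bullet> ?m s)"
    by (intro set_integrable_continuous continuous_on_inner Q_continuous p m)+
  have "(\<lambda>n. (?S ?p (k n) - ?S ?m (k n)) / 4) \<longlonglongrightarrow>
    ((LINT s:{0..T}|lborel. Q (?p s) \<bullet> ?p s) - (LINT s:{0..T}|lborel. Q (?m s) \<bullet> ?m s)) / 4"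
    by (intro tendsto_intros subsequence[of "?S _"] qv p m) simp
  moreover have "(?S ?p (k n) - ?S ?m (k n)) / 4 = (\<Sum>i<2 ^ k n. (a (g n i) \<bullet> dw n i) * (b (g n i) \<bullet> dw n i))" for n
  proof -
    have "?S ?p (k n) - ?S ?m (k n) = (\<Sum>i<2 ^ k n. 4 * ((a (g n i) \<bullet> dw n i) * (b (g n i) \<bullet> dw n i)))"
      unfolding sum_subtractf[symmetric]
      by (rule sum.cong[OF refl]) (simp add: inner_add_left inner_diff_left power2_eq_square algebra_simps)
    then show ?thesis by (simp add: sum_distrib_left[symmetric])
  qed
  moreover have "((LINT s:{0..T}|lborel. Q (?p s) \<bullet> ?p s) - (LINT s:{0..T}|lborel. Q (?m s) \<bullet> ?m s)) / 4
    = (LINT s:{0..T}|lborel. Q (a s) \<bullet> b s)"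
  proof -
    have "(LINT s:{0..T}|lborel. Q (?p s) \<bullet> ?p s) - (LINT s:{0..T}|lborel. Q (?m s) \<bullet> ?m s)
      = (LINT s:{0..T}|lborel. Q (?p s) \<bullet> ?p s - Q (?m s) \<bullet> ?m s)" using ip by simp
    also have "\<dots> = (LINT s:{0..T}|lborel. 4 * (Q (a s) \<bullet> b s))"
    proof (rule set_lebesgue_integral_cong)
      have "Q (?p s) \<bullet> ?p s - Q (?m s) \<bullet> ?m s = 4 * (Q (a s) \<bullet> b s)" for s
      proof -
        have "Q (b s) \<bullet> a s = Q (a s) \<bullet> b s" using Q_sym[of "b s" "a s"] by (simp add: inner_commute)
        then show ?thesis
          by (simp add: linear_add[OF bounded_linear.linear[OF Q_lin]] linear_diff[OF bounded_linear.linear[OF Q_lin]]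
              inner_add_left inner_add_right inner_diff_left inner_diff_right)
      qed
      then show "\<forall>s. s \<in> {0..T} \<longrightarrow> Q (?p s) \<bullet> ?p s - Q (?m s) \<bullet> ?m s = 4 * (Q (a s) \<bullet> b s)" by blast
    qed simp
    also have "\<dots> = 4 * (LINT s:{0..T}|lborel. Q (a s) \<bullet> b s)" by simp
    finally show ?thesis by simp
  qed
  ultimately show ?thesis by (simp only:)
qed

lemma dw_inner_bounded:
  assumes "continuous_on {0..T} a"
  shows "\<exists>K. \<forall>n. (\<Sum>i<2 ^ k n. (a (g n i) \<bullet> dw n i)\<^sup>2) \<le> K"
proof -
  obtain K where K: "0 \<le> K" "\<And>s. s \<in> {0..T} \<Longrightarrow> norm (a s) \<le> K" using continuous_bounded_norm[OF assms] by blast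
  have "(\<Sum>i<2 ^ k n. (a (g n i) \<bullet> dw n i)\<^sup>2) \<le> K\<^sup>2 * V" for n
  proof -
    have "(\<Sum>i<2 ^ k n. (a (g n i) \<bullet> dw n i)\<^sup>2) \<le> (\<Sum>i<2 ^ k n. K\<^sup>2 * (norm (dw n i))\<^sup>2)"
    proof (rule sum_mono)
      fix i assume "i \<in> {..<(2::nat) ^ k n}"
      then have "norm (a (g n i)) \<le> K" by (intro K g_mem) auto
      then have "\<bar>a (g n i) \<bullet> dw n i\<bar> \<le> K * norm (dw n i)"
        by (rule order_trans[OF Cauchy_Schwarz_ineq2 mult_right_mono]) simp
      then have "\<bar>a (g n i) \<bullet> dw n i\<bar>\<^sup>2 \<le> (K * norm (dw n i))\<^sup>2" by (intro power_mono) auto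
      then show "(a (g n i) \<bullet> dw n i)\<^sup>2 \<le> K\<^sup>2 * (norm (dw n i))\<^sup>2" by (simp add: power_mult_distrib)
    qed
    also have "\<dots> \<le> K\<^sup>2 * V" unfolding sum_distrib_left[symmetric] by (rule mult_left_mono[OF V]) simp
    finally show ?thesis .
  qed
  then show ?thesis by blast
qed

lemma sum_sq_add: "(\<Sum>i<N. (u i + v i)\<^sup>2) \<le> 2 * (\<Sum>i<N. (u i)\<^sup>2) + 2 * (\<Sum>i<N. (v i)\<^sup>2)" for u v :: "nat \<Rightarrow> real"
proof -
  have "(u i + v i)\<^sup>2 \<le> 2 * (u i)\<^sup>2 + 2 * (v i)\<^sup>2" for i
    using sum_squares_bound[of "u i" "v i"] by (simp add: power2_sum)
  then have "(\<Sum>i<N. (u i + v i)\<^sup>2) \<le> (\<Sum>i<N. 2 * (u i)\<^sup>2 + 2 * (v i)\<^sup>2)" by (intro sum_mono)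
  then show ?thesis by (simp add: sum.distrib sum_distrib_left)
qed

text \<open>The deviation of an increment of \<open>x\<close> from \<open>\<sigma>\<close> times
  that of \<open>w\<close> is the sum of an integral of the drift, whose squares are null, and of
  the error of the Ito part.\<close>

lemma dx_err: "(\<lambda>n. \<Sum>i<2 ^ k n. (dx r n i - \<sigma> r (g n i) \<bullet> dw n i)\<^sup>2) \<longlonglongrightarrow> 0"
proof (rule tendsto_sandwich[OF _ _ tendsto_const])
  show "\<forall>\<^sub>F n in sequentially. 0 \<le> (\<Sum>i<2 ^ k n. (dx r n i - \<sigma> r (g n i) \<bullet> dw n i)\<^sup>2)"
    by (intro always_eventually allI sum_nonneg) auto
  show "\<forall>\<^sub>F n in sequentially. (\<Sum>i<2 ^ k n. (dx r n i - \<sigma> r (g n i) \<bullet> dw n i)\<^sup>2)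
    \<le> 2 * (\<Sum>i<2 ^ k n. (norm (df r n i))\<^sup>2) + 2 * (\<Sum>i<2 ^ k n. (dI r n i - \<sigma> r (g n i) \<bullet> dw n i)\<^sup>2)"
  proof (intro always_eventually allI)
    fix n
    have "(\<Sum>i<2 ^ k n. (dx r n i - \<sigma> r (g n i) \<bullet> dw n i)\<^sup>2)
      = (\<Sum>i<2 ^ k n. (df r n i + (dI r n i - \<sigma> r (g n i) \<bullet> dw n i))\<^sup>2)"
      by (intro sum.cong refl) (simp only: lessThan_iff dx_eq add_diff_eq)
    also have "\<dots> \<le> 2 * (\<Sum>i<2 ^ k n. (df r n i)\<^sup>2) + 2 * (\<Sum>i<2 ^ k n. (dI r n i - \<sigma> r (g n i) \<bullet> dw n i)\<^sup>2)"
      by (rule sum_sq_add)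
    finally show "(\<Sum>i<2 ^ k n. (dx r n i - \<sigma> r (g n i) \<bullet> dw n i)\<^sup>2)
    \<le> 2 * (\<Sum>i<2 ^ k n. (norm (df r n i))\<^sup>2) + 2 * (\<Sum>i<2 ^ k n. (dI r n i - \<sigma> r (g n i) \<bullet> dw n i)\<^sup>2)" by simp
  qed
  have "(\<lambda>n. 2 * (\<Sum>i<2 ^ k n. (norm (df r n i))\<^sup>2) + 2 * (\<Sum>i<2 ^ k n. (dI r n i - \<sigma> r (g n i) \<bullet> dw n i)\<^sup>2)) \<longlonglongrightarrow> 2 * 0 + 2 * 0"
    by (intro tendsto_intros subsequence[OF integral_grid_square[OF T0 f]] err)
  then show "(\<lambda>n. 2 * (\<Sum>i<2 ^ k n. (norm (df r n i))\<^sup>2) + 2 * (\<Sum>i<2 ^ k n. (dI r n i - \<sigma> r (g n i) \<bullet> dw n i)\<^sup>2)) \<longlonglongrightarrow> 0"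
    by simp
qed

text \<open>The increment of \<open>x\<close> may be replaced by \<open>\<sigma> r\<close> times
  that of \<open>w\<close>, because the difference is quadratically null and its partner has bounded
  squares.\<close>

lemma covariation_dw_dx:
  assumes a: "continuous_on {0..T} a"
  shows "(\<lambda>n. \<Sum>i<2 ^ k n. (a (g n i) \<bullet> dw n i) * dx r n i) \<longlonglongrightarrow> (LINT s:{0..T}|lborel. Q (a s) \<bullet> \<sigma> r s)"
proof -
  obtain K where K: "\<And>n. (\<Sum>i<2 ^ k n. (a (g n i) \<bullet> dw n i)\<^sup>2) \<le> K" using dw_inner_bounded[OF a] by blast
  have "(\<lambda>n. (\<Sum>i<2 ^ k n. (dx r n i - \<sigma> r (g n i) \<bullet> dw n i) * (a (g n i) \<bullet> dw n i))
      + (\<Sum>i<2 ^ k n. (a (g n i) \<bullet> dw n i) * (\<sigma> r (g n i) \<bullet> dw n i)))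
    \<longlonglongrightarrow> 0 + (LINT s:{0..T}|lborel. Q (a s) \<bullet> \<sigma> r s)"
    by (intro tendsto_add sum_product_null[OF dx_err K] covariation a \<sigma>)
  then show ?thesis by (simp add: sum.distrib[symmetric] algebra_simps)
qed

lemma dx_square_bounded: "\<exists>K. \<forall>n. (\<Sum>i<2 ^ k n. (dx r n i)\<^sup>2) \<le> K"
proof -
  obtain K where K: "\<And>n. (\<Sum>i<2 ^ k n. (\<sigma> r (g n i) \<bullet> dw n i)\<^sup>2) \<le> K" using dw_inner_bounded[OF \<sigma>] by blast
  have "Bseq (\<lambda>n. \<Sum>i<2 ^ k n. (dx r n i - \<sigma> r (g n i) \<bullet> dw n i)\<^sup>2)"
    by (rule convergent_imp_Bseq[OF convergentI[OF dx_err]])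
  then obtain L where L: "\<And>n. norm (\<Sum>i<2 ^ k n. (dx r n i - \<sigma> r (g n i) \<bullet> dw n i)\<^sup>2) \<le> L"
    by (rule BseqE) blast
  have "(\<Sum>i<2 ^ k n. (dx r n i)\<^sup>2) \<le> 2 * L + 2 * K" for n
  proof -
    have "(\<Sum>i<2 ^ k n. (dx r n i)\<^sup>2) = (\<Sum>i<2 ^ k n. ((dx r n i - \<sigma> r (g n i) \<bullet> dw n i) + \<sigma> r (g n i) \<bullet> dw n i)\<^sup>2)" by simp
    also have "\<dots> \<le> 2 * (\<Sum>i<2 ^ k n. (dx r n i - \<sigma> r (g n i) \<bullet> dw n i)\<^sup>2) + 2 * (\<Sum>i<2 ^ k n. (\<sigma> r (g n i) \<bullet> dw n i)\<^sup>2)"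
      by (rule sum_sq_add)
    also have "\<dots> \<le> 2 * L + 2 * K" using L[of n] K[of n] by (intro add_mono mult_left_mono) auto
    finally show ?thesis .
  qed
  then show ?thesis by blast
qed

text \<open>One increment of \<open>x\<close> is replaced at a time. While the first is replaced,
  the second supplies the bounded squares; what remains is a covariation of \<open>w\<close> with
  \<open>x\<close>.\<close>

lemma covariation_dx_dx:
  assumes y: "continuous_on {0..T} (y :: real \<Rightarrow> real)"
  shows "(\<lambda>n. \<Sum>i<2 ^ k n. y (g n i) * (dx r n i * dx s n i)) \<longlonglongrightarrow> (LINT t:{0..T}|lborel. y t * (Q (\<sigma> r t) \<bullet> \<sigma> s t))"
proof -
  obtain K where K: "\<And>n. (\<Sum>i<2 ^ k n. (dx s n i)\<^sup>2) \<le> K" using dx_square_bounded by blast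
  obtain L where L: "0 \<le> L" "\<And>t. t \<in> {0..T} \<Longrightarrow> norm (y t) \<le> L" using continuous_bounded_norm[OF y] by blast
  have yb: "(\<Sum>i<2 ^ k n. (y (g n i) * dx s n i)\<^sup>2) \<le> L\<^sup>2 * K" for n
  proof -
    have "(\<Sum>i<2 ^ k n. (y (g n i) * dx s n i)\<^sup>2) \<le> (\<Sum>i<2 ^ k n. L\<^sup>2 * (dx s n i)\<^sup>2)"
    proof (rule sum_mono)
      fix i assume "i \<in> {..<(2::nat) ^ k n}"
      then have "norm (y (g n i)) \<le> L" by (intro L g_mem) auto
      then have "(norm (y (g n i)))\<^sup>2 \<le> L\<^sup>2" by (intro power_mono) auto
      then show "(y (g n i) * dx s n i)\<^sup>2 \<le> L\<^sup>2 * (dx s n i)\<^sup>2" by (simp add: power_mult_distrib mult_right_mono)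
    qed
    also have "\<dots> \<le> L\<^sup>2 * K" unfolding sum_distrib_left[symmetric] by (rule mult_left_mono[OF K]) simp
    finally show ?thesis .
  qed
  have "(\<lambda>n. (\<Sum>i<2 ^ k n. (dx r n i - \<sigma> r (g n i) \<bullet> dw n i) * (y (g n i) * dx s n i))
      + (\<Sum>i<2 ^ k n. ((y (g n i) *\<^sub>R \<sigma> r (g n i)) \<bullet> dw n i) * dx s n i))
    \<longlonglongrightarrow> 0 + (LINT t:{0..T}|lborel. Q (y t *\<^sub>R \<sigma> r t) \<bullet> \<sigma> s t)"
    by (intro tendsto_add sum_product_null[OF dx_err yb] covariation_dw_dx continuous_intros y \<sigma>)
  moreover have "(a - b) * (z * c) + z * b * c = z * (a * c)" for a b c z :: real
    by (simp add: algebra_simps)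
  ultimately show ?thesis
    by (simp only: sum.distrib[symmetric] inner_scaleR_left linear_cmul[OF bounded_linear.linear[OF Q_lin]] add_0)
qed

lemma norm_dx_square_bounded: "\<exists>K. \<forall>n. (\<Sum>i<2 ^ k n. (norm (x (g n (Suc i)) - x (g n i)))\<^sup>2) \<le> K"
proof -
  have "\<forall>r. \<exists>K. \<forall>n. (\<Sum>i<2 ^ k n. (dx r n i)\<^sup>2) \<le> K" using dx_square_bounded by blast
  from choice[OF this] obtain K where "\<forall>r n. (\<Sum>i<2 ^ k n. (dx r n i)\<^sup>2) \<le> K r" by (rule exE)
  then have K: "\<And>r n. (\<Sum>i<2 ^ k n. (dx r n i)\<^sup>2) \<le> K r" by simp
  have "(\<Sum>i<2 ^ k n. (norm (x (g n (Suc i)) - x (g n i)))\<^sup>2) \<le> (\<Sum>r\<in>UNIV. K r)" for n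
  proof -
    have "(norm v)\<^sup>2 = (\<Sum>r\<in>UNIV. (v $ r)\<^sup>2)" for v :: "real^2"
      by (simp add: norm_vec_def L2_set_def sum_nonneg)
    then have "(\<Sum>i<2 ^ k n. (norm (x (g n (Suc i)) - x (g n i)))\<^sup>2) = (\<Sum>r\<in>UNIV. \<Sum>i<2 ^ k n. (dx r n i)\<^sup>2)"
      by (subst sum.swap) simp
    also have "\<dots> \<le> (\<Sum>r\<in>UNIV. K r)" by (intro sum_mono K)
    finally show ?thesis .
  qed
  then show ?thesis by blast
qed

lemma riemann_inner:
  fixes y l :: "real \<Rightarrow> 'b::{real_inner,banach,second_countable_topology}"
  assumes "continuous_on {0..T} y" "set_integrable lborel {0..T} l"
  shows "(\<lambda>n. \<Sum>i<2 ^ k n. y (g n i) \<bullet> (LINT s:{g n i..g n (Suc i)}|lborel. l s)) \<longlonglongrightarrow> (LINT s:{0..T}|lborel. y s \<bullet> l s)"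
  by (rule subsequence[OF riemann_bilinear[OF bounded_bilinear_inner T0 assms]])

end

text \<open>The terms of an expanded product that vanish in the limit. Here \<open>d\<close> is the
  displacement of the path in a cell and \<open>p\<close> the integral of the norm of the drift; the
  prefixes d, l, r denote an increment, its linear Taylor part and its second-order remainder. Each
  term is e times \<open>d\<^sup>2\<close> or \<open>p\<close>, and these have bounded sums.\<close>

lemma remainder_bound:
  fixes \<psi> v d\<psi> dg l\<psi> lg r\<psi> rg dl dw :: "'h::real_inner"
  assumes m: "norm \<psi> \<le> m" "norm v \<le> m" and C: "norm l\<psi> \<le> C * d" "norm (d\<psi> - l\<psi>) \<le> C * d\<^sup>2"
      "norm (dg - lg) \<le> C * d\<^sup>2" "norm d\<psi> \<le> C * d" "norm dg \<le> C * d"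
    and r: "norm r\<psi> \<le> e * d\<^sup>2" "norm rg \<le> e * d\<^sup>2" and e: "d \<le> e" "norm dw \<le> e" "norm dl \<le> p"
    and pos: "0 \<le> d" "0 \<le> C" "0 \<le> m"
  shows "\<bar>- (\<psi> \<bullet> rg) + r\<psi> \<bullet> v + d\<psi> \<bullet> dl + (d\<psi> - l\<psi>) \<bullet> dw - (d\<psi> - l\<psi>) \<bullet> dg - l\<psi> \<bullet> (dg - lg)\<bar>
    \<le> e * ((2 * m + C + 2 * C\<^sup>2) * (d\<^sup>2 + p))"
proof -
  have e0: "0 \<le> e" and p0: "0 \<le> p" using pos e by (auto intro: order_trans[OF norm_ge_zero])
  have in_le: "\<bar>a \<bullet> b\<bar> \<le> A * B" if "norm a \<le> A" "norm b \<le> B" for a b :: 'h and A B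
    using that by (meson Cauchy_Schwarz_ineq2 mult_mono norm_ge_zero order_trans)
  have d3: "d\<^sup>2 * d \<le> e * d\<^sup>2" using e(1) by (simp add: mult.commute mult_right_mono)
  have 1: "\<bar>\<psi> \<bullet> rg\<bar> \<le> m * (e * d\<^sup>2)" by (rule in_le[OF m(1) r(2)])
  have 2: "\<bar>r\<psi> \<bullet> v\<bar> \<le> (e * d\<^sup>2) * m" by (rule in_le[OF r(1) m(2)])
  have 3: "\<bar>d\<psi> \<bullet> dl\<bar> \<le> C * (e * p)"
  proof -
    have "\<bar>d\<psi> \<bullet> dl\<bar> \<le> (C * d) * p" by (rule in_le[OF C(4) e(3)])
    also have "\<dots> \<le> C * (e * p)" using e(1) pos p0 by (simp add: mult.assoc mult_left_mono mult_right_mono)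
    finally show ?thesis .
  qed
  have 4: "\<bar>(d\<psi> - l\<psi>) \<bullet> dw\<bar> \<le> (C * d\<^sup>2) * e" by (rule in_le[OF C(2) e(2)])
  have 5: "\<bar>(d\<psi> - l\<psi>) \<bullet> dg\<bar> \<le> C\<^sup>2 * (e * d\<^sup>2)"
  proof -
    have "\<bar>(d\<psi> - l\<psi>) \<bullet> dg\<bar> \<le> (C * d\<^sup>2) * (C * d)" by (rule in_le[OF C(2) C(5)])
    also have "\<dots> = C\<^sup>2 * (d\<^sup>2 * d)" by (simp add: power2_eq_square mult_ac)
    also have "\<dots> \<le> C\<^sup>2 * (e * d\<^sup>2)" by (rule mult_left_mono[OF d3]) simp
    finally show ?thesis .
  qed
  have 6: "\<bar>l\<psi> \<bullet> (dg - lg)\<bar> \<le> C\<^sup>2 * (e * d\<^sup>2)"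
  proof -
    have "\<bar>l\<psi> \<bullet> (dg - lg)\<bar> \<le> (C * d) * (C * d\<^sup>2)" by (rule in_le[OF C(1) C(3)])
    also have "\<dots> = C\<^sup>2 * (d\<^sup>2 * d)" by (simp add: power2_eq_square mult_ac)
    also have "\<dots> \<le> C\<^sup>2 * (e * d\<^sup>2)" by (rule mult_left_mono[OF d3]) simp
    finally show ?thesis .
  qed
  have "\<bar>- (\<psi> \<bullet> rg) + r\<psi> \<bullet> v + d\<psi> \<bullet> dl + (d\<psi> - l\<psi>) \<bullet> dw - (d\<psi> - l\<psi>) \<bullet> dg - l\<psi> \<bullet> (dg - lg)\<bar>
    \<le> m * (e * d\<^sup>2) + (e * d\<^sup>2) * m + C * (e * p) + (C * d\<^sup>2) * e + C\<^sup>2 * (e * d\<^sup>2) + C\<^sup>2 * (e * d\<^sup>2)"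
    using 1 2 3 4 5 6 by linarith
  also have "\<dots> = e * ((2 * m + C + 2 * C\<^sup>2) * d\<^sup>2 + C * p)" by (simp add: algebra_simps)
  also have "\<dots> \<le> e * ((2 * m + C + 2 * C\<^sup>2) * d\<^sup>2 + (2 * m + C + 2 * C\<^sup>2) * p)"
    using pos p0 by (intro mult_left_mono[OF _ e0] add_left_mono mult_right_mono) auto
  finally show ?thesis by (simp add: distrib_left)
qed

section \<open>Second-order expansion along the path\<close>

context ito_path
begin

lemma eventually_along_k: "\<forall>\<^sub>F n in sequentially. P n \<Longrightarrow> \<forall>\<^sub>F n in sequentially. P (k n)"
  using filterlim_subseq[OF k] by (auto simp: filterlim_iff)

lemma sum_telescope_grid: "(\<Sum>i<2 ^ n. h (grid T n (Suc i)) - h (grid T n i)) = h T - (h 0 :: 'b::ab_group_add)"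
  using sum_lessThan_telescope[of "\<lambda>i. h (grid T n i)" "2 ^ n"] by simp

text \<open>The suprema of the first and second derivatives along the path give the constants.
  \<open>C\<close> is fixed before e, since only the second-order remainder is to become
  small.\<close>

lemma increment_bounds:
  fixes G :: "real^2 \<Rightarrow> 'h"
  assumes c2: "c2map D G G1 G2" and D: "\<forall>t\<in>{0..T}. x t \<in> D"
  shows "\<exists>C\<ge>0. \<forall>e>0. \<forall>\<^sub>F n in sequentially. \<forall>i<2 ^ k n.
    (let d = norm (x (g n (Suc i)) - x (g n i)); dG = G (x (g n (Suc i))) - G (x (g n i));
         l = (\<Sum>j\<in>UNIV. dx j n i *\<^sub>R G1 j (x (g n i)));
         q = (1/2) *\<^sub>R (\<Sum>j\<in>UNIV. \<Sum>m\<in>UNIV. (dx j n i * dx m n i) *\<^sub>R G2 j m (x (g n i)))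
     in norm l \<le> C * d \<and> norm (dG - l) \<le> C * d\<^sup>2 \<and> norm dG \<le> C * d \<and> norm (dG - l - q) \<le> e * d\<^sup>2)"
proof -
  note c2' = c2[unfolded c2map_def]
  have G1c: "continuous_on {0..T} (\<lambda>s. G1 j (x s))" for j
    by (rule continuous_on_compose2[of D "G1 j"]) (use c2' x D in auto)
  have G2c: "continuous_on {0..T} (\<lambda>s. G2 j l (x s))" for j l
    by (rule continuous_on_compose2[of D "G2 j l"]) (use c2' x D in auto)
  have "\<exists>K\<ge>0. \<forall>s\<in>{0..T}. norm (G1 j (x s)) \<le> K" for j by (rule continuous_bounded_norm[OF G1c])
  then obtain K1 where K1: "\<And>j. K1 j \<ge> 0" "\<And>j s. s \<in> {0..T} \<Longrightarrow> norm (G1 j (x s)) \<le> K1 j" by metis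
  have "\<exists>K\<ge>0. \<forall>s\<in>{0..T}. norm (G2 j l (x s)) \<le> K" for j l by (rule continuous_bounded_norm[OF G2c])
  then obtain K2 where K2: "\<And>j l. K2 j l \<ge> 0" "\<And>j l s. s \<in> {0..T} \<Longrightarrow> norm (G2 j l (x s)) \<le> K2 j l" by metis
  define A where "A = (\<Sum>j\<in>UNIV. K1 j)"
  define B where "B = (\<Sum>j\<in>UNIV. \<Sum>l\<in>UNIV. K2 j l)"
  have A0: "0 \<le> A" and B0: "0 \<le> B" unfolding A_def B_def by (intro sum_nonneg K1 K2)+
  define C where "C = A + B + 1"
  show ?thesis
  proof (intro exI[of _ C] conjI allI impI)
    show "0 \<le> C" using A0 B0 by (simp add: C_def)
    fix e :: real assume e: "e > 0"
    \<comment> \<open>The cap 1 bounds the remainder by a fixed multiple of the squared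
      displacement, which keeps \<open>C\<close> independent of e.\<close>
    have e1: "min e 1 > 0" using e by simp
    note ev1 = eventually_along_k[OF c2map_along_path[OF c2 T0 x D e1]]
    note ev2 = eventually_along_k[OF continuous_grid_osc[OF T0 x zero_less_one]]
    from ev1 ev2 show "\<forall>\<^sub>F n in sequentially. \<forall>i<2 ^ k n.
      (let d = norm (x (g n (Suc i)) - x (g n i)); dG = G (x (g n (Suc i))) - G (x (g n i));
         l = (\<Sum>j\<in>UNIV. dx j n i *\<^sub>R G1 j (x (g n i)));
         q = (1/2) *\<^sub>R (\<Sum>j\<in>UNIV. \<Sum>m\<in>UNIV. (dx j n i * dx m n i) *\<^sub>R G2 j m (x (g n i)))
       in norm l \<le> C * d \<and> norm (dG - l) \<le> C * d\<^sup>2 \<and> norm dG \<le> C * d \<and> norm (dG - l - q) \<le> e * d\<^sup>2)"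
    proof eventually_elim
      case (elim n)
      show ?case
      proof (intro allI impI)
        fix i assume i: "i < (2::nat) ^ k n"
        define d where "d = norm (x (g n (Suc i)) - x (g n i))"
        define dG where "dG = G (x (g n (Suc i))) - G (x (g n i))"
        define l where "l = (\<Sum>j\<in>UNIV. dx j n i *\<^sub>R G1 j (x (g n i)))"
        define q where "q = (1/2) *\<^sub>R (\<Sum>j\<in>UNIV. \<Sum>m\<in>UNIV. (dx j n i * dx m n i) *\<^sub>R G2 j m (x (g n i)))"
        have gi: "g n i \<in> {0..T}" using i by (intro g_mem) auto
        have d0: "0 \<le> d" by (simp add: d_def)
        have "g n (Suc i) \<in> {g n i..g n (Suc i)}" using T0 by (auto intro: grid_mono)
        then have d1: "d < 1" using elim(2) i unfolding d_def dist_norm by blast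
        have dxd: "\<bar>dx j n i\<bar> \<le> d" for j
          using component_le_norm_cart[of "x (g n (Suc i)) - x (g n i)" j] by (simp add: d_def)
        have l: "norm l \<le> A * d"
        proof -
          have "norm l \<le> (\<Sum>j\<in>UNIV. d * K1 j)"
            unfolding l_def using dxd d0 K1(2)[OF gi] by (intro sum_norm_le) (auto intro!: mult_mono)
          then show ?thesis by (simp add: A_def sum_distrib_left mult.commute)
        qed
        have q: "norm q \<le> B * d\<^sup>2"
        proof -
          have "norm (\<Sum>j\<in>UNIV. \<Sum>m\<in>UNIV. (dx j n i * dx m n i) *\<^sub>R G2 j m (x (g n i))) \<le> (\<Sum>j\<in>UNIV. \<Sum>m\<in>UNIV. (d * d) * K2 j m)"
            using dxd d0 K2(2)[OF gi] by (intro sum_norm_le) (auto simp: abs_mult intro!: mult_mono)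
          also have "\<dots> = B * d\<^sup>2" by (simp add: B_def sum_distrib_left power2_eq_square mult.commute)
          finally have "norm (\<Sum>j\<in>UNIV. \<Sum>m\<in>UNIV. (dx j n i * dx m n i) *\<^sub>R G2 j m (x (g n i))) \<le> B * d\<^sup>2" .
          moreover have "0 \<le> B * d\<^sup>2" using B0 by simp
          ultimately show ?thesis unfolding q_def norm_scaleR by simp
        qed
        have r: "norm (dG - l - q) \<le> min e 1 * d\<^sup>2"
          using elim(1) i unfolding dG_def l_def q_def d_def by blast
        have "min e 1 * d\<^sup>2 \<le> e * d\<^sup>2" "min e 1 * d\<^sup>2 \<le> 1 * d\<^sup>2" by (intro mult_right_mono; simp)+
        then have re: "norm (dG - l - q) \<le> e * d\<^sup>2" and r1: "norm (dG - l - q) \<le> d\<^sup>2" using r by auto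
        have dl: "norm (dG - l) \<le> (B + 1) * d\<^sup>2"
        proof -
          have "norm (dG - l) \<le> norm (dG - l - q) + norm q" using norm_triangle_ineq[of "dG - l - q" q] by simp
          also have "\<dots> \<le> d\<^sup>2 + B * d\<^sup>2" by (intro add_mono r1 q)
          finally show ?thesis by (simp add: distrib_right)
        qed
        have dd: "d\<^sup>2 \<le> d" using d0 d1 by (simp add: power2_eq_square mult_left_le)
        have "norm dG \<le> norm (dG - l) + norm l" using norm_triangle_ineq[of "dG - l" l] by simp
        also have "\<dots> \<le> (B + 1) * d\<^sup>2 + A * d" by (intro add_mono dl l)
        also have "\<dots> \<le> (B + 1) * d + A * d" using B0 dd by (intro add_right_mono mult_left_mono) auto
        also have "\<dots> = C * d" by (simp add: C_def algebra_simps)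
        finally have dG: "norm dG \<le> C * d" .
        have "A * d \<le> C * d" using d0 B0 by (intro mult_right_mono) (auto simp: C_def)
        then have l': "norm l \<le> C * d" using l by linarith
        have "(B + 1) * d\<^sup>2 \<le> C * d\<^sup>2" using A0 by (intro mult_right_mono) (auto simp: C_def)
        then have dl': "norm (dG - l) \<le> C * d\<^sup>2" using dl by linarith
        show "let d = norm (x (g n (Suc i)) - x (g n i)); dG = G (x (g n (Suc i))) - G (x (g n i));
         l = (\<Sum>j\<in>UNIV. dx j n i *\<^sub>R G1 j (x (g n i)));
         q = (1/2) *\<^sub>R (\<Sum>j\<in>UNIV. \<Sum>m\<in>UNIV. (dx j n i * dx m n i) *\<^sub>R G2 j m (x (g n i)))
       in norm l \<le> C * d \<and> norm (dG - l) \<le> C * d\<^sup>2 \<and> norm dG \<le> C * d \<and> norm (dG - l - q) \<le> e * d\<^sup>2"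
          unfolding Let_def d_def[symmetric] dG_def[symmetric] l_def[symmetric] q_def[symmetric]
          using l' dl' dG re by blast
      qed
    qed
  qed
qed

text \<open>Summation by parts over the cells with second-order expansions of both maps. By
  \<open>v_eq\<close> an increment of \<open>v\<close> is a drift integral plus an increment of
  \<open>w\<close> minus one of \<open>G\<close>. \<open>A\<close> collects the coefficients of
  single displacements, \<open>H\<close> those of their products. The sums that carry increments of
  \<open>w\<close> and of the Ito parts stay together on the left, where only their difference needs
  a limit.\<close>

lemma ito_product:
  fixes \<Psi> G :: "real^2 \<Rightarrow> 'h" and v drift :: "real \<Rightarrow> 'h"
  assumes c2p: "c2map D \<Psi> \<Psi>1 \<Psi>2" and c2g: "c2map D G G1 G2" and D: "\<forall>t\<in>{0..T}. x t \<in> D"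
    and v: "continuous_on {0..T} v" and l: "set_integrable lborel {0..T} drift"
    and v_eq: "\<forall>t\<in>{0..T}. v t + G (x t) = v 0 + G (x 0) + (LINT s:{0..t}|lborel. drift s) + w t - w 0"
  defines "A \<equiv> \<lambda>j s. \<Psi> (x s) \<bullet> G1 j (x s) - v s \<bullet> \<Psi>1 j (x s)"
    and "H \<equiv> \<lambda>j m s. (1/2) * (v s \<bullet> \<Psi>2 j m (x s)) - (1/2) * (\<Psi> (x s) \<bullet> G2 j m (x s)) - \<Psi>1 j (x s) \<bullet> G1 m (x s)"
  shows "(\<lambda>n. (\<Sum>i<2 ^ k n. \<Psi> (x (g n i)) \<bullet> dw n i) - (\<Sum>j\<in>UNIV. \<Sum>i<2 ^ k n. A j (g n i) * dI j n i)) \<longlonglongrightarrow>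
    \<Psi> (x T) \<bullet> v T - \<Psi> (x 0) \<bullet> v 0 - (LINT s:{0..T}|lborel. \<Psi> (x s) \<bullet> drift s)
      + (\<Sum>j\<in>UNIV. LINT s:{0..T}|lborel. A j s * f j s)
      - (\<Sum>j\<in>UNIV. \<Sum>m\<in>UNIV. LINT s:{0..T}|lborel. H j m s * (Q (\<sigma> j s) \<bullet> \<sigma> m s))
      - (\<Sum>j\<in>UNIV. LINT s:{0..T}|lborel. Q (\<Psi>1 j (x s)) \<bullet> \<sigma> j s)"
proof -
  have comp: "continuous_on {0..T} (\<lambda>s. h (x s))" if "continuous_on D h" for h :: "real^2 \<Rightarrow> 'h"
    by (rule continuous_on_compose2[OF that x]) (use D in auto)
  have Pc: "continuous_on {0..T} (\<lambda>s. \<Psi> (x s))" and P1c: "\<And>j. continuous_on {0..T} (\<lambda>s. \<Psi>1 j (x s))"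
    and P2c: "\<And>j m. continuous_on {0..T} (\<lambda>s. \<Psi>2 j m (x s))"
    using c2p unfolding c2map_def by (auto intro: comp)
  have G1c: "\<And>j. continuous_on {0..T} (\<lambda>s. G1 j (x s))" and G2c: "\<And>j m. continuous_on {0..T} (\<lambda>s. G2 j m (x s))"
    using c2g unfolding c2map_def by (auto intro: comp)
  have Ac: "continuous_on {0..T} (A j)" for j
    unfolding A_def by (intro continuous_intros Pc G1c P1c v)
  have Hc: "continuous_on {0..T} (H j m)" for j m
    unfolding H_def by (intro continuous_intros Pc G1c P1c v G2c P2c)
  define L where "L n i = (LINT s:{g n i..g n (Suc i)}|lborel. drift s)" for n i
  define dp where "dp n i = \<Psi> (x (g n (Suc i))) - \<Psi> (x (g n i))" for n i
  define dg where "dg n i = G (x (g n (Suc i))) - G (x (g n i))" for n i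
  define lp where "lp n i = (\<Sum>j\<in>UNIV. dx j n i *\<^sub>R \<Psi>1 j (x (g n i)))" for n i
  define lg where "lg n i = (\<Sum>j\<in>UNIV. dx j n i *\<^sub>R G1 j (x (g n i)))" for n i
  define qp where "qp n i = (1/2) *\<^sub>R (\<Sum>j\<in>UNIV. \<Sum>m\<in>UNIV. (dx j n i * dx m n i) *\<^sub>R \<Psi>2 j m (x (g n i)))" for n i
  define qg where "qg n i = (1/2) *\<^sub>R (\<Sum>j\<in>UNIV. \<Sum>m\<in>UNIV. (dx j n i * dx m n i) *\<^sub>R G2 j m (x (g n i)))" for n i
  \<comment> \<open>What is left after the terms of first and second order have been split off:
    second-order Taylor remainders and products of higher order.\<close>
  define rem where "rem n i = - (\<Psi> (x (g n i)) \<bullet> (dg n i - lg n i - qg n i)) + (dp n i - lp n i - qp n i) \<bullet> v (g n i)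
      + dp n i \<bullet> L n i + (dp n i - lp n i) \<bullet> dw n i - (dp n i - lp n i) \<bullet> dg n i - lp n i \<bullet> (dg n i - lg n i)" for n i
  have dv: "v (g n (Suc i)) = v (g n i) + L n i + dw n i - dg n i" if i: "i < 2 ^ k n" for n i
  proof -
    have "(LINT s:{0..g n (Suc i)}|lborel. drift s) = (LINT s:{0..g n i}|lborel. drift s) + L n i"
      unfolding L_def using i T0
      by (intro set_integral_split set_integrable_subset[OF l]) (auto intro: grid_nonneg grid_mono grid_le)
    moreover have "v t = v 0 + G (x 0) + (LINT s:{0..t}|lborel. drift s) + w t - w 0 - G (x t)" if "t \<in> {0..T}" for t
      using v_eq[rule_format, OF that] by (simp only: eq_diff_eq)
    from this[OF g_mem, of "Suc i" n] this[OF g_mem, of i n] i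
    have "v (g n (Suc i)) = v 0 + G (x 0) + (LINT s:{0..g n (Suc i)}|lborel. drift s) + w (g n (Suc i)) - w 0 - G (x (g n (Suc i)))"
      "v (g n i) = v 0 + G (x 0) + (LINT s:{0..g n i}|lborel. drift s) + w (g n i) - w 0 - G (x (g n i))"
      by simp_all
    ultimately show ?thesis by (simp only: dg_def) simp
  qed
  \<comment> \<open>Pure algebra. Here p and u are the values of the two factors, d and e the
    increments of \<open>\<Psi>\<close> and \<open>G\<close>, a and c their linear parts, q and q'
    their quadratic parts, l' the drift and b the Wiener increment. The covariation a \<bullet> b is
    kept apart, and the last bracket is the remainder.\<close>
  have id1: "(p + d) \<bullet> (u + l' + b - e) - p \<bullet> u = p \<bullet> b + p \<bullet> l' + (- (p \<bullet> c) + a \<bullet> u) + (- (p \<bullet> q') + q \<bullet> u - a \<bullet> c) + a \<bullet> b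
      + (- (p \<bullet> (e - c - q')) + (d - a - q) \<bullet> u + d \<bullet> l' + (d - a) \<bullet> b - (d - a) \<bullet> e - a \<bullet> (e - c))"
    for p d u l' b e a c q q' :: 'h
    by (simp add: inner_add_left inner_add_right inner_diff_left inner_diff_right)
  have aux2: "- (p \<bullet> (\<Sum>j\<in>UNIV. X j *\<^sub>R b j)) + (\<Sum>j\<in>UNIV. X j *\<^sub>R a j) \<bullet> u = - (\<Sum>j\<in>UNIV. (p \<bullet> b j - u \<bullet> a j) * X j)"
    for p u :: 'h and a b :: "2 \<Rightarrow> 'h" and X :: "2 \<Rightarrow> real"
    by (simp add: inner_sum_left inner_sum_right inner_commute[of u] right_diff_distrib sum_subtractf mult.commute)
  have aux3: "- (p \<bullet> ((1/2) *\<^sub>R (\<Sum>j\<in>UNIV. \<Sum>m\<in>UNIV. (X j * X m) *\<^sub>R b2 j m)))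
      + ((1/2) *\<^sub>R (\<Sum>j\<in>UNIV. \<Sum>m\<in>UNIV. (X j * X m) *\<^sub>R a2 j m)) \<bullet> u - (\<Sum>j\<in>UNIV. X j *\<^sub>R a j) \<bullet> (\<Sum>j\<in>UNIV. X j *\<^sub>R b j)
    = (\<Sum>j\<in>UNIV. \<Sum>m\<in>UNIV. ((1/2) * (u \<bullet> a2 j m) - (1/2) * (p \<bullet> b2 j m) - a j \<bullet> b m) * (X j * X m))"
    for p u :: 'h and a b :: "2 \<Rightarrow> 'h" and a2 b2 :: "2 \<Rightarrow> 2 \<Rightarrow> 'h" and X :: "2 \<Rightarrow> real"
  proof -
    have e1: "p \<bullet> ((1/2) *\<^sub>R (\<Sum>j\<in>UNIV. \<Sum>m\<in>UNIV. (X j * X m) *\<^sub>R b2 j m)) = (\<Sum>j\<in>UNIV. \<Sum>m\<in>UNIV. (1/2) * (p \<bullet> b2 j m) * (X j * X m))"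
      by (simp add: inner_sum_right sum_distrib_left mult_ac)
    have e2: "((1/2) *\<^sub>R (\<Sum>j\<in>UNIV. \<Sum>m\<in>UNIV. (X j * X m) *\<^sub>R a2 j m)) \<bullet> u = (\<Sum>j\<in>UNIV. \<Sum>m\<in>UNIV. (1/2) * (u \<bullet> a2 j m) * (X j * X m))"
      by (simp add: inner_sum_left sum_distrib_left mult_ac inner_commute[of u])
    have "(\<Sum>j\<in>UNIV. X j *\<^sub>R a j) \<bullet> (\<Sum>j\<in>UNIV. X j *\<^sub>R b j) = (\<Sum>m\<in>UNIV. \<Sum>j\<in>UNIV. (a j \<bullet> b m) * (X j * X m))"
      by (simp add: inner_sum_left inner_sum_right sum_distrib_left mult_ac)
    also have "\<dots> = (\<Sum>j\<in>UNIV. \<Sum>m\<in>UNIV. (a j \<bullet> b m) * (X j * X m))" by (rule sum.swap)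
    finally have e3: "(\<Sum>j\<in>UNIV. X j *\<^sub>R a j) \<bullet> (\<Sum>j\<in>UNIV. X j *\<^sub>R b j) = (\<Sum>j\<in>UNIV. \<Sum>m\<in>UNIV. (a j \<bullet> b m) * (X j * X m))" .
    show ?thesis unfolding e1 e2 e3 left_diff_distrib sum_subtractf by simp
  qed
  have id2: "- (\<Psi> (x (g n i)) \<bullet> lg n i) + lp n i \<bullet> v (g n i) = - (\<Sum>j\<in>UNIV. A j (g n i) * dx j n i)" for n i
    unfolding lg_def lp_def A_def by (rule aux2)
  have id3: "- (\<Psi> (x (g n i)) \<bullet> qg n i) + qp n i \<bullet> v (g n i) - lp n i \<bullet> lg n i
      = (\<Sum>j\<in>UNIV. \<Sum>m\<in>UNIV. H j m (g n i) * (dx j n i * dx m n i))" for n i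
    unfolding qg_def qp_def lp_def lg_def H_def by (rule aux3)
  have id4: "lp n i \<bullet> dw n i = (\<Sum>j\<in>UNIV. (\<Psi>1 j (x (g n i)) \<bullet> dw n i) * dx j n i)" for n i
    unfolding lp_def by (simp add: inner_sum_left mult.commute)
  have step: "\<Psi> (x (g n (Suc i))) \<bullet> v (g n (Suc i)) - \<Psi> (x (g n i)) \<bullet> v (g n i)
    = \<Psi> (x (g n i)) \<bullet> dw n i + \<Psi> (x (g n i)) \<bullet> L n i - (\<Sum>j\<in>UNIV. A j (g n i) * df j n i) - (\<Sum>j\<in>UNIV. A j (g n i) * dI j n i)
      + (\<Sum>j\<in>UNIV. \<Sum>m\<in>UNIV. H j m (g n i) * (dx j n i * dx m n i))
      + (\<Sum>j\<in>UNIV. (\<Psi>1 j (x (g n i)) \<bullet> dw n i) * dx j n i) + rem n i" if i: "i < 2 ^ k n" for n i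
  proof -
    have pp: "\<Psi> (x (g n (Suc i))) = \<Psi> (x (g n i)) + dp n i" by (simp add: dp_def)
    have dd: "(\<Sum>j\<in>UNIV. A j (g n i) * dx j n i) = (\<Sum>j\<in>UNIV. A j (g n i) * df j n i) + (\<Sum>j\<in>UNIV. A j (g n i) * dI j n i)"
      unfolding dx_eq[OF i] by (simp add: distrib_left sum.distrib)
    show ?thesis
      unfolding dv[OF i] pp id1[of _ _ _ _ _ _ "lg n i" "lp n i" "qg n i" "qp n i"] id2 id3 id4 dd rem_def[symmetric]
      by linarith
  qed
  have rem_lim: "(\<lambda>n. \<Sum>i<2 ^ k n. rem n i) \<longlonglongrightarrow> 0"
  proof (rule tendstoI)
    fix r :: real assume r: "r > 0"
    obtain K where K: "\<And>n. (\<Sum>i<2 ^ k n. (norm (x (g n (Suc i)) - x (g n i)))\<^sup>2) \<le> K" using norm_dx_square_bounded by blast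
    have K0: "0 \<le> K" using K[of 0] by (meson order_trans sum_nonneg zero_le_power2)
    obtain mp where mp: "0 \<le> mp" "\<forall>s\<in>{0..T}. norm (\<Psi> (x s)) \<le> mp" using continuous_bounded_norm[OF Pc] by blast
    obtain mv where mv: "0 \<le> mv" "\<forall>s\<in>{0..T}. norm (v s) \<le> mv" using continuous_bounded_norm[OF v] by blast
    obtain Cp where Cp: "0 \<le> Cp" "\<forall>e>0. \<forall>\<^sub>F n in sequentially. \<forall>i<2 ^ k n. norm (lp n i) \<le> Cp * norm (x (g n (Suc i)) - x (g n i)) \<and>
        norm (dp n i - lp n i) \<le> Cp * (norm (x (g n (Suc i)) - x (g n i)))\<^sup>2 \<and> norm (dp n i) \<le> Cp * norm (x (g n (Suc i)) - x (g n i)) \<and>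
        norm (dp n i - lp n i - qp n i) \<le> e * (norm (x (g n (Suc i)) - x (g n i)))\<^sup>2"
      using increment_bounds[OF c2p D, unfolded Let_def, folded dp_def lp_def qp_def] by (elim exE conjE) (rule that; assumption)
    obtain Cg where Cg: "0 \<le> Cg" "\<forall>e>0. \<forall>\<^sub>F n in sequentially. \<forall>i<2 ^ k n. norm (lg n i) \<le> Cg * norm (x (g n (Suc i)) - x (g n i)) \<and>
        norm (dg n i - lg n i) \<le> Cg * (norm (x (g n (Suc i)) - x (g n i)))\<^sup>2 \<and> norm (dg n i) \<le> Cg * norm (x (g n (Suc i)) - x (g n i)) \<and>
        norm (dg n i - lg n i - qg n i) \<le> e * (norm (x (g n (Suc i)) - x (g n i)))\<^sup>2"
      using increment_bounds[OF c2g D, unfolded Let_def, folded dg_def lg_def qg_def] by (elim exE conjE) (rule that; assumption)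
    define C where "C = Cp + Cg"
    define m where "m = mp + mv"
    define N where "N = (LINT s:{0..T}|lborel. norm (drift s))"
    have ln: "set_integrable lborel {0..T} (\<lambda>s. norm (drift s))" using l by (rule set_integrable_norm)
    have N0: "0 \<le> N" unfolding N_def set_lebesgue_integral_def by (intro integral_nonneg_AE) auto
    have C0: "0 \<le> C" and m0: "0 \<le> m" using Cp Cg mp mv by (auto simp: C_def m_def)
    \<comment> \<open>\<open>K\<close> bounds the sums of squared displacements and \<open>N\<close>
      is the L1 norm of the drift, so e B bounds the total remainder. The choice of e below makes
      this less than r.\<close>
    define B where "B = (2 * m + C + 2 * C\<^sup>2) * (K + N)"
    have B0: "0 \<le> B" using C0 m0 K0 N0 by (simp add: B_def)
    define e where "e = r / (B + 1)"
    have e: "0 < e" using r B0 by (simp add: e_def)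
    have ev1: "\<forall>\<^sub>F n in sequentially. \<forall>i<2 ^ k n. \<forall>s\<in>{g n i..g n (Suc i)}. dist (x s) (x (g n i)) < e"
      by (rule eventually_along_k[OF continuous_grid_osc[OF T0 x e]])
    have ev2: "\<forall>\<^sub>F n in sequentially. \<forall>i<2 ^ k n. \<forall>s\<in>{g n i..g n (Suc i)}. dist (w s) (w (g n i)) < e"
      by (rule eventually_along_k[OF continuous_grid_osc[OF T0 w e]])
    from ev1 ev2 Cp(2)[rule_format, OF e] Cg(2)[rule_format, OF e]
    show "\<forall>\<^sub>F n in sequentially. dist (\<Sum>i<2 ^ k n. rem n i) 0 < r"
    proof eventually_elim
      case (elim n)
      let ?d = "\<lambda>i. norm (x (g n (Suc i)) - x (g n i))" and ?p = "\<lambda>i. LINT s:{g n i..g n (Suc i)}|lborel. norm (drift s)"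
      have one: "\<bar>rem n i\<bar> \<le> e * ((2 * m + C + 2 * C\<^sup>2) * ((?d i)\<^sup>2 + ?p i))" if i: "i < 2 ^ k n" for i
        unfolding rem_def
      proof (rule remainder_bound)
        have gi: "g n i \<in> {0..T}" using i by (intro g_mem) auto
        have gs: "g n (Suc i) \<in> {g n i..g n (Suc i)}" using T0 by (auto intro: grid_mono)
        show "norm (\<Psi> (x (g n i))) \<le> m" "norm (v (g n i)) \<le> m"
          using mp mv gi by (auto simp: m_def intro: order_trans add_increasing add_increasing2)
        have CC: "Cp * z \<le> C * z" "Cg * z \<le> C * z" if "0 \<le> z" for z
          using that Cp Cg by (auto simp: C_def intro: mult_right_mono)
        note ep = elim(3)[rule_format, OF i] and eg = elim(4)[rule_format, OF i]
        show "norm (lp n i) \<le> C * ?d i" using ep CC(1)[of "?d i"] by simp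
        show "norm (dp n i) \<le> C * ?d i" using ep CC(1)[of "?d i"] by simp
        show "norm (dp n i - lp n i) \<le> C * (?d i)\<^sup>2" using ep CC(1)[of "(?d i)\<^sup>2"] by simp
        show "norm (dg n i) \<le> C * ?d i" using eg CC(2)[of "?d i"] by simp
        show "norm (dg n i - lg n i) \<le> C * (?d i)\<^sup>2" using eg CC(2)[of "(?d i)\<^sup>2"] by simp
        show "norm (dp n i - lp n i - qp n i) \<le> e * (?d i)\<^sup>2" using ep by blast
        show "norm (dg n i - lg n i - qg n i) \<le> e * (?d i)\<^sup>2" using eg by blast
        have "dist (x (g n (Suc i))) (x (g n i)) < e" using elim(1) i gs by blast
        then show "?d i \<le> e" by (simp add: dist_norm)
        have "dist (w (g n (Suc i))) (w (g n i)) < e" using elim(2) i gs by blast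
        then show "norm (dw n i) \<le> e" by (simp add: dist_norm)
        show "norm (L n i) \<le> ?p i" unfolding L_def by (intro set_integral_norm_bound set_integrable_grid[OF T0 l i])
      qed (use C0 m0 in auto)
      have "\<bar>\<Sum>i<2 ^ k n. rem n i\<bar> \<le> (\<Sum>i<2 ^ k n. e * ((2 * m + C + 2 * C\<^sup>2) * ((?d i)\<^sup>2 + ?p i)))"
        by (rule order_trans[OF sum_abs], rule sum_mono) (use one in auto)
      also have "\<dots> = e * ((2 * m + C + 2 * C\<^sup>2) * ((\<Sum>i<2 ^ k n. (?d i)\<^sup>2) + N))"
        unfolding N_def set_integral_grid[OF T0 ln, of "k n"] sum.distrib[symmetric] sum_distrib_left ..
      also have "\<dots> \<le> e * B"
        unfolding B_def using e C0 m0 K[of n] by (intro mult_left_mono add_right_mono) auto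
      also have "\<dots> < e * (B + 1)" using e by simp
      also have "\<dots> = r" using B0 by (simp add: e_def)
      finally show ?case by (simp add: dist_real_def)
    qed
  qed
  have total: "(\<Sum>i<2 ^ k n. \<Psi> (x (g n i)) \<bullet> dw n i) - (\<Sum>j\<in>UNIV. \<Sum>i<2 ^ k n. A j (g n i) * dI j n i)
    = \<Psi> (x T) \<bullet> v T - \<Psi> (x 0) \<bullet> v 0 - (\<Sum>i<2 ^ k n. \<Psi> (x (g n i)) \<bullet> L n i)
      + (\<Sum>j\<in>UNIV. \<Sum>i<2 ^ k n. A j (g n i) * df j n i)
      - (\<Sum>j\<in>UNIV. \<Sum>m\<in>UNIV. \<Sum>i<2 ^ k n. H j m (g n i) * (dx j n i * dx m n i))
      - (\<Sum>j\<in>UNIV. \<Sum>i<2 ^ k n. (\<Psi>1 j (x (g n i)) \<bullet> dw n i) * dx j n i) - (\<Sum>i<2 ^ k n. rem n i)" for n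
  proof -
    have "\<Psi> (x T) \<bullet> v T - \<Psi> (x 0) \<bullet> v 0
      = (\<Sum>i<2 ^ k n. \<Psi> (x (g n (Suc i))) \<bullet> v (g n (Suc i)) - \<Psi> (x (g n i)) \<bullet> v (g n i))"
      using sum_telescope_grid[of "\<lambda>t. \<Psi> (x t) \<bullet> v t" "k n"] by simp
    also have "\<dots> = (\<Sum>i<2 ^ k n. \<Psi> (x (g n i)) \<bullet> dw n i + \<Psi> (x (g n i)) \<bullet> L n i - (\<Sum>j\<in>UNIV. A j (g n i) * df j n i) - (\<Sum>j\<in>UNIV. A j (g n i) * dI j n i)
      + (\<Sum>j\<in>UNIV. \<Sum>m\<in>UNIV. H j m (g n i) * (dx j n i * dx m n i))
      + (\<Sum>j\<in>UNIV. (\<Psi>1 j (x (g n i)) \<bullet> dw n i) * dx j n i) + rem n i)"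
      by (rule sum.cong[OF refl]) (rule step, simp)
    also have "\<dots> = (\<Sum>i<2 ^ k n. \<Psi> (x (g n i)) \<bullet> dw n i) + (\<Sum>i<2 ^ k n. \<Psi> (x (g n i)) \<bullet> L n i)
      - (\<Sum>i<2 ^ k n. \<Sum>j\<in>UNIV. A j (g n i) * df j n i) - (\<Sum>i<2 ^ k n. \<Sum>j\<in>UNIV. A j (g n i) * dI j n i)
      + (\<Sum>i<2 ^ k n. \<Sum>j\<in>UNIV. \<Sum>m\<in>UNIV. H j m (g n i) * (dx j n i * dx m n i))
      + (\<Sum>i<2 ^ k n. \<Sum>j\<in>UNIV. (\<Psi>1 j (x (g n i)) \<bullet> dw n i) * dx j n i) + (\<Sum>i<2 ^ k n. rem n i)"
      by (simp only: sum.distrib sum_subtractf)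
    also have "(\<Sum>i<2 ^ k n. \<Sum>j\<in>UNIV. A j (g n i) * df j n i) = (\<Sum>j\<in>UNIV. \<Sum>i<2 ^ k n. A j (g n i) * df j n i)"
      by (rule sum.swap)
    also have "(\<Sum>i<2 ^ k n. \<Sum>j\<in>UNIV. A j (g n i) * dI j n i) = (\<Sum>j\<in>UNIV. \<Sum>i<2 ^ k n. A j (g n i) * dI j n i)"
      by (rule sum.swap)
    also have "(\<Sum>i<2 ^ k n. \<Sum>j\<in>UNIV. (\<Psi>1 j (x (g n i)) \<bullet> dw n i) * dx j n i) = (\<Sum>j\<in>UNIV. \<Sum>i<2 ^ k n. (\<Psi>1 j (x (g n i)) \<bullet> dw n i) * dx j n i)"
      by (rule sum.swap)
    also have "(\<Sum>i<2 ^ k n. \<Sum>j\<in>UNIV. \<Sum>m\<in>UNIV. H j m (g n i) * (dx j n i * dx m n i))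
      = (\<Sum>j\<in>UNIV. \<Sum>m\<in>UNIV. \<Sum>i<2 ^ k n. H j m (g n i) * (dx j n i * dx m n i))"
      by (subst sum.swap, rule sum.cong[OF refl], rule sum.swap)
    finally show ?thesis by linarith
  qed
  have df_lim: "(\<lambda>n. \<Sum>i<2 ^ k n. A j (g n i) * df j n i) \<longlonglongrightarrow> (LINT s:{0..T}|lborel. A j s * f j s)" for j
    using riemann_inner[OF Ac[of j] f[of j]] by simp
  have "(\<lambda>n. \<Psi> (x T) \<bullet> v T - \<Psi> (x 0) \<bullet> v 0 - (\<Sum>i<2 ^ k n. \<Psi> (x (g n i)) \<bullet> L n i)
      + (\<Sum>j\<in>UNIV. \<Sum>i<2 ^ k n. A j (g n i) * df j n i)
      - (\<Sum>j\<in>UNIV. \<Sum>m\<in>UNIV. \<Sum>i<2 ^ k n. H j m (g n i) * (dx j n i * dx m n i))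
      - (\<Sum>j\<in>UNIV. \<Sum>i<2 ^ k n. (\<Psi>1 j (x (g n i)) \<bullet> dw n i) * dx j n i) - (\<Sum>i<2 ^ k n. rem n i)) \<longlonglongrightarrow>
    \<Psi> (x T) \<bullet> v T - \<Psi> (x 0) \<bullet> v 0 - (LINT s:{0..T}|lborel. \<Psi> (x s) \<bullet> drift s)
      + (\<Sum>j\<in>UNIV. LINT s:{0..T}|lborel. A j s * f j s)
      - (\<Sum>j\<in>UNIV. \<Sum>m\<in>UNIV. LINT s:{0..T}|lborel. H j m s * (Q (\<sigma> j s) \<bullet> \<sigma> m s))
      - (\<Sum>j\<in>UNIV. LINT s:{0..T}|lborel. Q (\<Psi>1 j (x s)) \<bullet> \<sigma> j s) - 0"
    unfolding L_def
    by (intro tendsto_diff tendsto_add tendsto_const tendsto_sum riemann_inner[OF Pc l] df_lim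
        covariation_dx_dx[OF Hc] covariation_dw_dx[OF P1c] rem_lim)
  then show ?thesis by (simp only: total diff_zero)
qed

text \<open>The case of \<open>ito_product\<close> with constant \<open>\<Psi>\<close> and \<open>v = w - w 0 - G \<circ> x\<close>.\<close>

lemma ito_formula:
  fixes G :: "real^2 \<Rightarrow> 'h"
  assumes c2: "c2map D G G1 G2" and D: "\<forall>t\<in>{0..T}. x t \<in> D"
  shows "(\<lambda>n. \<Sum>j\<in>UNIV. \<Sum>i<2 ^ k n. (h \<bullet> G1 j (x (g n i))) * dI j n i) \<longlonglongrightarrow>
    h \<bullet> G (x T) - h \<bullet> G (x 0) - (\<Sum>j\<in>UNIV. LINT s:{0..T}|lborel. (h \<bullet> G1 j (x s)) * f j s)
      - (1/2) * (\<Sum>j\<in>UNIV. \<Sum>m\<in>UNIV. LINT s:{0..T}|lborel. (h \<bullet> G2 j m (x s)) * (Q (\<sigma> j s) \<bullet> \<sigma> m s))"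
proof -
  have c0: "c2map D (\<lambda>_. h) (\<lambda>_ _. 0) (\<lambda>_ _ _. 0)" by (auto simp: c2map_def intro: exI[of _ 1])
  have Gc: "continuous_on {0..T} (\<lambda>t. G (x t))"
    by (rule continuous_on_compose2[of D G]) (use c2 x D in \<open>auto simp: c2map_def\<close>)
  have vc: "continuous_on {0..T} (\<lambda>t. w t - w 0 - G (x t))" by (intro continuous_intros w Gc)
  have Q0: "Q 0 = 0" using Q_lin by (rule bounded_linear.linear[THEN linear_0])
  \<comment> \<open>With constant first factor, \<open>H\<close> reduces to minus one half of the
    inner product with the second derivative of \<open>G\<close>.\<close>
  have half: "(LINT s:{0..T}|lborel. ((1/2) * (u s \<bullet> 0) - (1/2) * a s - 0 \<bullet> c s) * b s)
      = (- 1 / 2) * (LINT s:{0..T}|lborel. a s * b s)" for a b :: "real \<Rightarrow> real" and u c :: "real \<Rightarrow> 'h"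
  proof -
    have "((1/2) * (u s \<bullet> 0) - (1/2) * a s - 0 \<bullet> c s) * b s = (- 1 / 2) * (a s * b s)" for s by simp
    then show ?thesis by (simp only: set_integral_mult_right)
  qed
  have dw: "(\<Sum>i<2 ^ k n. h \<bullet> dw n i) = h \<bullet> w T - h \<bullet> w 0" for n
    using sum_telescope_grid[of "\<lambda>t. h \<bullet> w t" "k n"] by (simp add: inner_diff_right)
  define R where "R n = (\<Sum>j\<in>UNIV. \<Sum>i<2 ^ k n. (h \<bullet> G1 j (x (g n i))) * dI j n i)" for n
  define S where "S = (\<Sum>j\<in>UNIV. LINT s:{0..T}|lborel. (h \<bullet> G1 j (x s)) * f j s)"
  define S2 where "S2 j m = (LINT s:{0..T}|lborel. (h \<bullet> G2 j m (x s)) * (Q (\<sigma> j s) \<bullet> \<sigma> m s))" for j m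
  have v_eq: "\<forall>t\<in>{0..T}. (w t - w 0 - G (x t)) + G (x t)
      = (w 0 - w 0 - G (x 0)) + G (x 0) + (LINT s:{0..t}|lborel. 0) + w t - w 0" by simp
  have "(\<lambda>n. (h \<bullet> w T - h \<bullet> w 0) - R n) \<longlonglongrightarrow> h \<bullet> (w T - w 0 - G (x T)) - h \<bullet> (w 0 - w 0 - G (x 0)) - 0 + S
      - (\<Sum>j\<in>UNIV. \<Sum>m\<in>UNIV. (- 1 / 2) * S2 j m) - 0"
    using ito_product[OF c0 c2 D vc _ v_eq] unfolding half
    by (simp add: set_integrable_def dw Q0 R_def S_def S2_def)
  also have "h \<bullet> (w T - w 0 - G (x T)) - h \<bullet> (w 0 - w 0 - G (x 0)) - 0 + S - (\<Sum>j\<in>UNIV. \<Sum>m\<in>UNIV. (- 1 / 2) * S2 j m) - 0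
      = (h \<bullet> w T - h \<bullet> w 0) - (h \<bullet> G (x T) - h \<bullet> G (x 0) - S - (1/2) * (\<Sum>j\<in>UNIV. \<Sum>m\<in>UNIV. S2 j m))"
    by (simp add: inner_diff_right sum_distrib_left sum_negf)
  finally have lim: "(\<lambda>n. (h \<bullet> w T - h \<bullet> w 0) - R n) \<longlonglongrightarrow> (h \<bullet> w T - h \<bullet> w 0)
      - (h \<bullet> G (x T) - h \<bullet> G (x 0) - S - (1/2) * (\<Sum>j\<in>UNIV. \<Sum>m\<in>UNIV. S2 j m))" .
  have "R \<longlonglongrightarrow> h \<bullet> G (x T) - h \<bullet> G (x 0) - S - (1/2) * (\<Sum>j\<in>UNIV. \<Sum>m\<in>UNIV. S2 j m)"
    using tendsto_diff[OF tendsto_const[of "h \<bullet> w T - h \<bullet> w 0"] lim] by (simp add: algebra_simps)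
  then show ?thesis unfolding R_def[abs_def] S_def S2_def .
qed

end

section \<open>The Cahn-Hilliard operator on sums\<close>

lemma has_derivative_cong_open:
  assumes "open S" "x \<in> S" "\<And>y. y \<in> S \<Longrightarrow> f y = g y"
  shows "(f has_derivative f') (at x) \<longleftrightarrow> (g has_derivative f') (at x)"
  using has_derivative_transform_within_open[of f f' x UNIV S g] has_derivative_transform_within_open[of g f' x UNIV S f] assms
  by auto

lemma differentiable_cong_open:
  assumes "open S" "x \<in> S" "\<And>y. y \<in> S \<Longrightarrow> f y = g y"
  shows "f differentiable (at x) \<longleftrightarrow> g differentiable (at x)"
  using has_derivative_cong_open[of S x f g, OF assms] unfolding differentiable_def by blast

lemma pdir_cong_open:
  assumes "open S" "x \<in> S" "\<And>y. y \<in> S \<Longrightarrow> f y = g y"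
  shows "pdir b f x = pdir b g x"
  unfolding pdir_def frechet_derivative_def using has_derivative_cong_open[of S x f g, OF assms] by simp

lemma pdir_eqI: "(f has_derivative f') (at x) \<Longrightarrow> pdir b f x = f' b"
  unfolding pdir_def using frechet_derivative_at by metis

lemma pdir_has_derivative:
  "f differentiable (at x) \<Longrightarrow> (f has_derivative frechet_derivative f (at x)) (at x)"
  by (simp add: frechet_derivative_works)

lemma pdir_add:
  assumes "f differentiable (at x)" "g differentiable (at x)"
  shows "pdir b (\<lambda>y. f y + g y) x = pdir b f x + pdir b g x"
  using pdir_eqI[OF has_derivative_add[OF pdir_has_derivative[OF assms(1)] pdir_has_derivative[OF assms(2)]]]
  by (simp add: pdir_def)

lemma pdir_mult:
  assumes "f differentiable (at x)" "g differentiable (at x)"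
  shows "pdir b (\<lambda>y. f y * g y) x = f x * pdir b g x + pdir b f x * g x"
  using pdir_eqI[OF has_derivative_mult[OF pdir_has_derivative[OF assms(1)] pdir_has_derivative[OF assms(2)]]]
  by (simp add: pdir_def)

lemma pdir_const [simp]: "pdir b (\<lambda>y. c) x = 0"
  by (rule pdir_eqI[OF has_derivative_const])

text \<open>The regularity under which the Laplacian is additive point by point. It is closed under
  products and so passes to polynomials in regular functions, which is how the potential
  enters.\<close>

definition twice_diff :: "(real^2) set \<Rightarrow> (real^2 \<Rightarrow> real) \<Rightarrow> bool" where
  "twice_diff \<Omega> f \<longleftrightarrow> (\<forall>x\<in>\<Omega>. f differentiable (at x) \<and> (\<forall>b\<in>Basis. pdir b f differentiable (at x)))"

lemma twice_diff_add:
  assumes "open \<Omega>" "twice_diff \<Omega> f" "twice_diff \<Omega> g"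
  shows "twice_diff \<Omega> (\<lambda>x. f x + g x)"
  unfolding twice_diff_def
proof (intro ballI conjI)
  fix x assume x: "x \<in> \<Omega>"
  show "(\<lambda>x. f x + g x) differentiable (at x)"
    using assms x unfolding twice_diff_def by (intro differentiable_add) auto
  fix b :: "real^2" assume b: "b \<in> Basis"
  have d: "(\<lambda>x. pdir b f x + pdir b g x) differentiable (at x)"
    using assms x b unfolding twice_diff_def by (intro differentiable_add) auto
  have e: "pdir b (\<lambda>x. f x + g x) y = pdir b f y + pdir b g y" if "y \<in> \<Omega>" for y
    using assms that unfolding twice_diff_def by (intro pdir_add) auto
  show "pdir b (\<lambda>x. f x + g x) differentiable (at x)"
    by (rule differentiable_cong_open[OF assms(1) x, THEN iffD2, OF e d])
qed

lemma twice_diff_mult: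
  assumes "open \<Omega>" "twice_diff \<Omega> f" "twice_diff \<Omega> g"
  shows "twice_diff \<Omega> (\<lambda>x. f x * g x)"
  unfolding twice_diff_def
proof (intro ballI conjI)
  fix x assume x: "x \<in> \<Omega>"
  show "(\<lambda>x. f x * g x) differentiable (at x)"
    using assms x unfolding twice_diff_def by (intro differentiable_mult) auto
  fix b :: "real^2" assume b: "b \<in> Basis"
  have d: "(\<lambda>x. f x * pdir b g x + pdir b f x * g x) differentiable (at x)"
    using assms x b unfolding twice_diff_def by (intro differentiable_add differentiable_mult) auto
  have e: "pdir b (\<lambda>x. f x * g x) y = f y * pdir b g y + pdir b f y * g y" if "y \<in> \<Omega>" for y
    using assms that unfolding twice_diff_def by (intro pdir_mult) auto
  show "pdir b (\<lambda>x. f x * g x) differentiable (at x)"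
    by (rule differentiable_cong_open[OF assms(1) x, THEN iffD2, OF e d])
qed

lemma twice_diff_const: "twice_diff \<Omega> (\<lambda>x. c)"
proof -
  have "pdir b (\<lambda>x::real^2. c) = (\<lambda>x. 0)" for b by (rule ext) simp
  then show ?thesis by (simp add: twice_diff_def)
qed

lemma axis_in_Basis: "axis j (1::real) \<in> Basis"
  by (simp add: axis_in_Basis_iff)

lemma lap_add:
  assumes "open \<Omega>" "twice_diff \<Omega> f" "twice_diff \<Omega> g" "x \<in> \<Omega>"
  shows "lap (\<lambda>x. f x + g x) x = lap f x + lap g x"
proof -
  have "pdir b (pdir b (\<lambda>x. f x + g x)) x = pdir b (pdir b f) x + pdir b (pdir b g) x" if b: "b \<in> Basis" for b
  proof -
    have "pdir b (pdir b (\<lambda>x. f x + g x)) x = pdir b (\<lambda>x. pdir b f x + pdir b g x) x"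
      using assms unfolding twice_diff_def by (intro pdir_cong_open[OF assms(1,4)] pdir_add) auto
    also have "\<dots> = pdir b (pdir b f) x + pdir b (pdir b g) x"
      using assms b unfolding twice_diff_def by (intro pdir_add) auto
    finally show ?thesis .
  qed
  then show ?thesis unfolding lap_def by (simp add: axis_in_Basis sum.distrib)
qed

lemma lap_cong_open:
  assumes "open \<Omega>" "x \<in> \<Omega>" "\<And>y. y \<in> \<Omega> \<Longrightarrow> f y = g y"
  shows "lap f x = lap g x"
proof -
  have "pdir b (pdir b f) x = pdir b (pdir b g) x" for b
    by (intro pdir_cong_open[OF assms(1)] assms)
  then show ?thesis by (simp add: lap_def)
qed

lemma pds_Cons: "pds (b # bs) f = pdir b (pds bs f)"
  by (simp add: pds_def)

lemma pds_Nil [simp]: "pds [] f = f"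
  by (simp add: pds_def)

lemma Ck_closure_differentiable:
  "Ck_closure k \<Omega> f \<Longrightarrow> bs \<in> lists Basis \<Longrightarrow> length bs < k \<Longrightarrow> x \<in> \<Omega> \<Longrightarrow> pds bs f differentiable (at x)"
  unfolding Ck_closure_def by blast

lemma Ck_closure_twice_diff:
  assumes "Ck_closure k \<Omega> f" "bs \<in> lists Basis" "length bs + 2 \<le> k"
  shows "twice_diff \<Omega> (pds bs f)"
  unfolding twice_diff_def pds_Cons[symmetric]
  using Ck_closure_differentiable[OF assms(1)] assms(2,3) by auto

lemma lap_pds: "lap f = (\<lambda>x. \<Sum>j\<in>UNIV. pds [axis j 1, axis j 1] f x)"
  by (simp add: lap_def pds_Cons)

lemma twice_diff_sum:
  assumes "open \<Omega>" "finite A" "\<And>a. a \<in> A \<Longrightarrow> twice_diff \<Omega> (f a)"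
  shows "twice_diff \<Omega> (\<lambda>x. \<Sum>a\<in>A. f a x)"
  using assms(2,3) by (induction A rule: finite_induct) (auto intro: twice_diff_const twice_diff_add[OF assms(1)])

lemma Ck_closure_lap:
  assumes "open \<Omega>" "Ck_closure 4 \<Omega> f"
  shows "twice_diff \<Omega> (lap f)"
  unfolding lap_pds
  by (intro twice_diff_sum[OF assms(1)] Ck_closure_twice_diff[OF assms(2)]) (auto simp: axis_in_Basis)

lemma F1_eq: "F1 u = u ^ 3 - u"
proof -
  have "(F_pot has_real_derivative (u ^ 3 - u)) (at u)"
    unfolding F_pot_def by (auto intro!: derivative_eq_intros simp: power2_eq_square power3_eq_cube field_simps)
  then show ?thesis unfolding F1_def by (rule DERIV_imp_deriv)
qed

lemma F2_eq: "F2 u = 3 * u\<^sup>2 - 1"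
proof -
  have "(F1 has_real_derivative (3 * u\<^sup>2 - 1)) (at u)"
    unfolding F1_eq[abs_def] by (auto intro!: derivative_eq_intros)
  then show ?thesis unfolding F2_def by (rule DERIV_imp_deriv)
qed

text \<open>The potential is quartic, so its derivative at a sum expands exactly, and each of the
  three brackets under the outer Laplacian is a polynomial in the two functions and their
  Laplacians. These are twice differentiable by the C^4 assumption, and the outer Laplacian
  splits.\<close>

lemma CH_op_split:
  assumes \<Omega>: "open \<Omega>" and \<Phi>: "Ck_closure 4 \<Omega> \<Phi>" and v: "Ck_closure 4 \<Omega> v" and x: "x \<in> \<Omega>"
  shows "CH_op \<epsilon> (\<lambda>x. \<Phi> x + v x) x = CH_op \<epsilon> \<Phi> x + CH_lin \<epsilon> \<Phi> v x + CH_nonlin \<Phi> v x"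
proof -
  note add = twice_diff_add[OF \<Omega>] and mult = twice_diff_mult[OF \<Omega>]
  have P: "twice_diff \<Omega> \<Phi>" and V: "twice_diff \<Omega> v"
    using Ck_closure_twice_diff[OF \<Phi>, of "[]"] Ck_closure_twice_diff[OF v, of "[]"] by auto
  have LP: "twice_diff \<Omega> (lap \<Phi>)" and LV: "twice_diff \<Omega> (lap v)"
    by (rule Ck_closure_lap[OF \<Omega> \<Phi>], rule Ck_closure_lap[OF \<Omega> v])
  define a where "a = (\<lambda>x. - \<epsilon>\<^sup>2 * lap \<Phi> x + F1 (\<Phi> x))"
  define b where "b = (\<lambda>x. - \<epsilon>\<^sup>2 * lap v x + F2 (\<Phi> x) * v x)"
  define c where "c = (\<lambda>x. F1 (\<Phi> x + v x) - F1 (\<Phi> x) - F2 (\<Phi> x) * v x)"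
  have a: "twice_diff \<Omega> a"
  proof -
    have "a = (\<lambda>x. - \<epsilon>\<^sup>2 * lap \<Phi> x + (\<Phi> x * (\<Phi> x * \<Phi> x) + (- 1) * \<Phi> x))"
      by (simp add: a_def F1_eq power3_eq_cube fun_eq_iff)
    then show ?thesis by (simp only:) (intro add mult P LP twice_diff_const)
  qed
  have b: "twice_diff \<Omega> b"
  proof -
    have "b = (\<lambda>x. - \<epsilon>\<^sup>2 * lap v x + (3 * (\<Phi> x * \<Phi> x) + (- 1)) * v x)"
      by (simp add: b_def F2_eq power2_eq_square fun_eq_iff)
    then show ?thesis by (simp only:) (intro add mult P V LV twice_diff_const)
  qed
  have c: "twice_diff \<Omega> c"
  proof -
    have "c = (\<lambda>x. 3 * (\<Phi> x * (v x * v x)) + v x * (v x * v x))"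
      by (simp add: c_def F1_eq F2_eq power2_eq_square power3_eq_cube fun_eq_iff algebra_simps)
    then show ?thesis by (simp only:) (intro add mult P V twice_diff_const)
  qed
  have "CH_op \<epsilon> (\<lambda>x. \<Phi> x + v x) x = lap (\<lambda>x. a x + (b x + c x)) x"
    unfolding CH_op_def
  proof (rule lap_cong_open[OF \<Omega> x])
    fix y assume "y \<in> \<Omega>"
    then have "lap (\<lambda>x. \<Phi> x + v x) y = lap \<Phi> y + lap v y" by (rule lap_add[OF \<Omega> P V])
    then show "- \<epsilon>\<^sup>2 * lap (\<lambda>x. \<Phi> x + v x) y + F1 (\<Phi> y + v y) = a y + (b y + c y)"
      by (simp add: a_def b_def c_def algebra_simps)
  qed
  also have "\<dots> = lap a x + (lap b x + lap c x)"
    using lap_add[OF \<Omega> a add[OF b c] x] lap_add[OF \<Omega> b c x] by simp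
  finally show ?thesis by (simp add: CH_op_def CH_lin_def CH_nonlin_def a_def b_def c_def)
qed

section \<open>Sums of functions with Neumann conditions\<close>

lemma extends_continuously_add:
  "extends_continuously \<Omega> f \<Longrightarrow> extends_continuously \<Omega> g \<Longrightarrow> extends_continuously \<Omega> (\<lambda>x. f x + g x)"
  unfolding extends_continuously_def
  by (elim exE, rename_tac f' g', rule_tac x="\<lambda>x. f' x + g' x" in exI) (auto intro: continuous_intros)

lemma extends_continuously_cmult:
  "extends_continuously \<Omega> f \<Longrightarrow> extends_continuously \<Omega> (\<lambda>x. c * f x)"
  unfolding extends_continuously_def
  by (elim exE, rename_tac f', rule_tac x="\<lambda>x. c * f' x" in exI) (auto intro: continuous_intros)

lemma extends_continuously_cong:
  "(\<And>x. x \<in> \<Omega> \<Longrightarrow> f x = g x) \<Longrightarrow> extends_continuously \<Omega> f \<longleftrightarrow> extends_continuously \<Omega> g"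
  unfolding extends_continuously_def by auto

lemma pds_add:
  assumes \<Omega>: "open \<Omega>" and f: "Ck_closure k \<Omega> f" and g: "Ck_closure k \<Omega> g"
  shows "bs \<in> lists Basis \<Longrightarrow> length bs \<le> k \<Longrightarrow> x \<in> \<Omega> \<Longrightarrow> pds bs (\<lambda>x. f x + g x) x = pds bs f x + pds bs g x"
proof (induction bs arbitrary: x)
  case (Cons b bs)
  have "pds (b # bs) (\<lambda>x. f x + g x) x = pdir b (\<lambda>x. pds bs f x + pds bs g x) x"
    unfolding pds_Cons using Cons by (intro pdir_cong_open[OF \<Omega>]) auto
  also have "\<dots> = pdir b (pds bs f) x + pdir b (pds bs g) x"
    using Cons.prems Ck_closure_differentiable[OF f] Ck_closure_differentiable[OF g] by (intro pdir_add) auto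
  finally show ?case by (simp add: pds_Cons)
qed simp

text \<open>The derivatives of a sum split only at points of the open domain, and the functions are
  arbitrary outside. Therefore all comparisons are congruences on an open set.\<close>

lemma Ck_closure_add:
  fixes f g :: "'a::euclidean_space \<Rightarrow> real"
  assumes \<Omega>: "open \<Omega>" and f: "Ck_closure k \<Omega> f" and g: "Ck_closure k \<Omega> g"
  shows "Ck_closure k \<Omega> (\<lambda>x. f x + g x)"
  unfolding Ck_closure_def
proof (intro ballI conjI impI)
  fix bs :: "'a list" assume bs: "bs \<in> lists Basis"
  note eq = pds_add[OF \<Omega> f g bs]
  show "extends_continuously \<Omega> (pds bs (\<lambda>x. f x + g x))" if "length bs \<le> k"
  proof -
    have "extends_continuously \<Omega> (\<lambda>x. pds bs f x + pds bs g x)"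
      using f g bs that unfolding Ck_closure_def by (intro extends_continuously_add) auto
    moreover have "extends_continuously \<Omega> (pds bs (\<lambda>x. f x + g x)) \<longleftrightarrow> extends_continuously \<Omega> (\<lambda>x. pds bs f x + pds bs g x)"
      by (rule extends_continuously_cong) (rule eq[OF that])
    ultimately show ?thesis by simp
  qed
  fix x assume l: "length bs < k" and x: "x \<in> \<Omega>"
  have "(\<lambda>x. pds bs f x + pds bs g x) differentiable (at x)"
    using f g bs l x by (intro differentiable_add Ck_closure_differentiable)
  moreover have "pds bs (\<lambda>x. f x + g x) differentiable (at x) \<longleftrightarrow> (\<lambda>x. pds bs f x + pds bs g x) differentiable (at x)"
    by (rule differentiable_cong_open[OF \<Omega> x]) (rule eq[OF less_imp_le[OF l]])
  ultimately show "pds bs (\<lambda>x. f x + g x) differentiable (at x)" by simp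
qed

lemma normal_deriv_zero_cong:
  assumes \<Omega>: "open \<Omega>" and "\<And>x. x \<in> \<Omega> \<Longrightarrow> f x = g x"
  shows "normal_deriv_zero \<Omega> f \<longleftrightarrow> normal_deriv_zero \<Omega> g"
proof -
  have "grad f y = grad g y" if "y \<in> \<Omega>" for y
    unfolding grad_def using pdir_cong_open[OF \<Omega> that assms(2)] by (simp add: vec_eq_iff)
  then have "((\<lambda>y. grad f y \<bullet> n) \<longlongrightarrow> 0) (at x within \<Omega>) \<longleftrightarrow> ((\<lambda>y. grad g y \<bullet> n) \<longlongrightarrow> 0) (at x within \<Omega>)" for x n
    by (intro Lim_cong_within) auto
  then show ?thesis by (simp add: normal_deriv_zero_def)
qed

lemma normal_deriv_zero_add:
  assumes f: "normal_deriv_zero \<Omega> f" "\<And>x. x \<in> \<Omega> \<Longrightarrow> f differentiable (at x)"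
    and g: "normal_deriv_zero \<Omega> g" "\<And>x. x \<in> \<Omega> \<Longrightarrow> g differentiable (at x)"
  shows "normal_deriv_zero \<Omega> (\<lambda>x. f x + g x)"
  unfolding normal_deriv_zero_def
proof (intro ballI allI impI)
  fix x n assume xn: "x \<in> frontier \<Omega>" "outer_normal \<Omega> x n"
  have "((\<lambda>y. grad f y \<bullet> n + grad g y \<bullet> n) \<longlongrightarrow> 0 + 0) (at x within \<Omega>)"
    using f(1) g(1) xn unfolding normal_deriv_zero_def by (intro tendsto_add) auto
  moreover have "grad (\<lambda>x. f x + g x) y = grad f y + grad g y" if "y \<in> \<Omega>" for y
    unfolding grad_def using pdir_add[OF f(2)[OF that] g(2)[OF that]] by (simp add: vec_eq_iff)
  then have "((\<lambda>y. grad f y \<bullet> n + grad g y \<bullet> n) \<longlongrightarrow> 0) (at x within \<Omega>)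
    \<longleftrightarrow> ((\<lambda>y. grad (\<lambda>x. f x + g x) y \<bullet> n) \<longlongrightarrow> 0) (at x within \<Omega>)"
    by (intro Lim_cong_within) (auto simp: inner_add_left)
  ultimately show "((\<lambda>y. grad (\<lambda>x. f x + g x) y \<bullet> n) \<longlongrightarrow> 0) (at x within \<Omega>)" by simp
qed

lemma neumann_C4_add:
  assumes \<Omega>: "open \<Omega>" and f: "neumann_C4 \<Omega> f" and g: "neumann_C4 \<Omega> g"
  shows "neumann_C4 \<Omega> (\<lambda>x. f x + g x)"
  unfolding neumann_C4_def
proof (intro conjI)
  have cf: "Ck_closure 4 \<Omega> f" and cg: "Ck_closure 4 \<Omega> g" using f g by (auto simp: neumann_C4_def)
  have tf: "twice_diff \<Omega> f" and tg: "twice_diff \<Omega> g"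
    using Ck_closure_twice_diff[OF cf, of "[]"] Ck_closure_twice_diff[OF cg, of "[]"] by auto
  note lf = Ck_closure_lap[OF \<Omega> cf] and lg = Ck_closure_lap[OF \<Omega> cg]
  show "Ck_closure 4 \<Omega> (\<lambda>x. f x + g x)" by (rule Ck_closure_add[OF \<Omega> cf cg])
  show "normal_deriv_zero \<Omega> (\<lambda>x. f x + g x)"
    using f g tf tg by (intro normal_deriv_zero_add) (auto simp: neumann_C4_def twice_diff_def)
  have "normal_deriv_zero \<Omega> (\<lambda>x. lap f x + lap g x)"
    using f g lf lg by (intro normal_deriv_zero_add) (auto simp: neumann_C4_def twice_diff_def)
  moreover have "normal_deriv_zero \<Omega> (lap (\<lambda>x. f x + g x)) \<longleftrightarrow> normal_deriv_zero \<Omega> (\<lambda>x. lap f x + lap g x)"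
    by (rule normal_deriv_zero_cong[OF \<Omega>]) (rule lap_add[OF \<Omega> tf tg])
  ultimately show "normal_deriv_zero \<Omega> (lap (\<lambda>x. f x + g x))" by simp
qed

section \<open>Families of functions as maps into the negative Sobolev space\<close>

lemma dxi_line_derivative:
  assumes "(\<lambda>\<eta>. h \<eta> x) differentiable (at (y + s *\<^sub>R d))"
  shows "((\<lambda>s. h (y + s *\<^sub>R d) x) has_real_derivative (\<Sum>j\<in>UNIV. d $ j * dxi j h (y + s *\<^sub>R d) x)) (at s)"
proof -
  let ?p = "y + s *\<^sub>R d" and ?D = "frechet_derivative (\<lambda>\<eta>. h \<eta> x) (at (y + s *\<^sub>R d))"
  have D: "((\<lambda>\<eta>. h \<eta> x) has_derivative ?D) (at ?p)" by (rule pdir_has_derivative[OF assms])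
  have lin: "linear ?D" using D by (rule has_derivative_linear)
  have "((\<lambda>s. y + s *\<^sub>R d) has_derivative (\<lambda>r. r *\<^sub>R d)) (at s)" by (auto intro!: derivative_eq_intros)
  from has_derivative_compose[OF this D] have "((\<lambda>s. h (y + s *\<^sub>R d) x) has_derivative (\<lambda>r. ?D (r *\<^sub>R d))) (at s)" .
  moreover have "?D (r *\<^sub>R d) = (\<Sum>j\<in>UNIV. d $ j * dxi j h ?p x) * r" for r
  proof -
    have "d = (\<Sum>j\<in>UNIV. d $ j *\<^sub>R axis j 1)" using basis_expansion[of d] by (simp add: scalar_mult_eq_scaleR)
    then have "?D d = (\<Sum>j\<in>UNIV. d $ j * ?D (axis j 1))"
      using linear_sum[OF lin, of "\<lambda>j. d $ j *\<^sub>R axis j 1" UNIV] by (simp add: linear_cmul[OF lin])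
    then show ?thesis by (simp add: linear_cmul[OF lin] dxi_def pdir_def mult.commute)
  qed
  ultimately show ?thesis by (simp add: has_field_derivative_def)
qed

text \<open>Maclaurin's formula along the segment from \<open>y\<close> to \<open>z\<close>. The
  intermediate point depends on x; uniformity in x is recovered in
  \<open>C2_family_remainder\<close>.\<close>

lemma dxi_taylor:
  assumes S: "convex S" "y \<in> S" "z \<in> S"
    and d1: "\<And>p. p \<in> S \<Longrightarrow> (\<lambda>\<eta>. h \<eta> x) differentiable (at p)"
    and d2: "\<And>p k. p \<in> S \<Longrightarrow> (\<lambda>\<eta>. dxi k h \<eta> x) differentiable (at p)"
  shows "\<exists>p\<in>S. h z x = h y x + (\<Sum>j\<in>UNIV. (z $ j - y $ j) * dxi j h y x)
    + (1/2) * (\<Sum>j\<in>UNIV. \<Sum>k\<in>UNIV. (z $ j - y $ j) * (z $ k - y $ k) * dxi j (dxi k h) p x)"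
proof -
  define d where "d = z - y"
  have pS: "y + s *\<^sub>R d \<in> S" if "0 \<le> s" "s \<le> 1" for s
  proof -
    have "y + s *\<^sub>R d = (1 - s) *\<^sub>R y + s *\<^sub>R z" by (simp add: d_def algebra_simps)
    then show ?thesis using S that by (simp add: convexD_alt)
  qed
  \<comment> \<open>The function restricted to the segment, followed by its first and second
    derivatives along it.\<close>
  define \<phi> where "\<phi> m s = (if m = 0 then h (y + s *\<^sub>R d) x
    else if m = 1 then (\<Sum>k\<in>UNIV. d $ k * dxi k h (y + s *\<^sub>R d) x)
    else (\<Sum>k\<in>UNIV. d $ k * (\<Sum>j\<in>UNIV. d $ j * dxi j (dxi k h) (y + s *\<^sub>R d) x)))" for m :: nat and s
  have "\<exists>t::real. 0 < t \<and> t < 1 \<and> \<phi> 0 1 = (\<Sum>m<2. \<phi> m 0 / fact m * 1 ^ m) + \<phi> 2 t / fact 2 * 1 ^ 2"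
  proof (rule Maclaurin)
    show "\<forall>m t. m < 2 \<and> 0 \<le> t \<and> t \<le> 1 \<longrightarrow> DERIV (\<phi> m) t :> \<phi> (Suc m) t"
    proof (intro allI impI)
      fix m :: nat and t :: real assume m: "m < 2 \<and> 0 \<le> t \<and> t \<le> 1"
      then consider "m = 0" | "m = 1" by linarith
      then show "DERIV (\<phi> m) t :> \<phi> (Suc m) t"
      proof cases
        case 1
        then show ?thesis unfolding \<phi>_def using dxi_line_derivative[of h x y t d, OF d1[OF pS]] m by simp
      next
        case 2
        have "DERIV (\<lambda>s. dxi k h (y + s *\<^sub>R d) x) t :> (\<Sum>j\<in>UNIV. d $ j * dxi j (dxi k h) (y + t *\<^sub>R d) x)" for k
          by (rule dxi_line_derivative[of "dxi k h" x y t d, OF d2[OF pS]]) (use m in auto)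
        then have "DERIV (\<lambda>s. \<Sum>k\<in>UNIV. d $ k * dxi k h (y + s *\<^sub>R d) x) t
          :> (\<Sum>k\<in>UNIV. d $ k * (\<Sum>j\<in>UNIV. d $ j * dxi j (dxi k h) (y + t *\<^sub>R d) x))"
          by (intro DERIV_sum DERIV_cmult)
        then show ?thesis using 2 unfolding \<phi>_def by simp
      qed
    qed
  qed auto
  then obtain t where t: "0 < t" "t < 1" "\<phi> 0 1 = (\<Sum>m<2. \<phi> m 0 / fact m * 1 ^ m) + \<phi> 2 t / fact 2 * 1 ^ 2"
    by blast
  have "h z x = h y x + (\<Sum>k\<in>UNIV. d $ k * dxi k h y x) + (1/2) * \<phi> 2 t"
    using t(3) by (simp add: \<phi>_def d_def numeral_2_eq_2)
  also have "\<phi> 2 t = (\<Sum>k\<in>UNIV. \<Sum>j\<in>UNIV. d $ j * d $ k * dxi j (dxi k h) (y + t *\<^sub>R d) x)"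
    unfolding \<phi>_def by (simp add: sum_distrib_left mult_ac)
  also have "\<dots> = (\<Sum>j\<in>UNIV. \<Sum>k\<in>UNIV. d $ j * d $ k * dxi j (dxi k h) (y + t *\<^sub>R d) x)" by (rule sum.swap)
  finally show ?thesis using pS[of t] t by (intro bexI[of _ "y + t *\<^sub>R d"]) (auto simp: d_def)
qed

lemma dxis_simps [simp]: "dxis [] g = g" "dxis (j # js) g = dxi j (dxis js g)"
  by (simp_all add: dxis_def)

lemma C2_family_dest:
  assumes "C2_family D \<Omega> g" "length js \<le> 2" "\<xi> \<in> D"
  shows "extends_continuously \<Omega> (dxis js g \<xi>)" "uniform_limit \<Omega> (dxis js g) (dxis js g \<xi>) (at \<xi>)"
    "length js < 2 \<Longrightarrow> x \<in> \<Omega> \<Longrightarrow> (\<lambda>\<eta>. dxis js g \<eta> x) differentiable (at \<xi>)"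
  using assms unfolding C2_family_def by auto

lemma dxis_add:
  assumes D: "open D" and u: "C2_family D \<Omega> u" and w: "C2_family D \<Omega> w" and x: "x \<in> \<Omega>"
  shows "length js \<le> 2 \<Longrightarrow> \<xi> \<in> D \<Longrightarrow> dxis js (\<lambda>\<xi> x. u \<xi> x + w \<xi> x) \<xi> x = dxis js u \<xi> x + dxis js w \<xi> x"
proof (induction js arbitrary: \<xi>)
  case (Cons j js)
  have "dxis (j # js) (\<lambda>\<xi> x. u \<xi> x + w \<xi> x) \<xi> x = pdir (axis j 1) (\<lambda>\<eta>. dxis js u \<eta> x + dxis js w \<eta> x) \<xi>"
    unfolding dxis_simps dxi_def[of j] using Cons by (intro pdir_cong_open[OF D]) auto
  also have "\<dots> = dxis (j # js) u \<xi> x + dxis (j # js) w \<xi> x"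
    unfolding dxis_simps dxi_def[of j] using Cons.prems C2_family_dest(3)[OF u _ _ _ x] C2_family_dest(3)[OF w _ _ _ x]
    by (intro pdir_add) auto
  finally show ?case .
qed simp

lemma C2_family_add:
  assumes D: "open D" and u: "C2_family D \<Omega> u" and w: "C2_family D \<Omega> w"
  shows "C2_family D \<Omega> (\<lambda>\<xi> x. u \<xi> x + w \<xi> x)"
  unfolding C2_family_def
proof (intro allI impI ballI conjI)
  let ?s = "\<lambda>\<xi> x. u \<xi> x + w \<xi> x"
  fix js \<xi> assume js: "length (js :: 2 list) \<le> 2" and xi: "\<xi> \<in> D"
  note eq = dxis_add[OF D u w _ js]
  note du = C2_family_dest[OF u js xi] and dw = C2_family_dest[OF w js xi]
  have "extends_continuously \<Omega> (dxis js ?s \<xi>) \<longleftrightarrow> extends_continuously \<Omega> (\<lambda>x. dxis js u \<xi> x + dxis js w \<xi> x)"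
    by (rule extends_continuously_cong) (rule eq[OF _ xi])
  then show "extends_continuously \<Omega> (dxis js ?s \<xi>)" using extends_continuously_add[OF du(1) dw(1)] by simp
  have ul: "uniform_limit \<Omega> (\<lambda>\<eta> x. dxis js u \<eta> x + dxis js w \<eta> x) (\<lambda>x. dxis js u \<xi> x + dxis js w \<xi> x) (at \<xi>)"
    by (rule uniform_limit_add[OF du(2) dw(2)])
  have ev: "\<forall>\<^sub>F \<eta> in at \<xi>. \<eta> \<in> D" using D xi by (rule eventually_at_in_open')
  show "uniform_limit \<Omega> (dxis js ?s) (dxis js ?s \<xi>) (at \<xi>)"
  proof (rule uniform_limit_cong[THEN iffD2, OF _ _ ul])
    show "\<forall>\<^sub>F \<eta> in at \<xi>. \<forall>x\<in>\<Omega>. dxis js ?s \<eta> x = dxis js u \<eta> x + dxis js w \<eta> x"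
      using ev by (rule eventually_mono) (use eq in blast)
  qed (rule eq[OF _ xi])
  fix x assume l: "length js < 2" and x: "x \<in> \<Omega>"
  have "(\<lambda>\<eta>. dxis js ?s \<eta> x) differentiable (at \<xi>) \<longleftrightarrow> (\<lambda>\<eta>. dxis js u \<eta> x + dxis js w \<eta> x) differentiable (at \<xi>)"
    by (rule differentiable_cong_open[OF D xi]) (rule eq[OF x])
  then show "(\<lambda>\<eta>. dxis js ?s \<eta> x) differentiable (at \<xi>)"
    using differentiable_add[OF du(3)[OF l x] dw(3)[OF l x]] by simp
qed

section \<open>The embedding of functions on a bounded domain\<close>

locale Hm1_space =
  fixes \<Omega> :: "(real^2) set" and \<iota> :: "(real^2 \<Rightarrow> real) \<Rightarrow> 'h::{real_inner,banach,second_countable_topology}"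
  assumes open_dom: "open \<Omega>" and bounded_dom: "bounded \<Omega>" and Hm1: "Hm1_0 \<Omega> \<iota>"
begin

definition vol :: real where "vol = measure lebesgue \<Omega>"

lemma lmeasurable_dom: "\<Omega> \<in> lmeasurable"
  using lmeasurable_open[OF bounded_dom open_dom] .

lemma finite_measure_dom: "finite_measure (lebesgue_on \<Omega>)"
  by (rule finite_measure_lebesgue_on[OF lmeasurable_dom])

lemma measure_dom: "measure (lebesgue_on \<Omega>) (space (lebesgue_on \<Omega>)) = vol"
  using lmeasurable_dom by (simp add: vol_def measure_restrict_space fmeasurableD)

lemma vol_nonneg: "0 \<le> vol"
  by (simp add: vol_def)

lemma extends_continuously_measurable:
  assumes "extends_continuously \<Omega> f"
  shows "f \<in> borel_measurable (lebesgue_on \<Omega>)" "\<exists>B. \<forall>x\<in>\<Omega>. \<bar>f x\<bar> \<le> B"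
proof -
  from assms obtain g where g: "continuous_on (closure \<Omega>) g" "\<forall>x\<in>\<Omega>. g x = f x"
    unfolding extends_continuously_def by blast
  have "continuous_on \<Omega> g" by (rule continuous_on_subset[OF g(1) closure_subset])
  then have "g \<in> borel_measurable (lebesgue_on \<Omega>)"
    using lmeasurable_dom by (intro continuous_imp_measurable_on_sets_lebesgue) auto
  then show "f \<in> borel_measurable (lebesgue_on \<Omega>)"
    by (rule measurable_cong[THEN iffD1, rotated]) (use g in auto)
  have "bounded (g ` closure \<Omega>)"
    using bounded_dom by (intro compact_imp_bounded compact_continuous_image g) (simp add: compact_closure)
  then obtain B where B: "\<forall>y\<in>g ` closure \<Omega>. norm y \<le> B" unfolding bounded_iff by blast
  have "\<bar>f x\<bar> \<le> B" if "x \<in> \<Omega>" for x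
  proof -
    have "x \<in> closure \<Omega>" using that closure_subset by blast
    then have "norm (g x) \<le> B" using B by blast
    then show ?thesis using g(2) that by simp
  qed
  then show "\<exists>B. \<forall>x\<in>\<Omega>. \<bar>f x\<bar> \<le> B" by blast
qed

lemma bounded_integrable:
  fixes f :: "real^2 \<Rightarrow> real"
  assumes "f \<in> borel_measurable (lebesgue_on \<Omega>)" "\<forall>x\<in>\<Omega>. \<bar>f x\<bar> \<le> B"
  shows "integrable (lebesgue_on \<Omega>) f" "integrable (lebesgue_on \<Omega>) (\<lambda>x. (f x)\<^sup>2)"
proof -
  interpret finite_measure "lebesgue_on \<Omega>" by (rule finite_measure_dom)
  show "integrable (lebesgue_on \<Omega>) f"
    by (rule integrable_const_bound[of _ B]) (use assms in \<open>auto intro!: AE_I2\<close>)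
  have "norm ((f x)\<^sup>2) \<le> B\<^sup>2" if "x \<in> \<Omega>" for x
    using power_mono[of "\<bar>f x\<bar>" B 2] assms(2) that by simp
  then show "integrable (lebesgue_on \<Omega>) (\<lambda>x. (f x)\<^sup>2)"
    by (intro integrable_const_bound[of _ "B\<^sup>2"] AE_I2 borel_measurable_power assms(1)) simp
qed

lemma extends_continuously_integrable: "extends_continuously \<Omega> f \<Longrightarrow> integrable (lebesgue_on \<Omega>) f"
proof -
  assume f: "extends_continuously \<Omega> f"
  obtain B where "\<forall>x\<in>\<Omega>. \<bar>f x\<bar> \<le> B" using extends_continuously_measurable(2)[OF f] by (elim exE)
  then show ?thesis by (rule bounded_integrable(1)[OF extends_continuously_measurable(1)[OF f]])
qed

lemma extends_continuously_L2: "extends_continuously \<Omega> f \<Longrightarrow> f \<in> L2 \<Omega>"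
proof -
  assume f: "extends_continuously \<Omega> f"
  obtain B where "\<forall>x\<in>\<Omega>. \<bar>f x\<bar> \<le> B" using extends_continuously_measurable(2)[OF f] by (elim exE)
  then show "f \<in> L2 \<Omega>"
    unfolding L2_def using extends_continuously_measurable(1)[OF f] bounded_integrable(2) by simp
qed

lemma int_dom_bound:
  assumes "integrable (lebesgue_on \<Omega>) f" "\<And>x. x \<in> \<Omega> \<Longrightarrow> \<bar>f x\<bar> \<le> c"
  shows "\<bar>int_dom \<Omega> f\<bar> \<le> c * vol"
proof -
  interpret finite_measure "lebesgue_on \<Omega>" by (rule finite_measure_dom)
  have "\<bar>int_dom \<Omega> f\<bar> \<le> (\<integral>x. \<bar>f x\<bar> \<partial>lebesgue_on \<Omega>)"
    unfolding int_dom_def using integral_norm_bound[of "lebesgue_on \<Omega>" f] by simp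
  also have "\<dots> \<le> (\<integral>x. c \<partial>lebesgue_on \<Omega>)"
    using assms by (intro integral_mono) (auto simp: fmeasurableD[OF lmeasurable_dom])
  also have "\<dots> = c * vol" using measure_dom by simp
  finally show ?thesis .
qed

lemma L2_0_I: "extends_continuously \<Omega> f \<Longrightarrow> int_dom \<Omega> f = 0 \<Longrightarrow> f \<in> L2_0 \<Omega>"
  by (simp add: L2_0_def extends_continuously_L2)

lemma iota_cong: "(\<And>x. x \<in> \<Omega> \<Longrightarrow> f x = g x) \<Longrightarrow> \<iota> f = \<iota> g"
proof -
  assume "\<And>x. x \<in> \<Omega> \<Longrightarrow> f x = g x"
  then have "AE x in lebesgue_on \<Omega>. f x = g x" by (intro AE_I2) simp
  then show ?thesis using Hm1 unfolding Hm1_0_def by blast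
qed

lemma iota_linear: "f \<in> L2_0 \<Omega> \<Longrightarrow> g \<in> L2_0 \<Omega> \<Longrightarrow> \<iota> (\<lambda>x. a * f x + b * g x) = a *\<^sub>R \<iota> f + b *\<^sub>R \<iota> g"
  using Hm1 unfolding Hm1_0_def by blast

lemma iota_add: "f \<in> L2_0 \<Omega> \<Longrightarrow> g \<in> L2_0 \<Omega> \<Longrightarrow> \<iota> (\<lambda>x. f x + g x) = \<iota> f + \<iota> g"
  using iota_linear[of f g 1 1] by simp

lemma iota_diff: "f \<in> L2_0 \<Omega> \<Longrightarrow> g \<in> L2_0 \<Omega> \<Longrightarrow> \<iota> (\<lambda>x. f x - g x) = \<iota> f - \<iota> g"
  using iota_linear[of f g 1 "-1"] by simp

lemma L2_sum_integrable:
  assumes "f \<in> L2 \<Omega>" "g \<in> L2 \<Omega>"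
  shows "integrable (lebesgue_on \<Omega>) f" "(\<lambda>x. a * f x + b * g x) \<in> L2 \<Omega>"
proof -
  interpret finite_measure "lebesgue_on \<Omega>" by (rule finite_measure_dom)
  have m: "f \<in> borel_measurable (lebesgue_on \<Omega>)" "g \<in> borel_measurable (lebesgue_on \<Omega>)"
    and i: "integrable (lebesgue_on \<Omega>) (\<lambda>x. (f x)\<^sup>2)" "integrable (lebesgue_on \<Omega>) (\<lambda>x. (g x)\<^sup>2)"
    using assms by (auto simp: L2_def)
  show "integrable (lebesgue_on \<Omega>) f" by (rule square_integrable_imp_integrable[OF m(1) i(1)])
  have "integrable (lebesgue_on \<Omega>) (\<lambda>x. (a * f x + b * g x)\<^sup>2)"
  proof (rule Bochner_Integration.integrable_bound)
    show "integrable (lebesgue_on \<Omega>) (\<lambda>x. 2 * a\<^sup>2 * (f x)\<^sup>2 + 2 * b\<^sup>2 * (g x)\<^sup>2)" using i by simp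
    show "(\<lambda>x. (a * f x + b * g x)\<^sup>2) \<in> borel_measurable (lebesgue_on \<Omega>)" using m by measurable
    show "AE x in lebesgue_on \<Omega>. norm ((a * f x + b * g x)\<^sup>2) \<le> norm (2 * a\<^sup>2 * (f x)\<^sup>2 + 2 * b\<^sup>2 * (g x)\<^sup>2)"
    proof (rule AE_I2)
      fix x
      have "(a * f x + b * g x)\<^sup>2 \<le> 2 * (a * f x)\<^sup>2 + 2 * (b * g x)\<^sup>2"
        using sum_squares_bound[of "a * f x" "b * g x"] by (simp add: power2_sum)
      then show "norm ((a * f x + b * g x)\<^sup>2) \<le> norm (2 * a\<^sup>2 * (f x)\<^sup>2 + 2 * b\<^sup>2 * (g x)\<^sup>2)"
        by (simp add: power_mult_distrib mult.assoc)
    qed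
  qed
  then show "(\<lambda>x. a * f x + b * g x) \<in> L2 \<Omega>" using m by (simp add: L2_def)
qed

lemma L2_0_linear: "f \<in> L2_0 \<Omega> \<Longrightarrow> g \<in> L2_0 \<Omega> \<Longrightarrow> (\<lambda>x. a * f x + b * g x) \<in> L2_0 \<Omega>"
  using L2_sum_integrable[of f g] L2_sum_integrable[of g f] by (simp add: L2_0_def int_dom_def)

lemma L2_0_add: "f \<in> L2_0 \<Omega> \<Longrightarrow> g \<in> L2_0 \<Omega> \<Longrightarrow> (\<lambda>x. f x + g x) \<in> L2_0 \<Omega>"
  using L2_0_linear[of f g 1 1] by simp

lemma L2_0_diff: "f \<in> L2_0 \<Omega> \<Longrightarrow> g \<in> L2_0 \<Omega> \<Longrightarrow> (\<lambda>x. f x - g x) \<in> L2_0 \<Omega>"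
  using L2_0_linear[of f g 1 "-1"] by simp

lemma L2_0_cmult: "f \<in> L2_0 \<Omega> \<Longrightarrow> (\<lambda>x. c * f x) \<in> L2_0 \<Omega>"
  using L2_0_linear[of f f c 0] by simp

lemma iota_cmult: "f \<in> L2_0 \<Omega> \<Longrightarrow> \<iota> (\<lambda>x. c * f x) = c *\<^sub>R \<iota> f"
  using iota_linear[of f f c 0] by simp

lemma zero_L2_0: "(\<lambda>x. 0) \<in> L2_0 \<Omega>"
  by (simp add: L2_0_def L2_def int_dom_def)

lemma L2_0_sum: "finite A \<Longrightarrow> (\<And>a. a \<in> A \<Longrightarrow> f a \<in> L2_0 \<Omega>) \<Longrightarrow> (\<lambda>x. \<Sum>a\<in>A. f a x) \<in> L2_0 \<Omega>"
  by (induction A rule: finite_induct) (auto intro: L2_0_add zero_L2_0)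

lemma iota_zero: "\<iota> (\<lambda>x. 0) = 0"
  using iota_cmult[OF zero_L2_0, of 0] by simp

lemma iota_sum: "finite A \<Longrightarrow> (\<And>a. a \<in> A \<Longrightarrow> f a \<in> L2_0 \<Omega>) \<Longrightarrow> \<iota> (\<lambda>x. \<Sum>a\<in>A. f a x) = (\<Sum>a\<in>A. \<iota> (f a))"
  by (induction A rule: finite_induct) (auto simp: iota_zero iota_add L2_0_sum)

text \<open>A supremum bound gives an L2 bound since the domain has finite volume, and the inverse
  square root is bounded on L2. This is how uniform limits of functions become norm limits of their
  images.\<close>

lemma iota_bound: "\<exists>C\<ge>0. \<forall>f\<in>L2_0 \<Omega>. \<forall>c\<ge>0. (\<forall>x\<in>\<Omega>. \<bar>f x\<bar> \<le> c) \<longrightarrow> norm (\<iota> f) \<le> C * c"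
proof -
  obtain S where S: "neumann_inv_sqrt \<Omega> S" "\<forall>f\<in>L2_0 \<Omega>. \<forall>g\<in>L2_0 \<Omega>. \<iota> f \<bullet> \<iota> g = L2_inner \<Omega> (S f) (S g)"
    using Hm1 unfolding Hm1_0_def by blast
  then obtain K where K: "\<forall>f\<in>L2_0 \<Omega>. L2_inner \<Omega> (S f) (S f) \<le> K * L2_inner \<Omega> f f"
    unfolding neumann_inv_sqrt_def by blast
  define C where "C = sqrt (\<bar>K\<bar> * vol)"
  have C0: "0 \<le> C" using vol_nonneg by (simp add: C_def)
  have "norm (\<iota> f) \<le> C * c" if f: "f \<in> L2_0 \<Omega>" and c: "0 \<le> c" "\<forall>x\<in>\<Omega>. \<bar>f x\<bar> \<le> c" for f c
  proof -
    have int: "integrable (lebesgue_on \<Omega>) (\<lambda>x. f x * f x)" using f by (simp add: L2_0_def L2_def power2_eq_square)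
    have "L2_inner \<Omega> f f \<le> \<bar>L2_inner \<Omega> f f\<bar>" by simp
    also have "\<dots> \<le> c\<^sup>2 * vol"
      unfolding L2_inner_def
    proof (rule int_dom_bound[OF int])
      fix x assume "x \<in> \<Omega>"
      then have "\<bar>f x\<bar> * \<bar>f x\<bar> \<le> c * c" using c by (intro mult_mono) auto
      then show "\<bar>f x * f x\<bar> \<le> c\<^sup>2" by (simp add: abs_mult power2_eq_square)
    qed
    finally have le: "L2_inner \<Omega> f f \<le> c\<^sup>2 * vol" .
    have nn: "0 \<le> L2_inner \<Omega> f f" unfolding L2_inner_def int_dom_def by (intro integral_nonneg_AE AE_I2) simp
    have "(norm (\<iota> f))\<^sup>2 = L2_inner \<Omega> (S f) (S f)" using S(2) f by (simp add: power2_norm_eq_inner)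
    also have "\<dots> \<le> K * L2_inner \<Omega> f f" using K f by blast
    also have "\<dots> \<le> \<bar>K\<bar> * L2_inner \<Omega> f f" using nn by (intro mult_right_mono) auto
    also have "\<dots> \<le> \<bar>K\<bar> * (c\<^sup>2 * vol)" using le by (intro mult_left_mono) auto
    also have "\<dots> = C\<^sup>2 * c\<^sup>2"
      using real_sqrt_pow2[OF mult_nonneg_nonneg[OF abs_ge_zero[of K] vol_nonneg]] by (simp only: C_def mult_ac)
    also have "\<dots> = (C * c)\<^sup>2" by (rule power_mult_distrib[symmetric])
    finally show ?thesis by (rule power2_le_imp_le) (rule mult_nonneg_nonneg[OF C0 c(1)])
  qed
  then show ?thesis using C0 by blast
qed

text \<open>Differentiation under the integral. By the mean value theorem and the uniform limit of
  the derivatives, a difference quotient is uniformly close to the derivative at \<xi>, and its mean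
  is zero because the means are constant.\<close>

lemma dxi_mean_zero:
  assumes D: "open D" "\<xi> \<in> D"
    and diff: "\<And>\<eta> x. \<eta> \<in> D \<Longrightarrow> x \<in> \<Omega> \<Longrightarrow> (\<lambda>\<eta>. h \<eta> x) differentiable (at \<eta>)"
    and ext: "\<And>\<eta>. \<eta> \<in> D \<Longrightarrow> extends_continuously \<Omega> (h \<eta>)" "extends_continuously \<Omega> (dxi j h \<xi>)"
    and ul: "uniform_limit \<Omega> (dxi j h) (dxi j h \<xi>) (at \<xi>)"
    and mean: "\<And>\<eta>. \<eta> \<in> D \<Longrightarrow> int_dom \<Omega> (h \<eta>) = c"
  shows "int_dom \<Omega> (dxi j h \<xi>) = 0"
proof -
  have "\<bar>int_dom \<Omega> (dxi j h \<xi>)\<bar> \<le> 0 + e" if e: "e > 0" for e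
  proof -
    define e' where "e' = e / (vol + 1)"
    have e': "0 < e'" using e vol_nonneg by (simp add: e'_def)
    have "\<forall>\<^sub>F \<eta> in at \<xi>. \<forall>x\<in>\<Omega>. dist (dxi j h \<eta> x) (dxi j h \<xi> x) < e'"
      using ul e' by (rule uniform_limitD)
    then obtain d1 where d1: "d1 > 0" "\<And>\<eta> x. \<eta> \<noteq> \<xi> \<Longrightarrow> dist \<eta> \<xi> < d1 \<Longrightarrow> x \<in> \<Omega> \<Longrightarrow> dist (dxi j h \<eta> x) (dxi j h \<xi> x) < e'"
      unfolding eventually_at by auto
    obtain d2 where d2: "d2 > 0" "ball \<xi> d2 \<subseteq> D" using D open_contains_ball by blast
    define s where "s = min d1 d2 / 2"
    have s: "0 < s" "s < d1" "s < d2" using d1(1) d2(1) by (auto simp: s_def)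
    let ?a = "axis j (1::real) :: real^2"
    have dist: "dist (\<xi> + t *\<^sub>R ?a) \<xi> = \<bar>t\<bar>" for t by (simp add: dist_norm norm_axis_1)
    have inD: "\<xi> + t *\<^sub>R ?a \<in> D" if "0 \<le> t" "t \<le> s" for t
    proof -
      have "\<xi> + t *\<^sub>R ?a \<in> ball \<xi> d2" using that s dist[of t] by (simp add: dist_commute)
      then show ?thesis using d2 by blast
    qed
    have est: "\<bar>h (\<xi> + s *\<^sub>R ?a) x - h \<xi> x - s * dxi j h \<xi> x\<bar> \<le> s * e'" if x: "x \<in> \<Omega>" for x
    proof -
      have der: "((\<lambda>t. h (\<xi> + t *\<^sub>R ?a) x) has_real_derivative dxi j h (\<xi> + t *\<^sub>R ?a) x) (at t)" if "0 \<le> t" "t \<le> s" for t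
      proof -
        have "(\<Sum>i\<in>UNIV. ?a $ i * dxi i h (\<xi> + t *\<^sub>R ?a) x) = dxi j h (\<xi> + t *\<^sub>R ?a) x"
          by (simp add: axis_def if_distrib[of "\<lambda>c. c * _"] cong: if_cong)
        then show ?thesis using dxi_line_derivative[of h x \<xi> t ?a, OF diff[OF inD[OF that] x]] by simp
      qed
      obtain z where z: "0 < z" "z < s" "h (\<xi> + s *\<^sub>R ?a) x - h (\<xi> + 0 *\<^sub>R ?a) x = (s - 0) * dxi j h (\<xi> + z *\<^sub>R ?a) x"
        using MVT2[OF s(1), of "\<lambda>t. h (\<xi> + t *\<^sub>R ?a) x" "\<lambda>t. dxi j h (\<xi> + t *\<^sub>R ?a) x"] der by blast
      have "\<xi> + z *\<^sub>R ?a \<noteq> \<xi>" using z(1) dist[of z] by auto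
      then have "dist (dxi j h (\<xi> + z *\<^sub>R ?a) x) (dxi j h \<xi> x) < e'"
        using z s dist[of z] x by (intro d1) auto
      then have "s * \<bar>dxi j h (\<xi> + z *\<^sub>R ?a) x - dxi j h \<xi> x\<bar> \<le> s * e'"
        using s(1) by (intro mult_left_mono) (auto simp: dist_real_def)
      then show ?thesis using z(3) s(1) by (simp add: right_diff_distrib[symmetric] abs_mult)
    qed
    have sD: "\<xi> + s *\<^sub>R ?a \<in> D" using inD[of s] s by simp
    have i1: "integrable (lebesgue_on \<Omega>) (h (\<xi> + s *\<^sub>R ?a))" "integrable (lebesgue_on \<Omega>) (h \<xi>)" "integrable (lebesgue_on \<Omega>) (dxi j h \<xi>)"
      using ext sD D by (auto intro: extends_continuously_integrable)
    have "\<bar>int_dom \<Omega> (\<lambda>x. h (\<xi> + s *\<^sub>R ?a) x - h \<xi> x - s * dxi j h \<xi> x)\<bar> \<le> (s * e') * vol"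
      using i1 est by (intro int_dom_bound) auto
    moreover have "int_dom \<Omega> (\<lambda>x. h (\<xi> + s *\<^sub>R ?a) x - h \<xi> x - s * dxi j h \<xi> x) = - s * int_dom \<Omega> (dxi j h \<xi>)"
    proof -
      have "int_dom \<Omega> (\<lambda>x. h (\<xi> + s *\<^sub>R ?a) x - h \<xi> x - s * dxi j h \<xi> x)
        = int_dom \<Omega> (h (\<xi> + s *\<^sub>R ?a)) - int_dom \<Omega> (h \<xi>) - s * int_dom \<Omega> (dxi j h \<xi>)"
        unfolding int_dom_def using i1 by simp
      then show ?thesis using mean[OF sD] mean[OF D(2)] by simp
    qed
    ultimately have "s * \<bar>int_dom \<Omega> (dxi j h \<xi>)\<bar> \<le> s * (e' * vol)" using s(1) by (simp add: abs_mult)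
    then have "\<bar>int_dom \<Omega> (dxi j h \<xi>)\<bar> \<le> e' * vol" using s(1) by simp
    also have "\<dots> \<le> e' * (vol + 1)" using e' by simp
    also have "\<dots> = e" using vol_nonneg by (simp add: e'_def)
    finally show ?thesis by simp
  qed
  then have "\<bar>int_dom \<Omega> (dxi j h \<xi>)\<bar> \<le> 0" by (rule field_le_epsilon)
  then show ?thesis by simp
qed

lemma iota_continuous:
  fixes h :: "'p::metric_space \<Rightarrow> real^2 \<Rightarrow> real"
  assumes h: "\<And>\<xi>. \<xi> \<in> D \<Longrightarrow> h \<xi> \<in> L2_0 \<Omega>"
    and ul: "\<And>\<xi>. \<xi> \<in> D \<Longrightarrow> uniform_limit \<Omega> h (h \<xi>) (at \<xi>)"
  shows "continuous_on D (\<lambda>\<xi>. \<iota> (h \<xi>))"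
  unfolding continuous_on_iff
proof (intro ballI allI impI)
  fix \<xi> e assume xi: "\<xi> \<in> D" and e: "0 < (e::real)"
  obtain C where C: "C \<ge> 0" "\<forall>f\<in>L2_0 \<Omega>. \<forall>c\<ge>0. (\<forall>x\<in>\<Omega>. \<bar>f x\<bar> \<le> c) \<longrightarrow> norm (\<iota> f) \<le> C * c"
    using iota_bound by (elim exE conjE) (rule that; assumption)
  define c where "c = e / (C + 1)"
  have c: "0 < c" using e C by (simp add: c_def)
  have "\<forall>\<^sub>F \<eta> in at \<xi>. \<forall>x\<in>\<Omega>. dist (h \<eta> x) (h \<xi> x) < c"
    using ul[OF xi] c by (rule uniform_limitD)
  then obtain d where d: "d > 0" "\<And>\<eta> x. \<eta> \<noteq> \<xi> \<Longrightarrow> dist \<eta> \<xi> < d \<Longrightarrow> x \<in> \<Omega> \<Longrightarrow> dist (h \<eta> x) (h \<xi> x) < c"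
    unfolding eventually_at by auto
  have "dist (\<iota> (h \<eta>)) (\<iota> (h \<xi>)) < e" if eta: "\<eta> \<in> D" "dist \<eta> \<xi> < d" for \<eta>
  proof (cases "\<eta> = \<xi>")
    case False
    have "\<bar>h \<eta> x - h \<xi> x\<bar> \<le> c" if "x \<in> \<Omega>" for x
      using d(2)[OF False eta(2) that] by (simp add: dist_real_def)
    then have "norm (\<iota> (\<lambda>x. h \<eta> x - h \<xi> x)) \<le> C * c"
      by (rule C(2)[rule_format, OF L2_0_diff[OF h[OF eta(1)] h[OF xi]] less_imp_le[OF c]])
    also have "\<dots> < (C + 1) * c" using c by simp
    also have "\<dots> = e" using C by (simp add: c_def)
    finally show ?thesis by (simp add: dist_norm iota_diff h eta xi)
  qed (use e in simp)
  then show "\<exists>d>0. \<forall>\<eta>\<in>D. dist \<eta> \<xi> < d \<longrightarrow> dist (\<iota> (h \<eta>)) (\<iota> (h \<xi>)) < e" using d(1) by blast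
qed

text \<open>Constant means have zero derivatives, and the first derivatives, having mean zero,
  satisfy the same premise again.\<close>

lemma C2_family_L2_0:
  assumes D: "open D" and fam: "C2_family D \<Omega> g"
    and mean: "\<And>\<xi>. \<xi> \<in> D \<Longrightarrow> int_dom \<Omega> (g \<xi>) = m" and xi: "\<xi> \<in> D"
  shows "dxi j g \<xi> \<in> L2_0 \<Omega>" "dxi j (dxi k g) \<xi> \<in> L2_0 \<Omega>"
proof -
  note F = C2_family_dest[OF fam]
  have m1: "int_dom \<Omega> (dxi j g \<xi>) = 0" if xi: "\<xi> \<in> D" for j \<xi>
    using F[of "[]"] F[of "[j]" \<xi>] xi by (intro dxi_mean_zero[OF D xi _ _ _ _ mean]) auto
  then show "dxi j g \<xi> \<in> L2_0 \<Omega>" using F(1)[of "[j]" \<xi>] xi by (intro L2_0_I) auto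
  have "int_dom \<Omega> (dxi j (dxi k g) \<xi>) = 0"
    using F[of "[k]"] F[of "[j, k]" \<xi>] xi by (intro dxi_mean_zero[OF D xi _ _ _ _ m1]) auto
  then show "dxi j (dxi k g) \<xi> \<in> L2_0 \<Omega>" using F(1)[of "[j, k]" \<xi>] xi by (intro L2_0_I) auto
qed

text \<open>Both the unknown intermediate point and \<open>y\<close> lie in a ball where the second
  derivatives differ from those at \<xi> by at most c, uniformly in x.\<close>

lemma C2_family_remainder:
  assumes D: "open D" and fam: "C2_family D \<Omega> g" and xi: "\<xi> \<in> D" and e: "0 < e"
  shows "\<exists>\<delta>>0. ball \<xi> \<delta> \<subseteq> D \<and> (\<forall>y\<in>ball \<xi> \<delta>. \<forall>z\<in>ball \<xi> \<delta>. \<forall>x\<in>\<Omega>.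
    \<bar>g z x - g y x - (\<Sum>j\<in>UNIV. (z $ j - y $ j) * dxi j g y x)
      - (1/2) * (\<Sum>j\<in>UNIV. \<Sum>k\<in>UNIV. ((z $ j - y $ j) * (z $ k - y $ k)) * dxi j (dxi k g) y x)\<bar> \<le> e * (norm (z - y))\<^sup>2)"
proof -
  note F = C2_family_dest[OF fam]
  \<comment> \<open>Four index pairs, each contributing 2 c, times the factor 1/2 give 4 c =
    e.\<close>
  define c where "c = e / 4"
  have c: "0 < c" using e by (simp add: c_def)
  have "\<forall>\<^sub>F \<eta> in at \<xi>. \<forall>x\<in>\<Omega>. dist (dxi j (dxi k g) \<eta> x) (dxi j (dxi k g) \<xi> x) < c" for j k
    using F(2)[of "[j, k]" \<xi>] xi by (intro uniform_limitD[OF _ c]) auto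
  then have "\<forall>\<^sub>F \<eta> in at \<xi>. \<forall>j k. \<forall>x\<in>\<Omega>. dist (dxi j (dxi k g) \<eta> x) (dxi j (dxi k g) \<xi> x) < c"
    by (simp add: eventually_all_finite)
  then obtain d1 where d1: "d1 > 0" "\<And>\<eta> j k x. \<eta> \<noteq> \<xi> \<Longrightarrow> dist \<eta> \<xi> < d1 \<Longrightarrow> x \<in> \<Omega> \<Longrightarrow>
      dist (dxi j (dxi k g) \<eta> x) (dxi j (dxi k g) \<xi> x) < c"
    unfolding eventually_at by auto
  obtain d2 where d2: "d2 > 0" "ball \<xi> d2 \<subseteq> D" using D xi open_contains_ball by blast
  define \<delta> where "\<delta> = min d1 d2"
  have \<delta>: "\<delta> > 0" "ball \<xi> \<delta> \<subseteq> D" using d1(1) d2 by (auto simp: \<delta>_def)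
  have near: "\<bar>dxi j (dxi k g) \<eta> x - dxi j (dxi k g) \<xi> x\<bar> \<le> c" if "\<eta> \<in> ball \<xi> \<delta>" "x \<in> \<Omega>" for \<eta> j k x
  proof (cases "\<eta> = \<xi>")
    case False
    have "dist \<eta> \<xi> < d1" using that by (simp add: \<delta>_def dist_commute)
    then show ?thesis using d1(2)[OF False _ that(2), of j k] by (simp add: dist_real_def)
  qed (use c in simp)
  have "\<bar>g z x - g y x - (\<Sum>j\<in>UNIV. (z $ j - y $ j) * dxi j g y x)
      - (1/2) * (\<Sum>j\<in>UNIV. \<Sum>k\<in>UNIV. ((z $ j - y $ j) * (z $ k - y $ k)) * dxi j (dxi k g) y x)\<bar> \<le> e * (norm (z - y))\<^sup>2"
    (is "\<bar>?R\<bar> \<le> _") if y: "y \<in> ball \<xi> \<delta>" and z: "z \<in> ball \<xi> \<delta>" and x: "x \<in> \<Omega>" for y z x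
  proof -
    have "\<exists>p\<in>ball \<xi> \<delta>. g z x = g y x + (\<Sum>j\<in>UNIV. (z $ j - y $ j) * dxi j g y x)
      + (1/2) * (\<Sum>j\<in>UNIV. \<Sum>k\<in>UNIV. (z $ j - y $ j) * (z $ k - y $ k) * dxi j (dxi k g) p x)"
    proof (rule dxi_taylor[OF convex_ball y z])
      fix p assume "p \<in> ball \<xi> \<delta>"
      then have p: "p \<in> D" using \<delta>(2) by blast
      show "(\<lambda>\<eta>. g \<eta> x) differentiable (at p)" using F(3)[of "[]" p x] p x by simp
      show "(\<lambda>\<eta>. dxi k g \<eta> x) differentiable (at p)" for k using F(3)[of "[k]" p x] p x by simp
    qed
    then obtain p where p: "p \<in> ball \<xi> \<delta>" "g z x = g y x + (\<Sum>j\<in>UNIV. (z $ j - y $ j) * dxi j g y x)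
      + (1/2) * (\<Sum>j\<in>UNIV. \<Sum>k\<in>UNIV. (z $ j - y $ j) * (z $ k - y $ k) * dxi j (dxi k g) p x)" by blast
    have "?R = (1/2) * (\<Sum>j\<in>UNIV. \<Sum>k\<in>UNIV. (z $ j - y $ j) * (z $ k - y $ k) * (dxi j (dxi k g) p x - dxi j (dxi k g) y x))"
      unfolding p(2) sum_2 by (simp add: algebra_simps)
    also have "\<bar>\<dots>\<bar> \<le> (1/2) * (\<Sum>j\<in>(UNIV::2 set). \<Sum>k\<in>(UNIV::2 set). (norm (z - y))\<^sup>2 * (2 * c))"
      unfolding abs_mult
    proof (intro mult_mono order_trans[OF sum_abs] sum_mono)
      fix j k :: 2
      have "\<bar>z $ j - y $ j\<bar> * \<bar>z $ k - y $ k\<bar> \<le> norm (z - y) * norm (z - y)"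
        using component_le_norm_cart[of "z - y"] by (intro mult_mono) auto
      moreover have "\<bar>dxi j (dxi k g) p x - dxi j (dxi k g) y x\<bar> \<le> 2 * c"
        using near[OF p(1) x, of j k] near[OF y x, of j k] by linarith
      ultimately show "\<bar>(z $ j - y $ j) * (z $ k - y $ k) * (dxi j (dxi k g) p x - dxi j (dxi k g) y x)\<bar> \<le> (norm (z - y))\<^sup>2 * (2 * c)"
        unfolding abs_mult power2_eq_square using c by (intro mult_mono[of "_ * _" "_ * _"]) auto
    qed auto
    also have "\<dots> = e * (norm (z - y))\<^sup>2" by (simp add: c_def)
    finally show ?thesis .
  qed
  then show ?thesis using \<delta> by blast
qed

text \<open>\<open>\<iota>\<close> carries its meaning only on functions of mean zero, whereas the
  members of the family share a mean that may be nonzero. Subtracting a fixed \<open>q\<close> of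
  the same mean corrects this and leaves the derivatives unchanged.\<close>

lemma family_c2map:
  assumes D: "open D" and fam: "C2_family D \<Omega> g" and q: "extends_continuously \<Omega> q"
    and mean: "\<And>\<xi>. \<xi> \<in> D \<Longrightarrow> int_dom \<Omega> (g \<xi>) = int_dom \<Omega> q"
  shows "c2map D (\<lambda>\<xi>. \<iota> (\<lambda>x. g \<xi> x - q x)) (\<lambda>j \<xi>. \<iota> (dxi j g \<xi>)) (\<lambda>j k \<xi>. \<iota> (dxi j (dxi k g) \<xi>))"
  unfolding c2map_def
proof (intro conjI allI ballI impI)
  note F = C2_family_dest[OF fam]
  have L1: "dxi j g \<xi> \<in> L2_0 \<Omega>" and L2: "dxi j (dxi k g) \<xi> \<in> L2_0 \<Omega>" if "\<xi> \<in> D" for j k \<xi>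
    by (rule C2_family_L2_0[OF D fam mean that]; assumption)+
  have int: "integrable (lebesgue_on \<Omega>) (g \<xi>)" if "\<xi> \<in> D" for \<xi>
    using F(1)[of "[]" \<xi>] that by (intro extends_continuously_integrable) simp
  have L0: "(\<lambda>x. g \<xi> x - q x) \<in> L2_0 \<Omega>" if xi: "\<xi> \<in> D" for \<xi>
  proof (rule L2_0_I)
    show "extends_continuously \<Omega> (\<lambda>x. g \<xi> x - q x)"
      using extends_continuously_add[OF F(1)[of "[]" \<xi>] extends_continuously_cmult[OF q, of "-1"]] xi by simp
    show "int_dom \<Omega> (\<lambda>x. g \<xi> x - q x) = 0"
      using mean[OF xi] int[OF xi] extends_continuously_integrable[OF q] by (simp add: int_dom_def)
  qed
  show "continuous_on D (\<lambda>\<xi>. \<iota> (\<lambda>x. g \<xi> x - q x))"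
  proof (rule iota_continuous[OF L0])
    fix \<xi> assume "\<xi> \<in> D"
    then have "uniform_limit \<Omega> g (g \<xi>) (at \<xi>)" using F(2)[of "[]" \<xi>] by simp
    then show "uniform_limit \<Omega> (\<lambda>\<xi> x. g \<xi> x - q x) (\<lambda>x. g \<xi> x - q x) (at \<xi>)"
      by (intro uniform_limit_minus uniform_limit_const)
  qed
  show "continuous_on D (\<lambda>\<xi>. \<iota> (dxi j g \<xi>))" for j
    using F(2)[of "[j]"] by (intro iota_continuous L1) auto
  show "continuous_on D (\<lambda>\<xi>. \<iota> (dxi j (dxi k g) \<xi>))" for j k
    using F(2)[of "[j, k]"] by (intro iota_continuous L2) auto
  fix \<xi> and e :: real assume xi: "\<xi> \<in> D" and e: "0 < e"
  obtain C where C: "C \<ge> 0" "\<forall>f\<in>L2_0 \<Omega>. \<forall>c\<ge>0. (\<forall>x\<in>\<Omega>. \<bar>f x\<bar> \<le> c) \<longrightarrow> norm (\<iota> f) \<le> C * c"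
    using iota_bound by (elim exE conjE) (rule that; assumption)
  define c where "c = e / (C + 1)"
  have c: "0 < c" using e C by (simp add: c_def)
  let ?R = "\<lambda>z y x. g z x - g y x - (\<Sum>j\<in>UNIV. (z $ j - y $ j) * dxi j g y x)
      - (1/2) * (\<Sum>j\<in>UNIV. \<Sum>k\<in>UNIV. ((z $ j - y $ j) * (z $ k - y $ k)) * dxi j (dxi k g) y x)"
  obtain \<delta> where \<delta>: "\<delta> > 0" "ball \<xi> \<delta> \<subseteq> D" "\<forall>y\<in>ball \<xi> \<delta>. \<forall>z\<in>ball \<xi> \<delta>. \<forall>x\<in>\<Omega>. \<bar>?R z y x\<bar> \<le> c * (norm (z - y))\<^sup>2"
    using C2_family_remainder[OF D fam xi c] by (elim exE conjE) (rule that; assumption)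
  have "norm (\<iota> (\<lambda>x. g z x - q x) - \<iota> (\<lambda>x. g y x - q x) - (\<Sum>j\<in>UNIV. (z $ j - y $ j) *\<^sub>R \<iota> (dxi j g y))
        - (1/2) *\<^sub>R (\<Sum>j\<in>UNIV. \<Sum>k\<in>UNIV. ((z $ j - y $ j) * (z $ k - y $ k)) *\<^sub>R \<iota> (dxi j (dxi k g) y)))
      \<le> e * (norm (z - y))\<^sup>2" if yz: "y \<in> ball \<xi> \<delta>" "z \<in> ball \<xi> \<delta>" for y z
  proof -
    have D': "y \<in> D" "z \<in> D" using yz \<delta>(2) by auto
    let ?a = "\<lambda>x. (g z x - q x) - (g y x - q x)" and ?b = "\<lambda>x. \<Sum>j\<in>UNIV. (z $ j - y $ j) * dxi j g y x"
    let ?s = "\<lambda>x. \<Sum>j\<in>UNIV. \<Sum>k\<in>UNIV. ((z $ j - y $ j) * (z $ k - y $ k)) * dxi j (dxi k g) y x"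
    have a: "?a \<in> L2_0 \<Omega>" by (intro L2_0_diff L0 D')
    have b: "?b \<in> L2_0 \<Omega>" by (intro L2_0_sum L2_0_cmult L1 D' finite)
    have s1: "(\<lambda>x. \<Sum>k\<in>UNIV. ((z $ j - y $ j) * (z $ k - y $ k)) * dxi j (dxi k g) y x) \<in> L2_0 \<Omega>" for j
      by (intro L2_0_sum L2_0_cmult L2 D' finite)
    have s: "?s \<in> L2_0 \<Omega>" by (intro L2_0_sum s1 finite)
    have R: "(\<lambda>x. (?a x - ?b x) - (1/2) * ?s x) \<in> L2_0 \<Omega>"
      by (intro L2_0_diff[OF L2_0_diff[OF a b] L2_0_cmult[OF s]])
    have "\<iota> (\<lambda>x. (?a x - ?b x) - (1/2) * ?s x) = \<iota> ?a - \<iota> ?b - (1/2) *\<^sub>R \<iota> ?s"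
      by (simp only: iota_diff[OF L2_0_diff[OF a b] L2_0_cmult[OF s]] iota_diff[OF a b] iota_cmult[OF s])
    moreover have "\<iota> ?a = \<iota> (\<lambda>x. g z x - q x) - \<iota> (\<lambda>x. g y x - q x)" by (intro iota_diff L0 D')
    moreover have "\<iota> ?b = (\<Sum>j\<in>UNIV. (z $ j - y $ j) *\<^sub>R \<iota> (dxi j g y))"
      using iota_sum[OF finite, of UNIV "\<lambda>j x. (z $ j - y $ j) * dxi j g y x"] L2_0_cmult[OF L1[OF D'(1)]] iota_cmult[OF L1[OF D'(1)]]
      by simp
    moreover have "\<iota> ?s = (\<Sum>j\<in>UNIV. \<Sum>k\<in>UNIV. ((z $ j - y $ j) * (z $ k - y $ k)) *\<^sub>R \<iota> (dxi j (dxi k g) y))"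
    proof -
      have "\<iota> ?s = (\<Sum>j\<in>UNIV. \<iota> (\<lambda>x. \<Sum>k\<in>UNIV. ((z $ j - y $ j) * (z $ k - y $ k)) * dxi j (dxi k g) y x))"
        by (rule iota_sum[OF finite s1])
      also have "\<dots> = (\<Sum>j\<in>UNIV. \<Sum>k\<in>UNIV. \<iota> (\<lambda>x. ((z $ j - y $ j) * (z $ k - y $ k)) * dxi j (dxi k g) y x))"
        by (rule sum.cong[OF refl]) (rule iota_sum[OF finite L2_0_cmult[OF L2[OF D'(1)]]])
      finally show ?thesis by (simp only: iota_cmult[OF L2[OF D'(1)]])
    qed
    moreover have "norm (\<iota> (\<lambda>x. (?a x - ?b x) - (1/2) * ?s x)) \<le> C * (c * (norm (z - y))\<^sup>2)"
    proof (rule C(2)[rule_format, OF R])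
      show "0 \<le> c * (norm (z - y))\<^sup>2" using c by simp
      fix x assume x: "x \<in> \<Omega>"
      have "\<bar>?R z y x\<bar> \<le> c * (norm (z - y))\<^sup>2" by (rule \<delta>(3)[rule_format, OF yz x])
      then show "\<bar>(?a x - ?b x) - (1/2) * ?s x\<bar> \<le> c * (norm (z - y))\<^sup>2"
        by (simp only: diff_diff_eq2 add_diff_cancel_right diff_add_cancel)
    qed
    moreover have "C * (c * (norm (z - y))\<^sup>2) \<le> e * (norm (z - y))\<^sup>2"
    proof -
      have "C * c \<le> (C + 1) * c" using c by simp
      also have "\<dots> = e" using C by (simp add: c_def)
      finally show ?thesis unfolding mult.assoc[symmetric] by (rule mult_right_mono) simp
    qed
    ultimately show ?thesis by (simp only:)
  qed
  then show "\<exists>\<delta>>0. \<forall>y\<in>ball \<xi> \<delta>. \<forall>z\<in>ball \<xi> \<delta>.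
      norm (\<iota> (\<lambda>x. g z x - q x) - \<iota> (\<lambda>x. g y x - q x) - (\<Sum>j\<in>UNIV. (z $ j - y $ j) *\<^sub>R \<iota> (dxi j g y))
        - (1/2) *\<^sub>R (\<Sum>j\<in>UNIV. \<Sum>k\<in>UNIV. ((z $ j - y $ j) * (z $ k - y $ k)) *\<^sub>R \<iota> (dxi j (dxi k g) y)))
      \<le> e * (norm (z - y))\<^sup>2" using \<delta>(1) by blast
qed

end

section \<open>The reduced system in the Hilbert space\<close>

lemma matrix_inv_works:
  assumes "invertible (A :: real^'n^'n)"
  shows "A ** matrix_inv A = mat 1" "matrix_inv A ** A = mat 1"
  using someI_ex[OF assms[unfolded invertible_def]] unfolding matrix_inv_def by auto

lemma matrix_inv_eqI:
  assumes "(A :: real^'n^'n) ** B = mat 1" "B ** A = mat 1"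
  shows "matrix_inv A = B"
proof -
  have "invertible A" using assms unfolding invertible_def by blast
  then have "matrix_inv A ** (A ** B) = B"
    by (simp add: matrix_mul_assoc matrix_inv_works)
  then show ?thesis using assms(1) by simp
qed

text \<open>Cramer's rule: for i = j, the trace minus a diagonal entry is the other diagonal entry.
  The formula makes the inverse a continuous function of the entries where the determinant is
  nonzero.\<close>

lemma matrix_inv_2:
  fixes A :: "real^2^2"
  assumes "det A \<noteq> 0"
  shows "matrix_inv A = (\<chi> i j. (if i = j then A$1$1 + A$2$2 - A$i$j else - A$i$j) / det A)"
proof (rule matrix_inv_eqI)
  let ?B = "(\<chi> i j. (if i = j then A$1$1 + A$2$2 - A$i$j else - A$i$j) / det A) :: real^2^2"
  show "A ** ?B = mat 1" "?B ** A = mat 1"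
    using assms unfolding vec_eq_iff forall_2 matrix_matrix_mult_def mat_def sum_2
    by (simp_all add: divide_simps) (simp_all add: det_2 algebra_simps)
qed

lemma continuous_on_matrix_inv_2:
  fixes A :: "'a::topological_space \<Rightarrow> real^2^2"
  assumes A: "\<And>i j. continuous_on E (\<lambda>z. A z $ i $ j)" and inv: "\<And>z. z \<in> E \<Longrightarrow> invertible (A z)"
  shows "continuous_on E (\<lambda>z. matrix_inv (A z) $ i $ j)"
proof -
  have d: "det (A z) \<noteq> 0" if "z \<in> E" for z using inv[OF that] by (simp add: invertible_det_nz)
  have dc: "continuous_on E (\<lambda>z. det (A z))" unfolding det_2 by (intro continuous_intros A)
  have "continuous_on E (\<lambda>z. (if i = j then A z$1$1 + A z$2$2 - A z$i$j else - A z$i$j) / det (A z))"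
  proof (rule continuous_on_divide[OF _ dc])
    show "continuous_on E (\<lambda>z. if i = j then A z$1$1 + A z$2$2 - A z$i$j else - A z$i$j)"
      by (cases "i = j") (simp_all, (intro continuous_intros A)+)
  qed (use d in blast)
  then show ?thesis
    by (rule continuous_on_eq) (simp add: matrix_inv_2[OF d])
qed

context prob_space begin

lemma small_limit_add:
  fixes f g :: "nat \<Rightarrow> 'a \<Rightarrow> real"
  assumes f: "\<forall>d>0. \<forall>e>0. \<forall>\<^sub>F l in sequentially. small M {\<omega>. A \<omega> \<and> \<bar>f l \<omega>\<bar> > d} e"
    and g: "\<forall>d>0. \<forall>e>0. \<forall>\<^sub>F l in sequentially. small M {\<omega>. A \<omega> \<and> \<bar>g l \<omega>\<bar> > d} e"
  shows "\<forall>d>0. \<forall>e>0. \<forall>\<^sub>F l in sequentially. small M {\<omega>. A \<omega> \<and> \<bar>f l \<omega> + g l \<omega>\<bar> > d} e"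
proof (intro allI impI)
  fix d e :: real assume d: "d > 0" and e: "e > 0"
  have "\<forall>\<^sub>F l in sequentially. small M {\<omega>. A \<omega> \<and> \<bar>f l \<omega>\<bar> > d / 2} (e / 2)"
    "\<forall>\<^sub>F l in sequentially. small M {\<omega>. A \<omega> \<and> \<bar>g l \<omega>\<bar> > d / 2} (e / 2)"
    by (rule f[rule_format, OF half_gt_zero[OF d] half_gt_zero[OF e]], rule g[rule_format, OF half_gt_zero[OF d] half_gt_zero[OF e]])
  then show "\<forall>\<^sub>F l in sequentially. small M {\<omega>. A \<omega> \<and> \<bar>f l \<omega> + g l \<omega>\<bar> > d} e"
  proof eventually_elim
    case (elim l)
    from small_Un[OF elim] show ?case
      by (rule small_mono_set) (auto simp: abs_if split: if_splits)
  qed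
qed

end

context wiener begin

text \<open>The sum of the absolute values is small whenever all the errors are, and it dominates
  each of them, so one subsequence serves finitely many errors.\<close>

lemma small_AE_tendsto_finite:
  fixes f :: "'i \<Rightarrow> nat \<Rightarrow> 's \<Rightarrow> real"
  assumes K: "finite K"
    and f: "\<And>a. a \<in> K \<Longrightarrow> \<forall>d>0. \<forall>e>0. \<forall>\<^sub>F l in sequentially. small M {\<omega>. A \<omega> \<and> \<bar>f a l \<omega>\<bar> > d} e"
  shows "\<exists>k. strict_mono (k :: nat \<Rightarrow> nat) \<and> (AE \<omega> in M. A \<omega> \<longrightarrow> (\<forall>a\<in>K. (\<lambda>j. f a (k j) \<omega>) \<longlonglongrightarrow> 0))"
proof -
  have "\<forall>d>0. \<forall>e>0. \<forall>\<^sub>F l in sequentially. small M {\<omega>. A \<omega> \<and> \<bar>\<Sum>a\<in>K. \<bar>f a l \<omega>\<bar>\<bar> > d} e"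
    using K f
  proof (induction K rule: finite_induct)
    case empty
    have "small M {} e" if "0 < e" for e
      unfolding small_def using that by (intro bexI[of _ "{}"]) auto
    then show ?case by simp
  next
    case (insert a K)
    have "\<forall>d>0. \<forall>e>0. \<forall>\<^sub>F l in sequentially. small M {\<omega>. A \<omega> \<and> \<bar>\<bar>f a l \<omega>\<bar>\<bar> > d} e"
      using insert.prems by simp
    from small_limit_add[OF this insert.IH] insert show ?case by simp
  qed
  then obtain k :: "nat \<Rightarrow> nat" where k: "strict_mono k"
    "AE \<omega> in M. A \<omega> \<longrightarrow> (\<lambda>j. \<Sum>a\<in>K. \<bar>f a (k j) \<omega>\<bar>) \<longlonglongrightarrow> 0"
    using small_AE_tendsto[of A "\<lambda>l \<omega>. \<Sum>a\<in>K. \<bar>f a l \<omega>\<bar>"] by blast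
  have "AE \<omega> in M. A \<omega> \<longrightarrow> (\<forall>a\<in>K. (\<lambda>j. f a (k j) \<omega>) \<longlonglongrightarrow> 0)"
    using k(2)
  proof (rule AE_mp, intro AE_I2 impI ballI)
    fix \<omega> a assume "A \<omega> \<longrightarrow> (\<lambda>j. \<Sum>a\<in>K. \<bar>f a (k j) \<omega>\<bar>) \<longlonglongrightarrow> 0" "A \<omega>" and a: "a \<in> K"
    then have "(\<lambda>j. \<Sum>a\<in>K. \<bar>f a (k j) \<omega>\<bar>) \<longlonglongrightarrow> 0" by blast
    then show "(\<lambda>j. f a (k j) \<omega>) \<longlonglongrightarrow> 0"
      by (rule Lim_null_comparison[rotated])
        (use member_le_sum[OF a, of "\<lambda>a. \<bar>f a _ \<omega>\<bar>"] K in \<open>auto intro!: always_eventually\<close>)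
  qed
  then show ?thesis using k(1) by blast
qed

lemma null_set_F: "N \<in> null_sets M \<Longrightarrow> B \<subseteq> N \<Longrightarrow> 0 \<le> t \<Longrightarrow> B \<in> sets (F t)"
proof -
  assume N: "N \<in> null_sets M" "B \<subseteq> N" and t: "0 \<le> t"
  have c: "complete_measure M" "null_sets M \<subseteq> sets (F 0)" using filt by (auto simp: complete_filtration_def)
  have "B \<in> sets M" using complete_measure.complete[OF c(1) N(2,1)] .
  then have "B \<in> null_sets M" by (rule null_sets_subset[OF N(1) _ N(2)])
  then show ?thesis using c(2) sets_F_mono[OF t] by blast
qed

text \<open>The measure is complete and its null sets belong to the filtration from time zero on, so
  a change on a null set preserves measurability at every time.\<close>

lemma measurable_F_AE_cong:
  fixes f g :: "'s \<Rightarrow> 'b::topological_space"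
  assumes g: "g \<in> borel_measurable (F t)" and ae: "AE \<omega> in M. f \<omega> = g \<omega>" and t: "0 \<le> t"
  shows "f \<in> borel_measurable (F t)"
proof (rule measurableI)
  from ae obtain N where N: "N \<in> null_sets M" "{\<omega> \<in> space M. f \<omega> \<noteq> g \<omega>} \<subseteq> N"
    by (auto elim: AE_E simp: null_sets_def)
  fix B :: "'b set" assume "B \<in> sets borel"
  then have gB: "g -` B \<inter> space M \<in> sets (F t)" using measurable_sets[OF g] by simp
  have NF: "N \<in> sets (F t)" by (rule null_set_F[OF N(1) order_refl t])
  have "(f -` B \<inter> space M) \<inter> N \<in> sets (F t)" by (rule null_set_F[OF N(1) Int_lower2 t])
  then have "((g -` B \<inter> space M) - N) \<union> ((f -` B \<inter> space M) \<inter> N) \<in> sets (F t)"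
    using gB NF by (intro sets.Un sets.Diff)
  also have "((g -` B \<inter> space M) - N) \<union> ((f -` B \<inter> space M) \<inter> N) = f -` B \<inter> space M"
    using N(2) by auto
  finally show "f -` B \<inter> space (F t) \<in> sets (F t)" by simp
qed simp

text \<open>The coefficients are continuous only where the matrix is invertible, and the state is
  there only almost surely and only before \<open>\<tau>\<close>.\<close>

lemma adapted_upto_compose:
  fixes X :: "real \<Rightarrow> 's \<Rightarrow> 'x::{zero,second_countable_topology}" and Y :: "real \<Rightarrow> 's \<Rightarrow> 'y::{zero,second_countable_topology}"
    and h :: "'x \<times> 'y \<Rightarrow> 'b::real_normed_vector"
  assumes tau: "stopping M F \<tau>" and X: "adapted_upto F \<tau> X" and Y: "adapted_upto F \<tau> Y"
    and E: "open E" and h: "continuous_on E h"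
    and ae: "AE \<omega> in M. \<forall>t\<ge>0. ereal t < \<tau> \<omega> \<longrightarrow> (X t \<omega>, Y t \<omega>) \<in> E"
  shows "adapted_upto F \<tau> (\<lambda>t \<omega>. h (X t \<omega>, Y t \<omega>))"
  unfolding adapted_upto_def
proof (intro allI impI)
  fix t :: real assume t: "0 \<le> t"
  \<comment> \<open>The extension by zero is Borel because \<open>E\<close> is open. It differs from
    the wanted value before \<open>\<tau>\<close> only on a null set.\<close>
  define h' where "h' z = (if z \<in> E then h z else 0)" for z
  have h': "h' \<in> borel_measurable borel"
    unfolding h'_def by (rule borel_measurable_continuous_on_if[OF _ h continuous_on_const]) (use E in simp)
  have Z: "(\<lambda>\<omega>. (if ereal t < \<tau> \<omega> then X t \<omega> else 0, if ereal t < \<tau> \<omega> then Y t \<omega> else 0)) \<in> borel_measurable (F t)"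
    using X Y t unfolding adapted_upto_def by (intro borel_measurable_Pair) auto
  define g where "g \<omega> = (if ereal t < \<tau> \<omega> then h' (if ereal t < \<tau> \<omega> then X t \<omega> else 0, if ereal t < \<tau> \<omega> then Y t \<omega> else 0) else 0)" for \<omega>
  have "g \<in> borel_measurable (F t)"
    unfolding g_def
  proof (rule measurable_If)
    show "(\<lambda>\<omega>. h' (if ereal t < \<tau> \<omega> then X t \<omega> else 0, if ereal t < \<tau> \<omega> then Y t \<omega> else 0)) \<in> borel_measurable (F t)"
      by (rule measurable_compose[OF Z h'])
    show "{\<omega> \<in> space (F t). ereal t < \<tau> \<omega>} \<in> sets (F t)" using stopping_set[OF tau t] by simp
  qed simp
  then show "(\<lambda>\<omega>. if ereal t < \<tau> \<omega> then h (X t \<omega>, Y t \<omega>) else 0) \<in> borel_measurable (F t)"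
  proof (rule measurable_F_AE_cong[OF _ _ t])
    show "AE \<omega> in M. (if ereal t < \<tau> \<omega> then h (X t \<omega>, Y t \<omega>) else 0) = g \<omega>"
      using ae
    proof (rule AE_mp, intro AE_I2 impI)
      fix \<omega> assume "\<forall>t\<ge>0. ereal t < \<tau> \<omega> \<longrightarrow> (X t \<omega>, Y t \<omega>) \<in> E"
      then show "(if ereal t < \<tau> \<omega> then h (X t \<omega>, Y t \<omega>) else 0) = g \<omega>"
        using t by (simp add: g_def h'_def)
    qed
  qed
qed

end

lemma continuous_on_set_integral:
  fixes f :: "real \<Rightarrow> real"
  assumes "set_integrable lborel {0..T} f"
  shows "continuous_on {0..T} (\<lambda>t. LINT s:{0..t}|lborel. f s)"
proof -
  have "continuous_on {0..T} (\<lambda>t. integral {0..t} f)"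
    by (rule indefinite_integral_continuous_1) (rule set_borel_integral_eq_integral(1)[OF assms])
  then show ?thesis
  proof (rule continuous_on_eq)
    fix t assume "t \<in> {0..T}"
    then have "set_integrable lborel {0..t} f" by (intro set_integrable_subset[OF assms]) auto
    then show "integral {0..t} f = (LINT s:{0..t}|lborel. f s)" by (simp add: set_borel_integral_eq_integral(2))
  qed
qed

text \<open>Equations are obtained almost surely at one time; this passes from the rational times to
  all times for a given outcome.\<close>

lemma zero_upto_from_rationals:
  fixes \<phi> :: "real \<Rightarrow> real"
  assumes c: "\<And>T. 0 < T \<Longrightarrow> ereal T < S \<Longrightarrow> continuous_on {0..T} \<phi>" and z: "\<phi> 0 = 0"
    and q: "\<And>q. q \<in> \<rat> \<Longrightarrow> 0 < q \<Longrightarrow> ereal q < S \<Longrightarrow> \<phi> q = 0"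
    and t: "0 \<le> t" "ereal t < S"
  shows "\<phi> t = 0"
proof (rule ccontr)
  assume nz: "\<phi> t \<noteq> 0"
  then have tp: "0 < t" using z t by (cases "t = 0") auto
  have "\<exists>q\<in>\<rat> \<inter> {0..t}. \<phi> q \<in> - {0} \<and> \<bar>q - t\<bar> < t"
    by (rule rational_witness[OF tp c[OF tp t(2)]]) (use tp nz in auto)
  then obtain r where r: "r \<in> \<rat>" "0 \<le> r" "r \<le> t" "\<phi> r \<noteq> 0" by auto
  then have "0 < r" using z by (cases "r = 0") auto
  then show False using q[OF r(1)] r t(2) by (metis ereal_less_eq(3) le_less_trans)
qed

text \<open>This and the next two definitions are \<open>A_mat\<close>, \<open>sig\<close> and
  \<open>drift_xi\<close> with the images of functions replaced by vectors of the Hilbert space, so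
  that the stochastic argument refers to no function space. The argument \<open>y\<close> of the
  drift stands for the image of the Cahn-Hilliard operator.\<close>

definition reduced_matrix ::
  "(2 \<Rightarrow> real^2 \<Rightarrow> 'h::real_inner) \<Rightarrow> (2 \<Rightarrow> 2 \<Rightarrow> real^2 \<Rightarrow> 'h) \<Rightarrow> (2 \<Rightarrow> real^2 \<Rightarrow> 'h) \<Rightarrow> real^2 \<Rightarrow> 'h \<Rightarrow> real^2^2" where
  "reduced_matrix \<Psi> \<Psi>1 G1 x n = (\<chi> k j. \<Psi> k x \<bullet> G1 j x - n \<bullet> \<Psi>1 k j x)"

definition reduced_sigma ::
  "(2 \<Rightarrow> real^2 \<Rightarrow> 'h::real_inner) \<Rightarrow> (2 \<Rightarrow> 2 \<Rightarrow> real^2 \<Rightarrow> 'h) \<Rightarrow> (2 \<Rightarrow> real^2 \<Rightarrow> 'h) \<Rightarrow> 2 \<Rightarrow> real^2 \<Rightarrow> 'h \<Rightarrow> 'h" where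
  "reduced_sigma \<Psi> \<Psi>1 G1 r x n = (\<Sum>i\<in>UNIV. (matrix_inv (reduced_matrix \<Psi> \<Psi>1 G1 x n) $ r $ i) *\<^sub>R \<Psi> i x)"

definition reduced_drift ::
  "('h::real_inner \<Rightarrow> 'h) \<Rightarrow> (2 \<Rightarrow> real^2 \<Rightarrow> 'h) \<Rightarrow> (2 \<Rightarrow> 2 \<Rightarrow> real^2 \<Rightarrow> 'h) \<Rightarrow> (2 \<Rightarrow> 2 \<Rightarrow> 2 \<Rightarrow> real^2 \<Rightarrow> 'h) \<Rightarrow>
   (2 \<Rightarrow> real^2 \<Rightarrow> 'h) \<Rightarrow> (2 \<Rightarrow> 2 \<Rightarrow> real^2 \<Rightarrow> 'h) \<Rightarrow> 2 \<Rightarrow> real^2 \<Rightarrow> 'h \<Rightarrow> 'h \<Rightarrow> real" where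
  "reduced_drift Q \<Psi> \<Psi>1 \<Psi>2 G1 G2 r x n y =
     (\<Sum>i\<in>UNIV. matrix_inv (reduced_matrix \<Psi> \<Psi>1 G1 x n) $ r $ i *
       (y \<bullet> \<Psi> i x +
        (\<Sum>j\<in>UNIV. \<Sum>k\<in>UNIV. (1/2 * (n \<bullet> \<Psi>2 i j k x) - \<Psi>1 i j x \<bullet> G1 k x - 1/2 * (\<Psi> i x \<bullet> G2 j k x))
           * (Q (reduced_sigma \<Psi> \<Psi>1 G1 k x n) \<bullet> reduced_sigma \<Psi> \<Psi>1 G1 j x n)) +
        (\<Sum>j\<in>UNIV. Q (\<Psi>1 i j x) \<bullet> reduced_sigma \<Psi> \<Psi>1 G1 j x n)))"

text \<open>Here \<open>\<nu>\<close> and \<open>l\<close> stand for the images of \<open>v\<close> and of the Cahn-Hilliard operator applied to \<open>ut + v\<close>,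
  \<open>\<Psi> k\<close> for that of \<open>\<psi> k\<close>, and \<open>G\<close> for that of \<open>ut \<xi> - ut \<xi>0\<close>; the digits mark derivatives.\<close>

locale reduced_system = wiener M F Q W
  for M :: "'s measure" and F :: "real \<Rightarrow> 's measure"
    and Q :: "'h::{real_inner,banach,second_countable_topology} \<Rightarrow> 'h" and W :: "real \<Rightarrow> 's \<Rightarrow> 'h" +
  fixes D :: "(real^2) set" and \<tau> :: "'s \<Rightarrow> ereal" and \<xi> :: "real \<Rightarrow> 's \<Rightarrow> real^2" and \<nu> l :: "real \<Rightarrow> 's \<Rightarrow> 'h"
    and \<Psi> :: "2 \<Rightarrow> real^2 \<Rightarrow> 'h" and \<Psi>1 :: "2 \<Rightarrow> 2 \<Rightarrow> real^2 \<Rightarrow> 'h" and \<Psi>2 :: "2 \<Rightarrow> 2 \<Rightarrow> 2 \<Rightarrow> real^2 \<Rightarrow> 'h"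
    and G :: "real^2 \<Rightarrow> 'h" and G1 :: "2 \<Rightarrow> real^2 \<Rightarrow> 'h" and G2 :: "2 \<Rightarrow> 2 \<Rightarrow> real^2 \<Rightarrow> 'h"
    and I :: "2 \<Rightarrow> real \<Rightarrow> 's \<Rightarrow> real" and J :: "2 \<Rightarrow> real \<Rightarrow> 's \<Rightarrow> 'h"
  assumes tau: "stopping M F \<tau>" and D: "open D"
    and c2\<Psi>: "\<And>k. c2map D (\<Psi> k) (\<Psi>1 k) (\<Psi>2 k)" and c2G: "c2map D G G1 G2"
    and adapted_\<xi>: "adapted_upto F \<tau> \<xi>" and adapted_\<nu>: "adapted_upto F \<tau> \<nu>"
    and path_cont: "AE \<omega> in M. continuous_upto (\<tau> \<omega>) (\<lambda>t. \<xi> t \<omega>) \<and> continuous_upto (\<tau> \<omega>) (\<lambda>t. \<nu> t \<omega>)"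
    and working: "AE \<omega> in M. \<forall>t\<ge>0. ereal t < \<tau> \<omega> \<longrightarrow> \<xi> t \<omega> \<in> D \<and> invertible (reduced_matrix \<Psi> \<Psi>1 G1 (\<xi> t \<omega>) (\<nu> t \<omega>))"
    and drift_integrable: "AE \<omega> in M. \<forall>t\<ge>0. ereal t < \<tau> \<omega> \<longrightarrow>
      (\<forall>r. set_integrable lborel {0..t} (\<lambda>s. reduced_drift Q \<Psi> \<Psi>1 \<Psi>2 G1 G2 r (\<xi> s \<omega>) (\<nu> s \<omega>) (l s \<omega>))) \<and>
      set_integrable lborel {0..t} (\<lambda>s. l s \<omega>)"
    and ito_\<xi>: "\<And>r. has_ito_integral M F W \<tau> (\<lambda>s \<omega>. blinfun_inner_right (reduced_sigma \<Psi> \<Psi>1 G1 r (\<xi> s \<omega>) (\<nu> s \<omega>))) (I r)"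
    and \<xi>_eq: "AE \<omega> in M. \<forall>t\<ge>0. ereal t < \<tau> \<omega> \<longrightarrow> (\<forall>r. \<xi> t \<omega> $ r = \<xi> 0 \<omega> $ r
      + (LINT s:{0..t}|lborel. reduced_drift Q \<Psi> \<Psi>1 \<Psi>2 G1 G2 r (\<xi> s \<omega>) (\<nu> s \<omega>) (l s \<omega>)) + I r t \<omega>)"
    and ito_\<nu>: "\<And>j. has_ito_integral M F W \<tau> (\<lambda>s \<omega>. blinfun_scaleR_left (G1 j (\<xi> s \<omega>))
      o\<^sub>L blinfun_inner_right (reduced_sigma \<Psi> \<Psi>1 G1 j (\<xi> s \<omega>) (\<nu> s \<omega>))) (J j)"
    and \<nu>_eq: "AE \<omega> in M. \<forall>t\<ge>0. ereal t < \<tau> \<omega> \<longrightarrow>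
      \<nu> t \<omega> = \<nu> 0 \<omega> + (LINT s:{0..t}|lborel. l s \<omega>) + W t \<omega>
        - (\<Sum>j\<in>UNIV. (LINT s:{0..t}|lborel.
             reduced_drift Q \<Psi> \<Psi>1 \<Psi>2 G1 G2 j (\<xi> s \<omega>) (\<nu> s \<omega>) (l s \<omega>) *\<^sub>R G1 j (\<xi> s \<omega>)) + J j t \<omega>)
        - (1/2) *\<^sub>R (\<Sum>i\<in>UNIV. \<Sum>j\<in>UNIV. LINT s:{0..t}|lborel.
             (Q (reduced_sigma \<Psi> \<Psi>1 G1 j (\<xi> s \<omega>) (\<nu> s \<omega>)) \<bullet> reduced_sigma \<Psi> \<Psi>1 G1 i (\<xi> s \<omega>) (\<nu> s \<omega>)) *\<^sub>R G2 i j (\<xi> s \<omega>))"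
begin

definition A :: "real \<Rightarrow> 's \<Rightarrow> real^2^2" where
  "A t \<omega> = reduced_matrix \<Psi> \<Psi>1 G1 (\<xi> t \<omega>) (\<nu> t \<omega>)"

definition \<sigma> :: "2 \<Rightarrow> real \<Rightarrow> 's \<Rightarrow> 'h" where
  "\<sigma> r t \<omega> = reduced_sigma \<Psi> \<Psi>1 G1 r (\<xi> t \<omega>) (\<nu> t \<omega>)"

definition f :: "2 \<Rightarrow> real \<Rightarrow> 's \<Rightarrow> real" where
  "f r t \<omega> = reduced_drift Q \<Psi> \<Psi>1 \<Psi>2 G1 G2 r (\<xi> t \<omega>) (\<nu> t \<omega>) (l t \<omega>)"

text \<open>The open set of states on which all coefficients of the system are continuous
  functions.\<close>

definition E :: "((real^2) \<times> 'h) set" where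
  "E = (D \<times> UNIV) \<inter> (\<lambda>z. det (reduced_matrix \<Psi> \<Psi>1 G1 (fst z) (snd z))) -` (- {0})"

lemma c2_continuous:
  "continuous_on D (\<Psi> k)" "continuous_on D (\<Psi>1 k j)" "continuous_on D (\<Psi>2 k j m)"
  "continuous_on D G" "continuous_on D (G1 j)" "continuous_on D (G2 j m)"
  using c2\<Psi>[of k] c2G unfolding c2map_def by auto

lemma continuous_matrix: "continuous_on (D \<times> UNIV) (\<lambda>z. reduced_matrix \<Psi> \<Psi>1 G1 (fst z) (snd z) $ k $ j)"
proof -
  have c: "continuous_on (D \<times> UNIV) (\<lambda>z. h (fst z))" if "continuous_on D h" for h :: "real^2 \<Rightarrow> 'h"
    by (rule continuous_on_compose2[OF that]) (auto intro: continuous_intros)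
  show ?thesis
    unfolding reduced_matrix_def by (simp, intro continuous_intros c c2_continuous)
qed

lemma open_E: "open E"
  unfolding E_def
proof (rule continuous_open_preimage)
  show "continuous_on (D \<times> UNIV) (\<lambda>z. det (reduced_matrix \<Psi> \<Psi>1 G1 (fst z) (snd z)))"
    unfolding det_2 by (intro continuous_intros continuous_matrix)
qed (auto intro: open_Times D)

lemma E_subset: "E \<subseteq> D \<times> UNIV"
  by (auto simp: E_def)

lemma E_invertible: "z \<in> E \<Longrightarrow> invertible (reduced_matrix \<Psi> \<Psi>1 G1 (fst z) (snd z))"
  by (simp add: E_def invertible_det_nz)

lemma in_E: "AE \<omega> in M. \<forall>t\<ge>0. ereal t < \<tau> \<omega> \<longrightarrow> (\<xi> t \<omega>, \<nu> t \<omega>) \<in> E"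
  using working by (rule AE_mp) (simp add: E_def invertible_det_nz)

lemma continuous_on_E_fst: "continuous_on D h \<Longrightarrow> continuous_on E (\<lambda>z. h (fst z))"
  by (rule continuous_on_compose2[of D h]) (use E_subset in \<open>auto intro: continuous_intros\<close>)

lemma continuous_sigma: "continuous_on E (\<lambda>z. reduced_sigma \<Psi> \<Psi>1 G1 r (fst z) (snd z))"
  unfolding reduced_sigma_def
  by (intro continuous_intros continuous_on_matrix_inv_2 continuous_on_E_fst c2_continuous E_invertible
      continuous_on_subset[OF continuous_matrix E_subset])

lemma adapted_compose: "continuous_on E (\<lambda>z. h (fst z) (snd z)) \<Longrightarrow> adapted_upto F \<tau> (\<lambda>t \<omega>. h (\<xi> t \<omega>) (\<nu> t \<omega>))"
  for h :: "real^2 \<Rightarrow> 'h \<Rightarrow> 'b::real_normed_vector"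
  using adapted_upto_compose[OF tau adapted_\<xi> adapted_\<nu> open_E _ in_E, of "\<lambda>z. h (fst z) (snd z)"] by simp

lemma continuous_compose:
  fixes h :: "real^2 \<Rightarrow> 'h \<Rightarrow> 'b::real_normed_vector"
  assumes "continuous_on E (\<lambda>z. h (fst z) (snd z))"
  shows "AE \<omega> in M. continuous_upto (\<tau> \<omega>) (\<lambda>t. h (\<xi> t \<omega>) (\<nu> t \<omega>))"
  using path_cont in_E
proof eventually_elim
  case (elim \<omega>)
  let ?S = "{t. 0 \<le> t \<and> ereal t < \<tau> \<omega>}"
  have "continuous_on ?S (\<lambda>t. (\<lambda>z. h (fst z) (snd z)) (\<xi> t \<omega>, \<nu> t \<omega>))"
    using elim unfolding continuous_upto_def by (intro continuous_on_compose2[OF assms] continuous_on_Pair) auto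
  then show ?case unfolding continuous_upto_def by simp
qed

lemma sigma_continuous: "AE \<omega> in M. \<forall>r. continuous_upto (\<tau> \<omega>) (\<lambda>t. \<sigma> r t \<omega>)"
  unfolding AE_all_countable \<sigma>_def using continuous_compose[OF continuous_sigma] by blast

lemma sigma_adapted: "adapted_upto F \<tau> (\<sigma> r)"
  unfolding \<sigma>_def[abs_def] by (rule adapted_compose[OF continuous_sigma])

text \<open>For almost every outcome the hypotheses of the pathwise locale hold; the error of the
  Ito parts along \<open>k\<close> is the one ingredient that has to be supplied.\<close>

lemma good_path:
  assumes T: "0 < T" and k: "strict_mono (k :: nat \<Rightarrow> nat)"
    and err: "AE \<omega> in M. ereal T < \<tau> \<omega> \<longrightarrow> (\<forall>r. (\<lambda>n. \<Sum>i<2 ^ k n. (I r (grid T (k n) (Suc i)) \<omega> - I r (grid T (k n) i) \<omega>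
      - \<sigma> r (grid T (k n) i) \<omega> \<bullet> (W (grid T (k n) (Suc i)) \<omega> - W (grid T (k n) i) \<omega>))\<^sup>2) \<longlonglongrightarrow> 0)"
  shows "AE \<omega> in M. ereal T < \<tau> \<omega> \<longrightarrow> (\<exists>V. ito_path T Q (\<lambda>t. W t \<omega>) k (\<lambda>t. \<xi> t \<omega>)
      (\<lambda>r t. f r t \<omega>) (\<lambda>r t. I r t \<omega>) (\<lambda>r t. \<sigma> r t \<omega>) V)"
proof -
  have Wc: "AE \<omega> in M. W 0 \<omega> = 0 \<and> continuous_on {0..} (\<lambda>t. W t \<omega>)"
    using Wiener unfolding Q_Wiener_def by (elim conjE) assumption
  show ?thesis
    using AE_quadratic_variation[OF T] Wc path_cont sigma_continuous drift_integrable \<xi>_eq err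
  proof eventually_elim
    case (elim \<omega>)
    show ?case
    proof
      assume t: "ereal T < \<tau> \<omega>"
      obtain V where V: "\<forall>n. (\<Sum>i<2 ^ n. (norm (W (grid T n (Suc i)) \<omega> - W (grid T n i) \<omega>))\<^sup>2) \<le> V"
        using elim(1) by blast
      have le: "ereal s < \<tau> \<omega>" if "s \<in> {0..T}" for s
        using that by (intro le_less_trans[OF _ t]) simp
      have "ito_path T Q (\<lambda>t. W t \<omega>) k (\<lambda>t. \<xi> t \<omega>) (\<lambda>r t. f r t \<omega>) (\<lambda>r t. I r t \<omega>) (\<lambda>r t. \<sigma> r t \<omega>) V"
      proof (rule ito_path.intro)
        show "bounded_linear Q" "\<And>x y. Q x \<bullet> y = x \<bullet> Q y" using cov by (auto simp: covariance_op_def)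
        show "continuous_on {0..T} (\<lambda>t. W t \<omega>)" by (rule continuous_on_subset[OF conjunct2[OF elim(2)]]) auto
        show "continuous_on {0..T} (\<lambda>t. \<xi> t \<omega>)" by (rule continuous_uptoD[OF conjunct1[OF elim(3)] t])
        show "continuous_on {0..T} (\<lambda>t. \<sigma> r t \<omega>)" for r by (rule continuous_uptoD[OF spec[OF elim(4)] t])
        show "set_integrable lborel {0..T} (\<lambda>t. f r t \<omega>)" for r
          using elim(5) T t unfolding f_def by auto
        show "\<xi> s \<omega> $ r = \<xi> 0 \<omega> $ r + (LINT t:{0..s}|lborel. f r t \<omega>) + I r s \<omega>" if "s \<in> {0..T}" for s r
          using elim(6) le[OF that] that unfolding f_def by simp
      qed (use T k V elim(1,7) t in blast)+
      then show "\<exists>V. ito_path T Q (\<lambda>t. W t \<omega>) k (\<lambda>t. \<xi> t \<omega>) (\<lambda>r t. f r t \<omega>) (\<lambda>r t. I r t \<omega>) (\<lambda>r t. \<sigma> r t \<omega>) V"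
        by blast
    qed
  qed
qed

end

text \<open>Testing the rank one integrand against \<open>h\<close> gives a functional, so that
  \<open>h \<bullet> J j\<close> is a real Ito integral to which the Riemann sum estimates
  apply.\<close>

lemma inner_right_compose_rank_one:
  "blinfun_inner_right h o\<^sub>L (blinfun_scaleR_left y o\<^sub>L blinfun_inner_right z) = blinfun_inner_right ((h \<bullet> y) *\<^sub>R z)"
  by (rule blinfun_eqI) (simp add: mult.commute)

lemma set_integral_point [simp]:
  fixes g :: "real \<Rightarrow> 'b::{banach,second_countable_topology}"
  shows "(LINT s:{a}|lborel. g s) = 0"
proof -
  have "AE s in lborel. s \<noteq> a" by (rule AE_lborel_singleton)
  then have "AE s in lborel. indicator {a} s *\<^sub>R g s = 0" by (rule AE_mp) simp
  then show ?thesis unfolding set_lebesgue_integral_def by (rule integral_eq_zero_AE)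
qed

section \<open>Error sums and the equation of the shifted process\<close>

context reduced_system begin

abbreviation dI :: "2 \<Rightarrow> real \<Rightarrow> nat \<Rightarrow> nat \<Rightarrow> 's \<Rightarrow> real" where
  "dI r T n i \<omega> \<equiv> I r (grid T n (Suc i)) \<omega> - I r (grid T n i) \<omega>"

abbreviation ddW :: "real \<Rightarrow> nat \<Rightarrow> nat \<Rightarrow> 's \<Rightarrow> 'h" where
  "ddW T n i \<omega> \<equiv> W (grid T n (Suc i)) \<omega> - W (grid T n i) \<omega>"

lemma riemann_error_small:
  fixes X Y :: "real \<Rightarrow> 's \<Rightarrow> real"
  assumes T: "0 < T" and ito: "has_ito_integral M F W \<tau> (\<lambda>s \<omega>. blinfun_inner_right (g s \<omega>)) X"
    and g: "adapted_upto F \<tau> g" and Y: "adapted_upto F \<tau> Y" "AE \<omega> in M. continuous_upto (\<tau> \<omega>) (\<lambda>t. Y t \<omega>)"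
  shows "\<forall>d>0. \<forall>e>0. \<forall>\<^sub>F n in sequentially. small M {\<omega>. ereal T < \<tau> \<omega> \<and>
      \<bar>\<Sum>i<2 ^ n. Y (grid T n i) \<omega> * (X (grid T n (Suc i)) \<omega> - X (grid T n i) \<omega> - g (grid T n i) \<omega> \<bullet> ddW T n i \<omega>)\<bar> > d} e" (is ?A)
    and "\<forall>d>0. \<forall>e>0. \<forall>\<^sub>F n in sequentially. small M {\<omega>. ereal T < \<tau> \<omega> \<and>
      \<bar>\<Sum>i<2 ^ n. (Y (grid T n i) \<omega> * (X (grid T n (Suc i)) \<omega> - X (grid T n i) \<omega> - g (grid T n i) \<omega> \<bullet> ddW T n i \<omega>))\<^sup>2\<bar> > d} e" (is ?B)
proof -
  note S = ito_riemann_small[OF T tau ito g Y, unfolded dW_def]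
  show ?A
  proof (intro allI impI)
    fix d e :: real assume "d > 0" "e > 0"
    from S[OF this] show "\<forall>\<^sub>F n in sequentially. small M {\<omega>. ereal T < \<tau> \<omega> \<and>
      \<bar>\<Sum>i<2 ^ n. Y (grid T n i) \<omega> * (X (grid T n (Suc i)) \<omega> - X (grid T n i) \<omega> - g (grid T n i) \<omega> \<bullet> ddW T n i \<omega>)\<bar> > d} e"
      by (rule eventually_mono) (erule small_mono_set, auto)
  qed
  show ?B
  proof (intro allI impI)
    fix d e :: real assume "d > 0" "e > 0"
    from S[OF this] show "\<forall>\<^sub>F n in sequentially. small M {\<omega>. ereal T < \<tau> \<omega> \<and>
      \<bar>\<Sum>i<2 ^ n. (Y (grid T n i) \<omega> * (X (grid T n (Suc i)) \<omega> - X (grid T n i) \<omega> - g (grid T n i) \<omega> \<bullet> ddW T n i \<omega>))\<^sup>2\<bar> > d} e"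
      by (rule eventually_mono) (erule small_mono_set, auto simp: abs_of_nonneg[OF sum_nonneg])
  qed
qed

text \<open>Even a constant has to be checked, because adaptedness refers to the process cut off at
  \<open>\<tau>\<close>. It serves as the weight of unweighted sums.\<close>

lemma one_adapted: "adapted_upto F \<tau> (\<lambda>t \<omega>. 1 :: real)"
  unfolding adapted_upto_def using stopping_set[OF tau] by (auto intro!: measurable_If)

lemma riemann_error_\<xi>:
  assumes T: "0 < T"
  shows "\<forall>d>0. \<forall>e>0. \<forall>\<^sub>F n in sequentially. small M {\<omega>. ereal T < \<tau> \<omega> \<and>
      \<bar>\<Sum>i<2 ^ n. (dI r T n i \<omega> - \<sigma> r (grid T n i) \<omega> \<bullet> ddW T n i \<omega>)\<^sup>2\<bar> > d} e"
  using riemann_error_small(2)[OF T ito_\<xi>[of r, folded \<sigma>_def] sigma_adapted one_adapted]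
  by (simp add: continuous_upto_def)

text \<open>The quadratic errors of the components of \<xi>, needed for the pathwise calculus, are
  added to the given errors by a disjoint sum, so that all of them vanish along the same
  levels.\<close>

lemma good_subsequence:
  fixes err :: "'i \<Rightarrow> nat \<Rightarrow> 's \<Rightarrow> real"
  assumes T: "0 < T" and K: "finite K"
    and err: "\<And>a. a \<in> K \<Longrightarrow> \<forall>d>0. \<forall>e>0. \<forall>\<^sub>F n in sequentially. small M {\<omega>. ereal T < \<tau> \<omega> \<and> \<bar>err a n \<omega>\<bar> > d} e"
  shows "\<exists>k. AE \<omega> in M. ereal T < \<tau> \<omega> \<longrightarrow> (\<forall>a\<in>K. (\<lambda>n. err a (k n) \<omega>) \<longlonglongrightarrow> 0) \<and>
    (\<exists>V. ito_path T Q (\<lambda>t. W t \<omega>) k (\<lambda>t. \<xi> t \<omega>) (\<lambda>r t. f r t \<omega>) (\<lambda>r t. I r t \<omega>) (\<lambda>r t. \<sigma> r t \<omega>) V)"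
proof -
  define sq where "sq r n \<omega> = (\<Sum>i<2 ^ n. (dI r T n i \<omega> - \<sigma> r (grid T n i) \<omega> \<bullet> ddW T n i \<omega>)\<^sup>2)" for r n \<omega>
  have "\<forall>d>0. \<forall>e>0. \<forall>\<^sub>F n in sequentially. small M {\<omega>. ereal T < \<tau> \<omega> \<and> \<bar>case_sum err sq a n \<omega>\<bar> > d} e"
    if a: "a \<in> K <+> UNIV" for a
  proof (cases a)
    case (Inl b)
    then show ?thesis using a err[of b] by auto
  next
    case (Inr r)
    then show ?thesis using riemann_error_\<xi>[OF T, of r] unfolding sq_def by simp
  qed
  then have "\<exists>k. strict_mono (k :: nat \<Rightarrow> nat) \<and> (AE \<omega> in M. ereal T < \<tau> \<omega> \<longrightarrow>
      (\<forall>a\<in>K <+> UNIV. (\<lambda>n. case_sum err sq a (k n) \<omega>) \<longlonglongrightarrow> 0))"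
    by (rule small_AE_tendsto_finite[OF finite_Plus[OF K finite]])
  then obtain k where k: "strict_mono k"
    and lim: "AE \<omega> in M. ereal T < \<tau> \<omega> \<longrightarrow> (\<forall>a\<in>K <+> UNIV. (\<lambda>n. case_sum err sq a (k n) \<omega>) \<longlonglongrightarrow> 0)"
    by (elim exE conjE) (rule that; assumption)
  have lim': "AE \<omega> in M. ereal T < \<tau> \<omega> \<longrightarrow> (\<forall>a\<in>K. (\<lambda>n. err a (k n) \<omega>) \<longlonglongrightarrow> 0) \<and> (\<forall>r. (\<lambda>n. sq r (k n) \<omega>) \<longlonglongrightarrow> 0)"
    using lim by (rule AE_mp) (simp add: Plus_def ball_Un)
  then have "AE \<omega> in M. ereal T < \<tau> \<omega> \<longrightarrow> (\<forall>r. (\<lambda>n. sq r (k n) \<omega>) \<longlonglongrightarrow> 0)" by (rule AE_mp) simp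
  from good_path[OF T k this[unfolded sq_def]] lim'
  have "AE \<omega> in M. ereal T < \<tau> \<omega> \<longrightarrow> (\<forall>a\<in>K. (\<lambda>n. err a (k n) \<omega>) \<longlonglongrightarrow> 0) \<and>
    (\<exists>V. ito_path T Q (\<lambda>t. W t \<omega>) k (\<lambda>t. \<xi> t \<omega>) (\<lambda>r t. f r t \<omega>) (\<lambda>r t. I r t \<omega>) (\<lambda>r t. \<sigma> r t \<omega>) V)"
    by eventually_elim simp
  then show ?thesis by (rule exI[of _ k])
qed

lemma riemann_error_\<xi>_weighted:
  assumes T: "0 < T" and h: "continuous_on E (\<lambda>z. h (fst z) (snd z))"
  shows "\<forall>d>0. \<forall>e>0. \<forall>\<^sub>F n in sequentially. small M {\<omega>. ereal T < \<tau> \<omega> \<and>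
      \<bar>\<Sum>i<2 ^ n. h (\<xi> (grid T n i) \<omega>) (\<nu> (grid T n i) \<omega>) * (dI r T n i \<omega> - \<sigma> r (grid T n i) \<omega> \<bullet> ddW T n i \<omega>)\<bar> > d} e"
  by (rule riemann_error_small(1)[OF T ito_\<xi>[of r, folded \<sigma>_def] sigma_adapted adapted_compose[of h] continuous_compose[of h]])
    (rule h)+

lemma riemann_error_\<nu>:
  assumes T: "0 < T"
  shows "\<forall>d>0. \<forall>e>0. \<forall>\<^sub>F n in sequentially. small M {\<omega>. ereal T < \<tau> \<omega> \<and>
      \<bar>\<Sum>i<2 ^ n. (h \<bullet> J j (grid T n (Suc i)) \<omega> - h \<bullet> J j (grid T n i) \<omega>
        - ((h \<bullet> G1 j (\<xi> (grid T n i) \<omega>)) *\<^sub>R \<sigma> j (grid T n i) \<omega>) \<bullet> ddW T n i \<omega>)\<bar> > d} e"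
proof -
  have "has_ito_integral M F W \<tau> (\<lambda>s \<omega>. blinfun_inner_right ((h \<bullet> G1 j (\<xi> s \<omega>)) *\<^sub>R \<sigma> j s \<omega>)) (\<lambda>t \<omega>. h \<bullet> J j t \<omega>)"
    using has_ito_integral_compose[OF ito_\<nu>[of j, folded \<sigma>_def], of "blinfun_inner_right h"]
    by (simp add: inner_right_compose_rank_one)
  moreover have "adapted_upto F \<tau> (\<lambda>s \<omega>. (h \<bullet> G1 j (\<xi> s \<omega>)) *\<^sub>R \<sigma> j s \<omega>)"
    unfolding \<sigma>_def
    by (rule adapted_compose[of "\<lambda>x n. (h \<bullet> G1 j x) *\<^sub>R reduced_sigma \<Psi> \<Psi>1 G1 j x n"])
      (intro continuous_intros continuous_sigma continuous_on_E_fst c2_continuous)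
  ultimately show ?thesis
    using riemann_error_small(1)[OF T _ _ one_adapted, of "\<lambda>s \<omega>. (h \<bullet> G1 j (\<xi> s \<omega>)) *\<^sub>R \<sigma> j s \<omega>" "\<lambda>t \<omega>. h \<bullet> J j t \<omega>"]
    by (simp add: continuous_upto_def)
qed

text \<open>The pathwise formula gives the limit of sums of \<open>h \<bullet> G1 j\<close> against
  increments of \<open>I j\<close>. Up to null errors these sums coincide with sums of increments of
  \<open>h \<bullet> J j\<close>, which telescope, so the unknown martingale part is identified on
  every level.\<close>

lemma G_increment:
  assumes T: "0 < T"
  shows "AE \<omega> in M. ereal T < \<tau> \<omega> \<longrightarrow> h \<bullet> G (\<xi> T \<omega>) - h \<bullet> G (\<xi> 0 \<omega>) = (\<Sum>j\<in>UNIV. h \<bullet> J j T \<omega> - h \<bullet> J j 0 \<omega>)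
    + (\<Sum>j\<in>UNIV. LINT s:{0..T}|lborel. (h \<bullet> G1 j (\<xi> s \<omega>)) * f j s \<omega>)
    + (1/2) * (\<Sum>j\<in>UNIV. \<Sum>m\<in>UNIV. LINT s:{0..T}|lborel. (h \<bullet> G2 j m (\<xi> s \<omega>)) * (Q (\<sigma> j s \<omega>) \<bullet> \<sigma> m s \<omega>))"
proof -
  define e1 where "e1 r n \<omega> = (\<Sum>i<2 ^ n. (h \<bullet> G1 r (\<xi> (grid T n i) \<omega>)) * (dI r T n i \<omega> - \<sigma> r (grid T n i) \<omega> \<bullet> ddW T n i \<omega>))" for r n \<omega>
  define e2 where "e2 r n \<omega> = (\<Sum>i<2 ^ n. (h \<bullet> J r (grid T n (Suc i)) \<omega> - h \<bullet> J r (grid T n i) \<omega>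
        - ((h \<bullet> G1 r (\<xi> (grid T n i) \<omega>)) *\<^sub>R \<sigma> r (grid T n i) \<omega>) \<bullet> ddW T n i \<omega>))" for r n \<omega>
  have G1h: "continuous_on E (\<lambda>z. h \<bullet> G1 r (fst z))" for r
    by (intro continuous_intros continuous_on_E_fst c2_continuous)
  have "\<forall>d>0. \<forall>e>0. \<forall>\<^sub>F n in sequentially. small M {\<omega>. ereal T < \<tau> \<omega> \<and> \<bar>case_sum e1 e2 a n \<omega>\<bar> > d} e" for a
  proof (cases a)
    case (Inl r)
    show ?thesis unfolding Inl sum.case e1_def by (rule riemann_error_\<xi>_weighted[OF T G1h])
  next
    case (Inr r)
    show ?thesis unfolding Inr sum.case e2_def by (rule riemann_error_\<nu>[OF T])
  qed
  from good_subsequence[where K=UNIV and err="case_sum e1 e2", OF T finite this]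
  obtain k where k: "AE \<omega> in M. ereal T < \<tau> \<omega> \<longrightarrow> (\<forall>a\<in>UNIV. (\<lambda>n. case_sum e1 e2 a (k n) \<omega>) \<longlonglongrightarrow> 0) \<and>
    (\<exists>V. ito_path T Q (\<lambda>t. W t \<omega>) k (\<lambda>t. \<xi> t \<omega>) (\<lambda>r t. f r t \<omega>) (\<lambda>r t. I r t \<omega>) (\<lambda>r t. \<sigma> r t \<omega>) V)"
    by (elim exE)
  from k working show ?thesis
  proof eventually_elim
    case (elim \<omega>)
    show ?case
    proof
      assume t: "ereal T < \<tau> \<omega>"
      obtain V where "ito_path T Q (\<lambda>t. W t \<omega>) k (\<lambda>t. \<xi> t \<omega>) (\<lambda>r t. f r t \<omega>) (\<lambda>r t. I r t \<omega>) (\<lambda>r t. \<sigma> r t \<omega>) V"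
        using elim(1) t by blast
      then interpret P: ito_path T Q "\<lambda>t. W t \<omega>" k "\<lambda>t. \<xi> t \<omega>" "\<lambda>r t. f r t \<omega>" "\<lambda>r t. I r t \<omega>" "\<lambda>r t. \<sigma> r t \<omega>" V .
      have le: "ereal s < \<tau> \<omega>" if "s \<in> {0..T}" for s
        using that by (intro le_less_trans[OF _ t]) simp
      have xD: "\<forall>s\<in>{0..T}. \<xi> s \<omega> \<in> D" using elim(2) le by simp
      have l0: "(\<lambda>n. case_sum e1 e2 a (k n) \<omega>) \<longlonglongrightarrow> 0" for a using elim(1) t by blast
      define R where "R n = (\<Sum>j\<in>UNIV. \<Sum>i<2 ^ k n. (h \<bullet> G1 j (\<xi> (grid T (k n) i) \<omega>)) * dI j T (k n) i \<omega>)" for n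
      \<comment> \<open>The sums with \<sigma> times the Wiener increments cancel between the two
        errors before any limit is taken.\<close>
      have eq: "R n - (\<Sum>j\<in>UNIV. e1 j (k n) \<omega> - e2 j (k n) \<omega>) = (\<Sum>j\<in>UNIV. h \<bullet> J j T \<omega> - h \<bullet> J j 0 \<omega>)" for n
      proof -
        have "(\<Sum>i<2 ^ k n. (h \<bullet> G1 j (\<xi> (grid T (k n) i) \<omega>)) * dI j T (k n) i \<omega>) - (e1 j (k n) \<omega> - e2 j (k n) \<omega>)
          = (\<Sum>i<2 ^ k n. h \<bullet> J j (grid T (k n) (Suc i)) \<omega> - h \<bullet> J j (grid T (k n) i) \<omega>)" for j
          unfolding e1_def e2_def by (simp add: sum_subtractf[symmetric] algebra_simps)
        also have "\<dots> j = h \<bullet> J j T \<omega> - h \<bullet> J j 0 \<omega>" for j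
          using sum_lessThan_telescope[of "\<lambda>i. h \<bullet> J j (grid T (k n) i) \<omega>" "2 ^ k n"] by simp
        finally show ?thesis unfolding R_def by (simp add: sum_subtractf[symmetric])
      qed
      have l1: "(\<lambda>n. \<Sum>j\<in>UNIV. e1 j (k n) \<omega> - e2 j (k n) \<omega>) \<longlonglongrightarrow> (\<Sum>j\<in>(UNIV::2 set). 0 - 0)"
        using l0[of "Inl _"] l0[of "Inr _"] by (intro tendsto_sum tendsto_diff) simp_all
      have l2: "R \<longlonglongrightarrow> h \<bullet> G (\<xi> T \<omega>) - h \<bullet> G (\<xi> 0 \<omega>)
          - (\<Sum>j\<in>UNIV. LINT s:{0..T}|lborel. (h \<bullet> G1 j (\<xi> s \<omega>)) * f j s \<omega>)
          - (1/2) * (\<Sum>j\<in>UNIV. \<Sum>m\<in>UNIV. LINT s:{0..T}|lborel. (h \<bullet> G2 j m (\<xi> s \<omega>)) * (Q (\<sigma> j s \<omega>) \<bullet> \<sigma> m s \<omega>))"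
        (is "_ \<longlonglongrightarrow> ?L")
        unfolding R_def[abs_def] by (rule P.ito_formula[OF c2G xD])
      have "(\<lambda>n. (\<Sum>j\<in>UNIV. h \<bullet> J j T \<omega> - h \<bullet> J j 0 \<omega>)) \<longlonglongrightarrow> ?L - (\<Sum>j\<in>(UNIV::2 set). 0 - 0)"
        using tendsto_diff[OF l2 l1] unfolding eq .
      then have "(\<Sum>j\<in>UNIV. h \<bullet> J j T \<omega> - h \<bullet> J j 0 \<omega>) = ?L"
        by (simp add: tendsto_const_iff)
      then show "h \<bullet> G (\<xi> T \<omega>) - h \<bullet> G (\<xi> 0 \<omega>) = (\<Sum>j\<in>UNIV. h \<bullet> J j T \<omega> - h \<bullet> J j 0 \<omega>)
        + (\<Sum>j\<in>UNIV. LINT s:{0..T}|lborel. (h \<bullet> G1 j (\<xi> s \<omega>)) * f j s \<omega>)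
        + (1/2) * (\<Sum>j\<in>UNIV. \<Sum>m\<in>UNIV. LINT s:{0..T}|lborel. (h \<bullet> G2 j m (\<xi> s \<omega>)) * (Q (\<sigma> j s \<omega>) \<bullet> \<sigma> m s \<omega>))"
        by linarith
    qed
  qed
qed

lemma W_path: "AE \<omega> in M. W 0 \<omega> = 0 \<and> continuous_on {0..} (\<lambda>t. W t \<omega>)"
  using Wiener unfolding Q_Wiener_def by (elim conjE) assumption

lemma coefficient_integrable:
  assumes T: "0 \<le> T" and t: "ereal T < \<tau> \<omega>"
    and good: "continuous_upto (\<tau> \<omega>) (\<lambda>t. \<xi> t \<omega>)" "\<forall>t\<ge>0. ereal t < \<tau> \<omega> \<longrightarrow> \<xi> t \<omega> \<in> D"
      "\<forall>r. continuous_upto (\<tau> \<omega>) (\<lambda>t. \<sigma> r t \<omega>)" "\<forall>r. set_integrable lborel {0..T} (\<lambda>s. f r s \<omega>)"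
  shows "set_integrable lborel {0..T} (\<lambda>s. f j s \<omega> *\<^sub>R G1 j (\<xi> s \<omega>))"
    and "set_integrable lborel {0..T} (\<lambda>s. (Q (\<sigma> j s \<omega>) \<bullet> \<sigma> i s \<omega>) *\<^sub>R G2 i j (\<xi> s \<omega>))"
proof -
  have x: "continuous_on {0..T} (\<lambda>s. \<xi> s \<omega>)" and s: "continuous_on {0..T} (\<lambda>s. \<sigma> r s \<omega>)" for r
    using good(1,3) t by (auto intro: continuous_uptoD)
  have le: "ereal s < \<tau> \<omega>" if "s \<in> {0..T}" for s
    using that by (intro le_less_trans[OF _ t]) simp
  have c: "continuous_on {0..T} (\<lambda>s. h (\<xi> s \<omega>))" if "continuous_on D h" for h :: "real^2 \<Rightarrow> 'h"
    by (rule continuous_on_compose2[OF that x]) (use good(2) le in auto)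
  have Q: "bounded_linear Q" using cov by (simp add: covariance_op_def)
  show "set_integrable lborel {0..T} (\<lambda>s. f j s \<omega> *\<^sub>R G1 j (\<xi> s \<omega>))"
    using set_integrable_bilinear[OF bounded_bilinear.flip[OF bounded_bilinear_scaleR] c[OF c2_continuous(5)]] good(4) by blast
  show "set_integrable lborel {0..T} (\<lambda>s. (Q (\<sigma> j s \<omega>) \<bullet> \<sigma> i s \<omega>) *\<^sub>R G2 i j (\<xi> s \<omega>))"
    by (intro set_integrable_continuous continuous_intros c c2_continuous s bounded_linear.continuous_on[OF Q])
qed

text \<open>Tested against \<open>h\<close>, the martingale, drift and second-order terms in the
  equation of \<open>\<nu>\<close> are exactly those of \<open>G_increment\<close> with the opposite
  sign.\<close>

lemma shifted_equation_fixed: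
  assumes T: "0 < T"
  shows "AE \<omega> in M. ereal T < \<tau> \<omega> \<longrightarrow>
    h \<bullet> (\<nu> T \<omega> + G (\<xi> T \<omega>) - \<nu> 0 \<omega> - G (\<xi> 0 \<omega>) - (LINT s:{0..T}|lborel. l s \<omega>) - W T \<omega>) = 0"
  using G_increment[OF T, of h] \<nu>_eq W_path drift_integrable path_cont sigma_continuous working
proof eventually_elim
  case (elim \<omega>)
  show ?case
  proof
    assume t: "ereal T < \<tau> \<omega>"
    have t0: "ereal 0 < \<tau> \<omega>" using T by (intro le_less_trans[OF _ t]) simp
    have fi: "\<forall>r. set_integrable lborel {0..T} (\<lambda>s. f r s \<omega>)" using elim(4) T t unfolding f_def by auto
    have wk: "\<forall>t\<ge>0. ereal t < \<tau> \<omega> \<longrightarrow> \<xi> t \<omega> \<in> D" using elim(7) by blast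
    note int = coefficient_integrable[OF less_imp_le[OF T] t conjunct1[OF elim(5)] wk elim(6) fi]
    \<comment> \<open>At time zero all time integrals and W vanish, so the equation of
      \<open>\<nu>\<close> itself gives the initial value of the sum of the
      \<open>J j\<close>.\<close>
    have J0: "(\<Sum>j\<in>UNIV. J j 0 \<omega>) = 0"
    proof -
      have "\<nu> 0 \<omega> = \<nu> 0 \<omega> + W 0 \<omega> - (\<Sum>j\<in>UNIV. J j 0 \<omega>)"
        using elim(2)[rule_format, OF order_refl t0] by simp
      then show ?thesis using elim(3) by simp
    qed
    have "\<nu> T \<omega> = \<nu> 0 \<omega> + (LINT s:{0..T}|lborel. l s \<omega>) + W T \<omega>
        - (\<Sum>j\<in>UNIV. (LINT s:{0..T}|lborel. f j s \<omega> *\<^sub>R G1 j (\<xi> s \<omega>)) + J j T \<omega>)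
        - (1/2) *\<^sub>R (\<Sum>i\<in>UNIV. \<Sum>j\<in>UNIV. LINT s:{0..T}|lborel. (Q (\<sigma> j s \<omega>) \<bullet> \<sigma> i s \<omega>) *\<^sub>R G2 i j (\<xi> s \<omega>))"
      unfolding f_def \<sigma>_def by (rule elim(2)[rule_format, OF less_imp_le[OF T] t])
    then have "h \<bullet> \<nu> T \<omega> = h \<bullet> (\<nu> 0 \<omega> + (LINT s:{0..T}|lborel. l s \<omega>) + W T \<omega>)
        - (\<Sum>j\<in>UNIV. h \<bullet> (LINT s:{0..T}|lborel. f j s \<omega> *\<^sub>R G1 j (\<xi> s \<omega>)) + h \<bullet> J j T \<omega>)
        - (1/2) * (\<Sum>i\<in>UNIV. \<Sum>j\<in>UNIV. h \<bullet> (LINT s:{0..T}|lborel. (Q (\<sigma> j s \<omega>) \<bullet> \<sigma> i s \<omega>) *\<^sub>R G2 i j (\<xi> s \<omega>)))"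
      by (simp add: inner_diff_right inner_add_right inner_sum_right)
    moreover have "h \<bullet> (LINT s:{0..T}|lborel. f j s \<omega> *\<^sub>R G1 j (\<xi> s \<omega>)) = (LINT s:{0..T}|lborel. (h \<bullet> G1 j (\<xi> s \<omega>)) * f j s \<omega>)" for j
      using int(1)[of j] unfolding set_integrable_def set_lebesgue_integral_def
      by (simp add: integral_inner_right[symmetric] mult_ac)
    moreover have "h \<bullet> (LINT s:{0..T}|lborel. (Q (\<sigma> j s \<omega>) \<bullet> \<sigma> i s \<omega>) *\<^sub>R G2 i j (\<xi> s \<omega>))
      = (LINT s:{0..T}|lborel. (h \<bullet> G2 i j (\<xi> s \<omega>)) * (Q (\<sigma> i s \<omega>) \<bullet> \<sigma> j s \<omega>))" for i j
    proof -
      \<comment> \<open>The system pairs \<open>G2 i j\<close> with the covariance in the order j,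
        i; symmetry of \<open>Q\<close> restores the order of the pathwise formula.\<close>
      have "Q (\<sigma> j s \<omega>) \<bullet> \<sigma> i s \<omega> = Q (\<sigma> i s \<omega>) \<bullet> \<sigma> j s \<omega>" for s
        using Q_symmetric by (simp add: inner_commute)
      then show ?thesis using int(2)[of j i] unfolding set_integrable_def set_lebesgue_integral_def
        by (simp add: integral_inner_right[symmetric] mult_ac)
    qed
    moreover have "(\<Sum>j\<in>UNIV. h \<bullet> J j 0 \<omega>) = 0"
      using J0 by (metis inner_sum_right inner_zero_right)
    moreover note elim(1)[rule_format, OF t]
    ultimately show "h \<bullet> (\<nu> T \<omega> + G (\<xi> T \<omega>) - \<nu> 0 \<omega> - G (\<xi> 0 \<omega>) - (LINT s:{0..T}|lborel. l s \<omega>) - W T \<omega>) = 0"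
      by (simp add: inner_diff_right inner_add_right sum.distrib sum_subtractf)
  qed
qed

end

section \<open>The equation for all times and conservation of the inner products\<close>

lemma sum_matrix_inverse:
  fixes y :: "'n::finite \<Rightarrow> 'b::real_vector"
  assumes "(A :: real^'n^'n) ** B = mat 1"
  shows "(\<Sum>j\<in>UNIV. A $ k $ j *\<^sub>R (\<Sum>i\<in>UNIV. B $ j $ i *\<^sub>R y i)) = y k"
proof -
  have "(\<Sum>j\<in>UNIV. A $ k $ j *\<^sub>R (\<Sum>i\<in>UNIV. B $ j $ i *\<^sub>R y i)) = (\<Sum>j\<in>UNIV. \<Sum>i\<in>UNIV. (A $ k $ j * B $ j $ i) *\<^sub>R y i)"
    by (simp add: scaleR_sum_right)
  also have "\<dots> = (\<Sum>i\<in>UNIV. \<Sum>j\<in>UNIV. (A $ k $ j * B $ j $ i) *\<^sub>R y i)" by (rule sum.swap)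
  also have "\<dots> = (\<Sum>i\<in>UNIV. (A ** B) $ k $ i *\<^sub>R y i)"
    by (simp add: matrix_matrix_mult_def scaleR_sum_left)
  also have "\<dots> = y k" unfolding assms by (simp add: mat_def if_distrib[of "\<lambda>c. c *\<^sub>R _"] cong: if_cong)
  finally show ?thesis .
qed

lemma set_integral_sum:
  fixes g :: "'i \<Rightarrow> real \<Rightarrow> real"
  assumes "\<And>a. a \<in> K \<Longrightarrow> set_integrable M S (g a)"
  shows "(LINT s:S|M. \<Sum>a\<in>K. g a s) = (\<Sum>a\<in>K. LINT s:S|M. g a s)" "set_integrable M S (\<lambda>s. \<Sum>a\<in>K. g a s)"
  using assms unfolding set_integrable_def set_lebesgue_integral_def scaleR_sum_right
  by (auto intro: Bochner_Integration.integral_sum)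

context reduced_system begin

lemma before_tau: "s \<in> {0..T} \<Longrightarrow> ereal T < \<tau> \<omega> \<Longrightarrow> ereal s < \<tau> \<omega>"
  by (auto intro: le_less_trans[of _ "ereal T"])

text \<open>The null set at a fixed time depends on the time and on \<open>h\<close>. Rational times
  and a countable dense set of vectors give one null set; continuity of the paths and density extend
  the equation.\<close>

lemma shifted_equation:
  "AE \<omega> in M. \<forall>t\<ge>0. ereal t < \<tau> \<omega> \<longrightarrow>
    \<nu> t \<omega> + G (\<xi> t \<omega>) = \<nu> 0 \<omega> + G (\<xi> 0 \<omega>) + (LINT s:{0..t}|lborel. l s \<omega>) + W t \<omega>"
proof -
  obtain H :: "'h set" where H: "countable H" "\<And>X. open X \<Longrightarrow> X \<noteq> {} \<Longrightarrow> \<exists>d\<in>H. d \<in> X"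
    using countable_dense_exists by blast
  let ?y = "\<lambda>t \<omega>. \<nu> t \<omega> + G (\<xi> t \<omega>) - \<nu> 0 \<omega> - G (\<xi> 0 \<omega>) - (LINT s:{0..t}|lborel. l s \<omega>) - W t \<omega>"
  have cq: "countable (\<rat> \<inter> {0::real<..})" by (intro countable_Int1 countable_rat)
  have "AE \<omega> in M. \<forall>q\<in>\<rat> \<inter> {0<..}. \<forall>h\<in>H. ereal q < \<tau> \<omega> \<longrightarrow> h \<bullet> ?y q \<omega> = 0"
    unfolding AE_ball_countable[OF cq] AE_ball_countable[OF H(1)] using shifted_equation_fixed by simp
  then show ?thesis
    using W_path path_cont working drift_integrable
  proof eventually_elim
    case (elim \<omega>)
    have xc: "continuous_on {0..T} (\<lambda>t. \<xi> t \<omega>)" and nc: "continuous_on {0..T} (\<lambda>t. \<nu> t \<omega>)" if "ereal T < \<tau> \<omega>" for T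
      using elim(3) that by (auto intro: continuous_uptoD)
    have zero: "h \<bullet> ?y t \<omega> = 0" if t: "0 \<le> t" "ereal t < \<tau> \<omega>" and h: "h \<in> H" for t h
    proof (rule zero_upto_from_rationals[OF _ _ _ t])
      show "h \<bullet> ?y 0 \<omega> = 0" using elim(2) by simp
      show "h \<bullet> ?y q \<omega> = 0" if "q \<in> \<rat>" "0 < q" "ereal q < \<tau> \<omega>" for q
        using elim(1) h that by blast
      fix T assume T: "0 < T" "ereal T < \<tau> \<omega>"
      have li: "set_integrable lborel {0..T} (\<lambda>s. l s \<omega>)" using elim(5) T by auto
      have "h \<bullet> (LINT s:{0..t}|lborel. l s \<omega>) = (LINT s:{0..t}|lborel. h \<bullet> l s \<omega>)" if "t \<in> {0..T}" for t
      proof -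
        have "set_integrable lborel {0..t} (\<lambda>s. l s \<omega>)" by (rule set_integrable_subset[OF li]) (use that in auto)
        then show ?thesis unfolding set_integrable_def set_lebesgue_integral_def
          by (simp add: integral_inner_right[symmetric])
      qed
      moreover have "set_integrable lborel {0..T} (\<lambda>s. h \<bullet> l s \<omega>)"
        using integrable_inner_right[of h, OF li[unfolded set_integrable_def]] by (simp add: set_integrable_def)
      note continuous_on_set_integral[OF this]
      ultimately have Lc: "continuous_on {0..T} (\<lambda>t. h \<bullet> (LINT s:{0..t}|lborel. l s \<omega>))"
        by (rule continuous_on_eq[rotated, OF sym])
      have Gc: "continuous_on {0..T} (\<lambda>t. G (\<xi> t \<omega>))"
        by (rule continuous_on_compose2[OF c2_continuous(4) xc[OF T(2)]]) (use elim(4) before_tau[OF _ T(2)] in auto)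
      have Wc: "continuous_on {0..T} (\<lambda>t. W t \<omega>)"
        by (rule continuous_on_subset[OF conjunct2[OF elim(2)]]) auto
      show "continuous_on {0..T} (\<lambda>t. h \<bullet> ?y t \<omega>)"
        unfolding inner_diff_right inner_add_right by (intro continuous_intros Lc Gc Wc nc[OF T(2)])
    qed
    show ?case
    proof (intro allI impI)
      fix t :: real assume t: "0 \<le> t" "ereal t < \<tau> \<omega>"
      have "?y t \<omega> = 0"
      proof (rule ccontr)
        assume nz: "?y t \<omega> \<noteq> 0"
        \<comment> \<open>A nonzero defect has positive inner product with itself, hence with all
          nearby vectors, among them one of the dense set.\<close>
        have "open {h. h \<bullet> ?y t \<omega> > 0}" by (intro open_Collect_less continuous_intros)
        moreover have "?y t \<omega> \<in> {h. h \<bullet> ?y t \<omega> > 0}" using nz by simp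
        ultimately obtain h where "h \<in> H" "h \<bullet> ?y t \<omega> > 0" using H(2)[of "{h. h \<bullet> ?y t \<omega> > 0}"] by blast
        then show False using zero[OF t] by simp
      qed
      then show "\<nu> t \<omega> + G (\<xi> t \<omega>) = \<nu> 0 \<omega> + G (\<xi> 0 \<omega>) + (LINT s:{0..t}|lborel. l s \<omega>) + W t \<omega>"
        by (simp add: algebra_simps)
    qed
  qed
qed

lemma sum_A_sigma: "invertible (A t \<omega>) \<Longrightarrow> (\<Sum>j\<in>UNIV. A t \<omega> $ k $ j *\<^sub>R \<sigma> j t \<omega>) = \<Psi> k (\<xi> t \<omega>)"
  unfolding \<sigma>_def reduced_sigma_def A_def by (rule sum_matrix_inverse[OF matrix_inv_works(1)])

text \<open>Multiplication by the matrix undoes the inverse in the definition of the drift and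
  leaves the bracket of one index. The symmetry of \<open>Q\<close> brings its double sum into the
  form that \<open>ito_product\<close> produces.\<close>

lemma sum_A_drift:
  assumes "invertible (A t \<omega>)"
  shows "(\<Sum>j\<in>UNIV. A t \<omega> $ k $ j * f j t \<omega>) = \<Psi> k (\<xi> t \<omega>) \<bullet> l t \<omega>
    + (\<Sum>j\<in>UNIV. \<Sum>m\<in>UNIV. ((1/2) * (\<nu> t \<omega> \<bullet> \<Psi>2 k j m (\<xi> t \<omega>)) - (1/2) * (\<Psi> k (\<xi> t \<omega>) \<bullet> G2 j m (\<xi> t \<omega>))
        - \<Psi>1 k j (\<xi> t \<omega>) \<bullet> G1 m (\<xi> t \<omega>)) * (Q (\<sigma> j t \<omega>) \<bullet> \<sigma> m t \<omega>))
    + (\<Sum>j\<in>UNIV. Q (\<Psi>1 k j (\<xi> t \<omega>)) \<bullet> \<sigma> j t \<omega>)"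
proof -
  have sym: "Q (\<sigma> m t \<omega>) \<bullet> \<sigma> j t \<omega> = Q (\<sigma> j t \<omega>) \<bullet> \<sigma> m t \<omega>" for j m
    using Q_symmetric by (simp add: inner_commute)
  define y where "y i = l t \<omega> \<bullet> \<Psi> i (\<xi> t \<omega>) +
        (\<Sum>j\<in>UNIV. \<Sum>m\<in>UNIV. (1/2 * (\<nu> t \<omega> \<bullet> \<Psi>2 i j m (\<xi> t \<omega>)) - \<Psi>1 i j (\<xi> t \<omega>) \<bullet> G1 m (\<xi> t \<omega>)
           - 1/2 * (\<Psi> i (\<xi> t \<omega>) \<bullet> G2 j m (\<xi> t \<omega>))) * (Q (\<sigma> m t \<omega>) \<bullet> \<sigma> j t \<omega>)) +
        (\<Sum>j\<in>UNIV. Q (\<Psi>1 i j (\<xi> t \<omega>)) \<bullet> \<sigma> j t \<omega>)" for i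
  have f: "f j t \<omega> = (\<Sum>i\<in>UNIV. matrix_inv (A t \<omega>) $ j $ i *\<^sub>R y i)" for j
    unfolding f_def reduced_drift_def A_def y_def \<sigma>_def by simp
  have "(\<Sum>j\<in>UNIV. A t \<omega> $ k $ j * f j t \<omega>) = y k"
    using sum_matrix_inverse[OF matrix_inv_works(1)[OF assms], of k y] unfolding f by simp
  then show ?thesis unfolding y_def sym by (simp add: inner_commute algebra_simps)
qed

text \<open>The left side of \<open>ito_product\<close> is an error sum and tends to zero; on its
  right side the choice of the drift cancels every integral. The increment of the inner product is
  all that remains, and so it is zero.\<close>

lemma conserved_fixed:
  assumes T: "0 < T"
  shows "AE \<omega> in M. ereal T < \<tau> \<omega> \<longrightarrow> \<Psi> k (\<xi> T \<omega>) \<bullet> \<nu> T \<omega> - \<Psi> k (\<xi> 0 \<omega>) \<bullet> \<nu> 0 \<omega> = 0"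
proof -
  define err where "err r n \<omega> = (\<Sum>i<2 ^ n. A (grid T n i) \<omega> $ k $ r * (dI r T n i \<omega> - \<sigma> r (grid T n i) \<omega> \<bullet> ddW T n i \<omega>))" for r n \<omega>
  have Ac: "continuous_on E (\<lambda>z. reduced_matrix \<Psi> \<Psi>1 G1 (fst z) (snd z) $ k $ r)" for r
    by (rule continuous_on_subset[OF continuous_matrix E_subset])
  have "\<forall>d>0. \<forall>e>0. \<forall>\<^sub>F n in sequentially. small M {\<omega>. ereal T < \<tau> \<omega> \<and> \<bar>err a n \<omega>\<bar> > d} e" for a
    unfolding err_def A_def by (rule riemann_error_\<xi>_weighted[OF T Ac])
  from good_subsequence[where K=UNIV and err=err, OF T finite this]
  obtain k' where k': "AE \<omega> in M. ereal T < \<tau> \<omega> \<longrightarrow> (\<forall>a\<in>UNIV. (\<lambda>n. err a (k' n) \<omega>) \<longlonglongrightarrow> 0) \<and>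
    (\<exists>V. ito_path T Q (\<lambda>t. W t \<omega>) k' (\<lambda>t. \<xi> t \<omega>) (\<lambda>r t. f r t \<omega>) (\<lambda>r t. I r t \<omega>) (\<lambda>r t. \<sigma> r t \<omega>) V)"
    by (elim exE)
  from k' working shifted_equation W_path path_cont drift_integrable show ?thesis
  proof eventually_elim
    case (elim \<omega>)
    show ?case
    proof
      assume t: "ereal T < \<tau> \<omega>"
      obtain V where "ito_path T Q (\<lambda>t. W t \<omega>) k' (\<lambda>t. \<xi> t \<omega>) (\<lambda>r t. f r t \<omega>) (\<lambda>r t. I r t \<omega>) (\<lambda>r t. \<sigma> r t \<omega>) V"
        using elim(1) t by blast
      then interpret P: ito_path T Q "\<lambda>t. W t \<omega>" k' "\<lambda>t. \<xi> t \<omega>" "\<lambda>r t. f r t \<omega>" "\<lambda>r t. I r t \<omega>" "\<lambda>r t. \<sigma> r t \<omega>" V .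
      note le = before_tau[OF _ t]
      have xD: "\<forall>s\<in>{0..T}. \<xi> s \<omega> \<in> D" using elim(2) le by simp
      have inv: "invertible (A s \<omega>)" if "s \<in> {0..T}" for s
        unfolding A_def using elim(2) le[OF that] that by simp
      have nc: "continuous_on {0..T} (\<lambda>s. \<nu> s \<omega>)" by (rule continuous_uptoD[OF conjunct2[OF elim(5)] t])
      have li: "set_integrable lborel {0..T} (\<lambda>s. l s \<omega>)" using elim(6) T t by auto
      have veq: "\<forall>s\<in>{0..T}. \<nu> s \<omega> + G (\<xi> s \<omega>) = \<nu> 0 \<omega> + G (\<xi> 0 \<omega>) + (LINT s:{0..s}|lborel. l s \<omega>) + W s \<omega> - W 0 \<omega>"
      proof
        fix s assume s: "s \<in> {0..T}"
        then have "0 \<le> s" by simp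
        from elim(3)[rule_format, OF this le[OF s]] conjunct1[OF elim(4)]
        show "\<nu> s \<omega> + G (\<xi> s \<omega>) = \<nu> 0 \<omega> + G (\<xi> 0 \<omega>) + (LINT s:{0..s}|lborel. l s \<omega>) + W s \<omega> - W 0 \<omega>"
          by (simp only: diff_zero)
      qed
      define h where "h j m s = ((1/2) * (\<nu> s \<omega> \<bullet> \<Psi>2 k j m (\<xi> s \<omega>)) - (1/2) * (\<Psi> k (\<xi> s \<omega>) \<bullet> G2 j m (\<xi> s \<omega>))
          - \<Psi>1 k j (\<xi> s \<omega>) \<bullet> G1 m (\<xi> s \<omega>)) * (Q (\<sigma> j s \<omega>) \<bullet> \<sigma> m s \<omega>)" for j m s
      define b where "b j s = Q (\<Psi>1 k j (\<xi> s \<omega>)) \<bullet> \<sigma> j s \<omega>" for j s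
      define R where "R n = (\<Sum>i<2 ^ k' n. \<Psi> k (\<xi> (grid T (k' n) i) \<omega>) \<bullet> ddW T (k' n) i \<omega>)
        - (\<Sum>j\<in>UNIV. \<Sum>i<2 ^ k' n. A (grid T (k' n) i) \<omega> $ k $ j * dI j T (k' n) i \<omega>)" for n
      have Aeq: "\<Psi> k (\<xi> s \<omega>) \<bullet> G1 j (\<xi> s \<omega>) - \<nu> s \<omega> \<bullet> \<Psi>1 k j (\<xi> s \<omega>) = A s \<omega> $ k $ j" for j s
        by (simp add: A_def reduced_matrix_def)
      have R1: "R \<longlonglongrightarrow> \<Psi> k (\<xi> T \<omega>) \<bullet> \<nu> T \<omega> - \<Psi> k (\<xi> 0 \<omega>) \<bullet> \<nu> 0 \<omega> - (LINT s:{0..T}|lborel. \<Psi> k (\<xi> s \<omega>) \<bullet> l s \<omega>)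
        + (\<Sum>j\<in>UNIV. LINT s:{0..T}|lborel. A s \<omega> $ k $ j * f j s \<omega>)
        - (\<Sum>j\<in>UNIV. \<Sum>m\<in>UNIV. LINT s:{0..T}|lborel. h j m s) - (\<Sum>j\<in>UNIV. LINT s:{0..T}|lborel. b j s)"
        using P.ito_product[OF c2\<Psi>[of k] c2G xD nc li veq]
        unfolding R_def[abs_def] h_def b_def Aeq .
      \<comment> \<open>By \<open>sum_A_sigma\<close> the Wiener sum with \<open>\<Psi> k\<close>
        is, at each grid point, the combination of the \<sigma> with the entries of A. The
        difference on the left is therefore exactly minus the sum of the errors.\<close>
      have Req: "R = (\<lambda>n. - (\<Sum>j\<in>UNIV. err j (k' n) \<omega>))"
      proof
        fix n
        have "\<Psi> k (\<xi> (grid T (k' n) i) \<omega>) \<bullet> ddW T (k' n) i \<omega>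
          = (\<Sum>j\<in>UNIV. A (grid T (k' n) i) \<omega> $ k $ j * (\<sigma> j (grid T (k' n) i) \<omega> \<bullet> ddW T (k' n) i \<omega>))" if "i < 2 ^ k' n" for i
          using sum_A_sigma[OF inv[OF grid_mem[OF less_imp_le[OF T], of i "k' n"]], of k] that
          by (simp add: inner_sum_left[symmetric] flip: inner_scaleR_left)
        then have "(\<Sum>i<2 ^ k' n. \<Psi> k (\<xi> (grid T (k' n) i) \<omega>) \<bullet> ddW T (k' n) i \<omega>)
          = (\<Sum>i<2 ^ k' n. \<Sum>j\<in>UNIV. A (grid T (k' n) i) \<omega> $ k $ j * (\<sigma> j (grid T (k' n) i) \<omega> \<bullet> ddW T (k' n) i \<omega>))"
          by simp
        also have "\<dots> = (\<Sum>j\<in>UNIV. \<Sum>i<2 ^ k' n. A (grid T (k' n) i) \<omega> $ k $ j * (\<sigma> j (grid T (k' n) i) \<omega> \<bullet> ddW T (k' n) i \<omega>))"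
          by (rule sum.swap)
        finally show "R n = - (\<Sum>j\<in>UNIV. err j (k' n) \<omega>)" unfolding R_def err_def by (simp add: right_diff_distrib sum_subtractf)
      qed
      have "(\<lambda>n. err j (k' n) \<omega>) \<longlonglongrightarrow> 0" for j
        using elim(1) t by blast
      then have "(\<lambda>n. - (\<Sum>j\<in>UNIV. err j (k' n) \<omega>)) \<longlonglongrightarrow> - (\<Sum>j\<in>(UNIV::2 set). 0)"
        by (intro tendsto_minus tendsto_sum)
      then have "R \<longlonglongrightarrow> 0" unfolding Req[symmetric] by simp
      \<comment> \<open>Two limits of the same sequence are compared: zero, and the expression from
        the product formula.\<close>
      note lim0 = LIMSEQ_unique[OF R1 this]
      have c: "continuous_on {0..T} (\<lambda>s. y (\<xi> s \<omega>))" if "continuous_on D y" for y :: "real^2 \<Rightarrow> 'h"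
        by (rule continuous_on_compose2[OF that P.x]) (use xD in auto)
      note c' = c[OF c2_continuous(1)] c[OF c2_continuous(2)] c[OF c2_continuous(3)] c[OF c2_continuous(5)] c[OF c2_continuous(6)]
      have hi: "set_integrable lborel {0..T} (h j m)" for j m
        unfolding h_def[abs_def] by (intro set_integrable_continuous continuous_intros c' nc P.\<sigma> P.Q_continuous)
      have bi: "set_integrable lborel {0..T} (b j)" for j
        unfolding b_def[abs_def] by (intro set_integrable_continuous continuous_intros c' P.\<sigma> P.Q_continuous)
      have Pi: "set_integrable lborel {0..T} (\<lambda>s. \<Psi> k (\<xi> s \<omega>) \<bullet> l s \<omega>)"
        by (rule set_integrable_bilinear[OF bounded_bilinear_inner c'(1) li])
      have Ai: "set_integrable lborel {0..T} (\<lambda>s. A s \<omega> $ k $ j * f j s \<omega>)" for j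
        unfolding Aeq[symmetric]
        by (rule set_integrable_bilinear[OF bounded_bilinear_mult _ P.f]) (intro continuous_intros c' nc)
      have "(\<Sum>j\<in>UNIV. LINT s:{0..T}|lborel. A s \<omega> $ k $ j * f j s \<omega>) = (LINT s:{0..T}|lborel. \<Sum>j\<in>UNIV. A s \<omega> $ k $ j * f j s \<omega>)"
        by (rule set_integral_sum(1)[symmetric, OF Ai])
      also have "\<dots> = (LINT s:{0..T}|lborel. (\<Psi> k (\<xi> s \<omega>) \<bullet> l s \<omega> + (\<Sum>j\<in>UNIV. \<Sum>m\<in>UNIV. h j m s)) + (\<Sum>j\<in>UNIV. b j s))"
        by (rule set_lebesgue_integral_cong) (simp_all add: sum_A_drift[OF inv] h_def b_def)
      also have "\<dots> = (LINT s:{0..T}|lborel. \<Psi> k (\<xi> s \<omega>) \<bullet> l s \<omega>) + (LINT s:{0..T}|lborel. \<Sum>j\<in>UNIV. \<Sum>m\<in>UNIV. h j m s)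
          + (LINT s:{0..T}|lborel. \<Sum>j\<in>UNIV. b j s)"
        by (subst set_integral_add(2), (intro set_integral_add(1) Pi set_integral_sum(2) hi bi)+)
          (subst set_integral_add(2), (intro Pi set_integral_sum(2) hi refl)+)
      also have "(LINT s:{0..T}|lborel. \<Sum>j\<in>UNIV. \<Sum>m\<in>UNIV. h j m s) = (\<Sum>j\<in>UNIV. \<Sum>m\<in>UNIV. LINT s:{0..T}|lborel. h j m s)"
        by (subst set_integral_sum(1), rule set_integral_sum(2)[OF hi]) (subst set_integral_sum(1)[OF hi], rule refl)
      also have "(LINT s:{0..T}|lborel. \<Sum>j\<in>UNIV. b j s) = (\<Sum>j\<in>UNIV. LINT s:{0..T}|lborel. b j s)"
        by (rule set_integral_sum(1)[OF bi])
      finally show "\<Psi> k (\<xi> T \<omega>) \<bullet> \<nu> T \<omega> - \<Psi> k (\<xi> 0 \<omega>) \<bullet> \<nu> 0 \<omega> = 0" using lim0 by linarith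
    qed
  qed
qed

lemma conserved:
  "AE \<omega> in M. \<forall>t\<ge>0. ereal t < \<tau> \<omega> \<longrightarrow> (\<forall>k. \<Psi> k (\<xi> t \<omega>) \<bullet> \<nu> t \<omega> = \<Psi> k (\<xi> 0 \<omega>) \<bullet> \<nu> 0 \<omega>)"
proof -
  have cq: "countable (\<rat> \<inter> {0::real<..})" by (intro countable_Int1 countable_rat)
  have "AE \<omega> in M. \<forall>q\<in>\<rat> \<inter> {0<..}. \<forall>k. ereal q < \<tau> \<omega> \<longrightarrow> \<Psi> k (\<xi> q \<omega>) \<bullet> \<nu> q \<omega> - \<Psi> k (\<xi> 0 \<omega>) \<bullet> \<nu> 0 \<omega> = 0"
    unfolding AE_ball_countable[OF cq] AE_all_countable using conserved_fixed by simp
  then show ?thesis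
    using path_cont working
  proof eventually_elim
    case (elim \<omega>)
    show ?case
    proof (intro allI impI)
      fix t k assume t: "0 \<le> t" "ereal t < \<tau> \<omega>"
      have "\<Psi> k (\<xi> t \<omega>) \<bullet> \<nu> t \<omega> - \<Psi> k (\<xi> 0 \<omega>) \<bullet> \<nu> 0 \<omega> = 0"
      proof (rule zero_upto_from_rationals[OF _ _ _ t])
        fix T assume T: "0 < T" "ereal T < \<tau> \<omega>"
        have xc: "continuous_on {0..T} (\<lambda>t. \<xi> t \<omega>)" and nc: "continuous_on {0..T} (\<lambda>t. \<nu> t \<omega>)"
          using elim(2) T by (auto intro: continuous_uptoD)
        have Pc: "continuous_on {0..T} (\<lambda>t. \<Psi> k (\<xi> t \<omega>))"
          by (rule continuous_on_compose2[OF c2_continuous(1) xc]) (use elim(3) before_tau[OF _ T(2)] in auto)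
        show "continuous_on {0..T} (\<lambda>t. \<Psi> k (\<xi> t \<omega>) \<bullet> \<nu> t \<omega> - \<Psi> k (\<xi> 0 \<omega>) \<bullet> \<nu> 0 \<omega>)"
          by (intro continuous_intros Pc nc)
      qed (use elim(1) in auto)
      then show "\<Psi> k (\<xi> t \<omega>) \<bullet> \<nu> t \<omega> = \<Psi> k (\<xi> 0 \<omega>) \<bullet> \<nu> 0 \<omega>" by simp
    qed
  qed
qed

end

section \<open>Translation between functions and their images\<close>

lemma A_mat_reduced:
  "A_mat \<iota> u \<psi> x v = reduced_matrix (\<lambda>k x. \<iota> (\<psi> k x)) (\<lambda>k j x. \<iota> (dxi j (\<psi> k) x)) (\<lambda>j x. \<iota> (dxi j u x)) x (\<iota> v)"
  by (simp add: A_mat_def reduced_matrix_def)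

lemma sig_reduced:
  "sig \<iota> u \<psi> r x v = reduced_sigma (\<lambda>k x. \<iota> (\<psi> k x)) (\<lambda>k j x. \<iota> (dxi j (\<psi> k) x)) (\<lambda>j x. \<iota> (dxi j u x)) r x (\<iota> v)"
  by (simp add: sig_def reduced_sigma_def A_mat_reduced)

lemma drift_xi_reduced:
  "drift_xi \<iota> Q \<epsilon> u \<psi> r x v = reduced_drift Q (\<lambda>k x. \<iota> (\<psi> k x)) (\<lambda>k j x. \<iota> (dxi j (\<psi> k) x))
     (\<lambda>k j m x. \<iota> (dxi j (dxi m (\<psi> k)) x)) (\<lambda>j x. \<iota> (dxi j u x)) (\<lambda>i j x. \<iota> (dxi i (dxi j u) x)) r x (\<iota> v)
     (\<iota> (CH_op \<epsilon> (\<lambda>y. v y + u x y)))"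
  unfolding drift_xi_def reduced_drift_def A_mat_reduced sig_reduced by (rule refl)

lemma open_inner_region: "open \<Omega> \<Longrightarrow> open (inner_region \<Omega> r)"
proof -
  assume "open \<Omega>"
  then have "open (\<Omega> \<inter> {x. r < infdist x (frontier \<Omega>)})"
    by (intro open_Int open_Collect_less continuous_intros)
  then show ?thesis by (simp add: inner_region_def Int_def)
qed

context Hm1_space begin

lemma vol_pos:
  assumes "\<Omega> \<noteq> {}"
  shows "0 < vol"
proof -
  have "\<not> negligible \<Omega>" using open_not_negligible[OF open_dom assms] .
  then have "vol \<noteq> 0" using lmeasurable_dom by (auto simp: vol_def negligible_iff_measure)
  then show ?thesis using vol_nonneg by simp
qed

lemma zero_avg_L2_0:
  assumes "\<Omega> \<noteq> {}" and f: "extends_continuously \<Omega> f"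
  shows "zero_avg \<Omega> f \<in> L2_0 \<Omega>"
proof (rule L2_0_I)
  have c: "extends_continuously \<Omega> (\<lambda>x. - (int_dom \<Omega> f / measure lebesgue \<Omega>))"
    unfolding extends_continuously_def by (rule exI[of _ "\<lambda>x. - (int_dom \<Omega> f / measure lebesgue \<Omega>)"]) auto
  show "extends_continuously \<Omega> (zero_avg \<Omega> f)"
    using extends_continuously_add[OF f c] by (simp add: zero_avg_def[abs_def])
  interpret finite_measure "lebesgue_on \<Omega>" by (rule finite_measure_dom)
  have "int_dom \<Omega> (zero_avg \<Omega> f) = int_dom \<Omega> f - int_dom \<Omega> f / vol * measure (lebesgue_on \<Omega>) (space (lebesgue_on \<Omega>))"
    unfolding zero_avg_def[abs_def] vol_def[symmetric] int_dom_def[of \<Omega> "\<lambda>x. f x - _"]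
    using extends_continuously_integrable[OF f] by (simp add: int_dom_def)
  also have "\<dots> = 0" using measure_dom vol_pos[OF assms(1)] by simp
  finally show "int_dom \<Omega> (zero_avg \<Omega> f) = 0" .
qed

end

lemma (in wiener) adapted_upto_AE_cong:
  assumes X: "adapted_upto F \<tau> X" and ae: "AE \<omega> in M. \<forall>t\<ge>0. ereal t < \<tau> \<omega> \<longrightarrow> Y t \<omega> = X t \<omega>"
  shows "adapted_upto F \<tau> Y"
  unfolding adapted_upto_def
proof (intro allI impI)
  fix t :: real assume t: "0 \<le> t"
  have "(\<lambda>\<omega>. if ereal t < \<tau> \<omega> then X t \<omega> else 0) \<in> borel_measurable (F t)"
    using X t unfolding adapted_upto_def by blast
  moreover have "AE \<omega> in M. (if ereal t < \<tau> \<omega> then Y t \<omega> else 0) = (if ereal t < \<tau> \<omega> then X t \<omega> else 0)"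
    using ae by (rule AE_mp) (use t in auto)
  ultimately show "(\<lambda>\<omega>. if ereal t < \<tau> \<omega> then Y t \<omega> else 0) \<in> borel_measurable (F t)"
    using t by (rule measurable_F_AE_cong)
qed

theorem lemma3p2:
  fixes \<Omega> D :: "(real^2) set"
    and \<iota> :: "(real^2 \<Rightarrow> real) \<Rightarrow> 'h::{real_inner,banach,second_countable_topology}"
    and \<rho>bar \<rho> \<delta> \<epsilon>0 \<epsilon> \<eta> :: real
    and \<kappa> \<alpha> :: "real \<Rightarrow> real" and U :: "real \<Rightarrow> real \<Rightarrow> real"
    and \<xi>0 :: "real^2" and a :: "real \<Rightarrow> real^2 \<Rightarrow> real"
    and u w ut :: "real \<Rightarrow> real^2 \<Rightarrow> real^2 \<Rightarrow> real" and c :: "real \<Rightarrow> real^2 \<Rightarrow> real^2"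
    and lam :: "real \<Rightarrow> real^2 \<Rightarrow> nat \<Rightarrow> real" and e :: "real \<Rightarrow> real^2 \<Rightarrow> nat \<Rightarrow> real^2 \<Rightarrow> real"
    and \<psi> :: "real \<Rightarrow> 2 \<Rightarrow> real^2 \<Rightarrow> real^2 \<Rightarrow> real"
    and M :: "'s measure" and F :: "real \<Rightarrow> 's measure" and Q :: "'h \<Rightarrow> 'h"
    and W :: "real \<Rightarrow> 's \<Rightarrow> 'h" and \<tau> :: "'s \<Rightarrow> ereal"
    and \<xi> :: "real \<Rightarrow> 's \<Rightarrow> real^2" and v :: "real \<Rightarrow> 's \<Rightarrow> real^2 \<Rightarrow> real"
  assumes domain: "smooth_bounded_domain \<Omega>"
    and Hm1: "Hm1_0 \<Omega> \<iota>"
    and profile: "droplet_profile \<rho>bar \<kappa> U \<alpha>"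
    and radius: "\<rho> > 0" "inner_region \<Omega> \<rho> \<noteq> {}"
    and region: "\<delta> > 0" "D = inner_region \<Omega> (\<rho> + \<delta>)" "\<xi>0 \<in> D"
    and droplets: "droplet_family \<Omega> D \<rho>bar U \<rho> \<xi>0 \<epsilon>0 a" "u = droplet U \<rho> a"
    and manifold: "slow_manifold \<Omega> D \<epsilon>0 u w c ut"
    and spectrum: "spectral_data \<Omega> D \<iota> \<epsilon>0 ut lam e \<psi>"
    and eps: "0 < \<epsilon>" "\<epsilon> < \<epsilon>0"
    and noise: "prob_space M" "complete_filtration M F" "covariance_op Q" "Q_Wiener M F Q W"
    and time: "stopping M F \<tau>"
    and working_region: "\<eta> > 1"
      "AE \<omega> in M. \<forall>t\<ge>0. ereal t < \<tau> \<omega> \<longrightarrow> \<xi> t \<omega> \<in> D \<and> norm (\<iota> (v t \<omega>)) < \<epsilon> powr \<eta> \<and>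
         invertible (A_mat \<iota> (ut \<epsilon>) (\<psi> \<epsilon>) (\<xi> t \<omega>) (v t \<omega>))"
    and system: "solves_system M F Q W \<iota> \<Omega> \<epsilon> (u \<epsilon>) (ut \<epsilon>) (c \<epsilon>) (\<psi> \<epsilon>) \<tau> \<xi> v"
    and initial: "AE \<omega> in M. 0 < \<tau> \<omega> \<longrightarrow> (\<forall>k. \<iota> (\<psi> \<epsilon> k (\<xi> 0 \<omega>)) \<bullet> \<iota> (v 0 \<omega>) = 0)"
  shows "solves_SCH M F W \<iota> \<Omega> \<epsilon> \<tau> (\<lambda>t \<omega> x. ut \<epsilon> (\<xi> t \<omega>) x + v t \<omega> x) \<and>
    (AE \<omega> in M. \<forall>t\<ge>0. ereal t < \<tau> \<omega> \<longrightarrow> (\<forall>k. \<iota> (\<psi> \<epsilon> k (\<xi> t \<omega>)) \<bullet> \<iota> (v t \<omega>) = 0))"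
proof -
  have \<Omega>: "open \<Omega>" "bounded \<Omega>" "\<Omega> \<noteq> {}" using domain by (auto simp: smooth_bounded_domain_def)
  interpret H: Hm1_space \<Omega> \<iota> by standard (fact \<Omega> Hm1)+
  interpret wiener M F Q W using noise by (simp add: wiener_def wiener_axioms_def)
  have D: "open D" unfolding region(2) by (rule open_inner_region[OF \<Omega>(1)])
  \<comment> \<open>The functions \<open>ut \<epsilon> x\<close> have a common mean over the region,
    which need not be zero. Differences from the one at \<open>\<xi>0\<close> have mean zero and can
    be embedded.\<close>
  define q where "q = ut \<epsilon> \<xi>0"
  have man: "C2_family D \<Omega> (w \<epsilon>)" "ut \<epsilon> = (\<lambda>\<xi> x. u \<epsilon> \<xi> x + w \<epsilon> \<xi> x)"
    and man': "\<And>x. x \<in> D \<Longrightarrow> int_dom \<Omega> (w \<epsilon> x) = 0 \<and> neumann_C4 \<Omega> (ut \<epsilon> x) \<and>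
      (\<forall>y\<in>\<Omega>. CH_op \<epsilon> (ut \<epsilon> x) y = (\<Sum>j\<in>UNIV. c \<epsilon> x $ j * dxi j (u \<epsilon>) x y))"
    using manifold eps unfolding slow_manifold_def by auto
  have drop: "C2_family D \<Omega> (u \<epsilon>)" and drop': "\<And>x. x \<in> D \<Longrightarrow> int_dom \<Omega> (u \<epsilon> x) = int_dom \<Omega> (u \<epsilon> \<xi>0)"
    using droplets eps unfolding droplet_family_def by auto
  have psi: "C2_family D \<Omega> (\<psi> \<epsilon> k)" and psi': "\<And>x. x \<in> D \<Longrightarrow> \<psi> \<epsilon> k x \<in> L2_0 \<Omega>" for k
    using spectrum eps unfolding spectral_data_def by auto
  have fam: "C2_family D \<Omega> (ut \<epsilon>)" unfolding man(2) by (rule C2_family_add[OF D drop man(1)])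
  have ext: "extends_continuously \<Omega> (ut \<epsilon> x)" if "x \<in> D" for x
    using C2_family_dest(1)[OF fam, of "[]" x] that by simp
  have mean: "int_dom \<Omega> (ut \<epsilon> x) = int_dom \<Omega> q" if x: "x \<in> D" for x
  proof -
    have "int_dom \<Omega> (ut \<epsilon> x) = int_dom \<Omega> (u \<epsilon> x) + int_dom \<Omega> (w \<epsilon> x)" if "x \<in> D" for x
      using C2_family_dest(1)[OF drop, of "[]" x] C2_family_dest(1)[OF man(1), of "[]" x] that
      unfolding man(2) int_dom_def by (simp add: H.extends_continuously_integrable)
    then show ?thesis
      by (simp only: q_def x region(3) drop'[OF x] man'[OF x, THEN conjunct1] man'[OF region(3), THEN conjunct1])
  qed
  have qe: "extends_continuously \<Omega> q" unfolding q_def by (rule ext[OF region(3)])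
  let ?G = "\<lambda>x. \<iota> (\<lambda>y. ut \<epsilon> x y - q y)"
  let ?l = "\<lambda>s \<omega>. \<iota> (CH_op \<epsilon> (\<lambda>y. v s \<omega> y + ut \<epsilon> (\<xi> s \<omega>) y))"
  have c2G: "c2map D ?G (\<lambda>j x. \<iota> (dxi j (ut \<epsilon>) x)) (\<lambda>i j x. \<iota> (dxi i (dxi j (ut \<epsilon>)) x))"
    by (rule H.family_c2map[OF D fam qe mean])
  \<comment> \<open>The basis functions have mean zero themselves, so the subtracted function is
    zero here.\<close>
  have c2\<Psi>: "c2map D (\<lambda>x. \<iota> (\<psi> \<epsilon> k x)) (\<lambda>j x. \<iota> (dxi j (\<psi> \<epsilon> k) x)) (\<lambda>j m x. \<iota> (dxi j (dxi m (\<psi> \<epsilon> k)) x))" for k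
  proof -
    have "extends_continuously \<Omega> (\<lambda>x. 0)" unfolding extends_continuously_def by (rule exI[of _ "\<lambda>x. 0"]) simp
    from H.family_c2map[OF D psi[of k] this] show ?thesis using psi' by (simp add: L2_0_def int_dom_def)
  qed
  let ?dv = "\<lambda>s \<omega>. \<iota> (drift_v \<epsilon> (u \<epsilon>) (ut \<epsilon>) (c \<epsilon>) (\<xi> s \<omega>) (v s \<omega>))"
  let ?f = "\<lambda>r s \<omega>. drift_xi \<iota> Q \<epsilon> (ut \<epsilon>) (\<psi> \<epsilon>) r (\<xi> s \<omega>) (v s \<omega>)"
  let ?s = "\<lambda>r s \<omega>. sig \<iota> (ut \<epsilon>) (\<psi> \<epsilon>) r (\<xi> s \<omega>) (v s \<omega>)"
  obtain I J where
    ad: "adapted_upto F \<tau> \<xi>" "adapted_upto F \<tau> (\<lambda>t \<omega>. \<iota> (v t \<omega>))" and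
    pc: "AE \<omega> in M. continuous_upto (\<tau> \<omega>) (\<lambda>t. \<xi> t \<omega>) \<and> continuous_upto (\<tau> \<omega>) (\<lambda>t. \<iota> (v t \<omega>))" and
    reg: "AE \<omega> in M. \<forall>t\<ge>0. ereal t < \<tau> \<omega> \<longrightarrow> neumann_C4 \<Omega> (v t \<omega>) \<and> v t \<omega> \<in> L2_0 \<Omega> \<and>
      (\<forall>r. set_integrable lborel {0..t} (\<lambda>s. ?f r s \<omega>)) \<and> set_integrable lborel {0..t} (\<lambda>s. ?dv s \<omega>)" and
    I: "\<forall>r. has_ito_integral M F W \<tau> (\<lambda>s \<omega>. blinfun_inner_right (?s r s \<omega>)) (I r)" and
    xi_eq: "AE \<omega> in M. \<forall>t\<ge>0. ereal t < \<tau> \<omega> \<longrightarrow> (\<forall>r. \<xi> t \<omega> $ r = \<xi> 0 \<omega> $ r + (LINT s:{0..t}|lborel. ?f r s \<omega>) + I r t \<omega>)" and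
    J: "\<forall>j. has_ito_integral M F W \<tau> (\<lambda>s \<omega>. blinfun_scaleR_left (\<iota> (dxi j (ut \<epsilon>) (\<xi> s \<omega>)))
      o\<^sub>L blinfun_inner_right (?s j s \<omega>)) (J j)" and
    v_eq: "AE \<omega> in M. \<forall>t\<ge>0. ereal t < \<tau> \<omega> \<longrightarrow>
      \<iota> (v t \<omega>) = \<iota> (v 0 \<omega>) + (LINT s:{0..t}|lborel. ?dv s \<omega>) + W t \<omega>
        - (\<Sum>j\<in>UNIV. (LINT s:{0..t}|lborel. ?f j s \<omega> *\<^sub>R \<iota> (dxi j (ut \<epsilon>) (\<xi> s \<omega>))) + J j t \<omega>)
        - (1/2) *\<^sub>R (\<Sum>i\<in>UNIV. \<Sum>j\<in>UNIV. LINT s:{0..t}|lborel.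
             (Q (?s j s \<omega>) \<bullet> ?s i s \<omega>) *\<^sub>R \<iota> (dxi i (dxi j (ut \<epsilon>)) (\<xi> s \<omega>)))"
    using system unfolding solves_system_def by (elim exE conjE) (rule that; assumption)
  let ?m = "\<lambda>t \<omega>. \<Sum>j\<in>UNIV. (LINT s:{0..t}|lborel. ?f j s \<omega> *\<^sub>R \<iota> (dxi j (ut \<epsilon>) (\<xi> s \<omega>))) + J j t \<omega>"
  let ?c = "\<lambda>t \<omega>. (1/2) *\<^sub>R (\<Sum>i\<in>UNIV. \<Sum>j\<in>UNIV. LINT s:{0..t}|lborel.
    (Q (?s j s \<omega>) \<bullet> ?s i s \<omega>) *\<^sub>R \<iota> (dxi i (dxi j (ut \<epsilon>)) (\<xi> s \<omega>)))"
  \<comment> \<open>On the manifold the terms with \<open>c\<close> are the Cahn-Hilliard operator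
    at \<open>ut\<close>, so the drift of v is the exact expansion of this operator at
    \<open>ut + v\<close>.\<close>
  have drift_eq: "\<iota> (drift_v \<epsilon> (u \<epsilon>) (ut \<epsilon>) (c \<epsilon>) x v') = \<iota> (CH_op \<epsilon> (\<lambda>y. v' y + ut \<epsilon> x y))"
    if x: "x \<in> D" and v': "neumann_C4 \<Omega> v'" for x v'
  proof (rule H.iota_cong)
    fix y assume y: "y \<in> \<Omega>"
    have cl: "Ck_closure 4 \<Omega> (ut \<epsilon> x)" "Ck_closure 4 \<Omega> v'" using man'[OF x] v' by (simp_all add: neumann_C4_def)
    have "CH_op \<epsilon> (ut \<epsilon> x) y = (\<Sum>j\<in>UNIV. c \<epsilon> x $ j * dxi j (u \<epsilon>) x y)" using man'[OF x] y by blast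
    then show "drift_v \<epsilon> (u \<epsilon>) (ut \<epsilon>) (c \<epsilon>) x v' y = CH_op \<epsilon> (\<lambda>y. v' y + ut \<epsilon> x y) y"
      using CH_op_split[OF \<Omega>(1) cl y, of \<epsilon>] unfolding drift_v_def by (simp add: add.commute[of "v' _"])
  qed
  have l_eq: "AE \<omega> in M. \<forall>t\<ge>0. ereal t < \<tau> \<omega> \<longrightarrow> ?dv t \<omega> = ?l t \<omega>"
    using reg working_region(2)
  proof eventually_elim
    case (elim \<omega>)
    show ?case
    proof (intro allI impI)
      fix t :: real assume t: "0 \<le> t" "ereal t < \<tau> \<omega>"
      from elim[rule_format, OF t] show "?dv t \<omega> = ?l t \<omega>" by (intro drift_eq) (elim conjE, assumption)+
    qed
  qed
  have before: "ereal s < \<tau> \<omega>" if "s \<in> {0..t}" "ereal t < \<tau> \<omega>" for s t \<omega>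
    using that by (auto intro: le_less_trans[of _ "ereal t"])
  have integrable: "AE \<omega> in M. \<forall>t\<ge>0. ereal t < \<tau> \<omega> \<longrightarrow>
      (\<forall>r. set_integrable lborel {0..t} (\<lambda>s. ?f r s \<omega>)) \<and> set_integrable lborel {0..t} (\<lambda>s. ?l s \<omega>)"
    using reg l_eq
  proof eventually_elim
    case (elim \<omega>)
    show ?case
    proof (intro allI impI conjI)
      fix t :: real assume t: "0 \<le> t" "ereal t < \<tau> \<omega>"
      note e = elim(1)[rule_format, OF t]
      show "set_integrable lborel {0..t} (\<lambda>s. ?f r s \<omega>)" for r using e by (elim conjE) (erule spec)
      have "set_integrable lborel {0..t} (\<lambda>s. ?dv s \<omega>) \<longleftrightarrow> set_integrable lborel {0..t} (\<lambda>s. ?l s \<omega>)"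
        by (rule set_integrable_cong[OF refl refl]) (use elim(2) before[OF _ t(2)] in simp)
      then show "set_integrable lborel {0..t} (\<lambda>s. ?l s \<omega>)" using e by (elim conjE) (rule iffD1)
    qed
  qed
  have v_eq': "AE \<omega> in M. \<forall>t\<ge>0. ereal t < \<tau> \<omega> \<longrightarrow>
      \<iota> (v t \<omega>) = \<iota> (v 0 \<omega>) + (LINT s:{0..t}|lborel. ?l s \<omega>) + W t \<omega>
        - ?m t \<omega> - ?c t \<omega>"
    using v_eq l_eq
  proof eventually_elim
    case (elim \<omega>)
    show ?case
    proof (intro allI impI)
      fix t :: real assume t: "0 \<le> t" "ereal t < \<tau> \<omega>"
      have "(LINT s:{0..t}|lborel. ?dv s \<omega>) = (LINT s:{0..t}|lborel. ?l s \<omega>)"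
        by (rule set_lebesgue_integral_cong) (use elim(2) before[OF _ t(2)] in simp_all)
      then show "\<iota> (v t \<omega>) = \<iota> (v 0 \<omega>) + (LINT s:{0..t}|lborel. ?l s \<omega>) + W t \<omega>
        - ?m t \<omega> - ?c t \<omega>"
        using elim(1)[rule_format, OF t] by (simp only:)
    qed
  qed
  have wk: "AE \<omega> in M. \<forall>t\<ge>0. ereal t < \<tau> \<omega> \<longrightarrow> \<xi> t \<omega> \<in> D \<and>
      invertible (A_mat \<iota> (ut \<epsilon>) (\<psi> \<epsilon>) (\<xi> t \<omega>) (v t \<omega>))"
    using working_region(2) by (rule AE_mp) (intro AE_I2 impI, blast)
  note R_axioms = time D c2\<Psi> c2G ad pc wk[unfolded A_mat_reduced] integrable[unfolded drift_xi_reduced]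
    spec[OF I, unfolded sig_reduced] xi_eq[unfolded drift_xi_reduced] spec[OF J, unfolded sig_reduced]
    v_eq'[unfolded drift_xi_reduced sig_reduced]
  interpret R: reduced_system M F Q W D \<tau> \<xi> "\<lambda>t \<omega>. \<iota> (v t \<omega>)" ?l "\<lambda>k x. \<iota> (\<psi> \<epsilon> k x)" "\<lambda>k j x. \<iota> (dxi j (\<psi> \<epsilon> k) x)"
    "\<lambda>k j m x. \<iota> (dxi j (dxi m (\<psi> \<epsilon> k)) x)" ?G "\<lambda>j x. \<iota> (dxi j (ut \<epsilon>) x)" "\<lambda>i j x. \<iota> (dxi i (dxi j (ut \<epsilon>)) x)" I J
    by (rule reduced_system.intro[OF wiener_axioms], rule reduced_system_axioms.intro) (rule R_axioms)+
  have G_L2: "(\<lambda>y. ut \<epsilon> x y - q y) \<in> L2_0 \<Omega>" if x: "x \<in> D" for x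
  proof (rule H.L2_0_I)
    show "extends_continuously \<Omega> (\<lambda>y. ut \<epsilon> x y - q y)"
      using extends_continuously_add[OF ext[OF x] extends_continuously_cmult[OF qe, of "-1"]] by simp
    show "int_dom \<Omega> (\<lambda>y. ut \<epsilon> x y - q y) = 0"
      using mean[OF x] H.extends_continuously_integrable[OF ext[OF x]] H.extends_continuously_integrable[OF qe]
      by (simp add: int_dom_def)
  qed
  let ?u = "\<lambda>t \<omega> x. ut \<epsilon> (\<xi> t \<omega>) x + v t \<omega> x"
  \<comment> \<open>The mean of \<open>ut + v\<close> is that of \<open>q\<close>. Subtracting it
    gives a fixed vector plus \<open>G\<close> plus the image of v.\<close>
  have avg_eq: "\<iota> (zero_avg \<Omega> (\<lambda>y. ut \<epsilon> x y + v' y)) = \<iota> (zero_avg \<Omega> q) + ?G x + \<iota> v'"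
    if x: "x \<in> D" and v': "v' \<in> L2_0 \<Omega>" for x v'
  proof -
    have "integrable (lebesgue_on \<Omega>) v'" using H.L2_sum_integrable(1)[of v' v'] v' by (simp add: L2_0_def)
    then have "int_dom \<Omega> (\<lambda>y. ut \<epsilon> x y + v' y) = int_dom \<Omega> (ut \<epsilon> x) + int_dom \<Omega> v'"
      using H.extends_continuously_integrable[OF ext[OF x]] by (simp add: int_dom_def)
    also have "\<dots> = int_dom \<Omega> q" using mean[OF x] v' by (simp add: L2_0_def)
    finally have "zero_avg \<Omega> (\<lambda>y. ut \<epsilon> x y + v' y) = (\<lambda>y. (zero_avg \<Omega> q y + (ut \<epsilon> x y - q y)) + v' y)"
      by (simp add: zero_avg_def fun_eq_iff)
    then show ?thesis
      using H.iota_add[OF H.L2_0_add[OF H.zero_avg_L2_0[OF \<Omega>(3) qe] G_L2[OF x]] v']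
        H.iota_add[OF H.zero_avg_L2_0[OF \<Omega>(3) qe] G_L2[OF x]] by (simp only:)
  qed
  have avg: "AE \<omega> in M. \<forall>t\<ge>0. ereal t < \<tau> \<omega> \<longrightarrow>
    \<iota> (zero_avg \<Omega> (?u t \<omega>)) = \<iota> (zero_avg \<Omega> q) + ?G (\<xi> t \<omega>) + \<iota> (v t \<omega>)"
    using reg wk
  proof eventually_elim
    case (elim \<omega>)
    show ?case
    proof (intro allI impI)
      fix t :: real assume t: "0 \<le> t" "ereal t < \<tau> \<omega>"
      from elim[rule_format, OF t] show "\<iota> (zero_avg \<Omega> (?u t \<omega>)) = \<iota> (zero_avg \<Omega> q) + ?G (\<xi> t \<omega>) + \<iota> (v t \<omega>)"
        by (intro avg_eq) (elim conjE, assumption)+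
    qed
  qed
  \<comment> \<open>Adaptedness and path continuity of the centred solution both come from this one
    continuous function of the state.\<close>
  have cont: "continuous_on R.E (\<lambda>z. \<iota> (zero_avg \<Omega> q) + ?G (fst z) + snd z)"
    by (intro continuous_intros R.continuous_on_E_fst R.c2_continuous)
  have "adapted_upto F \<tau> (\<lambda>t \<omega>. \<iota> (zero_avg \<Omega> (?u t \<omega>)))"
    using R.adapted_compose[of "\<lambda>x n. \<iota> (zero_avg \<Omega> q) + ?G x + n", OF cont] avg by (rule adapted_upto_AE_cong)
  moreover have "AE \<omega> in M. continuous_upto (\<tau> \<omega>) (\<lambda>t. \<iota> (zero_avg \<Omega> (?u t \<omega>)))"
    using R.continuous_compose[of "\<lambda>x n. \<iota> (zero_avg \<Omega> q) + ?G x + n", OF cont] avg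
  proof eventually_elim
    case (elim \<omega>)
    show ?case using elim(1) unfolding continuous_upto_def
      by (rule continuous_on_eq) (use elim(2) in simp)
  qed
  moreover have "AE \<omega> in M. \<forall>t\<ge>0. ereal t < \<tau> \<omega> \<longrightarrow> neumann_C4 \<Omega> (?u t \<omega>) \<and> (\<lambda>x. ?u t \<omega> x - ?u 0 \<omega> x) \<in> L2_0 \<Omega> \<and>
      set_integrable lborel {0..t} (\<lambda>s. \<iota> (CH_op \<epsilon> (?u s \<omega>))) \<and>
      \<iota> (\<lambda>x. ?u t \<omega> x - ?u 0 \<omega> x) = (LINT s:{0..t}|lborel. \<iota> (CH_op \<epsilon> (?u s \<omega>))) + W t \<omega>"
    using reg wk integrable R.shifted_equation
  proof eventually_elim
    case (elim \<omega>)
    show ?case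
    proof (rule allI, rule impI, rule impI)
      fix t :: real assume t: "0 \<le> t" "ereal t < \<tau> \<omega>"
      have t0: "ereal 0 < \<tau> \<omega>" using before[of 0 t \<omega>] t by simp
      have x: "\<xi> t \<omega> \<in> D" "\<xi> 0 \<omega> \<in> D"
        by (rule conjunct1[OF elim(2)[rule_format, OF t]], rule conjunct1[OF elim(2)[rule_format, OF order_refl t0]])
      have v: "v t \<omega> \<in> L2_0 \<Omega>" "v 0 \<omega> \<in> L2_0 \<Omega>" "neumann_C4 \<Omega> (v t \<omega>)"
        by (rule conjunct1[OF conjunct2[OF elim(1)[rule_format, OF t]]],
          rule conjunct1[OF conjunct2[OF elim(1)[rule_format, OF order_refl t0]]],
          rule conjunct1[OF elim(1)[rule_format, OF t]])
      have op: "CH_op \<epsilon> (?u s \<omega>) = CH_op \<epsilon> (\<lambda>y. v s \<omega> y + ut \<epsilon> (\<xi> s \<omega>) y)" for s by (simp only: add.commute)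
      \<comment> \<open>Inserting \<open>q\<close> twice regroups the increment into differences
        that each have mean zero, on which \<open>\<iota>\<close> is additive.\<close>
      have d: "(\<lambda>x. ?u t \<omega> x - ?u 0 \<omega> x)
        = (\<lambda>y. ((ut \<epsilon> (\<xi> t \<omega>) y - q y) - (ut \<epsilon> (\<xi> 0 \<omega>) y - q y)) + (v t \<omega> y - v 0 \<omega> y))" by (simp add: fun_eq_iff)
      note L = H.L2_0_diff[OF G_L2[OF x(1)] G_L2[OF x(2)]] H.L2_0_diff[OF v(1,2)]
      have "\<iota> (\<lambda>x. ?u t \<omega> x - ?u 0 \<omega> x) = (?G (\<xi> t \<omega>) - ?G (\<xi> 0 \<omega>)) + (\<iota> (v t \<omega>) - \<iota> (v 0 \<omega>))"
        unfolding d H.iota_add[OF L] H.iota_diff[OF G_L2[OF x(1)] G_L2[OF x(2)]] H.iota_diff[OF v(1,2)] ..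
      also have "\<dots> = (LINT s:{0..t}|lborel. ?l s \<omega>) + W t \<omega>"
        using elim(4)[rule_format, OF t] by (simp add: algebra_simps)
      finally have eq: "\<iota> (\<lambda>x. ?u t \<omega> x - ?u 0 \<omega> x) = (LINT s:{0..t}|lborel. ?l s \<omega>) + W t \<omega>" .
      show "neumann_C4 \<Omega> (?u t \<omega>) \<and> (\<lambda>x. ?u t \<omega> x - ?u 0 \<omega> x) \<in> L2_0 \<Omega> \<and>
        set_integrable lborel {0..t} (\<lambda>s. \<iota> (CH_op \<epsilon> (?u s \<omega>))) \<and>
        \<iota> (\<lambda>x. ?u t \<omega> x - ?u 0 \<omega> x) = (LINT s:{0..t}|lborel. \<iota> (CH_op \<epsilon> (?u s \<omega>))) + W t \<omega>"
        unfolding op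
      proof (intro conjI eq)
        show "neumann_C4 \<Omega> (?u t \<omega>)" using man'[OF x(1)] v(3) by (intro neumann_C4_add[OF \<Omega>(1)]) blast+
        show "(\<lambda>x. ?u t \<omega> x - ?u 0 \<omega> x) \<in> L2_0 \<Omega>" unfolding d by (rule H.L2_0_add[OF L])
        show "set_integrable lborel {0..t} (\<lambda>s. ?l s \<omega>)" using elim(3)[rule_format, OF t] by (elim conjE) assumption
      qed
    qed
  qed
  ultimately have "solves_SCH M F W \<iota> \<Omega> \<epsilon> \<tau> ?u" unfolding solves_SCH_def by (intro conjI)
  moreover have "AE \<omega> in M. \<forall>t\<ge>0. ereal t < \<tau> \<omega> \<longrightarrow> (\<forall>k. \<iota> (\<psi> \<epsilon> k (\<xi> t \<omega>)) \<bullet> \<iota> (v t \<omega>) = 0)"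
    using R.conserved initial
  proof eventually_elim
    case (elim \<omega>)
    show ?case
    proof (intro allI impI)
      fix t :: real and k assume t: "0 \<le> t" "ereal t < \<tau> \<omega>"
      have "0 < \<tau> \<omega>" using before[of 0 t \<omega>] t by (simp add: zero_ereal_def)
      then have "\<iota> (\<psi> \<epsilon> k (\<xi> 0 \<omega>)) \<bullet> \<iota> (v 0 \<omega>) = 0" using elim(2) by blast
      then show "\<iota> (\<psi> \<epsilon> k (\<xi> t \<omega>)) \<bullet> \<iota> (v t \<omega>) = 0" using elim(1)[rule_format, OF t, of k] by (simp only:)
    qed
  qed
  ultimately show ?thesis by (rule conjI)
qed

end
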